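(* Let $R:\mathcal X\times\mathcal X\to(0,\infty)$ be the interaction kernel and $T:L^2(\mathcal X,\mu)\to L^2(\mathcal X,\mu)$ the corresponding integral operator defined in the context. Suppose $T$ is a compact operator. Then there exists a unique (in distribution) strictly stationary stochastic process $\{X_t\}_{t\in\mathbb Z}$, with $X_t=(X_t^{(1)},\ldots,X_t^{(p)})$ and $X_t^{(a)}\in\mathcal X^{(a)}$, such that for every $a\in[p]$ and $t\in\mathbb Z$ the conditional distribution of $X_t^{(a)}$ given $\mathcal H_{(a,t)}$ has the density (CS) given in the context. Moreover, let $r:=r(T)=r(T^* )$ be the spectral radius of $T$ and $T^*$, and let $v$ and $w$ be $\mu$-a.e. positive eigenfunctions of $T$ and $T^*$ respectively corresponding to $r$, scaled so that $\langle v,w\rangle=1$. Then for any $n\in\mathbb N$ and any shift $m\in\mathbb Z$, the joint density of $(X_m,\ldots,X_{m+n-1})$ with respect to the $n$-fold product of $\mu$ is $$p_{[1:n]}(x_1,\ldots,x_n)=\frac{1}{r^{n-1}}\,v(x_1)\Big[\prod_{t=2}^{n}R(x_{t-1},x_t)\Big]w(x_n),\qquad x_1,\ldots,x_n\in\mathcal X.$$ In particular, for all $t\in\mathbb Z$, the marginal density of $X_t$ with respect to $\mu$ is $p_1(x)=v(x)w(x)$.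
   Context: Setting. Let $p\ge 1$, $[p]=\{1,\ldots,p\}$. For each $a\in[p]$ let $\mathcal X^{(a)}\subseteq\mathbb R$ be a measurable set with a sigma-finite measure $\mu_a$; put $\mathcal X=\prod_{a=1}^p\mathcal X^{(a)}$ and $\mu=\otimes_{a=1}^p\mu_a$. Let $s_a,c_a:\mathcal X^{(a)}\to\mathbb R$ be measurable, $\theta=(\theta^{(1)},\ldots,\theta^{(p)})^\top\in\mathbb R^p$, and let $\Phi_{-1},\Phi_0,\Phi_1$ be real $p\times p$ matrices with entries $\Phi_\ell^{(a,b)}$, where $\Phi_0$ is symmetric with zero diagonal and $\Phi_{-1}=\Phi_1^\top$ (standing assumptions). For $x=(x^{(1)},\ldots,x^{(p)})\in\mathcal X$ write $\mathbf s(x)=(s_1(x^{(1)}),\ldots,s_p(x^{(p)}))^\top$, $\mathbf c(x)=(c_1(x^{(1)}),\ldots,c_p(x^{(p)}))^\top$, and let $\mathbf 1_p$ be the vector of ones. Interaction kernel: $G(x)=\exp\big(\theta^\top\mathbf s(x)+\mathbf 1_p^\top\mathbf c(x)+\tfrac12x^\top\Phi_0x\big)$, $H(x,y)=\exp(x^\top\Phi_1y)$, and $R(x,y)=G(x)^{1/2}H(x,y)G(y)^{1/2}$ for $x,y\in\mathcal X$. Operators on $L^2(\mathcal X,\mu)$ (complex-valued functions, inner product $\langle f,g\rangle=\int f\bar g\,d\mu$): $T(f)[y]=\int_{\mathcal X}R(x,y)f(x)\,\mu(dx)$, with adjoint $T^*(f)[y]=\int_{\mathcal X}R(y,x)f(x)\,\mu(dx)$.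 By the Krein–Rutman theorem, when $T$ is compact, $r(T)>0$ is an eigenvalue of both $T$ and $T^*$, each having an a.e. positive eigenfunction for it, unique up to scaling. Conditional specification. For a process $\{X_t\}$, $\mathcal H_{(a,t)}=\sigma\big(X_\tau^{(b)}: b\in[p],\tau\in\mathbb Z,(b,\tau)\ne(a,t)\big)$. The required conditional density of $X_t^{(a)}$ given $\mathcal H_{(a,t)}$, with respect to $\mu_a$, is $$\text{(CS)}\quad p_a(x_t^{(a)}\mid\mathcal H_{(a,t)})\propto\exp\big(\theta^{(a)}s_a(x_t^{(a)})+x_t^{(a)}\Theta_a(\mathcal H_{(a,t)})+c_a(x_t^{(a)})\big),\quad x_t^{(a)}\in\mathcal X^{(a)},$$ $$\Theta_a(\mathcal H_{(a,t)})=\sum_{b\ne a}\Phi_0^{(a,b)}x_t^{(b)}+\sum_{b\in[p]}\big[\Phi_{-1}^{(a,b)}x_{t-1}^{(b)}+\Phi_1^{(a,b)}x_{t+1}^{(b)}\big].$$ *)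

theory Defs
  imports "HOL-Probability.Probability"
begin

section \<open>Square-integrable functions and operators on them\<close>

text \<open>
  Elements of \<open>L\<^sup>2\<close> are represented by functions; equality in \<open>L\<^sup>2\<close> is equality almost everywhere,
  and an operator is a map on functions that is used only up to almost-everywhere equality.
\<close>

definition L2 :: "'x measure \<Rightarrow> ('x \<Rightarrow> complex) set" where
  "L2 M = {f \<in> borel_measurable M. integrable M (\<lambda>x. (cmod (f x))\<^sup>2)}"

definition L2_norm :: "'x measure \<Rightarrow> ('x \<Rightarrow> complex) \<Rightarrow> real" where
  "L2_norm M f = sqrt (LINT x|M. (cmod (f x))\<^sup>2)"

definition L2_inner :: "'x measure \<Rightarrow> ('x \<Rightarrow> complex) \<Rightarrow> ('x \<Rightarrow> complex) \<Rightarrow> complex" where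
  "L2_inner M f g = (LINT x|M. f x * cnj (g x))"

definition integral_op ::
  "'x measure \<Rightarrow> ('x \<Rightarrow> 'x \<Rightarrow> real) \<Rightarrow> ('x \<Rightarrow> complex) \<Rightarrow> 'x \<Rightarrow> complex" where
  "integral_op M K f y = (LINT x|M. complex_of_real (K x y) * f x)"

text \<open>
  The Bochner integral of a non-integrable function is \<open>0\<close>, so that the integrals defining the
  operator exist has to be required separately.
\<close>

definition integral_op_on_L2 :: "'x measure \<Rightarrow> ('x \<Rightarrow> 'x \<Rightarrow> real) \<Rightarrow> bool" where
  "integral_op_on_L2 M K \<longleftrightarrow>
     (\<forall>f\<in>L2 M. (AE y in M. integrable M (\<lambda>x. complex_of_real (K x y) * f x)) \<and>
               integral_op M K f \<in> L2 M)"

definition compact_op ::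
  "'x measure \<Rightarrow> (('x \<Rightarrow> complex) \<Rightarrow> 'x \<Rightarrow> complex) \<Rightarrow> bool" where
  "compact_op M T \<longleftrightarrow>
     (\<forall>f\<in>L2 M. T f \<in> L2 M) \<and>
     (\<forall>f :: nat \<Rightarrow> 'x \<Rightarrow> complex.
        (\<forall>n. f n \<in> L2 M) \<and> (\<exists>C. \<forall>n. L2_norm M (f n) \<le> C) \<longrightarrow>
        (\<exists>g\<in>L2 M. \<exists>k. strict_mono k \<and>
           (\<lambda>n. L2_norm M (\<lambda>x. T (f (k n)) x - g x)) \<longlonglongrightarrow> 0))"

text \<open>
  The resolvent set: \<open>T - z\<close> is injective and surjective on \<open>L\<^sup>2\<close>, with bounded inverse (the
  inequality includes injectivity).
\<close>

definition resolvent_set ::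
  "'x measure \<Rightarrow> (('x \<Rightarrow> complex) \<Rightarrow> 'x \<Rightarrow> complex) \<Rightarrow> complex set" where
  "resolvent_set M T =
     {z. (\<forall>g\<in>L2 M. \<exists>f\<in>L2 M. AE x in M. T f x - z * f x = g x) \<and>
         (\<exists>C. \<forall>f\<in>L2 M. L2_norm M f \<le> C * L2_norm M (\<lambda>x. T f x - z * f x))}"

definition spectral_radius ::
  "'x measure \<Rightarrow> (('x \<Rightarrow> complex) \<Rightarrow> 'x \<Rightarrow> complex) \<Rightarrow> real" where
  "spectral_radius M T = (SUP z\<in>- resolvent_set M T. cmod z)"

definition eigenfunction ::
  "'x measure \<Rightarrow> (('x \<Rightarrow> complex) \<Rightarrow> 'x \<Rightarrow> complex) \<Rightarrow> complex \<Rightarrow> ('x \<Rightarrow> complex) \<Rightarrow> bool" where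
  "eigenfunction M T z f \<longleftrightarrow>
     f \<in> L2 M \<and> \<not> (AE x in M. f x = 0) \<and> (AE x in M. T f x = z * f x)"

definition AE_positive :: "'x measure \<Rightarrow> ('x \<Rightarrow> complex) \<Rightarrow> bool" where
  "AE_positive M f \<longleftrightarrow> (AE x in M. f x \<in> \<real> \<and> 0 < Re (f x))"


section \<open>The interaction kernel\<close>

definition G_fun ::
  "real ^ 'p \<Rightarrow> ('p \<Rightarrow> real \<Rightarrow> real) \<Rightarrow> ('p \<Rightarrow> real \<Rightarrow> real) \<Rightarrow> real ^ 'p ^ 'p \<Rightarrow>
   ('p::finite \<Rightarrow> real) \<Rightarrow> real" where
  "G_fun \<theta> s c \<Phi>0 x =
     exp (\<theta> \<bullet> (\<chi> a. s a (x a)) + (\<chi> a. 1) \<bullet> (\<chi> a. c a (x a))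
          + 1 / 2 * ((\<chi> a. x a) \<bullet> (\<Phi>0 *v (\<chi> a. x a))))"

definition H_fun ::
  "real ^ 'p ^ 'p \<Rightarrow> ('p::finite \<Rightarrow> real) \<Rightarrow> ('p \<Rightarrow> real) \<Rightarrow> real" where
  "H_fun \<Phi>1 x y = exp ((\<chi> a. x a) \<bullet> (\<Phi>1 *v (\<chi> a. y a)))"

definition R_kernel ::
  "real ^ 'p \<Rightarrow> ('p \<Rightarrow> real \<Rightarrow> real) \<Rightarrow> ('p \<Rightarrow> real \<Rightarrow> real) \<Rightarrow>
   real ^ 'p ^ 'p \<Rightarrow> real ^ 'p ^ 'p \<Rightarrow> ('p::finite \<Rightarrow> real) \<Rightarrow> ('p \<Rightarrow> real) \<Rightarrow> real" where
  "R_kernel \<theta> s c \<Phi>0 \<Phi>1 x y =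
     sqrt (G_fun \<theta> s c \<Phi>0 x) * H_fun \<Phi>1 x y * sqrt (G_fun \<theta> s c \<Phi>0 y)"


section \<open>Processes and the conditional specification\<close>

definition process :: "'w measure \<Rightarrow> 'x measure \<Rightarrow> (int \<Rightarrow> 'w \<Rightarrow> 'x) \<Rightarrow> bool" where
  "process P S X \<longleftrightarrow> prob_space P \<and> (\<forall>t. X t \<in> measurable P S)"

definition law :: "'w measure \<Rightarrow> 'x measure \<Rightarrow> (int \<Rightarrow> 'w \<Rightarrow> 'x) \<Rightarrow> (int \<Rightarrow> 'x) measure" where
  "law P S X = distr P (Pi\<^sub>M UNIV (\<lambda>_. S)) (\<lambda>\<omega> t. X t \<omega>)"

definition strictly_stationary :: "'w measure \<Rightarrow> 'x measure \<Rightarrow> (int \<Rightarrow> 'w \<Rightarrow> 'x) \<Rightarrow> bool" where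
  "strictly_stationary P S X \<longleftrightarrow>
     (\<forall>J h. finite J \<longrightarrow>
        distr P (Pi\<^sub>M J (\<lambda>_. S)) (\<lambda>\<omega>. \<lambda>t\<in>J. X (t + h) \<omega>) =
        distr P (Pi\<^sub>M J (\<lambda>_. S)) (\<lambda>\<omega>. \<lambda>t\<in>J. X t \<omega>))"

text \<open>The \<open>\<sigma>\<close>-algebra generated by all coordinates except coordinate \<open>a\<close> at time \<open>t\<close>.\<close>

definition others ::
  "'w measure \<Rightarrow> (int \<Rightarrow> 'w \<Rightarrow> 'p \<Rightarrow> real) \<Rightarrow> 'p \<Rightarrow> int \<Rightarrow> 'w measure" where
  "others P X a t =
     sigma (space P)
       {(\<lambda>\<omega>. X \<tau> \<omega> b) -` B \<inter> space P | b \<tau> B. (b, \<tau>) \<noteq> (a, t) \<and> B \<in> sets borel}"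

text \<open>
  The conditional distribution of \<open>Y\<close> given \<open>F\<close> has a density with respect to \<open>\<nu>\<close> proportional to
  \<open>f \<omega>\<close>; this includes that \<open>f \<omega>\<close> can be normalised for almost every \<open>\<omega>\<close>.
\<close>

definition cond_density_propto ::
  "'w measure \<Rightarrow> 'w measure \<Rightarrow> ('w \<Rightarrow> 'y) \<Rightarrow> 'y measure \<Rightarrow> ('w \<Rightarrow> 'y \<Rightarrow> real) \<Rightarrow> bool" where
  "cond_density_propto P F Y \<nu> f \<longleftrightarrow>
     (AE \<omega> in P. integrable \<nu> (f \<omega>) \<and> (AE y in \<nu>. 0 \<le> f \<omega> y) \<and> 0 < (LINT y|\<nu>. f \<omega> y)) \<and>
     (\<forall>B\<in>sets \<nu>. AE \<omega> in P.
        real_cond_exp P F (indicator (Y -` B \<inter> space P)) \<omega> =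
        (LINT y:B|\<nu>. f \<omega> y / (LINT z|\<nu>. f \<omega> z)))"

definition Theta_fun ::
  "real ^ 'p ^ 'p \<Rightarrow> real ^ 'p ^ 'p \<Rightarrow> real ^ 'p ^ 'p \<Rightarrow>
   (int \<Rightarrow> 'w \<Rightarrow> 'p::finite \<Rightarrow> real) \<Rightarrow> 'p \<Rightarrow> int \<Rightarrow> 'w \<Rightarrow> real" where
  "Theta_fun \<Phi>m \<Phi>0 \<Phi>1 X a t \<omega> =
     (\<Sum>b\<in>UNIV - {a}. \<Phi>0 $ a $ b * X t \<omega> b) +
     (\<Sum>b\<in>UNIV. \<Phi>m $ a $ b * X (t - 1) \<omega> b + \<Phi>1 $ a $ b * X (t + 1) \<omega> b)"

definition satisfies_CS ::
  "('p \<Rightarrow> real measure) \<Rightarrow> real ^ 'p \<Rightarrow> ('p \<Rightarrow> real \<Rightarrow> real) \<Rightarrow> ('p \<Rightarrow> real \<Rightarrow> real) \<Rightarrow>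
   real ^ 'p ^ 'p \<Rightarrow> real ^ 'p ^ 'p \<Rightarrow> real ^ 'p ^ 'p \<Rightarrow>
   'w measure \<Rightarrow> (int \<Rightarrow> 'w \<Rightarrow> 'p::finite \<Rightarrow> real) \<Rightarrow> bool" where
  "satisfies_CS \<mu> \<theta> s c \<Phi>m \<Phi>0 \<Phi>1 P X \<longleftrightarrow>
     (\<forall>a t. cond_density_propto P (others P X a t) (\<lambda>\<omega>. X t \<omega> a) (\<mu> a)
        (\<lambda>\<omega> x. exp (\<theta> $ a * s a x + x * Theta_fun \<Phi>m \<Phi>0 \<Phi>1 X a t \<omega> + c a x)))"

definition stationary_CS_process ::
  "('p \<Rightarrow> real measure) \<Rightarrow> real ^ 'p \<Rightarrow> ('p \<Rightarrow> real \<Rightarrow> real) \<Rightarrow> ('p \<Rightarrow> real \<Rightarrow> real) \<Rightarrow>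
   real ^ 'p ^ 'p \<Rightarrow> real ^ 'p ^ 'p \<Rightarrow> real ^ 'p ^ 'p \<Rightarrow>
   'w measure \<Rightarrow> (int \<Rightarrow> 'w \<Rightarrow> 'p::finite \<Rightarrow> real) \<Rightarrow> bool" where
  "stationary_CS_process \<mu> \<theta> s c \<Phi>m \<Phi>0 \<Phi>1 P X \<longleftrightarrow>
     process P (Pi\<^sub>M UNIV \<mu>) X \<and> strictly_stationary P (Pi\<^sub>M UNIV \<mu>) X \<and>
     satisfies_CS \<mu> \<theta> s c \<Phi>m \<Phi>0 \<Phi>1 P X"

end

theory Submission
  imports Defs
begin

text \<open>
  Compactness and positivity of the kernel give everywhere positive eigenfunctions \<open>v\<close>, \<open>w\<close> of \<open>T\<close> and
  \<open>T'\<close> for the same eigenvalue \<open>r\<close>: an infimum of positive supersolutions plays the role of Krein--Rutman.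
  Pairing with \<open>v\<close> and \<open>w\<close> shows that \<open>r\<close> is the spectral radius of both operators. The densities
  \<open>v(x\<^sub>1) \<Prod> R(x\<^sub>t\<^sub>-\<^sub>1, x\<^sub>t) w(x\<^sub>n) / r\<^sup>n\<^sup>-\<^sup>1\<close> are consistent and shift invariant by the two eigenvalue equations,
  so Kolmogorov's theorem yields a stationary process. It satisfies (CS) because changing one coordinate
  of \<open>x\<^sub>t\<close> changes \<open>R(x\<^sub>t\<^sub>-\<^sub>1, x\<^sub>t) R(x\<^sub>t, x\<^sub>t\<^sub>+\<^sub>1)\<close> exactly by the ratio of the single-site densities.

  Conversely, resampling all coordinates in a window of time one after another turns (CS) into a statement
  about blocks: given everything else, a block has density proportional to the product of kernels along it.
  As the block grows, \<open>T\<^sup>n f / r\<^sup>n\<close> converges to \<open>\<langle>f, w\<rangle> v\<close>, so the influence of the boundary disappears,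
  uniformly enough because stationarity keeps the law of the boundary values fixed; only the law above remains.
\<close>

section \<open>Square-integrable functions\<close>

text \<open>Supersolutions are used because the inequality \<open>T u \<le> l u\<close> is preserved
  by \<open>T\<close>, and because Neumann series yield such \<open>u\<close> for every
  \<open>l\<close> above a geometric growth rate. At the infimum these two facts force normalised
  almost eigenfunctions, and compactness makes them converge. Compactness is assumed for
  \<open>T\<close> alone, so boundedness and compactness of the adjoint are derived before anything
  symmetric in \<open>v\<close> and \<open>w\<close> can be said.

  The delicate point of uniqueness is that \<open>T\<^sup>n f / r\<^sup>n\<close> converges only in
  measure, while the boundary values of a block are random and may depend on the block. Two facts
  repair this: the one-time law is absolutely continuous, so almost every boundary value is
  admissible, and the joint law of a block and its distant boundary has one density against the
  product law, whatever the distance. A one-sided estimate between two probability measures then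
  gives equality.

  In the other direction the normalising integral in (CS) might diverge for some neighbours; its
  finiteness almost surely is extracted from the chain itself.\<close>

definition sq_integrable :: "'x measure \<Rightarrow> ('x \<Rightarrow> 'b::{banach, second_countable_topology}) \<Rightarrow> bool" where
  "sq_integrable M f \<longleftrightarrow> f \<in> borel_measurable M \<and> integrable M (\<lambda>x. (norm (f x))\<^sup>2)"

text \<open>Both notions leave the codomain open, so that the complex space \<open>L2\<close> of the
  statement and the real functions on which order arguments run share one set of lemmas.\<close>

definition sq_norm :: "'x measure \<Rightarrow> ('x \<Rightarrow> 'b::{banach, second_countable_topology}) \<Rightarrow> real" where
  "sq_norm M f = sqrt (LINT x|M. (norm (f x))\<^sup>2)"

lemma sq_integrable_measurable [measurable_dest, simp]: "sq_integrable M f \<Longrightarrow> f \<in> borel_measurable M"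
  by (simp add: sq_integrable_def)

lemma sq_norm_nonneg [simp]: "0 \<le> sq_norm M f"
  by (simp add: sq_norm_def)

lemma sq_norm_power2: "(sq_norm M f)\<^sup>2 = (LINT x|M. (norm (f x))\<^sup>2)"
  by (simp add: sq_norm_def)

lemma sq_nn_integral:
  assumes "sq_integrable M f"
  shows "(\<integral>\<^sup>+x. ennreal ((norm (f x))\<^sup>2) \<partial>M) = ennreal ((sq_norm M f)\<^sup>2)"
  using assms by (simp add: sq_integrable_def sq_norm_power2 nn_integral_eq_integral)

lemma sq_integrableI_nn:
  assumes [measurable]: "f \<in> borel_measurable M"
    and "(\<integral>\<^sup>+x. ennreal ((norm (f x))\<^sup>2) \<partial>M) \<le> ennreal (c\<^sup>2)" "0 \<le> c"
  shows "sq_integrable M f" "sq_norm M f \<le> c"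
proof -
  have "integrable M (\<lambda>x. (norm (f x))\<^sup>2)"
    by (rule integrableI_bounded) (use assms(2) in \<open>auto intro: le_less_trans\<close>)
  then show *: "sq_integrable M f"
    by (simp add: sq_integrable_def)
  show "sq_norm M f \<le> c"
    using assms(2) sq_nn_integral[OF *] assms(3) by (auto intro!: power2_le_imp_le[OF _ assms(3)])
qed

lemma sq_integrable_bound:
  assumes g: "sq_integrable M g" and [measurable]: "f \<in> borel_measurable M"
    and le: "AE x in M. norm (f x) \<le> norm (g x)"
  shows "sq_integrable M f" "sq_norm M f \<le> sq_norm M g"
proof -
  have "(\<integral>\<^sup>+x. ennreal ((norm (f x))\<^sup>2) \<partial>M) \<le> (\<integral>\<^sup>+x. ennreal ((norm (g x))\<^sup>2) \<partial>M)"
    using le by (intro nn_integral_mono_AE) (auto intro!: ennreal_leI power_mono)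
  then have *: "(\<integral>\<^sup>+x. ennreal ((norm (f x))\<^sup>2) \<partial>M) \<le> ennreal ((sq_norm M g)\<^sup>2)"
    using sq_nn_integral[OF g] by simp
  show "sq_integrable M f" "sq_norm M f \<le> sq_norm M g"
    using sq_integrableI_nn[OF assms(2) *] by simp_all
qed

lemma sq_norm_cong_AE:
  assumes "AE x in M. norm (f x) = norm (g x)"
    and [measurable]: "f \<in> borel_measurable M" "g \<in> borel_measurable M"
  shows "sq_norm M f = sq_norm M g"
  unfolding sq_norm_def using assms(1)
  by (intro arg_cong[where f=sqrt] integral_cong_AE) auto

lemma sq_norm_eq_0_iff:
  assumes "sq_integrable M f"
  shows "sq_norm M f = 0 \<longleftrightarrow> (AE x in M. f x = 0)"
proof -
  have "sq_norm M f = 0 \<longleftrightarrow> (LINT x|M. (norm (f x))\<^sup>2) = 0"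
    by (simp add: sq_norm_def)
  also have "\<dots> \<longleftrightarrow> (AE x in M. (norm (f x))\<^sup>2 = 0)"
    using assms by (intro integral_nonneg_eq_0_iff_AE) (auto simp: sq_integrable_def)
  finally show ?thesis by simp
qed

lemma ennreal_power2_le_imp_le:
  assumes "X\<^sup>2 \<le> (ennreal c)\<^sup>2" "0 \<le> c"
  shows "X \<le> ennreal c"
  using assms by (cases X) (auto simp: ennreal_power ennreal_top_mult top_unique abs_le_square_iff[symmetric])

text \<open>Cauchy-Schwarz for nonnegative integrals presupposes no integrability; its finite
  right-hand side is then what makes the product integrable.\<close>

lemma sq_Hoelder:
  fixes f :: "'x \<Rightarrow> 'b::{banach, second_countable_topology}"
    and g :: "'x \<Rightarrow> 'c::{banach, second_countable_topology}"
  assumes f: "sq_integrable M f" and g: "sq_integrable M g"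
  shows "integrable M (\<lambda>x. norm (f x) * norm (g x))"
    "(LINT x|M. norm (f x) * norm (g x)) \<le> sq_norm M f * sq_norm M g"
proof -
  have [measurable]: "f \<in> borel_measurable M" "g \<in> borel_measurable M"
    using f g by auto
  have "(\<integral>\<^sup>+x. ennreal (norm (f x)) * ennreal (norm (g x)) \<partial>M)\<^sup>2
      \<le> (\<integral>\<^sup>+x. (ennreal (norm (f x)))\<^sup>2 \<partial>M) * (\<integral>\<^sup>+x. (ennreal (norm (g x)))\<^sup>2 \<partial>M)"
    by (rule Cauchy_Schwarz_nn_integral) auto
  also have "\<dots> = ennreal ((sq_norm M f)\<^sup>2) * ennreal ((sq_norm M g)\<^sup>2)"
    using sq_nn_integral[OF f] sq_nn_integral[OF g] by (simp add: ennreal_power)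
  also have "\<dots> = (ennreal (sq_norm M f * sq_norm M g))\<^sup>2"
    by (simp add: ennreal_power ennreal_mult' power_mult_distrib)
  finally have "(\<integral>\<^sup>+x. ennreal (norm (f x)) * ennreal (norm (g x)) \<partial>M) \<le> ennreal (sq_norm M f * sq_norm M g)"
    by (rule ennreal_power2_le_imp_le) simp
  then have le: "(\<integral>\<^sup>+x. ennreal (norm (f x) * norm (g x)) \<partial>M) \<le> ennreal (sq_norm M f * sq_norm M g)"
    by (simp add: ennreal_mult')
  show int: "integrable M (\<lambda>x. norm (f x) * norm (g x))"
    by (rule integrableI_bounded) (use le in \<open>auto intro: le_less_trans simp: abs_mult\<close>)
  show "(LINT x|M. norm (f x) * norm (g x)) \<le> sq_norm M f * sq_norm M g"
    using le by (subst (asm) nn_integral_eq_integral[OF int]) auto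
qed

text \<open>Membership and Minkowski's inequality come from one estimate: the nonnegative integral
  of the squared norm of the sum is at most the square of the sum of the norms, the mixed term being
  controlled by \<open>sq_Hoelder\<close>.\<close>

lemma sq_integrable_add:
  assumes f: "sq_integrable M f" and g: "sq_integrable M g"
  shows "sq_integrable M (\<lambda>x. f x + g x)" "sq_norm M (\<lambda>x. f x + g x) \<le> sq_norm M f + sq_norm M g"
proof -
  have [measurable]: "f \<in> borel_measurable M" "g \<in> borel_measurable M"
    using f g by auto
  have int: "integrable M (\<lambda>x. (norm (f x))\<^sup>2)" "integrable M (\<lambda>x. (norm (g x))\<^sup>2)"
    "integrable M (\<lambda>x. norm (f x) * norm (g x))"
    using f g sq_Hoelder(1)[OF f g] by (auto simp: sq_integrable_def)
  have "(\<integral>\<^sup>+x. ennreal ((norm (f x + g x))\<^sup>2) \<partial>M)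
      \<le> (\<integral>\<^sup>+x. ennreal ((norm (f x))\<^sup>2 + 2 * (norm (f x) * norm (g x)) + (norm (g x))\<^sup>2) \<partial>M)"
  proof (intro nn_integral_mono ennreal_leI)
    fix x
    show "(norm (f x + g x))\<^sup>2 \<le> (norm (f x))\<^sup>2 + 2 * (norm (f x) * norm (g x)) + (norm (g x))\<^sup>2"
      using power_mono[OF norm_triangle_ineq[of "f x" "g x"] norm_ge_zero, of 2] by (simp add: power2_sum)
  qed
  also have "\<dots> = ennreal (LINT x|M. (norm (f x))\<^sup>2 + 2 * (norm (f x) * norm (g x)) + (norm (g x))\<^sup>2)"
    using int by (intro nn_integral_eq_integral) auto
  also have "(LINT x|M. (norm (f x))\<^sup>2 + 2 * (norm (f x) * norm (g x)) + (norm (g x))\<^sup>2)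
     = (sq_norm M f)\<^sup>2 + 2 * (LINT x|M. norm (f x) * norm (g x)) + (sq_norm M g)\<^sup>2"
    using int by (simp add: sq_norm_power2)
  also have "\<dots> \<le> (sq_norm M f + sq_norm M g)\<^sup>2"
    using sq_Hoelder(2)[OF f g] by (simp add: power2_sum)
  finally have "(\<integral>\<^sup>+x. ennreal ((norm (f x + g x))\<^sup>2) \<partial>M) \<le> ennreal ((sq_norm M f + sq_norm M g)\<^sup>2)"
    by (simp add: ennreal_leI)
  then show "sq_integrable M (\<lambda>x. f x + g x)" "sq_norm M (\<lambda>x. f x + g x) \<le> sq_norm M f + sq_norm M g"
    using sq_integrableI_nn[of "\<lambda>x. f x + g x" M "sq_norm M f + sq_norm M g"] by simp_all
qed

lemma sq_integrable_uminus:
  assumes f: "sq_integrable M f"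
  shows "sq_integrable M (\<lambda>x. - f x)" "sq_norm M (\<lambda>x. - f x) = sq_norm M f"
  using f by (auto simp: sq_integrable_def sq_norm_def)

lemma sq_norm_minus_commute: "sq_norm M (\<lambda>x. f x - g x) = sq_norm M (\<lambda>x. g x - f x)"
  by (simp add: sq_norm_def norm_minus_commute)

lemma sq_integrable_diff:
  assumes f: "sq_integrable M f" and g: "sq_integrable M g"
  shows "sq_integrable M (\<lambda>x. f x - g x)" "sq_norm M (\<lambda>x. f x - g x) \<le> sq_norm M f + sq_norm M g"
  using sq_integrable_add[OF f sq_integrable_uminus(1)[OF g]] sq_integrable_uminus(2)[OF g] by simp_all

lemma sq_norm_triangle_diff:
  assumes f: "sq_integrable M f" and g: "sq_integrable M g" and h: "sq_integrable M h"
  shows "sq_norm M (\<lambda>x. f x - h x) \<le> sq_norm M (\<lambda>x. f x - g x) + sq_norm M (\<lambda>x. g x - h x)"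
  using sq_integrable_add(2)[OF sq_integrable_diff(1)[OF f g] sq_integrable_diff(1)[OF g h]] by simp

lemma sq_norm_diff_abs:
  assumes f: "sq_integrable M f" and g: "sq_integrable M g"
  shows "\<bar>sq_norm M f - sq_norm M g\<bar> \<le> sq_norm M (\<lambda>x. f x - g x)"
  using sq_integrable_add(2)[OF sq_integrable_diff(1)[OF f g] g]
    sq_integrable_add(2)[OF sq_integrable_diff(1)[OF g f] f]
  by (simp add: sq_norm_minus_commute[of M g f] abs_if)

lemma sq_integrable_mult:
  fixes f :: "'x \<Rightarrow> 'b::{banach, second_countable_topology, real_normed_field}"
  assumes f: "sq_integrable M f"
  shows "sq_integrable M (\<lambda>x. c * f x)" "sq_norm M (\<lambda>x. c * f x) = norm c * sq_norm M f"
  using f by (auto simp: sq_integrable_def sq_norm_def norm_mult power_mult_distrib real_sqrt_mult)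

lemma sq_integrable_zero [simp]: "sq_integrable M (\<lambda>x. 0)" "sq_norm M (\<lambda>x. 0) = 0"
  by (auto simp: sq_integrable_def sq_norm_def)

lemma sq_integrable_sum:
  assumes f: "\<And>i. i \<in> I \<Longrightarrow> sq_integrable M (f i)"
  shows "sq_integrable M (\<lambda>x. \<Sum>i\<in>I. f i x) \<and> sq_norm M (\<lambda>x. \<Sum>i\<in>I. f i x) \<le> (\<Sum>i\<in>I. sq_norm M (f i))"
  using f
proof (induction I rule: infinite_finite_induct)
  case (insert i I)
  then show ?case
    using sq_integrable_add[of M "f i" "\<lambda>x. \<Sum>i\<in>I. f i x"] by fastforce
qed auto

lemma sq_integrable_norm:
  assumes "sq_integrable M f"
  shows "sq_integrable M (\<lambda>x. norm (f x))" "sq_norm M (\<lambda>x. norm (f x)) = sq_norm M f"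
  using assms by (auto simp: sq_integrable_def sq_norm_def)

lemma sq_integrable_of_real:
  fixes f :: "'x \<Rightarrow> real"
  shows "sq_integrable M (\<lambda>x. complex_of_real (f x)) \<longleftrightarrow> sq_integrable M f"
    "sq_norm M (\<lambda>x. complex_of_real (f x)) = sq_norm M f"
proof -
  have "(\<lambda>x. complex_of_real (f x)) \<in> borel_measurable M \<longleftrightarrow> f \<in> borel_measurable M"
  proof
    assume "(\<lambda>x. complex_of_real (f x)) \<in> borel_measurable M"
    from measurable_compose[OF this borel_measurable_Re] show "f \<in> borel_measurable M" by simp
  qed measurable
  then show "sq_integrable M (\<lambda>x. complex_of_real (f x)) \<longleftrightarrow> sq_integrable M f"
    by (simp only: sq_integrable_def norm_of_real real_norm_def power2_abs)
  show "sq_norm M (\<lambda>x. complex_of_real (f x)) = sq_norm M f"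
    by (simp add: sq_norm_def)
qed

section \<open>Completeness, and closedness of the positive cone\<close>

lemma sq_complete_sum:
  fixes h :: "nat \<Rightarrow> 'x \<Rightarrow> 'b::{banach, second_countable_topology}"
  assumes h: "\<And>n. sq_integrable M (h n)" and s: "summable (\<lambda>n. sq_norm M (h n))"
  shows "\<exists>g. sq_integrable M g \<and> (\<lambda>n. sq_norm M (\<lambda>x. (\<Sum>i<n. h i x) - g x)) \<longlonglongrightarrow> 0"
proof -
  have [measurable]: "h n \<in> borel_measurable M" for n using h[of n] by auto
  define C where "C = (\<Sum>n. sq_norm M (h n))"
  have C0: "0 \<le> C" unfolding C_def using s by (intro suminf_nonneg) auto
  define S where "S n x = (\<Sum>i<n. norm (h i x))" for n x
  have [measurable]: "S n \<in> borel_measurable M" for n unfolding S_def by measurable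
  have S: "sq_integrable M (S n)" "sq_norm M (S n) \<le> C" for n
  proof -
    have *: "sq_integrable M (S n) \<and> sq_norm M (S n) \<le> (\<Sum>i<n. sq_norm M (h i))"
      using sq_integrable_sum[of "{..<n}" M "\<lambda>i x. norm (h i x)"] h
      by (auto simp: S_def[abs_def] sq_integrable_norm)
    moreover have "(\<Sum>i<n. sq_norm M (h i)) \<le> C"
      unfolding C_def using s by (intro sum_le_suminf) auto
    ultimately show "sq_integrable M (S n)" "sq_norm M (S n) \<le> C" by auto
  qed
  have Smono: "S n x \<le> S m x" if "n \<le> m" for n m x
    unfolding S_def using that by (intro sum_mono2) auto
  have S0: "0 \<le> S n x" for n x unfolding S_def by (intro sum_nonneg) auto
  \<comment> \<open>By monotone convergence the integral of this supremum is at most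
    \<open>C\<^sup>2\<close>, so it is finite almost everywhere, and where it is finite the series
    converges absolutely.\<close>
  define V where "V x = (SUP n. ennreal ((S n x)\<^sup>2))" for x
  have [measurable]: "V \<in> borel_measurable M" unfolding V_def by measurable
  have Vint: "(\<integral>\<^sup>+x. V x \<partial>M) \<le> ennreal (C\<^sup>2)"
  proof -
    have "(\<integral>\<^sup>+x. V x \<partial>M) = (SUP n. \<integral>\<^sup>+x. ennreal ((S n x)\<^sup>2) \<partial>M)"
      unfolding V_def
      by (intro nn_integral_monotone_convergence_SUP)
        (auto simp: incseq_def le_fun_def intro!: ennreal_leI power_mono Smono S0)
    also have "\<dots> \<le> ennreal (C\<^sup>2)"
    proof (rule SUP_least)
      fix n
      have "(\<integral>\<^sup>+x. ennreal ((S n x)\<^sup>2) \<partial>M) = ennreal ((sq_norm M (S n))\<^sup>2)"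
        using sq_nn_integral[OF S(1)[of n]] by simp
      also have "\<dots> \<le> ennreal (C\<^sup>2)"
        using S(2)[of n] by (intro ennreal_leI power_mono) auto
      finally show "(\<integral>\<^sup>+x. ennreal ((S n x)\<^sup>2) \<partial>M) \<le> ennreal (C\<^sup>2)" .
    qed
    finally show ?thesis .
  qed
  then have "(\<integral>\<^sup>+x. V x \<partial>M) \<noteq> \<infinity>" by (auto simp: top_unique)
  then have Vfin: "AE x in M. V x \<noteq> \<infinity>"
    by (intro nn_integral_PInf_AE) auto
  have summ: "summable (\<lambda>n. norm (h n x))" if fin: "V x \<noteq> \<infinity>" for x
  proof -
    obtain v where v: "V x = ennreal v" "0 \<le> v" using fin by (cases "V x") auto
    have "ennreal ((S n x)\<^sup>2) \<le> ennreal v" for n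
      unfolding v(1)[symmetric] V_def by (intro SUP_upper) auto
    then have "(S n x)\<^sup>2 \<le> v" for n using v(2) by simp
    then have "S n x \<le> sqrt v" for n by (simp add: real_le_rsqrt)
    then show ?thesis
      by (intro summableI_nonneg_bounded[where x="sqrt v"]) (auto simp: S_def)
  qed
  define g where "g x = (\<Sum>n. h n x)" for x
  have [measurable]: "g \<in> borel_measurable M" unfolding g_def by measurable
  have sh: "summable (\<lambda>i. sq_norm M (h (i + n)))" for n
    by (rule summable_ignore_initial_segment[OF s])
  \<comment> \<open>Fatou's lemma on the finite segments \<open>{n..<n+m}\<close>: their norms are
    at most the tail of the summable series of norms, and the bound passes to the pointwise
    limit.\<close>
  have tail: "(\<integral>\<^sup>+x. ennreal ((norm ((\<Sum>i<n. h i x) - g x))\<^sup>2) \<partial>M) \<le> ennreal ((\<Sum>i. sq_norm M (h (i + n)))\<^sup>2)" for n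
  proof -
    have lim: "AE x in M. (\<lambda>m. ennreal ((norm (\<Sum>i\<in>{n..<n+m}. h i x))\<^sup>2)) \<longlonglongrightarrow> ennreal ((norm ((\<Sum>i<n. h i x) - g x))\<^sup>2)"
      using Vfin
    proof eventually_elim
      case (elim x)
      have sx: "summable (\<lambda>n. h n x)" using summ[OF elim] by (rule summable_norm_cancel)
      then have "(\<lambda>m. \<Sum>i<m. h i x) \<longlonglongrightarrow> g x" unfolding g_def by (rule summable_LIMSEQ)
      then have "(\<lambda>m. \<Sum>i<m+n. h i x) \<longlonglongrightarrow> g x" by (rule LIMSEQ_ignore_initial_segment)
      then have "(\<lambda>m. (\<Sum>i<m+n. h i x) - (\<Sum>i<n. h i x)) \<longlonglongrightarrow> g x - (\<Sum>i<n. h i x)"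
        by (intro tendsto_intros)
      moreover have "(\<Sum>i<m+n. h i x) - (\<Sum>i<n. h i x) = (\<Sum>i\<in>{n..<n+m}. h i x)" for m
        using sum_diff_nat_ivl[of 0 n "m + n" "\<lambda>i. h i x"] by (simp add: atLeast0LessThan add.commute)
      ultimately have "(\<lambda>m. \<Sum>i\<in>{n..<n+m}. h i x) \<longlonglongrightarrow> g x - (\<Sum>i<n. h i x)" by simp
      then show ?case
        by (subst norm_minus_commute) (intro tendsto_intros tendsto_ennrealI)
    qed
    have "(\<integral>\<^sup>+x. ennreal ((norm ((\<Sum>i<n. h i x) - g x))\<^sup>2) \<partial>M)
        = (\<integral>\<^sup>+x. liminf (\<lambda>m. ennreal ((norm (\<Sum>i\<in>{n..<n+m}. h i x))\<^sup>2)) \<partial>M)"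
    proof (rule nn_integral_cong_AE)
      show "AE x in M. ennreal ((norm ((\<Sum>i<n. h i x) - g x))\<^sup>2)
          = liminf (\<lambda>m. ennreal ((norm (\<Sum>i\<in>{n..<n+m}. h i x))\<^sup>2))"
        using lim
      proof eventually_elim
        case (elim x)
        show ?case
          by (rule lim_imp_Liminf[OF trivial_limit_sequentially elim, symmetric])
      qed
    qed
    also have "\<dots> \<le> liminf (\<lambda>m. \<integral>\<^sup>+x. ennreal ((norm (\<Sum>i\<in>{n..<n+m}. h i x))\<^sup>2) \<partial>M)"
      by (intro nn_integral_liminf) auto
    also have "\<dots> \<le> ennreal ((\<Sum>i. sq_norm M (h (i + n)))\<^sup>2)"
    proof -
      let ?c = "ennreal ((\<Sum>i. sq_norm M (h (i + n)))\<^sup>2)"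
      have "(\<integral>\<^sup>+x. ennreal ((norm (\<Sum>i\<in>{n..<n+m}. h i x))\<^sup>2) \<partial>M) \<le> ?c" for m
      proof -
      have *: "sq_integrable M (\<lambda>x. \<Sum>i\<in>{n..<n+m}. h i x)"
        "sq_norm M (\<lambda>x. \<Sum>i\<in>{n..<n+m}. h i x) \<le> (\<Sum>i\<in>{n..<n+m}. sq_norm M (h i))"
        using sq_integrable_sum[of "{n..<n+m}" M h] h by auto
      have "(\<Sum>i\<in>{n..<n+m}. sq_norm M (h i)) = (\<Sum>i<m. sq_norm M (h (i + n)))"
        using sum.shift_bounds_nat_ivl[of "\<lambda>i. sq_norm M (h i)" 0 n m] by (simp add: atLeast0LessThan add.commute)
      also have "\<dots> \<le> (\<Sum>i. sq_norm M (h (i + n)))"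
        by (intro sum_le_suminf sh) auto
      finally have "sq_norm M (\<lambda>x. \<Sum>i\<in>{n..<n+m}. h i x) \<le> (\<Sum>i. sq_norm M (h (i + n)))"
        using *(2) by simp
      then show ?thesis
        unfolding sq_nn_integral[OF *(1)] by (intro ennreal_leI power_mono) auto
      qed
      then have "liminf (\<lambda>m. \<integral>\<^sup>+x. ennreal ((norm (\<Sum>i\<in>{n..<n+m}. h i x))\<^sup>2) \<partial>M) \<le> liminf (\<lambda>m. ?c)"
        by (intro Liminf_mono always_eventually allI)
      then show ?thesis
        by (simp add: Liminf_const)
    qed
    finally show ?thesis .
  qed
  have t0: "0 \<le> (\<Sum>i. sq_norm M (h (i + n)))" for n
    by (intro suminf_nonneg sh) auto
  have d: "sq_integrable M (\<lambda>x. (\<Sum>i<n. h i x) - g x)" "sq_norm M (\<lambda>x. (\<Sum>i<n. h i x) - g x) \<le> (\<Sum>i. sq_norm M (h (i + n)))" for n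
    by (rule sq_integrableI_nn[OF _ tail t0], measurable)+
  have "sq_integrable M g"
    using sq_integrable_uminus(1)[OF d(1)[of 0]] by simp
  moreover have "(\<lambda>n. sq_norm M (\<lambda>x. (\<Sum>i<n. h i x) - g x)) \<longlonglongrightarrow> 0"
    by (rule tendsto_sandwich[OF _ _ tendsto_const suminf_exist_split2[OF s]])
      (auto simp: d(2))
  ultimately show ?thesis by blast
qed

text \<open>A subsequence whose increments are below \<open>(1/2)^j\<close> telescopes into an
  absolutely summable series; the Cauchy property then carries its limit over to the whole
  sequence.\<close>

lemma sq_complete:
  fixes f :: "nat \<Rightarrow> 'x \<Rightarrow> 'b::{banach, second_countable_topology}"
  assumes f: "\<And>n. sq_integrable M (f n)"
    and cauchy: "\<And>e. 0 < e \<Longrightarrow> \<exists>N. \<forall>m\<ge>N. \<forall>n\<ge>N. sq_norm M (\<lambda>x. f m x - f n x) < e"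
  shows "\<exists>g. sq_integrable M g \<and> (\<lambda>n. sq_norm M (\<lambda>x. f n x - g x)) \<longlonglongrightarrow> 0"
proof -
  have "\<forall>j. \<exists>N. \<forall>m\<ge>N. \<forall>n\<ge>N. sq_norm M (\<lambda>x. f m x - f n x) < (1/2)^j"
    using cauchy by simp
  then obtain N where N: "\<And>j m n. m \<ge> N j \<Longrightarrow> n \<ge> N j \<Longrightarrow> sq_norm M (\<lambda>x. f m x - f n x) < (1/2)^j"
    by metis
  \<comment> \<open>Summing the \<open>N i\<close> makes the indices increase and dominate
    \<open>N j\<close>; the extra \<open>j\<close> makes them tend to infinity.\<close>
  define k where "k j = (\<Sum>i\<le>j. N i) + j" for j
  have kN: "k j \<ge> N j" for j
    unfolding k_def using member_le_sum[of j "{..j}" N] by simp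
  have kj: "k j \<ge> j" for j unfolding k_def by simp
  have kS: "k (Suc j) \<ge> k j" for j unfolding k_def by simp
  define h where "h j x = f (k (Suc j)) x - f (k j) x" for j x
  have h: "sq_integrable M (h j)" for j
    unfolding h_def by (intro sq_integrable_diff f)
  have hn: "sq_norm M (h j) \<le> (1/2)^j" for j
    using N[of j "k (Suc j)" "k j"] kN[of j] kS[of j] unfolding h_def by simp
  have "summable (\<lambda>j. sq_norm M (h j))"
    by (rule summable_comparison_test'[where g="\<lambda>j. (1/2)^j"]) (use hn in auto)
  from sq_complete_sum[OF h this] obtain g where g: "sq_integrable M g"
    and lim: "(\<lambda>n. sq_norm M (\<lambda>x. (\<Sum>i<n. h i x) - g x)) \<longlonglongrightarrow> 0" by blast
  define G where "G x = g x + f (k 0) x" for x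
  have G: "sq_integrable M G" unfolding G_def by (intro sq_integrable_add f g)
  have tel: "(\<Sum>i<n. h i x) = f (k n) x - f (k 0) x" for n x
    unfolding h_def by (rule sum_lessThan_telescope)
  have lim': "(\<lambda>n. sq_norm M (\<lambda>x. f (k n) x - G x)) \<longlonglongrightarrow> 0"
    using lim unfolding tel G_def by (simp add: algebra_simps)
  have "(\<lambda>n. sq_norm M (\<lambda>x. f n x - G x)) \<longlonglongrightarrow> 0"
  proof (rule LIMSEQ_I)
    fix e :: real assume e: "0 < e"
    obtain N1 where N1: "\<And>m n. m \<ge> N1 \<Longrightarrow> n \<ge> N1 \<Longrightarrow> sq_norm M (\<lambda>x. f m x - f n x) < e/2"
      using cauchy[of "e/2"] e by auto
    obtain N2 where N2: "\<And>n. n \<ge> N2 \<Longrightarrow> sq_norm M (\<lambda>x. f (k n) x - G x) < e/2"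
      using LIMSEQ_D[OF lim', of "e/2"] e by auto
    have "norm (sq_norm M (\<lambda>x. f n x - G x) - 0) < e" if "n \<ge> N1" for n
      using sq_norm_triangle_diff[OF f[of n] f[of "k (max N1 N2)"] G]
        N1[OF that, of "k (max N1 N2)"] N2[of "max N1 N2"] kj[of "max N1 N2"] by auto
    then show "\<exists>no. \<forall>n\<ge>no. norm (sq_norm M (\<lambda>x. f n x - G x) - 0) < e" by blast
  qed
  with G show ?thesis by blast
qed

text \<open>The negative part of \<open>g\<close> is dominated by \<open>|f n - g|\<close> for every
  \<open>n\<close>, so its norm is 0.\<close>

lemma sq_limit_nonneg:
  fixes f :: "nat \<Rightarrow> 'x \<Rightarrow> real"
  assumes f: "\<And>n. sq_integrable M (f n)" and g: "sq_integrable M g"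
    and lim: "(\<lambda>n. sq_norm M (\<lambda>x. f n x - g x)) \<longlonglongrightarrow> 0"
    and pos: "\<And>n. AE x in M. 0 \<le> f n x"
  shows "AE x in M. 0 \<le> g x"
proof -
  have [measurable]: "g \<in> borel_measurable M" using g by auto
  have *: "sq_integrable M (\<lambda>x. max 0 (- g x))"
    by (rule sq_integrable_bound[OF g]) auto
  have "sq_norm M (\<lambda>x. max 0 (- g x)) \<le> sq_norm M (\<lambda>x. f n x - g x)" for n
    by (rule sq_integrable_bound(2)[OF sq_integrable_diff(1)[OF f g]])
      (use pos[of n] in \<open>auto elim!: eventually_mono\<close>)
  then have "sq_norm M (\<lambda>x. max 0 (- g x)) \<le> 0"
    by (intro LIMSEQ_le_const[OF lim]) auto
  then have "AE x in M. max 0 (- g x) = 0"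
    using sq_norm_eq_0_iff[OF *] by (simp add: order_antisym)
  then show ?thesis by eventually_elim linarith
qed

lemma sq_limit_unique:
  assumes f: "\<And>n. sq_integrable M (f n)" and g: "sq_integrable M g" and h: "sq_integrable M h"
    and limg: "(\<lambda>n. sq_norm M (\<lambda>x. f n x - g x)) \<longlonglongrightarrow> 0"
    and limh: "(\<lambda>n. sq_norm M (\<lambda>x. f n x - h x)) \<longlonglongrightarrow> 0"
  shows "AE x in M. g x = h x"
proof -
  have "sq_norm M (\<lambda>x. g x - h x) \<le> sq_norm M (\<lambda>x. f n x - g x) + sq_norm M (\<lambda>x. f n x - h x)" for n
    using sq_norm_triangle_diff[OF g f[of n] h] unfolding sq_norm_minus_commute[of M g "f n"] .
  then have "sq_norm M (\<lambda>x. g x - h x) \<le> 0"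
    using LIMSEQ_le_const[OF tendsto_add[OF limg limh]] by force
  then have "AE x in M. g x - h x = 0"
    using sq_norm_eq_0_iff[OF sq_integrable_diff(1)[OF g h]] by (simp add: order_antisym)
  then show ?thesis by eventually_elim simp
qed

lemma sq_limit_norm:
  assumes f: "\<And>n. sq_integrable M (f n)" and g: "sq_integrable M g"
    and lim: "(\<lambda>n. sq_norm M (\<lambda>x. f n x - g x)) \<longlonglongrightarrow> 0"
  shows "(\<lambda>n. sq_norm M (f n)) \<longlonglongrightarrow> sq_norm M g"
proof -
  have "(\<lambda>n. sq_norm M (f n) - sq_norm M g) \<longlonglongrightarrow> 0"
    by (rule tendsto_rabs_zero_cancel, rule tendsto_sandwich[OF _ _ tendsto_const lim])
      (auto simp: sq_norm_diff_abs[OF f g])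
  then show ?thesis by (simp add: LIM_zero_iff)
qed

lemma L2_iff_sq_integrable: "f \<in> L2 M \<longleftrightarrow> sq_integrable M f"
  by (simp add: L2_def sq_integrable_def)

lemma L2_norm_eq_sq_norm: "L2_norm M f = sq_norm M f"
  by (simp add: L2_norm_def sq_norm_def)

lemma borel_measurable_cnj [measurable]: "cnj \<in> borel_measurable borel"
  by (intro borel_measurable_continuous_onI continuous_intros)

section \<open>Compact integral operators with positive kernel\<close>

text \<open>\<open>lower_bound\<close> does two things: it makes \<open>M\<close> a nonzero measure,
  and it keeps the constants of supersolutions away from 0, so that the principal eigenvalue is
  positive. It holds for the transposed kernel too, so the locale can be interpreted for the
  adjoint.\<close>

locale positive_kernel =
  fixes M :: "'x measure" and K :: "'x \<Rightarrow> 'x \<Rightarrow> real"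
  assumes sigma_finite: "sigma_finite_measure M"
    and K_measurable: "(\<lambda>(x, y). K x y) \<in> borel_measurable (M \<Otimes>\<^sub>M M)"
    and K_pos: "\<And>x y. 0 < K x y"
    and on_L2: "integral_op_on_L2 M K"
    and compact: "compact_op M (integral_op M K)"
    and lower_bound: "\<exists>A\<in>sets M. 0 < emeasure M A \<and> emeasure M A < \<infinity> \<and> (\<exists>e>0. \<forall>x\<in>A. \<forall>y\<in>A. e \<le> K x y)"
begin

sublocale M: sigma_finite_measure M by (rule sigma_finite)
sublocale MM: pair_sigma_finite M M by standard

abbreviation "T \<equiv> integral_op M K"
abbreviation "T' \<equiv> integral_op M (\<lambda>x y. K y x)"

definition Tr :: "('x \<Rightarrow> real) \<Rightarrow> 'x \<Rightarrow> real" where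
  "Tr f y = (LINT x|M. K x y * f x)"

lemma K_measurable_comp [measurable (raw)]:
  assumes [measurable]: "f \<in> measurable N M" "g \<in> measurable N M"
  shows "(\<lambda>z. K (f z) (g z)) \<in> borel_measurable N"
  using measurable_compose[OF measurable_Pair[OF assms] K_measurable] by simp

lemma K_nonneg [simp]: "0 \<le> K x y"
  using K_pos[of x y] by simp

lemma K_ne_0 [simp]: "K x y \<noteq> 0"
  using K_pos[of x y] by simp

lemma T_integrable:
  assumes "sq_integrable M f"
  shows "AE y in M. integrable M (\<lambda>x. complex_of_real (K x y) * f x)"
  using on_L2 assms by (auto simp: integral_op_on_L2_def L2_iff_sq_integrable)

lemma T_sq_integrable: "sq_integrable M f \<Longrightarrow> sq_integrable M (T f)"
  using on_L2 by (auto simp: integral_op_on_L2_def L2_iff_sq_integrable)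

lemma T_of_real: "T (\<lambda>x. complex_of_real (f x)) = (\<lambda>y. complex_of_real (Tr f y))"
proof
  fix y show "T (\<lambda>x. complex_of_real (f x)) y = complex_of_real (Tr f y)"
    unfolding integral_op_def Tr_def of_real_mult[symmetric] by (rule integral_complex_of_real)
qed

lemma Tr_integrable:
  assumes "sq_integrable M f"
  shows "AE y in M. integrable M (\<lambda>x. K x y * f x)"
proof -
  have "AE y in M. integrable M (\<lambda>x. complex_of_real (K x y) * complex_of_real (f x))"
    using assms by (intro T_integrable) (simp add: sq_integrable_of_real)
  then show ?thesis
  proof eventually_elim
    case (elim y)
    then have "integrable M (\<lambda>x. complex_of_real (K x y * f x))" by simp
    from integrable_Re[OF this] show ?case by simp
  qed
qed

lemma Tr_sq_integrable: "sq_integrable M f \<Longrightarrow> sq_integrable M (Tr f)"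
  using T_sq_integrable[of "\<lambda>x. complex_of_real (f x)"] unfolding T_of_real sq_integrable_of_real .

lemma T_diff:
  assumes "sq_integrable M f" "sq_integrable M g"
  shows "AE y in M. T (\<lambda>x. f x - g x) y = T f y - T g y"
  using T_integrable[OF assms(1)] T_integrable[OF assms(2)]
proof eventually_elim
  case (elim y)
  then show ?case by (simp add: integral_op_def right_diff_distrib)
qed

lemma Tr_diff:
  assumes "sq_integrable M f" "sq_integrable M g"
  shows "AE y in M. Tr (\<lambda>x. f x - g x) y = Tr f y - Tr g y"
  using Tr_integrable[OF assms(1)] Tr_integrable[OF assms(2)]
proof eventually_elim
  case (elim y)
  then show ?case by (simp add: Tr_def right_diff_distrib)
qed

lemma T_mult: "T (\<lambda>x. c * f x) y = c * T f y"
proof -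
  have "(\<lambda>x. complex_of_real (K x y) * (c * f x)) = (\<lambda>x. c * (complex_of_real (K x y) * f x))"
    by (simp add: fun_eq_iff)
  then show ?thesis by (simp add: integral_op_def)
qed

lemma Tr_mult: "Tr (\<lambda>x. c * f x) y = c * Tr f y"
proof -
  have "(\<lambda>x. K x y * (c * f x)) = (\<lambda>x. c * (K x y * f x))"
    by (simp add: fun_eq_iff)
  then show ?thesis by (simp add: Tr_def)
qed

lemma T_cong_AE:
  assumes "AE x in M. f x = g x" and [measurable]: "f \<in> borel_measurable M" "g \<in> borel_measurable M"
  shows "AE y in M. T f y = T g y"
proof (rule AE_I2)
  fix y assume [measurable]: "y \<in> space M"
  show "T f y = T g y"
    unfolding integral_op_def using assms(1) by (intro integral_cong_AE) auto
qed

lemma Tr_cong_AE: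
  assumes "AE x in M. f x = g x" and [measurable]: "f \<in> borel_measurable M" "g \<in> borel_measurable M"
  shows "AE y in M. Tr f y = Tr g y"
proof (rule AE_I2)
  fix y assume [measurable]: "y \<in> space M"
  show "Tr f y = Tr g y"
    unfolding Tr_def using assms(1) by (intro integral_cong_AE) auto
qed

lemma T_compact:
  assumes f: "\<And>n. sq_integrable M (f n)" and C: "\<And>n. sq_norm M (f n) \<le> C"
  obtains g and k :: "nat \<Rightarrow> nat" where "sq_integrable M g" "strict_mono k"
    "(\<lambda>n. sq_norm M (\<lambda>x. T (f (k n)) x - g x)) \<longlonglongrightarrow> 0"
proof -
  have "\<forall>n. f n \<in> L2 M" using f by (simp add: L2_iff_sq_integrable)
  moreover have "\<exists>C. \<forall>n. L2_norm M (f n) \<le> C" using C by (auto simp: L2_norm_eq_sq_norm)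
  ultimately obtain g k where "g \<in> L2 M" "strict_mono k"
    "(\<lambda>n. L2_norm M (\<lambda>x. T (f (k n)) x - g x)) \<longlonglongrightarrow> 0"
    using compact[unfolded compact_op_def, THEN conjunct2, rule_format, of f] by auto
  then show thesis
    using that[of g k] by (simp add: L2_iff_sq_integrable L2_norm_eq_sq_norm)
qed

text \<open>Unit vectors \<open>f n\<close> with \<open>\<parallel>T f n\<parallel> > n\<close> are
  impossible: by compactness some subsequence of the images converges and is therefore
  bounded.\<close>

lemma T_bounded: "\<exists>C>0. \<forall>f. sq_integrable M f \<longrightarrow> sq_norm M (T f) \<le> C * sq_norm M f"
proof (rule ccontr)
  assume neg: "\<not> ?thesis"
  have "\<exists>f. sq_integrable M f \<and> sq_norm M f = 1 \<and> sq_norm M (T f) > real n" for n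
  proof -
    obtain f where f: "sq_integrable M f" "sq_norm M (T f) > real (Suc n) * sq_norm M f"
      using neg by (metis not_le of_nat_0_less_iff zero_less_Suc)
    have n0: "sq_norm M f \<noteq> 0"
    proof
      assume 0: "sq_norm M f = 0"
      then have "AE x in M. f x = 0" using sq_norm_eq_0_iff[OF f(1)] by simp
      then have "AE y in M. T f y = T (\<lambda>x. 0) y"
        using f(1) by (intro T_cong_AE) auto
      then have "AE y in M. T f y = 0" by (simp add: integral_op_def)
      then have "sq_norm M (T f) = 0"
        using sq_norm_eq_0_iff[OF T_sq_integrable[OF f(1)]] by simp
      with f(2) 0 show False by simp
    qed
    then have p: "sq_norm M f > 0" using sq_norm_nonneg[of M f] by linarith
    let ?c = "complex_of_real (1 / sq_norm M f)"
    have "sq_norm M (T (\<lambda>x. ?c * f x)) = (1 / sq_norm M f) * sq_norm M (T f)"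
      unfolding T_mult sq_integrable_mult(2)[OF T_sq_integrable[OF f(1)]] norm_of_real using p by simp
    also have "\<dots> > real n"
      using f(2) p by (simp add: field_simps)
    finally show ?thesis
      using sq_integrable_mult[OF f(1), of ?c] p
      by (intro exI[of _ "\<lambda>x. ?c * f x"]) (simp add: norm_divide)
  qed
  then have "\<forall>n. \<exists>f. sq_integrable M f \<and> sq_norm M f = 1 \<and> sq_norm M (T f) > real n" by blast
  from choice[OF this] obtain f
    where f: "\<And>n. sq_integrable M (f n)" "\<And>n. sq_norm M (f n) = 1" "\<And>n. sq_norm M (T (f n)) > real n"
    by blast
  obtain g and k :: "nat \<Rightarrow> nat" where g: "sq_integrable M g" "strict_mono k"
    and lim: "(\<lambda>n. sq_norm M (\<lambda>x. T (f (k n)) x - g x)) \<longlonglongrightarrow> 0"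
    by (rule T_compact[of f 1]) (simp_all add: f)
  have "(\<lambda>n. sq_norm M (T (f (k n)))) \<longlonglongrightarrow> sq_norm M g"
    by (rule sq_limit_norm[OF _ g(1) lim]) (intro T_sq_integrable f)
  then have "Bseq (\<lambda>n. sq_norm M (T (f (k n))))"
    by (intro convergent_imp_Bseq convergentI)
  then obtain B where B: "\<And>n. \<bar>sq_norm M (T (f (k n)))\<bar> \<le> B"
    by (auto simp: Bseq_def)
  obtain n :: nat where n: "B \<le> real n" using real_arch_simple by blast
  have "real n \<le> real (k n)" using g(2) seq_suble by (simp add: seq_suble)
  with n f(3)[of "k n"] B[of n] show False by linarith
qed

text \<open>Some bound for the operator norm, chosen once; it is not claimed to be the least
  one.\<close>

definition opC :: real where
  "opC = (SOME C. 0 < C \<and> (\<forall>f. sq_integrable M f \<longrightarrow> sq_norm M (T f) \<le> C * sq_norm M f))"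

lemma opC: "0 < opC" "sq_integrable M f \<Longrightarrow> sq_norm M (T f) \<le> opC * sq_norm M f"
  using someI_ex[OF T_bounded[unfolded Bex_def]] unfolding opC_def by auto

lemma Tr_bounded: "sq_integrable M f \<Longrightarrow> sq_norm M (Tr f) \<le> opC * sq_norm M f"
  using opC(2)[of "\<lambda>x. complex_of_real (f x)"] unfolding T_of_real sq_integrable_of_real .

text \<open>The limit supplied by complex compactness may be complex; its real part serves, because
  the distance of a real number to \<open>Re b\<close> is at most its distance to
  \<open>b\<close>.\<close>

lemma Tr_compact:
  fixes f :: "nat \<Rightarrow> 'x \<Rightarrow> real"
  assumes f: "\<And>n. sq_integrable M (f n)" and C: "\<And>n. sq_norm M (f n) \<le> C"
  obtains g and k :: "nat \<Rightarrow> nat" where "sq_integrable M g" "strict_mono k"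
    "(\<lambda>n. sq_norm M (\<lambda>x. Tr (f (k n)) x - g x)) \<longlonglongrightarrow> 0"
proof -
  obtain g and k :: "nat \<Rightarrow> nat" where g: "sq_integrable M g" and k: "strict_mono k"
    and lim: "(\<lambda>n. sq_norm M (\<lambda>x. T (\<lambda>x. complex_of_real (f (k n) x)) x - g x)) \<longlonglongrightarrow> 0"
    by (rule T_compact[of "\<lambda>n x. complex_of_real (f n x)" C]) (simp_all add: sq_integrable_of_real f C)
  have [measurable]: "g \<in> borel_measurable M" using g by auto
  have Re: "sq_integrable M (\<lambda>x. Re (g x))"
    by (rule sq_integrable_bound[OF g]) (auto simp: abs_Re_le_cmod)
  have le: "sq_norm M (\<lambda>x. Tr (f (k n)) x - Re (g x)) \<le> sq_norm M (\<lambda>x. T (\<lambda>x. complex_of_real (f (k n) x)) x - g x)" for n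
  proof (rule sq_integrable_bound(2))
    have s: "sq_integrable M (Tr (f (k n)))" by (intro Tr_sq_integrable f)
    then show "sq_integrable M (\<lambda>x. T (\<lambda>x. complex_of_real (f (k n) x)) x - g x)"
      unfolding T_of_real by (intro sq_integrable_diff g) (simp add: sq_integrable_of_real)
    show "(\<lambda>x. Tr (f (k n)) x - Re (g x)) \<in> borel_measurable M" using s by measurable
    show "AE x in M. norm (Tr (f (k n)) x - Re (g x)) \<le> norm (T (\<lambda>x. complex_of_real (f (k n) x)) x - g x)"
      unfolding T_of_real using abs_Re_le_cmod[of "complex_of_real a - b" for a b] by simp
  qed
  have "(\<lambda>n. sq_norm M (\<lambda>x. Tr (f (k n)) x - Re (g x))) \<longlonglongrightarrow> 0"
    by (rule tendsto_sandwich[OF _ _ tendsto_const lim]) (auto simp: le)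
  with Re k show thesis by (rule that)
qed

lemma T_limit:
  assumes f: "\<And>n. sq_integrable M (f n)" and g: "sq_integrable M g"
    and lim: "(\<lambda>n. sq_norm M (\<lambda>x. f n x - g x)) \<longlonglongrightarrow> 0"
  shows "(\<lambda>n. sq_norm M (\<lambda>x. T (f n) x - T g x)) \<longlonglongrightarrow> 0"
proof -
  have "sq_norm M (\<lambda>x. T (f n) x - T g x) \<le> opC * sq_norm M (\<lambda>x. f n x - g x)" for n
  proof -
    have "sq_norm M (\<lambda>x. T (f n) x - T g x) = sq_norm M (T (\<lambda>x. f n x - g x))"
      using T_diff[OF f[of n] g] T_sq_integrable[OF f[of n]] T_sq_integrable[OF g]
        T_sq_integrable[OF sq_integrable_diff(1)[OF f[of n] g]]
      by (intro sq_norm_cong_AE) auto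
    then show ?thesis
      using opC(2)[OF sq_integrable_diff(1)[OF f[of n] g]] by simp
  qed
  then show ?thesis
    by (intro tendsto_sandwich[OF _ _ tendsto_const tendsto_mult_right_zero[OF lim, of opC]]) auto
qed

lemma Tr_limit:
  assumes f: "\<And>n. sq_integrable M (f n)" and g: "sq_integrable M g"
    and lim: "(\<lambda>n. sq_norm M (\<lambda>x. f n x - g x)) \<longlonglongrightarrow> 0"
  shows "(\<lambda>n. sq_norm M (\<lambda>x. Tr (f n) x - Tr g x)) \<longlonglongrightarrow> 0"
proof -
  have *: "(\<lambda>n. sq_norm M (\<lambda>x. complex_of_real (f n x) - complex_of_real (g x))) \<longlonglongrightarrow> 0"
    using lim unfolding of_real_diff[symmetric] sq_integrable_of_real .
  have "(\<lambda>n. sq_norm M (\<lambda>x. T (\<lambda>x. complex_of_real (f n x)) x - T (\<lambda>x. complex_of_real (g x)) x)) \<longlonglongrightarrow> 0"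
    using f g by (intro T_limit *) (simp_all add: sq_integrable_of_real)
  then show ?thesis
    unfolding T_of_real of_real_diff[symmetric] sq_integrable_of_real .
qed

section \<open>Nonnegative integrals and the adjoint operator\<close>

definition nT :: "('x \<Rightarrow> ennreal) \<Rightarrow> 'x \<Rightarrow> ennreal" where
  "nT f y = (\<integral>\<^sup>+x. ennreal (K x y) * f x \<partial>M)"

text \<open>Like \<open>nT\<close>, this version takes values in \<open>ennreal\<close>: it is
  defined for every measurable nonnegative function, in particular for sections \<open>K x\<close>
  of the kernel, whose square-integrability is not known, and Tonelli applies to it without side
  conditions.\<close>

definition nT' :: "('x \<Rightarrow> ennreal) \<Rightarrow> 'x \<Rightarrow> ennreal" where
  "nT' f x = (\<integral>\<^sup>+y. ennreal (K x y) * f y \<partial>M)"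

lemma nT_measurable [measurable (raw)]:
  assumes [measurable]: "(\<lambda>(z, x). f z x) \<in> borel_measurable (N \<Otimes>\<^sub>M M)" "g \<in> measurable N M"
  shows "(\<lambda>z. nT (f z) (g z)) \<in> borel_measurable N" "(\<lambda>z. nT' (f z) (g z)) \<in> borel_measurable N"
  unfolding nT_def nT'_def by measurable

lemma nT_duality:
  assumes [measurable]: "f \<in> borel_measurable M" "g \<in> borel_measurable M"
  shows "(\<integral>\<^sup>+y. nT f y * g y \<partial>M) = (\<integral>\<^sup>+x. f x * nT' g x \<partial>M)"
proof -
  have "(\<integral>\<^sup>+y. nT f y * g y \<partial>M) = (\<integral>\<^sup>+y. \<integral>\<^sup>+x. ennreal (K x y) * f x * g y \<partial>M \<partial>M)"
    unfolding nT_def by (intro nn_integral_cong nn_integral_multc[symmetric]) auto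
  also have "\<dots> = (\<integral>\<^sup>+x. \<integral>\<^sup>+y. ennreal (K x y) * f x * g y \<partial>M \<partial>M)"
    by (rule MM.Fubini') measurable
  also have "\<dots> = (\<integral>\<^sup>+x. f x * nT' g x \<partial>M)"
    unfolding nT'_def
    by (intro nn_integral_cong) (subst nn_integral_cmult[symmetric], auto simp: mult_ac)
  finally show ?thesis .
qed

lemma nT_eq_Tr:
  assumes f: "sq_integrable M f" and pos: "\<And>x. 0 \<le> f x"
  shows "AE y in M. nT (\<lambda>x. ennreal (f x)) y = ennreal (Tr f y)"
  using Tr_integrable[OF f]
proof eventually_elim
  case (elim y)
  then have "(\<integral>\<^sup>+x. ennreal (K x y * f x) \<partial>M) = ennreal (Tr f y)"
    unfolding Tr_def by (intro nn_integral_eq_integral) (auto simp: pos)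
  then show ?case by (simp add: nT_def ennreal_mult' pos)
qed

lemma nn_sq_Hoelder:
  fixes f g :: "'x \<Rightarrow> real"
  assumes f: "sq_integrable M f" and g: "sq_integrable M g" and "\<And>x. 0 \<le> f x" "\<And>x. 0 \<le> g x"
  shows "(\<integral>\<^sup>+x. ennreal (f x) * ennreal (g x) \<partial>M) \<le> ennreal (sq_norm M f * sq_norm M g)"
proof -
  have "(\<integral>\<^sup>+x. ennreal (f x) * ennreal (g x) \<partial>M) = (\<integral>\<^sup>+x. ennreal (norm (f x) * norm (g x)) \<partial>M)"
    using assms(3,4) by (simp add: ennreal_mult')
  also have "\<dots> = ennreal (LINT x|M. norm (f x) * norm (g x))"
    by (intro nn_integral_eq_integral sq_Hoelder(1)[OF f g]) auto
  finally show ?thesis using sq_Hoelder(2)[OF f g] by (simp add: ennreal_leI)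
qed

text \<open>It is not known in advance that the adjoint maps into \<open>L2\<close>. For a
  square-integrable truncation \<open>f\<close> of \<open>F = T' g\<close> one has
  \<open>\<parallel>f\<parallel>\<^sup>2 \<le> \<langle>f, F\<rangle> = \<langle>T f, g\<rangle>
  \<le> opC \<parallel>f\<parallel> \<parallel>g\<parallel>\<close>; cancelling
  \<open>\<parallel>f\<parallel>\<close> bounds all truncations alike, and monotone convergence
  reaches \<open>F\<close>.\<close>

lemma nT'_bounded:
  fixes g :: "'x \<Rightarrow> real"
  assumes g: "sq_integrable M g" and pos: "\<And>x. 0 \<le> g x"
  shows "(\<integral>\<^sup>+x. (nT' (\<lambda>y. ennreal (g y)) x)\<^sup>2 \<partial>M) \<le> ennreal ((opC * sq_norm M g)\<^sup>2)"
proof -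
  have [measurable]: "g \<in> borel_measurable M" using g by auto
  define F where "F x = nT' (\<lambda>y. ennreal (g y)) x" for x
  have F[measurable]: "F \<in> borel_measurable M" unfolding F_def by measurable
  obtain A :: "nat \<Rightarrow> 'x set" where A: "range A \<subseteq> sets M" "(\<Union>i. A i) = space M"
    "\<And>i. emeasure M (A i) \<noteq> \<infinity>" "incseq A"
    using M.sigma_finite_incseq by blast
  have [measurable]: "A n \<in> sets M" for n using A(1) by auto
  \<comment> \<open>Cut off in height by \<open>n\<close> and in space by a set of finite measure,
    \<open>F\<close> becomes square-integrable, whatever infinite values it may have.\<close>
  define f where "f n x = enn2real (min (F x) (of_nat n)) * indicator (A n) x" for n x
  have [measurable]: "f n \<in> borel_measurable M" for n unfolding f_def by measurable
  have f0: "0 \<le> f n x" for n x unfolding f_def by simp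
  have fF: "ennreal (f n x) \<le> F x" for n x
    unfolding f_def by (cases "F x") (auto simp: indicator_def min_def ennreal_of_nat_eq_real_of_nat)
  have fn: "f n x \<le> real n * indicator (A n) x" for n x
    unfolding f_def by (cases "F x") (auto simp: indicator_def min_def ennreal_of_nat_eq_real_of_nat)
  have sq: "sq_integrable M (f n)" for n
  proof (rule sq_integrable_bound)
    have "integrable M (\<lambda>x. (real n)\<^sup>2 * indicator (A n) x)"
      using A(3)[of n] by (intro integrable_mult_right integrable_real_indicator) (auto simp: less_top)
    moreover have "(norm (real n * indicator (A n) x))\<^sup>2 = (real n)\<^sup>2 * indicator (A n) x" for x
      by (auto simp: indicator_def)
    ultimately show "sq_integrable M (\<lambda>x. real n * indicator (A n) x)"
      by (simp only: sq_integrable_def) simp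
    show "AE x in M. norm (f n x) \<le> norm (real n * indicator (A n) x :: real)"
      using fn[of n] f0[of n] by (auto intro: order_trans)
  qed simp
  have bd: "sq_norm M (f n) \<le> opC * sq_norm M g" for n
  proof -
    have "ennreal ((sq_norm M (f n))\<^sup>2) = (\<integral>\<^sup>+x. ennreal ((norm (f n x))\<^sup>2) \<partial>M)"
      using sq_nn_integral[OF sq] by simp
    also have "\<dots> \<le> (\<integral>\<^sup>+x. ennreal (f n x) * F x \<partial>M)"
      using fF[of n] f0[of n] by (intro nn_integral_mono) (auto simp: power2_eq_square ennreal_mult' intro!: mult_left_mono)
    also have "\<dots> = (\<integral>\<^sup>+y. nT (\<lambda>x. ennreal (f n x)) y * ennreal (g y) \<partial>M)"
      unfolding F_def by (subst nT_duality) auto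
    also have "\<dots> = (\<integral>\<^sup>+y. ennreal (norm (Tr (f n) y)) * ennreal (g y) \<partial>M)"
    proof (rule nn_integral_cong_AE, use nT_eq_Tr[OF sq f0, of n] in eventually_elim)
      fix y assume "nT (\<lambda>x. ennreal (f n x)) y = ennreal (Tr (f n) y)"
      moreover have "0 \<le> Tr (f n) y" unfolding Tr_def by (intro integral_nonneg_AE) (auto simp: f0)
      ultimately show "nT (\<lambda>x. ennreal (f n x)) y * ennreal (g y) = ennreal (norm (Tr (f n) y)) * ennreal (g y)"
        by simp
    qed
    also have "\<dots> \<le> ennreal (sq_norm M (\<lambda>y. norm (Tr (f n) y)) * sq_norm M g)"
      by (intro nn_sq_Hoelder g pos sq_integrable_norm Tr_sq_integrable sq) auto
    also have "\<dots> \<le> ennreal (opC * sq_norm M (f n) * sq_norm M g)"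
      unfolding sq_integrable_norm(2)[OF Tr_sq_integrable[OF sq]]
      by (intro ennreal_leI mult_right_mono Tr_bounded sq) auto
    finally have "(sq_norm M (f n))\<^sup>2 \<le> opC * sq_norm M (f n) * sq_norm M g"
      using opC(1) by (simp add: mult_nonneg_nonneg)
    then have "sq_norm M (f n) * sq_norm M (f n) \<le> sq_norm M (f n) * (opC * sq_norm M g)"
      by (simp add: power2_eq_square mult_ac)
    then show ?thesis
      using opC(1) sq_norm_nonneg[of M "f n"] sq_norm_nonneg[of M g]
      by (cases "sq_norm M (f n) = 0") (simp_all add: mult_le_cancel_left)
  qed
  have fmono: "f n x \<le> f (Suc n) x" for n x
  proof -
    have "A n \<subseteq> A (Suc n)" using A(4) by (simp add: incseq_SucD)
    then show "f n x \<le> f (Suc n) x"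
      unfolding f_def
      by (cases "F x") (auto simp: indicator_def min_def ennreal_of_nat_eq_real_of_nat top_unique simp del: of_nat_Suc)
  qed
  then have fmono': "f n x \<le> f m x" if "n \<le> m" for n m x
    using that by (rule lift_Suc_mono_le[of "\<lambda>n. f n x"])
  have mono: "incseq (\<lambda>n x. (ennreal (f n x))\<^sup>2)"
    by (intro incseq_SucI le_funI power_mono ennreal_leI fmono) auto
  have lim: "(F x)\<^sup>2 = (SUP n. (ennreal (f n x))\<^sup>2)" if x: "x \<in> space M" for x
  proof (rule antisym)
    show "(SUP n. (ennreal (f n x))\<^sup>2) \<le> (F x)\<^sup>2"
      using fF by (intro SUP_least power_mono) auto
    obtain m where m: "x \<in> A m" using A(2) x by auto
    have fge: "min (F x) (of_nat n) \<le> ennreal (f (max n m) x)" for n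
    proof -
      have "x \<in> A (max n m)" using m A(4) by (meson incseqD max.cobounded2 subsetD)
      then have "ennreal (f (max n m) x) = min (F x) (of_nat (max n m))"
        unfolding f_def by (cases "F x") (auto simp: min_def ennreal_of_nat_eq_real_of_nat top_unique)
      moreover have "(of_nat n :: ennreal) \<le> of_nat (max n m)" by simp
      ultimately show ?thesis by (simp add: min.coboundedI2 le_max_iff_disj)
    qed
    have "F x = (SUP n. min (F x) (of_nat n))"
    proof (cases "F x")
      case (real r)
      obtain n where "r \<le> real n" using real_arch_simple by blast
      then have "min (F x) (of_nat n) = F x" using real by (simp add: min_def ennreal_of_nat_eq_real_of_nat)
      then have "F x \<le> (SUP n. min (F x) (of_nat n))"
        by (intro SUP_upper2[of n]) auto
      moreover have "(SUP n. min (F x) (of_nat n)) \<le> F x"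
        by (rule SUP_least) simp
      ultimately show ?thesis by (rule antisym)
    next
      case top
      then show ?thesis by (simp add: ennreal_SUP_of_nat_eq_top)
    qed
    also have "\<dots> \<le> (SUP n. ennreal (f n x))"
      by (intro SUP_least) (use fge in \<open>blast intro: SUP_upper2\<close>)
    finally have "F x \<le> (SUP n. ennreal (f n x))" .
    then have "(F x)\<^sup>2 \<le> (SUP n. ennreal (f n x))\<^sup>2" by (intro power_mono) auto
    \<comment> \<open>The square of a supremum is a double supremum; monotonicity in the index
      collapses it to the diagonal.\<close>
    also have "\<dots> = (SUP m. SUP n. ennreal (f n x) * ennreal (f m x))"
      by (simp add: power2_eq_square SUP_mult_left_ennreal SUP_mult_right_ennreal)
    also have "\<dots> \<le> (SUP n. (ennreal (f n x))\<^sup>2)"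
    proof (intro SUP_least)
      fix n m
      have "ennreal (f n x) * ennreal (f m x) \<le> (ennreal (f (max n m) x))\<^sup>2"
        unfolding power2_eq_square by (intro mult_mono ennreal_leI fmono') auto
      then show "ennreal (f n x) * ennreal (f m x) \<le> (SUP n. (ennreal (f n x))\<^sup>2)"
        by (rule order_trans) (rule SUP_upper, simp)
    qed
    finally show "(F x)\<^sup>2 \<le> (SUP n. (ennreal (f n x))\<^sup>2)" .
  qed
  have "(\<integral>\<^sup>+x. (F x)\<^sup>2 \<partial>M) = (\<integral>\<^sup>+x. (SUP n. (ennreal (f n x))\<^sup>2) \<partial>M)"
    by (intro nn_integral_cong lim)
  also have "\<dots> = (SUP n. \<integral>\<^sup>+x. (ennreal (f n x))\<^sup>2 \<partial>M)"
    by (intro nn_integral_monotone_convergence_SUP mono) auto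
  also have "\<dots> \<le> ennreal ((opC * sq_norm M g)\<^sup>2)"
  proof (rule SUP_least)
    fix n
    have "(\<integral>\<^sup>+x. (ennreal (f n x))\<^sup>2 \<partial>M) = ennreal ((sq_norm M (f n))\<^sup>2)"
      using sq_nn_integral[OF sq, of n] f0[of n] by (simp add: ennreal_power)
    also have "\<dots> \<le> ennreal ((opC * sq_norm M g)\<^sup>2)"
      using bd[of n] by (intro ennreal_leI power_mono) auto
    finally show "(\<integral>\<^sup>+x. (ennreal (f n x))\<^sup>2 \<partial>M) \<le> ennreal ((opC * sq_norm M g)\<^sup>2)" .
  qed
  finally show ?thesis unfolding F_def .
qed

lemma cnj_mult_integrable:
  assumes "sq_integrable M f" "sq_integrable M g"
  shows "integrable M (\<lambda>x. f x * cnj (g x))"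
proof -
  have [measurable]: "f \<in> borel_measurable M" "g \<in> borel_measurable M" using assms by auto
  show ?thesis
    by (rule Bochner_Integration.integrable_bound[OF sq_Hoelder(1)[OF assms]]) (auto simp: norm_mult)
qed

text \<open>The nonnegative case applied to \<open>|g|\<close> gives absolute convergence of the
  defining integral almost everywhere and dominates \<open>|T' g|\<close>.\<close>

lemma T'_bounded:
  assumes g: "sq_integrable M g"
  shows "AE x in M. integrable M (\<lambda>y. complex_of_real (K x y) * g y)"
    "sq_integrable M (T' g)" "sq_norm M (T' g) \<le> opC * sq_norm M g"
proof -
  have [measurable]: "g \<in> borel_measurable M" using g by auto
  define F where "F x = nT' (\<lambda>y. ennreal (norm (g y))) x" for x
  have F[measurable]: "F \<in> borel_measurable M" unfolding F_def by measurable
  have Feq: "F x = (\<integral>\<^sup>+y. ennreal (norm (complex_of_real (K x y) * g y)) \<partial>M)" for x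
    unfolding F_def nT'_def by (simp add: norm_mult ennreal_mult')
  have le: "(\<integral>\<^sup>+x. (F x)\<^sup>2 \<partial>M) \<le> ennreal ((opC * sq_norm M g)\<^sup>2)"
    using nT'_bounded[OF sq_integrable_norm(1)[OF g]] unfolding sq_integrable_norm(2)[OF g] F_def by simp
  then have "(\<integral>\<^sup>+x. (F x)\<^sup>2 \<partial>M) \<noteq> \<infinity>" by (auto simp: top_unique)
  then have "AE x in M. (F x)\<^sup>2 \<noteq> \<infinity>" by (intro nn_integral_PInf_AE) auto
  moreover note AE_space[of M]
  ultimately have "AE x in M. integrable M (\<lambda>y. complex_of_real (K x y) * g y)
     \<and> ennreal (norm (T' g x)) \<le> F x"
  proof eventually_elim
    fix x assume fin: "(F x)\<^sup>2 \<noteq> \<infinity>" and [measurable]: "x \<in> space M"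
    have "F x < \<infinity>" using fin by (cases "F x") (auto simp: power2_eq_square ennreal_top_mult)
    then have int: "integrable M (\<lambda>y. complex_of_real (K x y) * g y)"
      unfolding Feq by (intro integrableI_bounded) auto
    moreover have "ennreal (norm (T' g x)) \<le> F x"
      unfolding Feq integral_op_def by (rule integral_norm_bound_ennreal[OF int])
    ultimately show "integrable M (\<lambda>y. complex_of_real (K x y) * g y) \<and> ennreal (norm (T' g x)) \<le> F x" by simp
  qed
  note both = this
  show "AE x in M. integrable M (\<lambda>y. complex_of_real (K x y) * g y)"
    using both by eventually_elim simp
  have le2: "AE x in M. ennreal (norm (T' g x)) \<le> F x"
    using both by eventually_elim simp
  have [measurable]: "T' g \<in> borel_measurable M" unfolding integral_op_def by measurable
  have "(\<integral>\<^sup>+x. ennreal ((norm (T' g x))\<^sup>2) \<partial>M) \<le> (\<integral>\<^sup>+x. (F x)\<^sup>2 \<partial>M)"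
  proof (rule nn_integral_mono_AE, use le2 in eventually_elim)
    fix x assume "ennreal (norm (T' g x)) \<le> F x"
    then show "ennreal ((norm (T' g x))\<^sup>2) \<le> (F x)\<^sup>2"
      unfolding ennreal_power[OF norm_ge_zero, symmetric] by (intro power_mono) auto
  qed
  with le have *: "(\<integral>\<^sup>+x. ennreal ((norm (T' g x))\<^sup>2) \<partial>M) \<le> ennreal ((opC * sq_norm M g)\<^sup>2)"
    by simp
  show "sq_integrable M (T' g)" "sq_norm M (T' g) \<le> opC * sq_norm M g"
    using sq_integrableI_nn[OF _ *] opC(1) by simp_all
qed

text \<open>Fubini; the double integral converges absolutely because its majorant is the pairing of
  \<open>T |f|\<close> with \<open>|g|\<close>, both square-integrable.\<close>

lemma duality:
  assumes f: "sq_integrable M f" and g: "sq_integrable M g"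
  shows "L2_inner M (T f) g = L2_inner M f (T' g)"
proof -
  have [measurable]: "f \<in> borel_measurable M" "g \<in> borel_measurable M" using f g by auto
  define h where "h x y = complex_of_real (K x y) * f x * cnj (g y)" for x y
  have [measurable]: "(\<lambda>(x, y). h x y) \<in> borel_measurable (M \<Otimes>\<^sub>M M)"
    unfolding h_def by measurable
  have Tf: "sq_integrable M (Tr (\<lambda>x. norm (f x)))"
    by (intro Tr_sq_integrable sq_integrable_norm f)
  have "(\<integral>\<^sup>+p. ennreal (norm (case_prod h p)) \<partial>(M \<Otimes>\<^sub>M M)) = (\<integral>\<^sup>+y. \<integral>\<^sup>+x. ennreal (norm (h x y)) \<partial>M \<partial>M)"
    by (subst MM.nn_integral_snd[symmetric]) (auto simp: split_beta)
  also have "\<dots> = (\<integral>\<^sup>+y. nT (\<lambda>x. ennreal (norm (f x))) y * ennreal (norm (g y)) \<partial>M)"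
    unfolding nT_def h_def
    by (intro nn_integral_cong, subst nn_integral_multc[symmetric]) (auto simp: norm_mult ennreal_mult')
  also have "\<dots> = (\<integral>\<^sup>+y. ennreal (norm (Tr (\<lambda>x. norm (f x)) y)) * ennreal (norm (g y)) \<partial>M)"
  proof (rule nn_integral_cong_AE, use nT_eq_Tr[OF sq_integrable_norm(1)[OF f] norm_ge_zero] in eventually_elim)
    fix y assume "nT (\<lambda>x. ennreal (norm (f x))) y = ennreal (Tr (\<lambda>x. norm (f x)) y)"
    moreover have "0 \<le> Tr (\<lambda>x. norm (f x)) y" unfolding Tr_def by (intro integral_nonneg_AE) auto
    ultimately show "nT (\<lambda>x. ennreal (norm (f x))) y * ennreal (norm (g y))
       = ennreal (norm (Tr (\<lambda>x. norm (f x)) y)) * ennreal (norm (g y))" by simp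
  qed
  also have "\<dots> \<le> ennreal (sq_norm M (\<lambda>y. norm (Tr (\<lambda>x. norm (f x)) y)) * sq_norm M (\<lambda>y. norm (g y)))"
    by (intro nn_sq_Hoelder sq_integrable_norm g Tf) auto
  also have "\<dots> < \<infinity>" by simp
  finally have int: "integrable (M \<Otimes>\<^sub>M M) (case_prod h)"
    by (intro integrableI_bounded) auto
  have "L2_inner M (T f) g = (LINT y|M. LINT x|M. h x y)"
    by (simp add: L2_inner_def integral_op_def h_def)
  also have "\<dots> = (LINT x|M. LINT y|M. h x y)"
    by (rule MM.Fubini_integral[OF int])
  also have "\<dots> = L2_inner M f (T' g)"
  proof -
    have "(LINT y|M. h x y) = f x * cnj (T' g x)" for x
    proof -
      have "(LINT y|M. h x y) = (LINT y|M. f x * cnj (complex_of_real (K x y) * g y))"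
        by (simp add: h_def mult_ac)
      also have "\<dots> = f x * cnj (T' g x)"
        unfolding integral_op_def by (simp only: integral_mult_right_zero Bochner_Integration.integral_cnj)
      finally show ?thesis .
    qed
    then show ?thesis by (simp add: L2_inner_def)
  qed
  finally show ?thesis .
qed

lemma L2_inner_self: "L2_inner M f f = complex_of_real ((sq_norm M f)\<^sup>2)"
  unfolding L2_inner_def sq_norm_power2 integral_complex_of_real[symmetric]
  by (simp only: complex_norm_square)

lemma L2_inner_le:
  assumes "sq_integrable M f" "sq_integrable M g"
  shows "cmod (L2_inner M f g) \<le> sq_norm M f * sq_norm M g"
proof -
  have "cmod (L2_inner M f g) \<le> (LINT x|M. norm (f x * cnj (g x)))"
    unfolding L2_inner_def by (rule integral_norm_bound)
  also have "\<dots> \<le> sq_norm M f * sq_norm M g"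
    using sq_Hoelder(2)[OF assms] by (simp add: norm_mult)
  finally show ?thesis .
qed

lemma T'_diff:
  assumes "sq_integrable M f" "sq_integrable M g"
  shows "AE y in M. T' (\<lambda>x. f x - g x) y = T' f y - T' g y"
  using T'_bounded(1)[OF assms(1)] T'_bounded(1)[OF assms(2)]
proof eventually_elim
  case (elim y)
  then show ?case by (simp add: integral_op_def right_diff_distrib)
qed

text \<open>Compactness passes to the adjoint because \<open>\<parallel>T' f\<parallel>\<^sup>2 = \<langle>T (T' f), f\<rangle>\<close>.\<close>

lemma T'_compact: "compact_op M T'"
  unfolding compact_op_def L2_iff_sq_integrable L2_norm_eq_sq_norm
proof (intro conjI allI ballI impI)
  fix f assume "f \<in> L2 M" then show "sq_integrable M (T' f)"
    by (intro T'_bounded) (simp add: L2_iff_sq_integrable)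
next
  fix f :: "nat \<Rightarrow> 'x \<Rightarrow> complex"
  assume "(\<forall>n. sq_integrable M (f n)) \<and> (\<exists>C. \<forall>n. sq_norm M (f n) \<le> C)"
  then obtain C where f: "\<And>n. sq_integrable M (f n)" and C: "\<And>n. sq_norm M (f n) \<le> C" by auto
  have C0: "0 \<le> C" using C[of 0] sq_norm_nonneg order_trans by blast
  have Tf: "sq_integrable M (T' (f n))" for n by (rule T'_bounded[OF f])
  obtain g and k :: "nat \<Rightarrow> nat" where g: "sq_integrable M g" and k: "strict_mono k"
    and lim: "(\<lambda>n. sq_norm M (\<lambda>x. T (T' (f (k n))) x - g x)) \<longlonglongrightarrow> 0"
  proof (rule T_compact[of "\<lambda>n. T' (f n)" "opC * C"])
    show "sq_norm M (T' (f n)) \<le> opC * C" for n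
      using T'_bounded(3)[OF f[of n]] C[of n] opC(1) by (meson mult_left_mono less_imp_le order_trans)
  qed (use Tf in auto)
  define F where "F n = f (k n)" for n
  have F: "sq_integrable M (F n)" "sq_norm M (F n) \<le> C" for n unfolding F_def by (fact f C)+
  have TF: "sq_integrable M (T' (F n))" "sq_integrable M (T (T' (F n)))" for n
    unfolding F_def by (auto intro: Tf T_sq_integrable)
  \<comment> \<open>The identity behind compactness, applied to a difference:
    \<open>T' (F m)\<close> and \<open>T' (F n)\<close> are close as soon as
    \<open>T (T' (F m))\<close> and \<open>T (T' (F n))\<close> are, the factor \<open>2 * C\<close>
    bounding the norm of \<open>F m - F n\<close>.\<close>
  have key: "(sq_norm M (\<lambda>x. T' (F m) x - T' (F n) x))\<^sup>2
     \<le> (sq_norm M (\<lambda>x. T (T' (F m)) x - g x) + sq_norm M (\<lambda>x. T (T' (F n)) x - g x)) * (2 * C)" for m n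
  proof -
    let ?d = "\<lambda>x. F m x - F n x"
    have d: "sq_integrable M ?d" "sq_norm M ?d \<le> 2 * C"
      using sq_integrable_diff[OF F(1)[of m] F(1)[of n]] F(2)[of m] F(2)[of n] by auto
    have e1: "sq_norm M (\<lambda>x. T' (F m) x - T' (F n) x) = sq_norm M (T' ?d)"
      using T'_diff[OF F(1)[of m] F(1)[of n]] TF T'_bounded(2)[OF d(1)]
      by (intro sq_norm_cong_AE) auto
    have a: "AE x in M. T (T' ?d) x = T (T' (F m)) x - T (T' (F n)) x"
    proof -
      have "AE x in M. T (T' ?d) x = T (\<lambda>x. T' (F m) x - T' (F n) x) x"
        using T'_diff[OF F(1)[of m] F(1)[of n]] TF T'_bounded(2)[OF d(1)]
        by (intro T_cong_AE) auto
      with T_diff[OF TF(1)[of m] TF(1)[of n]] show ?thesis by eventually_elim simp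
    qed
    have e2: "sq_norm M (T (T' ?d)) = sq_norm M (\<lambda>x. T (T' (F m)) x - T (T' (F n)) x)"
      using a TF T_sq_integrable[OF T'_bounded(2)[OF d(1)]] by (intro sq_norm_cong_AE) auto
    have "complex_of_real ((sq_norm M (T' ?d))\<^sup>2) = L2_inner M (T' ?d) (T' ?d)"
      by (rule L2_inner_self[symmetric])
    also have "\<dots> = L2_inner M (T (T' ?d)) ?d"
      by (rule duality[symmetric]) (intro T'_bounded d)+
    finally have "(sq_norm M (T' ?d))\<^sup>2 = cmod (L2_inner M (T (T' ?d)) ?d)"
      by (metis norm_of_real abs_of_nonneg zero_le_power2)
    also have "\<dots> \<le> sq_norm M (T (T' ?d)) * sq_norm M ?d"
      by (intro L2_inner_le T_sq_integrable T'_bounded d)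
    also have "\<dots> \<le> (sq_norm M (\<lambda>x. T (T' (F m)) x - g x) + sq_norm M (\<lambda>x. T (T' (F n)) x - g x)) * (2 * C)"
    proof (intro mult_mono d)
      show "sq_norm M (T (T' ?d)) \<le> sq_norm M (\<lambda>x. T (T' (F m)) x - g x) + sq_norm M (\<lambda>x. T (T' (F n)) x - g x)"
        unfolding e2 using sq_norm_triangle_diff[OF TF(2)[of m] g TF(2)[of n]]
        unfolding sq_norm_minus_commute[of M g "T (T' (F n))"] .
    qed (auto intro: add_nonneg_nonneg)
    finally show ?thesis unfolding e1 .
  qed
  have "\<exists>N. \<forall>m\<ge>N. \<forall>n\<ge>N. sq_norm M (\<lambda>x. T' (F m) x - T' (F n) x) < e" if e: "0 < e" for e
  proof -
    \<comment> \<open>Chosen so that \<open>2 * d * (2 * C) < e\<^sup>2\<close>; the added 1 covers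
      \<open>C = 0\<close>.\<close>
    define d where "d = e\<^sup>2 / (4 * C + 1)"
    have d: "0 < d" unfolding d_def using e C0 by simp
    obtain N where N: "\<And>n. n \<ge> N \<Longrightarrow> sq_norm M (\<lambda>x. T (T' (F n)) x - g x) < d"
      using LIMSEQ_D[OF lim d] unfolding F_def by auto
    have "sq_norm M (\<lambda>x. T' (F m) x - T' (F n) x) < e" if "m \<ge> N" "n \<ge> N" for m n
    proof (rule power2_less_imp_less)
      have "(sq_norm M (\<lambda>x. T' (F m) x - T' (F n) x))\<^sup>2 \<le> (d + d) * (2 * C)"
        using N[OF that(1)] N[OF that(2)] C0 by (intro order_trans[OF key] mult_right_mono add_mono) auto
      also have "\<dots> = e\<^sup>2 * (4 * C / (4 * C + 1))" unfolding d_def by simp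
      also have "\<dots> < e\<^sup>2 * 1" using e C0 by (intro mult_strict_left_mono) auto
      finally show "(sq_norm M (\<lambda>x. T' (F m) x - T' (F n) x))\<^sup>2 < e\<^sup>2" by simp
    qed (use e in auto)
    then show ?thesis by blast
  qed
  then obtain h where "sq_integrable M h" "(\<lambda>n. sq_norm M (\<lambda>x. T' (F n) x - h x)) \<longlonglongrightarrow> 0"
    using sq_complete[of M "\<lambda>n. T' (F n)"] TF(1) by blast
  then show "\<exists>g\<in>L2 M. \<exists>k. strict_mono k \<and> (\<lambda>n. sq_norm M (\<lambda>x. T' (f (k n)) x - g x)) \<longlonglongrightarrow> 0"
    using k unfolding F_def by (auto simp: L2_iff_sq_integrable)
qed

text \<open>All results of the locale hold for the adjoint through this interpretation; most facts
  about \<open>w\<close> are obtained as facts about \<open>v\<close> for the transposed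
  kernel.\<close>

lemma transpose: "positive_kernel M (\<lambda>x y. K y x)"
proof
  show "(\<lambda>(x, y). K y x) \<in> borel_measurable (M \<Otimes>\<^sub>M M)" by measurable
  show "integral_op_on_L2 M (\<lambda>x y. K y x)"
    unfolding integral_op_on_L2_def L2_iff_sq_integrable using T'_bounded(1,2)
    by (auto simp: L2_iff_sq_integrable)
  show "\<exists>A\<in>sets M. 0 < emeasure M A \<and> emeasure M A < \<infinity> \<and> (\<exists>e>0. \<forall>x\<in>A. \<forall>y\<in>A. e \<le> K y x)"
    using lower_bound by blast
qed (auto intro: K_pos T'_compact)

end

section \<open>The principal eigenfunction\<close>

context positive_kernel
begin

lemma Tr_add:
  assumes "sq_integrable M f" "sq_integrable M g"
  shows "AE y in M. Tr (\<lambda>x. f x + g x) y = Tr f y + Tr g y"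
  using Tr_integrable[OF assms(1)] Tr_integrable[OF assms(2)]
proof eventually_elim
  case (elim y)
  then show ?case by (simp add: Tr_def distrib_left)
qed

lemma Tr_nonneg:
  assumes "AE x in M. 0 \<le> f x"
  shows "0 \<le> Tr f y"
  unfolding Tr_def by (rule integral_nonneg_AE) (use assms in \<open>auto elim: eventually_mono\<close>)

lemma Tr_mono:
  assumes f: "sq_integrable M f" and g: "sq_integrable M g" and le: "AE x in M. f x \<le> g x"
  shows "AE y in M. Tr f y \<le> Tr g y"
  using Tr_integrable[OF f] Tr_integrable[OF g]
proof eventually_elim
  case (elim y)
  show ?case
    unfolding Tr_def
    by (rule integral_mono_AE[OF elim]) (use le in \<open>auto elim!: eventually_mono intro: mult_left_mono\<close>)
qed

text \<open>If the integral of a nonnegative \<open>f\<close> against the strictly positive section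
  of the kernel at \<open>y\<close> vanishes, so does \<open>f\<close> almost everywhere. Thus a
  single nonzero function becomes positive everywhere but on a null set.\<close>

lemma Tr_strict_pos:
  assumes f: "sq_integrable M f" and pos: "AE x in M. 0 \<le> f x" and ne: "\<not> (AE x in M. f x = 0)"
  shows "AE y in M. 0 < Tr f y"
  using Tr_integrable[OF f]
proof eventually_elim
  case (elim y)
  have pos': "AE x in M. 0 \<le> K x y * f x" using pos by (auto elim!: eventually_mono)
  have "Tr f y \<noteq> 0"
  proof
    assume "Tr f y = 0"
    then have "AE x in M. K x y * f x = 0"
      using integral_nonneg_eq_0_iff_AE[OF elim pos'] by (simp add: Tr_def)
    then have "AE x in M. f x = 0" by eventually_elim simp
    with ne show False by simp
  qed
  with Tr_nonneg[OF pos, of y] show ?case by linarith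
qed

lemma Tr_pow_sq_integrable: "sq_integrable M f \<Longrightarrow> sq_integrable M ((Tr ^^ n) f)"
  by (induction n) (auto intro: Tr_sq_integrable)

lemma Tr_pow_nonneg: "AE x in M. 0 \<le> f x \<Longrightarrow> AE x in M. 0 \<le> (Tr ^^ n) f x"
proof (induction n)
  case (Suc n)
  from Tr_nonneg[OF Suc.IH[OF Suc.prems]] show ?case by simp
qed simp

text \<open>The \<open>l\<close> admitting a positive supersolution \<open>T u \<le> l u\<close>; their infimum is the principal eigenvalue.\<close>

definition super :: "real set" where
  "super = {l. 0 < l \<and> (\<exists>u. sq_integrable M u \<and> (AE x in M. 0 < u x) \<and> (AE x in M. Tr u x \<le> l * u x))}"

text \<open>The Neumann series \<open>g = \<Sum> T\<^sup>n u / l\<^sup>n\<^sup>+\<^sup>1\<close>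
  converges since \<open>q < l\<close> and formally satisfies \<open>l g - T g = u \<ge> 0\<close>,
  so it is a supersolution for \<open>l\<close>.\<close>

lemma super_geometric:
  assumes u: "sq_integrable M u" "AE x in M. 0 < u x"
    and geo: "\<And>n. sq_norm M ((Tr ^^ n) u) \<le> C * q ^ n" and q: "0 \<le> q" "q < l"
  shows "l \<in> super"
proof -
  have l: "0 < l" using q by simp
  have C: "0 \<le> C" using geo[of 0] order_trans[OF sq_norm_nonneg] by fastforce
  have u0: "AE x in M. 0 \<le> u x" using u(2) by eventually_elim simp
  define h where "h n x = (1 / l ^ Suc n) * (Tr ^^ n) u x" for n x
  have h: "sq_integrable M (h n)" for n
    unfolding h_def by (intro sq_integrable_mult Tr_pow_sq_integrable u)
  have h0: "AE x in M. 0 \<le> h n x" for n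
    using Tr_pow_nonneg[OF u0, of n] l unfolding h_def by (auto elim!: eventually_mono)
  have hn: "sq_norm M (h n) \<le> (C / l) * (q / l) ^ n" for n
  proof -
    have "sq_norm M (h n) = (1 / l ^ Suc n) * sq_norm M ((Tr ^^ n) u)"
      unfolding h_def sq_integrable_mult(2)[OF Tr_pow_sq_integrable[OF u(1)]] using l by simp
    also have "\<dots> \<le> (1 / l ^ Suc n) * (C * q ^ n)"
      using l by (intro mult_left_mono geo) auto
    also have "\<dots> = (C / l) * (q / l) ^ n"
      by (simp add: power_divide)
    finally show ?thesis .
  qed
  have "summable (\<lambda>n. sq_norm M (h n))"
  proof (rule summable_comparison_test'[where g="\<lambda>n. (C / l) * (q / l) ^ n"])
    show "summable (\<lambda>n. (C / l) * (q / l) ^ n)"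
      using l q by (intro summable_mult summable_geometric) simp
  qed (use hn in auto)
  from sq_complete_sum[OF h this] obtain g where g: "sq_integrable M g"
    and lim: "(\<lambda>n. sq_norm M (\<lambda>x. (\<Sum>i<n. h i x) - g x)) \<longlonglongrightarrow> 0" by blast
  define s where "s n x = (\<Sum>i<n. h i x)" for n x
  have s: "sq_integrable M (s n)" for n
    unfolding s_def using sq_integrable_sum[of "{..<n}" M h] h by auto
  have lim: "(\<lambda>n. sq_norm M (\<lambda>x. s n x - g x)) \<longlonglongrightarrow> 0" using lim unfolding s_def .
  \<comment> \<open>Applying \<open>T\<close> shifts the partial sums by one term; the boundary term
    of this telescoping is exactly \<open>u\<close>. Its sign is all that has to survive the
    limit.\<close>
  have Ts: "AE x in M. Tr (s n) x = l * s (Suc n) x - u x" for n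
  proof (induction n)
    case 0
    show ?case unfolding s_def h_def Tr_def using l by simp
  next
    case (Suc n)
    have Th: "Tr (h n) x = l * h (Suc n) x" for x
      unfolding h_def Tr_mult using l by simp
    have sS: "s (Suc m) x = s m x + h m x" for m x unfolding s_def by simp
    have "AE x in M. Tr (s (Suc n)) x = Tr (s n) x + Tr (h n) x"
      using Tr_add[OF s[of n] h[of n]] unfolding s_def by simp
    with Suc show ?case
      unfolding Th sS by eventually_elim (simp add: algebra_simps)
  qed
  have "AE x in M. 0 \<le> l * g x - Tr g x"
  proof (rule sq_limit_nonneg)
    show "sq_integrable M (\<lambda>x. l * s (Suc n) x - Tr (s n) x)" for n
      by (intro sq_integrable_diff sq_integrable_mult s Tr_sq_integrable)
    show "sq_integrable M (\<lambda>x. l * g x - Tr g x)"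
      by (intro sq_integrable_diff sq_integrable_mult g Tr_sq_integrable)
    show "AE x in M. 0 \<le> l * s (Suc n) x - Tr (s n) x" for n
      using Ts[of n] u0 by eventually_elim simp
    have le: "sq_norm M (\<lambda>x. (l * s (Suc n) x - Tr (s n) x) - (l * g x - Tr g x))
       \<le> l * sq_norm M (\<lambda>x. s (Suc n) x - g x) + sq_norm M (\<lambda>x. Tr (s n) x - Tr g x)" for n
    proof -
      have "sq_norm M (\<lambda>x. (l * s (Suc n) x - Tr (s n) x) - (l * g x - Tr g x))
        = sq_norm M (\<lambda>x. l * (s (Suc n) x - g x) - (Tr (s n) x - Tr g x))"
        by (simp add: algebra_simps)
      also have "\<dots> \<le> sq_norm M (\<lambda>x. l * (s (Suc n) x - g x)) + sq_norm M (\<lambda>x. Tr (s n) x - Tr g x)"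
        by (intro sq_integrable_diff sq_integrable_mult s g Tr_sq_integrable)
      also have "sq_norm M (\<lambda>x. l * (s (Suc n) x - g x)) = l * sq_norm M (\<lambda>x. s (Suc n) x - g x)"
        using sq_integrable_mult(2)[OF sq_integrable_diff(1)[OF s[of "Suc n"] g], of l] l by simp
      finally show ?thesis .
    qed
    have "(\<lambda>n. l * sq_norm M (\<lambda>x. s (Suc n) x - g x) + sq_norm M (\<lambda>x. Tr (s n) x - Tr g x)) \<longlonglongrightarrow> l * 0 + 0"
      by (intro tendsto_add tendsto_mult tendsto_const LIMSEQ_Suc[OF lim] Tr_limit s g lim)
    then have z: "(\<lambda>n. l * sq_norm M (\<lambda>x. s (Suc n) x - g x) + sq_norm M (\<lambda>x. Tr (s n) x - Tr g x)) \<longlonglongrightarrow> 0"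
      by simp
    show "(\<lambda>n. sq_norm M (\<lambda>x. (l * s (Suc n) x - Tr (s n) x) - (l * g x - Tr g x))) \<longlonglongrightarrow> 0"
      by (rule tendsto_sandwich[OF _ _ tendsto_const z]) (simp_all only: le sq_norm_nonneg eventually_True)
  qed
  then have sup: "AE x in M. Tr g x \<le> l * g x" by eventually_elim simp
  \<comment> \<open>All terms are nonnegative, so the sum dominates its first term
    \<open>u / l\<close>, which is strictly positive.\<close>
  have "AE x in M. 0 \<le> g x - h 0 x"
  proof (rule sq_limit_nonneg)
    show "sq_integrable M (\<lambda>x. s (Suc n) x - h 0 x)" for n by (intro sq_integrable_diff s h)
    show "sq_integrable M (\<lambda>x. g x - h 0 x)" by (intro sq_integrable_diff g h)
    show "AE x in M. 0 \<le> s (Suc n) x - h 0 x" for n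
    proof -
      have "AE x in M. \<forall>i. 0 \<le> h i x" using h0 by (simp add: AE_all_countable)
      then show ?thesis
        by eventually_elim (simp add: s_def sum.lessThan_Suc_shift sum_nonneg del: sum.lessThan_Suc)
    qed
    show "(\<lambda>n. sq_norm M (\<lambda>x. s (Suc n) x - h 0 x - (g x - h 0 x))) \<longlonglongrightarrow> 0"
      using LIMSEQ_Suc[OF lim] by simp
  qed
  with u(2) have "AE x in M. 0 < g x"
  proof eventually_elim
    case (elim x)
    have "0 < h 0 x" unfolding h_def using elim(1) l by simp
    with elim(2) show ?case by linarith
  qed
  with sup g l show ?thesis unfolding super_def by blast
qed

text \<open>The powers of \<open>T\<close> grow at most like \<open>opC ^ n\<close>, so any constant
  above \<open>opC\<close> works for any positive square-integrable start. Such a start is an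
  integrable positive function bounded by 1, whose square is dominated by itself.\<close>

lemma super_nonempty: "super \<noteq> {}"
proof -
  obtain f :: "'x \<Rightarrow> real" where f[measurable]: "f \<in> borel_measurable M"
    and f': "\<And>x. 0 < f x" "\<And>x. f x \<le> 1" and int: "integrable M f"
    by (rule M.obtain_positive_integrable_function) (rule that)
  define u :: "'x \<Rightarrow> real" where "u = f"
  have u: "sq_integrable M u"
    unfolding sq_integrable_def u_def
  proof (intro conjI f)
    show "integrable M (\<lambda>x. (norm (f x))\<^sup>2)"
      by (rule Bochner_Integration.integrable_bound[OF int])
        (auto simp: power2_eq_square f'(2) less_imp_le[OF f'(1)] intro!: AE_I2 mult_left_le)
  qed
  have geo: "sq_norm M ((Tr ^^ n) u) \<le> sq_norm M u * opC ^ n" for n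
  proof (induction n)
    case (Suc n)
    have "sq_norm M ((Tr ^^ Suc n) u) \<le> opC * sq_norm M ((Tr ^^ n) u)"
      using Tr_bounded[OF Tr_pow_sq_integrable[OF u], of n] by simp
    also have "\<dots> \<le> opC * (sq_norm M u * opC ^ n)"
      using opC(1) by (intro mult_left_mono Suc) simp
    finally show ?case by (simp add: mult_ac)
  qed simp
  have "AE x in M. 0 < u x" unfolding u_def by (simp add: f')
  from super_geometric[OF u this geo, of "opC + 1"] show ?thesis
    using opC(1) by auto
qed

text \<open>On the set \<open>A\<close> where the kernel is at least \<open>e\<close>, a
  supersolution satisfies \<open>e \<integral>\<^sub>A u \<le> T u \<le> l u\<close>. Integrating
  over \<open>A\<close> and cancelling the positive number \<open>\<integral>\<^sub>A u\<close>
  leaves \<open>e * measure M A \<le> l\<close>.\<close>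

lemma super_lower_bound: "\<exists>d>0. \<forall>l\<in>super. d \<le> l"
proof -
  obtain A e where A[measurable]: "A \<in> sets M" and A0: "0 < emeasure M A" and Af: "emeasure M A < \<infinity>"
    and e: "0 < e" and Ke: "\<And>x y. x \<in> A \<Longrightarrow> y \<in> A \<Longrightarrow> e \<le> K x y"
    using lower_bound by blast
  have m: "0 < measure M A" using A0 Af by (simp add: measure_def enn2real_positive_iff)
  have "e * measure M A \<le> l" if lS: "l \<in> super" for l
  proof -
    obtain u where l: "0 < l" and u: "sq_integrable M u" "AE x in M. 0 < u x" "AE x in M. Tr u x \<le> l * u x"
      using lS unfolding super_def by blast
    have um[measurable]: "u \<in> borel_measurable M" using u by auto
    have I: "sq_integrable M (indicator A :: 'x \<Rightarrow> real)"
      unfolding sq_integrable_def using Af by (auto simp: power2_eq_square indicator_inter_arith[symmetric])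
    have intA: "integrable M (\<lambda>x. indicator A x * u x)"
    proof -
      have "integrable M (\<lambda>x. norm (indicator A x :: real) * norm (u x))"
        by (rule sq_Hoelder(1)[OF I u(1)])
      then show ?thesis
        by (rule Bochner_Integration.integrable_bound) (auto simp: abs_mult)
    qed
    define a where "a = (LINT x|M. indicator A x * u x)"
    have a: "0 < a"
    proof -
      have 0: "AE x in M. 0 \<le> indicator A x * u x" using u(2) by eventually_elim simp
      have "a \<noteq> 0"
      proof
        assume "a = 0"
        then have "AE x in M. indicator A x * u x = 0"
          using integral_nonneg_eq_0_iff_AE[OF intA 0] unfolding a_def by simp
        with u(2) have "AE x in M. x \<notin> A" by eventually_elim (auto simp: indicator_def)
        then have "emeasure M A = 0" using A by (simp add: AE_iff_measurable[OF A, of "\<lambda>x. x \<notin> A"] sets.sets_into_space Int_absorb1 Collect_conj_eq)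
        with A0 show False by simp
      qed
      moreover have "0 \<le> a" unfolding a_def by (rule integral_nonneg_AE[OF 0])
      ultimately show ?thesis by linarith
    qed
    have "AE y in M. e * a * indicator A y \<le> l * (indicator A y * u y)"
      using u(3) Tr_integrable[OF u(1)]
    proof eventually_elim
      case (elim y)
      show ?case
      proof (cases "y \<in> A")
        case True
        have "e * a = (LINT x|M. e * (indicator A x * u x))" unfolding a_def by simp
        also have "\<dots> \<le> Tr u y"
          unfolding Tr_def
        proof (rule integral_mono_AE)
          show "AE x in M. e * (indicator A x * u x) \<le> K x y * u x"
            using u(2)
          proof eventually_elim
            case (elim x)
            then show ?case using Ke[OF _ True, of x] by (auto simp: indicator_def)
          qed
        qed (use intA elim in auto)
        finally show ?thesis using elim(1) True by simp
      qed simp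
    qed
    then have "(LINT y|M. e * a * indicator A y) \<le> (LINT y|M. l * (indicator A y * u y))"
      using intA Af by (intro integral_mono_AE) auto
    then have "e * a * measure M A \<le> l * a" using A sets.sets_into_space[OF A] by (simp add: a_def Int_absorb1)
    then show ?thesis using a by (simp add: mult_ac)
  qed
  then show ?thesis using e m by (intro exI[of _ "e * measure M A"]) auto
qed

lemma super_bdd_below: "bdd_below super"
  using super_lower_bound by (auto simp: bdd_below_def)

lemma Inf_super_pos: "0 < Inf super"
proof -
  obtain d where "0 < d" "\<And>l. l \<in> super \<Longrightarrow> d \<le> l" using super_lower_bound by blast
  then show ?thesis using cInf_greatest[OF super_nonempty, of d] by simp
qed

text \<open>All iterates of a supersolution are supersolutions for the same \<open>l\<close>. If
  \<open>T\<close> shrank every one of them at least by the factor \<open>q\<close>, the Neumann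
  series would produce an element of \<open>super\<close> below its infimum. The iterate that
  escapes this, normalised, is \<open>g\<close>.\<close>

lemma almost_eigenfunction:
  assumes l: "l \<in> super" and q: "0 \<le> q" "q < Inf super"
  shows "\<exists>g. sq_integrable M g \<and> (AE x in M. 0 \<le> g x) \<and> sq_norm M g = 1 \<and>
    (AE x in M. Tr g x \<le> l * g x) \<and> q \<le> sq_norm M (Tr g)"
proof -
  obtain u where l0: "0 < l" and u: "sq_integrable M u" "AE x in M. 0 < u x" "AE x in M. Tr u x \<le> l * u x"
    using l unfolding super_def by blast
  have u0: "AE x in M. 0 \<le> u x" using u(2) by eventually_elim simp
  have sq: "sq_integrable M ((Tr ^^ n) u)" for n by (intro Tr_pow_sq_integrable u)
  have "\<exists>n. q * sq_norm M ((Tr ^^ n) u) < sq_norm M ((Tr ^^ Suc n) u)"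
  proof (rule ccontr)
    assume "\<not> ?thesis"
    then have step: "sq_norm M ((Tr ^^ Suc n) u) \<le> q * sq_norm M ((Tr ^^ n) u)" for n by (simp add: not_less)
    have geo: "sq_norm M ((Tr ^^ n) u) \<le> sq_norm M u * q ^ n" for n
    proof (induction n)
      case (Suc n)
      have "q * sq_norm M ((Tr ^^ n) u) \<le> q * (sq_norm M u * q ^ n)"
        using q by (intro mult_left_mono Suc)
      with step[of n] show ?case by (simp add: mult_ac)
    qed simp
    \<comment> \<open>The midpoint lies above the rate \<open>q\<close>, as the Neumann series
      demands, and still below the infimum.\<close>
    have "(q + Inf super) / 2 \<in> super"
      by (rule super_geometric[OF u(1,2) geo]) (use q in auto)
    then have "Inf super \<le> (q + Inf super) / 2" by (rule cInf_lower[OF _ super_bdd_below])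
    with q show False by simp
  qed
  then obtain n where n: "q * sq_norm M ((Tr ^^ n) u) < sq_norm M ((Tr ^^ Suc n) u)" by blast
  define N where "N = sq_norm M ((Tr ^^ n) u)"
  have "N \<noteq> 0"
  proof
    assume "N = 0"
    then have "sq_norm M ((Tr ^^ Suc n) u) \<le> 0" using Tr_bounded[OF sq[of n]] unfolding N_def by simp
    with n \<open>N = 0\<close> show False unfolding N_def by simp
  qed
  then have N: "0 < N" unfolding N_def using sq_norm_nonneg order_le_less by metis
  have le: "AE x in M. Tr ((Tr ^^ n) u) x \<le> l * (Tr ^^ n) u x" for n
  proof (induction n)
    case (Suc n)
    have "AE x in M. Tr (Tr ((Tr ^^ n) u)) x \<le> Tr (\<lambda>x. l * (Tr ^^ n) u x) x"
      by (intro Tr_mono Suc sq_integrable_mult sq Tr_sq_integrable)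
    then show ?case by (simp add: Tr_mult)
  qed (use u in simp)
  define g where "g x = (1 / N) * (Tr ^^ n) u x" for x
  have g: "sq_integrable M g" unfolding g_def by (intro sq_integrable_mult sq)
  moreover have "AE x in M. 0 \<le> g x" using Tr_pow_nonneg[OF u0, of n] N unfolding g_def by (auto elim!: eventually_mono)
  moreover have "sq_norm M g = 1"
    unfolding g_def sq_integrable_mult(2)[OF sq] using N by (simp add: N_def)
  moreover have "AE x in M. Tr g x \<le> l * g x"
    unfolding g_def Tr_mult using le[of n] by eventually_elim (use N in \<open>simp add: field_simps\<close>)
  moreover have "q \<le> sq_norm M (Tr g)"
  proof -
    have "sq_norm M (Tr g) = (1 / N) * sq_norm M ((Tr ^^ Suc n) u)"
      unfolding g_def Tr_mult sq_integrable_mult(2)[OF Tr_sq_integrable[OF sq]] using N by simp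
    moreover have "(1 / N) * (q * N) \<le> (1 / N) * sq_norm M ((Tr ^^ Suc n) u)"
      using n N unfolding N_def[symmetric] by (intro mult_left_mono) auto
    ultimately show ?thesis using N by simp
  qed
  ultimately show ?thesis by blast
qed

text \<open>Pointwise, \<open>0 \<le> T g \<le> l g\<close> gives
  \<open>(l g - T g)\<^sup>2 \<le> (l g)\<^sup>2 - (T g)\<^sup>2\<close>. Hence the defect is small
  whenever \<open>T g\<close> has almost the norm of \<open>l g\<close>.\<close>

lemma super_defect:
  assumes g: "sq_integrable M g" "AE x in M. 0 \<le> g x" and le: "AE x in M. Tr g x \<le> l * g x"
  shows "(sq_norm M (\<lambda>x. l * g x - Tr g x))\<^sup>2 \<le> l\<^sup>2 * (sq_norm M g)\<^sup>2 - (sq_norm M (Tr g))\<^sup>2"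
proof -
  have sq: "sq_integrable M (Tr g)" "sq_integrable M (\<lambda>x. l * g x)" "sq_integrable M (\<lambda>x. l * g x - Tr g x)"
    by (intro sq_integrable_diff sq_integrable_mult Tr_sq_integrable g)+
  then have int: "integrable M (\<lambda>x. (Tr g x)\<^sup>2)" "integrable M (\<lambda>x. (l * g x)\<^sup>2)" "integrable M (\<lambda>x. (l * g x - Tr g x)\<^sup>2)"
    by (simp_all add: sq_integrable_def)
  have "(sq_norm M (\<lambda>x. l * g x - Tr g x))\<^sup>2 = (LINT x|M. (l * g x - Tr g x)\<^sup>2)"
    by (simp add: sq_norm_power2)
  also have "\<dots> \<le> (LINT x|M. (l * g x)\<^sup>2 - (Tr g x)\<^sup>2)"
  proof (intro integral_mono_AE int Bochner_Integration.integrable_diff)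
    show "AE x in M. (l * g x - Tr g x)\<^sup>2 \<le> (l * g x)\<^sup>2 - (Tr g x)\<^sup>2"
      using le
    proof eventually_elim
      case (elim x)
      have "0 \<le> Tr g x * (l * g x - Tr g x)" using elim Tr_nonneg[OF g(2), of x] by (intro mult_nonneg_nonneg) auto
      then show ?case by (simp add: power2_eq_square algebra_simps)
    qed
  qed
  also have "\<dots> = (sq_norm M (\<lambda>x. l * g x))\<^sup>2 - (sq_norm M (Tr g))\<^sup>2"
    using int by (simp add: sq_norm_power2)
  also have "(sq_norm M (\<lambda>x. l * g x))\<^sup>2 = l\<^sup>2 * (sq_norm M g)\<^sup>2"
    unfolding sq_integrable_mult(2)[OF g(1)] by (simp add: power_mult_distrib)
  finally show ?thesis .
qed

text \<open>Squeezing \<open>l n\<close> down and \<open>q n\<close> up to the infimum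
  \<open>r\<close> makes the defect bound \<open>(l n)\<^sup>2 - (q n)\<^sup>2\<close> vanish.
  Compactness makes \<open>T (g n)\<close> converge along a subsequence, and then
  \<open>r * g n\<close> has the same limit, which is the eigenfunction.\<close>

theorem principal_eigenfunction:
  "\<exists>r v. 0 < r \<and> sq_integrable M v \<and> (AE x in M. 0 < v x) \<and> (AE x in M. Tr v x = r * v x)"
proof -
  define r where "r = Inf super"
  have r: "0 < r" unfolding r_def by (rule Inf_super_pos)
  have "\<forall>n. \<exists>l. l \<in> super \<and> l < r + 1 / real (Suc n)"
  proof
    fix n
    show "\<exists>l. l \<in> super \<and> l < r + 1 / real (Suc n)"
      using cInf_lessD[OF super_nonempty, of "r + 1 / real (Suc n)"] unfolding r_def by auto
  qed
  from choice[OF this] obtain l where l: "\<And>n. l n \<in> super" "\<And>n. l n < r + 1 / real (Suc n)" by blast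
  have lr: "r \<le> l n" for n unfolding r_def by (rule cInf_lower[OF l(1) super_bdd_below])
  \<comment> \<open>Any sequence in \<open>[0, r)\<close> tending to \<open>r\<close> would do; this
    one starts at 0.\<close>
  define q where "q n = r * (1 - 1 / real (Suc n))" for n
  have q: "0 \<le> q n" "q n < r" for n unfolding q_def using r by (simp_all add: field_simps)
  have "\<forall>n. \<exists>g. sq_integrable M g \<and> (AE x in M. 0 \<le> g x) \<and> sq_norm M g = 1 \<and>
    (AE x in M. Tr g x \<le> l n * g x) \<and> q n \<le> sq_norm M (Tr g)"
    using almost_eigenfunction[OF l(1)] q unfolding r_def by blast
  from choice[OF this] obtain g where g: "\<And>n. sq_integrable M (g n)" "\<And>n. AE x in M. 0 \<le> g n x"
    "\<And>n. sq_norm M (g n) = 1" "\<And>n. AE x in M. Tr (g n) x \<le> l n * g n x" "\<And>n. q n \<le> sq_norm M (Tr (g n))"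
    by blast
  have l_lim: "l \<longlonglongrightarrow> r"
  proof (rule tendsto_sandwich[of "\<lambda>n. r" _ _ "\<lambda>n. r + 1 / real (Suc n)"])
    have "(\<lambda>n. r + 1 / real (Suc n)) \<longlonglongrightarrow> r + 0"
      by (intro tendsto_add tendsto_const LIMSEQ_Suc[OF lim_1_over_n])
    then show "(\<lambda>n. r + 1 / real (Suc n)) \<longlonglongrightarrow> r" by simp
    show "\<forall>\<^sub>F n in sequentially. l n \<le> r + 1 / real (Suc n)"
      using l(2) by (intro always_eventually allI less_imp_le)
  qed (simp_all add: lr)
  have q_lim: "q \<longlonglongrightarrow> r"
  proof -
    have "(\<lambda>n. r * (1 - 1 / real (Suc n))) \<longlonglongrightarrow> r * (1 - 0)"
      by (intro tendsto_mult tendsto_diff tendsto_const LIMSEQ_Suc[OF lim_1_over_n])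
    then show ?thesis unfolding q_def by simp
  qed
  have defect: "(\<lambda>n. sq_norm M (\<lambda>x. l n * g n x - Tr (g n) x)) \<longlonglongrightarrow> 0"
  proof -
    have le: "(sq_norm M (\<lambda>x. l n * g n x - Tr (g n) x))\<^sup>2 \<le> (l n)\<^sup>2 - (q n)\<^sup>2" for n
    proof -
      have "(q n)\<^sup>2 \<le> (sq_norm M (Tr (g n)))\<^sup>2" using g(5)[of n] q(1)[of n] by (intro power_mono)
      with super_defect[OF g(1,2,4), of n] g(3)[of n] show ?thesis by simp
    qed
    have "(\<lambda>n. sqrt ((l n)\<^sup>2 - (q n)\<^sup>2)) \<longlonglongrightarrow> sqrt (r\<^sup>2 - r\<^sup>2)"
      by (intro tendsto_intros l_lim q_lim)
    then have lim0: "(\<lambda>n. sqrt ((l n)\<^sup>2 - (q n)\<^sup>2)) \<longlonglongrightarrow> 0" by simp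
    show ?thesis
      by (rule tendsto_sandwich[OF _ _ tendsto_const lim0]) (auto intro!: always_eventually real_le_rsqrt le)
  qed
  obtain h and k :: "nat \<Rightarrow> nat" where h: "sq_integrable M h" and k: "strict_mono k"
    and lim: "(\<lambda>n. sq_norm M (\<lambda>x. Tr (g (k n)) x - h x)) \<longlonglongrightarrow> 0"
    by (rule Tr_compact[of g 1]) (simp_all add: g)
  \<comment> \<open>Scaled by \<open>r\<close>, these functions converge to the same limit
    \<open>h\<close> as the images \<open>T (g (k n))\<close>.\<close>
  define G where "G n x = r * g (k n) x" for n x
  have G: "sq_integrable M (G n)" for n unfolding G_def by (intro sq_integrable_mult g)
  have G_lim: "(\<lambda>n. sq_norm M (\<lambda>x. G n x - h x)) \<longlonglongrightarrow> 0"
  proof -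
    have le: "sq_norm M (\<lambda>x. G n x - h x) \<le> \<bar>r - l (k n)\<bar> + sq_norm M (\<lambda>x. l (k n) * g (k n) x - Tr (g (k n)) x)
       + sq_norm M (\<lambda>x. Tr (g (k n)) x - h x)" for n
    proof -
      have s1: "sq_integrable M (\<lambda>x. l (k n) * g (k n) x)" by (intro sq_integrable_mult g)
      have "sq_norm M (\<lambda>x. G n x - l (k n) * g (k n) x) = sq_norm M (\<lambda>x. (r - l (k n)) * g (k n) x)"
        unfolding G_def by (simp add: algebra_simps)
      also have "\<dots> = \<bar>r - l (k n)\<bar>" unfolding sq_integrable_mult(2)[OF g(1)] g(3) by simp
      finally have e: "sq_norm M (\<lambda>x. G n x - l (k n) * g (k n) x) = \<bar>r - l (k n)\<bar>" .
      show ?thesis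
        using sq_norm_triangle_diff[OF G[of n] s1 h] sq_norm_triangle_diff[OF s1 Tr_sq_integrable[OF g(1)[of "k n"]] h] e
        by linarith
    qed
    have "(\<lambda>n. \<bar>r - l (k n)\<bar> + sq_norm M (\<lambda>x. l (k n) * g (k n) x - Tr (g (k n)) x)
       + sq_norm M (\<lambda>x. Tr (g (k n)) x - h x)) \<longlonglongrightarrow> \<bar>r - r\<bar> + 0 + 0"
      using LIMSEQ_subseq_LIMSEQ[OF l_lim k] LIMSEQ_subseq_LIMSEQ[OF defect k]
      by (intro tendsto_add tendsto_rabs tendsto_diff tendsto_const lim) (auto simp: o_def)
    then have z: "(\<lambda>n. \<bar>r - l (k n)\<bar> + sq_norm M (\<lambda>x. l (k n) * g (k n) x - Tr (g (k n)) x)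
       + sq_norm M (\<lambda>x. Tr (g (k n)) x - h x)) \<longlonglongrightarrow> 0" by simp
    show ?thesis by (rule tendsto_sandwich[OF _ _ tendsto_const z]) (auto simp: le)
  qed
  have "AE x in M. Tr h x = r * h x"
  proof (rule sq_limit_unique[of M "\<lambda>n. Tr (G n)"])
    show "sq_integrable M (Tr (G n))" for n by (intro Tr_sq_integrable G)
    show "sq_integrable M (Tr h)" by (intro Tr_sq_integrable h)
    show "sq_integrable M (\<lambda>x. r * h x)" by (intro sq_integrable_mult h)
    show "(\<lambda>n. sq_norm M (\<lambda>x. Tr (G n) x - Tr h x)) \<longlonglongrightarrow> 0"
      by (rule Tr_limit[OF G h G_lim])
    have "sq_norm M (\<lambda>x. Tr (G n) x - r * h x) = r * sq_norm M (\<lambda>x. Tr (g (k n)) x - h x)" for n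
      unfolding G_def Tr_mult right_diff_distrib[symmetric]
      using sq_integrable_mult(2)[OF sq_integrable_diff(1)[OF Tr_sq_integrable[OF g(1)] h], of r "k n"] r by simp
    then show "(\<lambda>n. sq_norm M (\<lambda>x. Tr (G n) x - r * h x)) \<longlonglongrightarrow> 0"
      using tendsto_mult_right_zero[OF lim, of r] by simp
  qed
  note eig = this
  have h0: "AE x in M. 0 \<le> h x"
    by (rule sq_limit_nonneg[OF Tr_sq_integrable[OF g(1)] h lim]) (auto intro: Tr_nonneg g(2))
  \<comment> \<open>The lower bounds \<open>q n\<close> on the norms of the images survive in the
    limit and exclude \<open>h = 0\<close>.\<close>
  have "r \<le> sq_norm M h"
  proof (rule LIMSEQ_le)
    show "(\<lambda>n. q (k n)) \<longlonglongrightarrow> r" using LIMSEQ_subseq_LIMSEQ[OF q_lim k] by (simp add: o_def)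
    show "(\<lambda>n. sq_norm M (Tr (g (k n)))) \<longlonglongrightarrow> sq_norm M h"
      by (rule sq_limit_norm[OF Tr_sq_integrable[OF g(1)] h lim])
  qed (use g(5) in auto)
  then have "\<not> (AE x in M. h x = 0)" using r sq_norm_eq_0_iff[OF h] by auto
  from Tr_strict_pos[OF h h0 this] eig have "AE x in M. 0 < h x"
    by eventually_elim (use r in \<open>simp add: zero_less_mult_iff\<close>)
  with r h eig show ?thesis by blast
qed

definition Tr' :: "('x \<Rightarrow> real) \<Rightarrow> 'x \<Rightarrow> real" where
  "Tr' f x = (LINT y|M. K x y * f y)"

text \<open>This and the next identity match the constants of the transposed interpretation with
  those at hand, so that facts can be transferred in both directions.\<close>

lemma transpose_Tr: "positive_kernel.Tr M (\<lambda>x y. K y x) = Tr'"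
  by (simp add: fun_eq_iff positive_kernel.Tr_def[OF transpose] Tr'_def)

lemma transpose_Tr': "positive_kernel.Tr' M (\<lambda>x y. K y x) = Tr"
  by (simp add: fun_eq_iff positive_kernel.Tr'_def[OF transpose] Tr_def)

lemma Tr'_sq_integrable: "sq_integrable M f \<Longrightarrow> sq_integrable M (Tr' f)"
  using positive_kernel.Tr_sq_integrable[OF transpose] by (simp add: transpose_Tr)

lemma T'_of_real: "T' (\<lambda>x. complex_of_real (f x)) = (\<lambda>y. complex_of_real (Tr' f y))"
  using positive_kernel.T_of_real[OF transpose, of f] by (simp add: transpose_Tr)

lemma Tr_duality:
  assumes f: "sq_integrable M f" and g: "sq_integrable M g"
  shows "(LINT y|M. Tr f y * g y) = (LINT x|M. f x * Tr' g x)"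
proof -
  have "L2_inner M (T (\<lambda>x. complex_of_real (f x))) (\<lambda>x. complex_of_real (g x))
      = L2_inner M (\<lambda>x. complex_of_real (f x)) (T' (\<lambda>x. complex_of_real (g x)))"
    using f g by (intro duality) (simp_all add: sq_integrable_of_real)
  then show ?thesis
    unfolding T_of_real T'_of_real L2_inner_def complex_cnj_complex_of_real of_real_mult[symmetric] integral_complex_of_real
    by (simp only: of_real_eq_iff)
qed

lemma mult_integrable:
  fixes f g :: "'x \<Rightarrow> real"
  assumes "sq_integrable M f" "sq_integrable M g"
  shows "integrable M (\<lambda>x. f x * g x)"
proof -
  have [measurable]: "f \<in> borel_measurable M" "g \<in> borel_measurable M" using assms by auto
  show ?thesis
    by (rule Bochner_Integration.integrable_bound[OF sq_Hoelder(1)[OF assms]]) (auto simp: abs_mult)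
qed

lemma integral_mult_pos:
  fixes f g :: "'x \<Rightarrow> real"
  assumes f: "sq_integrable M f" and g: "sq_integrable M g"
    and f0: "AE x in M. 0 \<le> f x" and g0: "AE x in M. 0 < g x"
  shows "0 \<le> (LINT x|M. f x * g x)"
    and "(LINT x|M. f x * g x) = 0 \<longleftrightarrow> (AE x in M. f x = 0)"
proof -
  have 0: "AE x in M. 0 \<le> f x * g x" using f0 g0 by eventually_elim simp
  show "0 \<le> (LINT x|M. f x * g x)" by (rule integral_nonneg_AE[OF 0])
  have "(LINT x|M. f x * g x) = 0 \<longleftrightarrow> (AE x in M. f x * g x = 0)"
    by (rule integral_nonneg_eq_0_iff_AE[OF mult_integrable[OF f g] 0])
  also have "\<dots> \<longleftrightarrow> (AE x in M. f x = 0)"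
  proof
    assume "AE x in M. f x * g x = 0"
    with g0 show "AE x in M. f x = 0" by eventually_elim simp
  qed (auto elim!: eventually_mono)
  finally show "(LINT x|M. f x * g x) = 0 \<longleftrightarrow> (AE x in M. f x = 0)" .
qed

lemma not_null: "\<not> (AE x in M. False)"
proof
  assume "AE x in M. False"
  moreover obtain A where A: "A \<in> sets M" "0 < emeasure M A" using lower_bound by blast
  ultimately have "A \<in> null_sets M"
    using AE_iff_null_sets[OF A(1)] by (simp add: eventually_mono)
  with A(2) show False by auto
qed

text \<open>Evaluating \<open>\<langle>T v, w\<rangle> = \<langle>v, T' w\<rangle>\<close> by either
  eigenvalue equation gives \<open>r \<langle>v, w\<rangle> = r' \<langle>v, w\<rangle>\<close>, and
  the pairing of two positive functions is not 0.\<close>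

lemma principal_value_unique:
  assumes v: "sq_integrable M v" "AE x in M. 0 < v x" "AE x in M. Tr v x = r * v x"
    and w: "sq_integrable M w" "AE x in M. 0 < w x" "AE x in M. Tr' w x = r' * w x"
  shows "r = r'"
proof -
  have [measurable]: "v \<in> borel_measurable M" "w \<in> borel_measurable M" using v w by auto
  have [measurable]: "Tr v \<in> borel_measurable M" "Tr' w \<in> borel_measurable M"
    using Tr_sq_integrable[OF v(1)] Tr'_sq_integrable[OF w(1)] by auto
  have v0: "AE x in M. 0 \<le> v x" using v(2) by eventually_elim simp
  have "r * (LINT x|M. v x * w x) = (LINT x|M. Tr v x * w x)"
    unfolding integral_mult_right_zero[symmetric]
    using v(3) by (intro integral_cong_AE) (auto elim!: eventually_mono)
  also have "\<dots> = (LINT x|M. v x * Tr' w x)" by (rule Tr_duality[OF v(1) w(1)])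
  also have "\<dots> = r' * (LINT x|M. v x * w x)"
    unfolding integral_mult_right_zero[symmetric]
    using w(3) by (intro integral_cong_AE) (auto elim!: eventually_mono)
  finally have "r * (LINT x|M. v x * w x) = r' * (LINT x|M. v x * w x)" .
  moreover have "(LINT x|M. v x * w x) \<noteq> 0"
  proof
    assume "(LINT x|M. v x * w x) = 0"
    then have "AE x in M. v x = 0" using integral_mult_pos(2)[OF v(1) w(1) v0 w(2)] by simp
    with v(2) have "AE x in M. False" by eventually_elim simp
    with not_null show False by simp
  qed
  ultimately show ?thesis by simp
qed

lemma T_norm_le: "cmod (T f y) \<le> Tr (\<lambda>x. cmod (f x)) y"
proof -
  have "cmod (T f y) \<le> (LINT x|M. cmod (complex_of_real (K x y) * f x))"
    unfolding integral_op_def by (rule integral_norm_bound)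
  then show ?thesis by (simp add: Tr_def norm_mult)
qed

text \<open>Pairing \<open>\<bar>z\<bar> \<bar>f\<bar> \<le> T \<bar>f\<bar>\<close> with \<open>w\<close> bounds every eigenvalue.\<close>

lemma eigenvalue_bound:
  assumes w: "sq_integrable M w" "AE x in M. 0 < w x" "AE x in M. Tr' w x = r * w x"
    and z: "r < cmod z" and f: "sq_integrable M f" "AE x in M. T f x = z * f x"
  shows "AE x in M. f x = 0"
proof -
  define F where "F x = cmod (f x)" for x
  have F: "sq_integrable M F" unfolding F_def by (intro sq_integrable_norm f)
  have F0: "AE x in M. 0 \<le> F x" unfolding F_def by simp
  have [measurable]: "F \<in> borel_measurable M" "w \<in> borel_measurable M" "Tr' w \<in> borel_measurable M"
    using F w Tr'_sq_integrable[OF w(1)] by auto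
  have "cmod z * (LINT x|M. F x * w x) = (LINT x|M. (cmod z * F x) * w x)"
    by (simp add: mult.assoc)
  also have "\<dots> \<le> (LINT x|M. Tr F x * w x)"
  proof (rule integral_mono_AE)
    show "AE x in M. cmod z * F x * w x \<le> Tr F x * w x"
      using f(2) w(2)
    proof eventually_elim
      case (elim x)
      have "cmod z * F x = cmod (T f x)" unfolding F_def elim(1) by (simp add: norm_mult)
      also have "\<dots> \<le> Tr F x" unfolding F_def by (rule T_norm_le)
      finally show ?case using elim(2) by (intro mult_right_mono) auto
    qed
  qed (auto intro!: mult_integrable sq_integrable_mult Tr_sq_integrable F w)
  also have "\<dots> = (LINT x|M. F x * Tr' w x)" by (rule Tr_duality[OF F w(1)])
  also have "\<dots> = r * (LINT x|M. F x * w x)"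
    unfolding integral_mult_right_zero[symmetric]
    using w(3) by (intro integral_cong_AE) (auto elim!: eventually_mono)
  finally have le: "(cmod z - r) * (LINT x|M. F x * w x) \<le> 0" by (simp add: algebra_simps)
  have "(LINT x|M. F x * w x) \<le> 0"
    using le z by (simp add: mult_le_0_iff)
  then have "(LINT x|M. F x * w x) = 0" using integral_mult_pos(1)[OF F w(1) F0 w(2)] by linarith
  then have "AE x in M. F x = 0" using integral_mult_pos(2)[OF F w(1) F0 w(2)] by simp
  then show ?thesis unfolding F_def by simp
qed

section \<open>The resolvent and the spectral radius\<close>

lemma T_minus_sq_integrable: "sq_integrable M f \<Longrightarrow> sq_integrable M (\<lambda>x. T f x - z * f x)"
  by (intro sq_integrable_diff sq_integrable_mult T_sq_integrable)

lemma T_minus_bounded: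
  assumes f: "sq_integrable M f"
  shows "sq_norm M (\<lambda>x. T f x - z * f x) \<le> (opC + cmod z) * sq_norm M f"
  using sq_integrable_diff(2)[OF T_sq_integrable[OF f] sq_integrable_mult(1)[OF f], of z] opC(2)[OF f]
  unfolding sq_integrable_mult(2)[OF f] by (simp add: algebra_simps)

text \<open>Suppose unit vectors satisfy \<open>T f n - z f n \<longlonglongrightarrow> 0\<close>.
  Along a subsequence \<open>T f n\<close> converges to some \<open>g\<close>, hence so does
  \<open>z f n\<close>; then \<open>T g = z g\<close> and
  \<open>\<parallel>g\<parallel> = |z| \<noteq> 0\<close>, contrary to the absence of
  eigenvectors.\<close>

lemma bounded_below:
  assumes z: "z \<noteq> 0" and no: "\<And>f. sq_integrable M f \<Longrightarrow> AE x in M. T f x = z * f x \<Longrightarrow> AE x in M. f x = 0"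
  shows "\<exists>C>0. \<forall>f. sq_integrable M f \<longrightarrow> sq_norm M f \<le> C * sq_norm M (\<lambda>x. T f x - z * f x)"
proof (rule ccontr)
  assume neg: "\<not> ?thesis"
  have "\<forall>n. \<exists>f. sq_integrable M f \<and> sq_norm M f = 1 \<and> sq_norm M (\<lambda>x. T f x - z * f x) \<le> 1 / real (Suc n)"
  proof
    fix n
    have "0 < real (Suc n)" by simp
    then obtain f where f: "sq_integrable M f" "\<not> sq_norm M f \<le> real (Suc n) * sq_norm M (\<lambda>x. T f x - z * f x)"
      using neg by blast
    have "0 \<le> real (Suc n) * sq_norm M (\<lambda>x. T f x - z * f x)" by simp
    with f(2) have p: "0 < sq_norm M f" by linarith
    let ?c = "complex_of_real (1 / sq_norm M f)"
    have e: "(\<lambda>x. T (\<lambda>x. ?c * f x) x - z * (?c * f x)) = (\<lambda>x. ?c * (T f x - z * f x))"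
      unfolding T_mult by (simp add: fun_eq_iff algebra_simps)
    have "sq_norm M (\<lambda>x. T (\<lambda>x. ?c * f x) x - z * (?c * f x)) = (1 / sq_norm M f) * sq_norm M (\<lambda>x. T f x - z * f x)"
      unfolding e sq_integrable_mult(2)[OF T_minus_sq_integrable[OF f(1)]] norm_of_real using p by simp
    also have "\<dots> \<le> 1 / real (Suc n)"
      using f(2) p by (simp add: divide_simps mult.commute del: of_nat_Suc)
    finally show "\<exists>f. sq_integrable M f \<and> sq_norm M f = 1 \<and> sq_norm M (\<lambda>x. T f x - z * f x) \<le> 1 / real (Suc n)"
      using sq_integrable_mult[OF f(1), of ?c] p
      by (intro exI[of _ "\<lambda>x. ?c * f x"]) (simp add: norm_divide)
  qed
  from choice[OF this] obtain f where f: "\<And>n. sq_integrable M (f n)" "\<And>n. sq_norm M (f n) = 1"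
    "\<And>n. sq_norm M (\<lambda>x. T (f n) x - z * f n x) \<le> 1 / real (Suc n)" by blast
  obtain g and k :: "nat \<Rightarrow> nat" where g: "sq_integrable M g" and k: "strict_mono k"
    and lim: "(\<lambda>n. sq_norm M (\<lambda>x. T (f (k n)) x - g x)) \<longlonglongrightarrow> 0"
    by (rule T_compact[of f 1]) (simp_all add: f)
  have zf: "sq_integrable M (\<lambda>x. z * f n x)" for n by (intro sq_integrable_mult f)
  have lim2: "(\<lambda>n. sq_norm M (\<lambda>x. z * f (k n) x - g x)) \<longlonglongrightarrow> 0"
  proof -
    have le: "sq_norm M (\<lambda>x. z * f (k n) x - g x) \<le> 1 / real (Suc (k n)) + sq_norm M (\<lambda>x. T (f (k n)) x - g x)" for n
      using sq_norm_triangle_diff[OF zf[of "k n"] T_sq_integrable[OF f(1)[of "k n"]] g] f(3)[of "k n"]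
      unfolding sq_norm_minus_commute[of M "\<lambda>x. z * f (k n) x" "T (f (k n))"] by linarith
    have "(\<lambda>n. 1 / real (Suc (k n)) + sq_norm M (\<lambda>x. T (f (k n)) x - g x)) \<longlonglongrightarrow> 0 + 0"
      using LIMSEQ_subseq_LIMSEQ[OF LIMSEQ_Suc[OF lim_1_over_n] k] by (intro tendsto_add lim) (simp add: o_def)
    then have z0: "(\<lambda>n. 1 / real (Suc (k n)) + sq_norm M (\<lambda>x. T (f (k n)) x - g x)) \<longlonglongrightarrow> 0" by simp
    show ?thesis by (rule tendsto_sandwich[OF _ _ tendsto_const z0]) (use le in \<open>auto simp del: of_nat_Suc\<close>)
  qed
  have "AE x in M. T g x = z * g x"
  proof (rule sq_limit_unique[of M "\<lambda>n. T (\<lambda>x. z * f (k n) x)"])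
    show "(\<lambda>n. sq_norm M (\<lambda>x. T (\<lambda>x. z * f (k n) x) x - T g x)) \<longlonglongrightarrow> 0"
      by (rule T_limit[OF zf g lim2])
    have "sq_norm M (\<lambda>x. T (\<lambda>x. z * f (k n) x) x - z * g x) = cmod z * sq_norm M (\<lambda>x. T (f (k n)) x - g x)" for n
      unfolding T_mult right_diff_distrib[symmetric]
      by (rule sq_integrable_mult(2)[OF sq_integrable_diff(1)[OF T_sq_integrable[OF f(1)] g]])
    then show "(\<lambda>n. sq_norm M (\<lambda>x. T (\<lambda>x. z * f (k n) x) x - z * g x)) \<longlonglongrightarrow> 0"
      using tendsto_mult_right_zero[OF lim, of "cmod z"] by simp
  qed (intro T_sq_integrable zf g sq_integrable_mult)+
  from no[OF g this] have "sq_norm M g = 0" using sq_norm_eq_0_iff[OF g] by simp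
  moreover have "(\<lambda>n. sq_norm M (\<lambda>x. z * f (k n) x)) \<longlonglongrightarrow> sq_norm M g"
    by (rule sq_limit_norm[OF zf g lim2])
  then have "(\<lambda>n. cmod z) \<longlonglongrightarrow> sq_norm M g"
    unfolding sq_integrable_mult(2)[OF f(1)] f(2) by simp
  then have "sq_norm M g = cmod z" by (simp add: LIMSEQ_const_iff)
  ultimately show False using z by simp
qed

lemma sq_norm_diff_expand:
  fixes f g :: "'x \<Rightarrow> complex"
  assumes f: "sq_integrable M f" and g: "sq_integrable M g"
  shows "(sq_norm M (\<lambda>x. f x - g x))\<^sup>2 = (sq_norm M f)\<^sup>2 - 2 * Re (L2_inner M g f) + (sq_norm M g)\<^sup>2"
proof -
  have pt: "(cmod (a - b))\<^sup>2 = (cmod a)\<^sup>2 - 2 * Re (b * cnj a) + (cmod b)\<^sup>2" for a b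
    unfolding cmod_power2 by (simp add: power2_eq_square algebra_simps)
  have int: "integrable M (\<lambda>x. (cmod (f x))\<^sup>2)" "integrable M (\<lambda>x. (cmod (g x))\<^sup>2)"
    using f g by (auto simp: sq_integrable_def)
  have int2: "integrable M (\<lambda>x. g x * cnj (f x))" by (rule cnj_mult_integrable[OF g f])
  define R where "R x = Re (g x * cnj (f x))" for x
  have R: "integrable M R" "(LINT x|M. R x) = Re (L2_inner M g f)"
    unfolding R_def L2_inner_def by (rule integrable_Re[OF int2], rule integral_Re[OF int2])
  have "(sq_norm M (\<lambda>x. f x - g x))\<^sup>2 = (LINT x|M. (cmod (f x))\<^sup>2 - 2 * R x + (cmod (g x))\<^sup>2)"
    unfolding sq_norm_power2 pt R_def ..
  also have "\<dots> = (LINT x|M. (cmod (f x))\<^sup>2) - 2 * (LINT x|M. R x) + (LINT x|M. (cmod (g x))\<^sup>2)"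
    using int R(1) by simp
  also note R(2)
  finally show ?thesis unfolding sq_norm_power2 .
qed

lemma L2_inner_minus:
  assumes "sq_integrable M f" "sq_integrable M g" "sq_integrable M h"
  shows "L2_inner M (\<lambda>x. f x - g x) h = L2_inner M f h - L2_inner M g h"
    "L2_inner M h (\<lambda>x. f x - g x) = L2_inner M h f - L2_inner M h g"
  unfolding L2_inner_def
  using cnj_mult_integrable[OF assms(1,3)] cnj_mult_integrable[OF assms(2,3)]
    cnj_mult_integrable[OF assms(3,1)] cnj_mult_integrable[OF assms(3,2)]
  by (simp_all add: left_diff_distrib right_diff_distrib)

lemma L2_inner_mult: "L2_inner M (\<lambda>x. c * f x) g = c * L2_inner M f g"
  "L2_inner M f (\<lambda>x. c * g x) = cnj c * L2_inner M f g"
proof -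
  have "(\<lambda>x. f x * cnj (c * g x)) = (\<lambda>x. cnj c * (f x * cnj (g x)))" by (simp add: fun_eq_iff)
  then show "L2_inner M f (\<lambda>x. c * g x) = cnj c * L2_inner M f g"
    unfolding L2_inner_def by simp
  show "L2_inner M (\<lambda>x. c * f x) g = c * L2_inner M f g"
    unfolding L2_inner_def by (simp add: mult.assoc)
qed

lemma T_minus_duality:
  assumes f: "sq_integrable M f" and g: "sq_integrable M g"
  shows "L2_inner M (\<lambda>x. T f x - z * f x) g = L2_inner M f (\<lambda>x. T' g x - cnj z * g x)"
proof -
  have "L2_inner M (\<lambda>x. T f x - z * f x) g = L2_inner M (T f) g - z * L2_inner M f g"
    by (subst L2_inner_minus(1)) (auto intro: T_sq_integrable sq_integrable_mult f g simp: L2_inner_mult)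
  also have "\<dots> = L2_inner M f (\<lambda>x. T' g x - cnj z * g x)"
    by (subst L2_inner_minus(2)) (auto intro: T'_bounded sq_integrable_mult f g simp: L2_inner_mult duality[OF f g])
  finally show ?thesis .
qed

text \<open>With \<open>A = T - z\<close> and \<open>A\<^sup>* = T' - cnj z\<close> bounded below, \<open>e \<mapsto> e - A A\<^sup>* e / \<alpha>\<^sup>2\<close> is a strict contraction
  for \<open>\<alpha> \<ge> \<parallel>A\<parallel>\<close>, so the residuals of the corresponding iteration for \<open>A f = g\<close> are summable.\<close>

lemma surjective:
  assumes below: "\<And>f. sq_integrable M f \<Longrightarrow> sq_norm M f \<le> C * sq_norm M (\<lambda>x. T' f x - cnj z * f x)"
    and C: "0 < C" and g: "sq_integrable M g"
  shows "\<exists>f. sq_integrable M f \<and> (AE x in M. T f x - z * f x = g x)"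
proof -
  define A where "A f x = T f x - z * f x" for f x
  define B where "B f x = T' f x - cnj z * f x" for f x
  define \<alpha> where "\<alpha> = opC + cmod z"
  have \<alpha>: "0 < \<alpha>" unfolding \<alpha>_def using opC(1) norm_ge_zero[of z] by linarith
  \<comment> \<open>With this step length the quadratic term of
    \<open>\<parallel>e - c A (B e)\<parallel>\<^sup>2\<close> is at most
    \<open>c \<parallel>B e\<parallel>\<^sup>2\<close>, half of what the mixed term
    subtracts.\<close>
  define c where "c = 1 / \<alpha>\<^sup>2"
  have c: "0 < c" unfolding c_def using \<alpha> by simp
  have A: "sq_integrable M (A f)" "sq_norm M (A f) \<le> \<alpha> * sq_norm M f" if "sq_integrable M f" for f
    unfolding A_def \<alpha>_def by (rule T_minus_sq_integrable[OF that], rule T_minus_bounded[OF that])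
  have B: "sq_integrable M (B f)" "sq_norm M (B f) \<le> \<alpha> * sq_norm M f" if "sq_integrable M f" for f
  proof -
    show "sq_integrable M (B f)" unfolding B_def by (intro sq_integrable_diff sq_integrable_mult T'_bounded that)
    show "sq_norm M (B f) \<le> \<alpha> * sq_norm M f"
      using sq_integrable_diff(2)[OF T'_bounded(2)[OF that] sq_integrable_mult(1)[OF that], of "cnj z"] T'_bounded(3)[OF that]
      unfolding sq_integrable_mult(2)[OF that] B_def \<alpha>_def by (simp add: algebra_simps)
  qed
  define S where "S e x = e x - complex_of_real c * A (B e) x" for e x
  have S: "sq_integrable M (S e)" if "sq_integrable M e" for e
    unfolding S_def by (intro sq_integrable_diff sq_integrable_mult A B that)
  \<comment> \<open>The square root, because the estimate is one for squares; \<open>max 0\<close>,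
    because nothing rules out \<open>C\<^sup>2 < c\<close> here.\<close>
  define \<rho> where "\<rho> = sqrt (max 0 (1 - c / C\<^sup>2))"
  have \<rho>: "0 \<le> \<rho>" "\<rho> < 1" unfolding \<rho>_def using c C by (auto simp: real_sqrt_lt_1_iff)
  have contr: "sq_norm M (S e) \<le> \<rho> * sq_norm M e" if e: "sq_integrable M e" for e
  proof -
    have AB: "sq_integrable M (A (B e))" by (intro A B e)
    have "L2_inner M (A (B e)) e = L2_inner M (B e) (B e)"
      using T_minus_duality[OF B(1)[OF e] e, of z] unfolding A_def[symmetric] B_def[symmetric] .
    then have in': "Re (L2_inner M (\<lambda>x. complex_of_real c * A (B e) x) e) = c * (sq_norm M (B e))\<^sup>2"
      by (simp add: L2_inner_mult L2_inner_self)
    have "(sq_norm M (S e))\<^sup>2 = (sq_norm M e)\<^sup>2 - 2 * (c * (sq_norm M (B e))\<^sup>2) + (c * sq_norm M (A (B e)))\<^sup>2"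
      unfolding S_def using sq_norm_diff_expand[OF e sq_integrable_mult(1)[OF AB], of "complex_of_real c"]
      unfolding in' sq_integrable_mult(2)[OF AB] using c by simp
    also have "(c * sq_norm M (A (B e)))\<^sup>2 \<le> (c * (\<alpha> * sq_norm M (B e)))\<^sup>2"
      using c by (intro power_mono mult_left_mono A B e) auto
    also have "(c * (\<alpha> * sq_norm M (B e)))\<^sup>2 = c * (sq_norm M (B e))\<^sup>2"
      unfolding c_def using \<alpha> by (simp add: power2_eq_square)
    also have "(sq_norm M e)\<^sup>2 - 2 * (c * (sq_norm M (B e))\<^sup>2) + c * (sq_norm M (B e))\<^sup>2
       = (sq_norm M e)\<^sup>2 - c * (sq_norm M (B e))\<^sup>2" by simp
    also have "\<dots> \<le> (sq_norm M e)\<^sup>2 - c * ((sq_norm M e)\<^sup>2 / C\<^sup>2)"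
    proof -
      have "sq_norm M e / C \<le> sq_norm M (B e)"
        using below[OF e] C unfolding B_def by (simp add: divide_simps mult.commute)
      then have "(sq_norm M e / C)\<^sup>2 \<le> (sq_norm M (B e))\<^sup>2" using C by (intro power_mono) auto
      then have "c * ((sq_norm M e)\<^sup>2 / C\<^sup>2) \<le> c * (sq_norm M (B e))\<^sup>2"
        using c by (intro mult_left_mono) (auto simp: power_divide)
      then show ?thesis by simp
    qed
    also have "\<dots> = (1 - c / C\<^sup>2) * (sq_norm M e)\<^sup>2" by (simp add: algebra_simps)
    also have "\<dots> \<le> \<rho>\<^sup>2 * (sq_norm M e)\<^sup>2"
      unfolding \<rho>_def by (intro mult_right_mono) auto
    finally have "(sq_norm M (S e))\<^sup>2 \<le> (\<rho> * sq_norm M e)\<^sup>2" by (simp add: power_mult_distrib)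
    then show ?thesis by (rule power2_le_imp_le) (use \<rho>(1) in auto)
  qed
  define e where "e n = (S ^^ n) g" for n
  have e0: "e 0 = g" and eS: "e (Suc n) = S (e n)" for n unfolding e_def by auto
  have e: "sq_integrable M (e n)" for n by (induction n) (auto simp: e0 eS g S)
  have en: "sq_norm M (e n) \<le> \<rho> ^ n * sq_norm M g" for n
  proof (induction n)
    case (Suc n)
    have "\<rho> * sq_norm M (e n) \<le> \<rho> * (\<rho> ^ n * sq_norm M g)" by (intro mult_left_mono Suc \<rho>)
    with contr[OF e[of n]] show ?case by (simp add: eS mult.assoc)
  qed (simp add: e0)
  \<comment> \<open>The correction made at step \<open>n\<close>:
    \<open>A (h n) = e n - e (Suc n)\<close>, so applying \<open>A\<close> to the sum of the
    corrections telescopes to \<open>g\<close> minus the residual.\<close>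
  define h where "h n x = complex_of_real c * B (e n) x" for n x
  have h: "sq_integrable M (h n)" for n unfolding h_def by (intro sq_integrable_mult B e)
  have hn: "sq_norm M (h n) \<le> (c * \<alpha> * sq_norm M g) * \<rho> ^ n" for n
  proof -
    have "sq_norm M (h n) = c * sq_norm M (B (e n))"
      unfolding h_def sq_integrable_mult(2)[OF B(1)[OF e]] using c by simp
    also have "\<dots> \<le> c * (\<alpha> * (\<rho> ^ n * sq_norm M g))"
      using c \<alpha> by (intro mult_left_mono order_trans[OF B(2)[OF e]] en) auto
    finally show ?thesis by (simp add: mult_ac)
  qed
  have "summable (\<lambda>n. sq_norm M (h n))"
  proof (rule summable_comparison_test'[where g="\<lambda>n. (c * \<alpha> * sq_norm M g) * \<rho> ^ n"])
    show "summable (\<lambda>n. (c * \<alpha> * sq_norm M g) * \<rho> ^ n)"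
      using \<rho> by (intro summable_mult summable_geometric) simp
  qed (use hn in auto)
  from sq_complete_sum[OF h this] obtain f where f: "sq_integrable M f"
    and lim: "(\<lambda>n. sq_norm M (\<lambda>x. (\<Sum>i<n. h i x) - f x)) \<longlonglongrightarrow> 0" by blast
  define s where "s n x = (\<Sum>i<n. h i x)" for n x
  have s: "sq_integrable M (s n)" for n
    unfolding s_def using sq_integrable_sum[of "{..<n}" M h] h by auto
  have lim: "(\<lambda>n. sq_norm M (\<lambda>x. s n x - f x)) \<longlonglongrightarrow> 0" using lim unfolding s_def .
  have As: "AE x in M. A (s n) x = g x - e n x" for n
  proof (induction n)
    case 0
    show ?case by (simp add: A_def s_def integral_op_def e0)
  next
    case (Suc n)
    have sS: "s (Suc n) = (\<lambda>x. s n x - - h n x)" unfolding s_def by simp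
    have neg: "T (\<lambda>x. - h n x) x = - T (h n) x" for x
      using T_mult[of "-1" "h n" x] by simp
    have Ah: "A (h n) x = e n x - e (Suc n) x" for x
      unfolding eS S_def A_def h_def T_mult by (simp add: algebra_simps)
    have "AE x in M. A (s (Suc n)) x = A (s n) x + A (h n) x"
      using T_diff[OF s[of n] sq_integrable_uminus(1)[OF h[of n]]]
      unfolding A_def sS neg by eventually_elim (simp add: algebra_simps)
    with Suc show ?case unfolding Ah by eventually_elim simp
  qed
  have "AE x in M. A f x = g x"
  proof (rule sq_limit_unique[of M "\<lambda>n. A (s n)"])
    show "(\<lambda>n. sq_norm M (\<lambda>x. A (s n) x - A f x)) \<longlonglongrightarrow> 0"
    proof (rule tendsto_sandwich[OF _ _ tendsto_const tendsto_mult_right_zero[OF lim, of \<alpha>]])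
      have "sq_norm M (\<lambda>x. A (s n) x - A f x) \<le> \<alpha> * sq_norm M (\<lambda>x. s n x - f x)" for n
      proof -
        have d: "sq_integrable M (\<lambda>x. s n x - f x)" by (intro sq_integrable_diff s f)
        have "AE x in M. A (\<lambda>x. s n x - f x) x = A (s n) x - A f x"
          using T_diff[OF s[of n] f] unfolding A_def by eventually_elim (simp add: algebra_simps)
        then have "sq_norm M (\<lambda>x. A (s n) x - A f x) = sq_norm M (A (\<lambda>x. s n x - f x))"
          using A(1)[OF s[of n]] A(1)[OF f] A(1)[OF d] by (intro sq_norm_cong_AE) auto
        with A(2)[OF d] show ?thesis by simp
      qed
      then show "\<forall>\<^sub>F n in sequentially. sq_norm M (\<lambda>x. A (s n) x - A f x) \<le> \<alpha> * sq_norm M (\<lambda>x. s n x - f x)" by simp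
    qed simp
    show "(\<lambda>n. sq_norm M (\<lambda>x. A (s n) x - g x)) \<longlonglongrightarrow> 0"
    proof -
      have "sq_norm M (\<lambda>x. A (s n) x - g x) = sq_norm M (e n)" for n
        using As[of n] A(1)[OF s[of n]] g e[of n] by (intro sq_norm_cong_AE) auto
      moreover have z: "(\<lambda>n. \<rho> ^ n * sq_norm M g) \<longlonglongrightarrow> 0"
        using \<rho> by (intro tendsto_mult_left_zero LIMSEQ_power_zero) simp
      have "(\<lambda>n. sq_norm M (e n)) \<longlonglongrightarrow> 0"
        by (rule tendsto_sandwich[OF _ _ tendsto_const z]) (auto simp: en)
      ultimately show ?thesis by simp
    qed
  qed (intro A s f g)+
  with f show ?thesis unfolding A_def by blast
qed

text \<open>Outside the disc of radius \<open>r\<close> neither \<open>T\<close> nor its adjoint has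
  the relevant eigenvalue (pair with \<open>w\<close> in the first case, with \<open>v\<close> in
  the second). So \<open>T - z\<close> and its adjoint are bounded below, which gives injectivity
  with bounded inverse and surjectivity. On the circle, \<open>r\<close> itself is attained, since
  \<open>v\<close> violates boundedness below.\<close>

theorem spectral_radius_eq:
  assumes v: "sq_integrable M v" "AE x in M. 0 < v x" "AE x in M. Tr v x = r * v x"
    and w: "sq_integrable M w" "AE x in M. 0 < w x" "AE x in M. Tr' w x = r * w x"
    and r: "0 < r"
  shows "spectral_radius M T = r"
proof -
  interpret tr: positive_kernel M "\<lambda>x y. K y x" by (rule transpose)
  have res: "z \<in> resolvent_set M T" if z: "r < cmod z" for z
  proof -
    have z0: "z \<noteq> 0" using z r by auto
    have "\<exists>C>0. \<forall>f. sq_integrable M f \<longrightarrow> sq_norm M f \<le> C * sq_norm M (\<lambda>x. T f x - z * f x)"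
      by (rule bounded_below[OF z0 eigenvalue_bound[OF w z]])
    moreover have "\<exists>C>0. \<forall>f. sq_integrable M f \<longrightarrow> sq_norm M f \<le> C * sq_norm M (\<lambda>x. T' f x - cnj z * f x)"
    proof (rule tr.bounded_below)
      fix f assume "sq_integrable M f" "AE x in M. T' f x = cnj z * f x"
      then show "AE x in M. f x = 0"
        using tr.eigenvalue_bound[of v r "cnj z" f] v z by (simp add: transpose_Tr')
    qed (use z0 in simp)
    ultimately show ?thesis
      unfolding resolvent_set_def L2_norm_eq_sq_norm using surjective[of _ z]
      by (auto simp: L2_iff_sq_integrable Ball_def Bex_def)
  qed
  have "complex_of_real r \<notin> resolvent_set M T"
  proof
    assume "complex_of_real r \<in> resolvent_set M T"
    then obtain C where C: "\<And>f. sq_integrable M f \<Longrightarrow> sq_norm M f \<le> C * sq_norm M (\<lambda>x. T f x - complex_of_real r * f x)"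
      unfolding resolvent_set_def L2_norm_eq_sq_norm Ball_def L2_iff_sq_integrable by blast
    let ?v = "\<lambda>x. complex_of_real (v x)"
    have sv: "sq_integrable M ?v" using v by (simp add: sq_integrable_of_real)
    have "AE x in M. T ?v x - complex_of_real r * ?v x = 0"
      unfolding T_of_real using v(3) by eventually_elim simp
    then have "sq_norm M (\<lambda>x. T ?v x - complex_of_real r * ?v x) = 0"
      using sq_norm_eq_0_iff[OF T_minus_sq_integrable[OF sv]] by simp
    with C[OF sv] have "sq_norm M v \<le> 0" by (simp add: sq_integrable_of_real)
    then have "AE x in M. v x = 0" using sq_norm_eq_0_iff[OF v(1)] sq_norm_nonneg[of M v] by simp
    with v(2) have "AE x in M. False" by eventually_elim simp
    with not_null show False by simp
  qed
  then have "r \<in> cmod ` (- resolvent_set M T)"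
    using r by (intro image_eqI[of _ _ "complex_of_real r"]) auto
  moreover have "x \<le> r" if "x \<in> cmod ` (- resolvent_set M T)" for x
    using that res by force
  ultimately show ?thesis
    unfolding spectral_radius_def by (rule cSup_eq_maximum)
qed

end

section \<open>Convergence to the principal eigenfunction\<close>

text \<open>Positivity is required at every point, so that \<open>v\<close> and \<open>w\<close> can
  be divided by without exceptional sets. The normalisation makes \<open>v w\<close> a probability
  density.\<close>

locale principal_pair = positive_kernel M K for M :: "'x measure" and K +
  fixes r :: real and v w :: "'x \<Rightarrow> real"
  assumes r_pos: "0 < r"
    and v_pos: "\<And>x. 0 < v x" and w_pos: "\<And>x. 0 < w x"
    and v_sq: "sq_integrable M v" and w_sq: "sq_integrable M w"
    and v_eigen: "AE x in M. Tr v x = r * v x" and w_eigen: "AE x in M. Tr' w x = r * w x"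
    and vw_integral: "(LINT x|M. v x * w x) = 1"
begin

lemma transpose_pair: "principal_pair M (\<lambda>x y. K y x) r w v"
proof -
  interpret tr: positive_kernel M "\<lambda>x y. K y x" by (rule transpose)
  show ?thesis
    by unfold_locales
      (use r_pos v_pos w_pos v_sq w_sq v_eigen w_eigen vw_integral in
        \<open>auto simp: transpose_Tr transpose_Tr' mult.commute\<close>)
qed

lemma v_measurable [measurable]: "v \<in> borel_measurable M" using v_sq by auto
lemma w_measurable [measurable]: "w \<in> borel_measurable M" using w_sq by auto

lemma vw_nonneg [simp]: "0 \<le> v x" "0 \<le> w x" "0 \<le> r"
  using v_pos[of x] w_pos[of x] r_pos by simp_all

lemma vw_ne_0 [simp]: "v x \<noteq> 0" "w x \<noteq> 0" "r \<noteq> 0"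
  using v_pos[of x] w_pos[of x] r_pos by auto

text \<open>The \<open>L\<^sup>1\<close> norm with weight \<open>w\<close>. As \<open>w\<close> is
  an eigenfunction of the adjoint, \<open>T / r\<close> is a contraction for it, which the
  \<open>L2\<close> norm does not offer.\<close>

definition wnorm :: "('x \<Rightarrow> real) \<Rightarrow> real" where
  "wnorm f = (LINT x|M. \<bar>f x\<bar> * w x)"

lemma abs_sq_integrable: "sq_integrable M f \<Longrightarrow> sq_integrable M (\<lambda>x. \<bar>f x\<bar>)" for f :: "'x \<Rightarrow> real"
  using sq_integrable_norm(1)[of M f] by simp

lemma wnorm_integrable:
  assumes "sq_integrable M f"
  shows "integrable M (\<lambda>x. \<bar>f x\<bar> * w x)"
  by (intro mult_integrable abs_sq_integrable assms w_sq)

lemma wnorm_nonneg: "0 \<le> wnorm f"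
  unfolding wnorm_def by (intro integral_nonneg_AE) auto

lemma wnorm_le_sq_norm:
  assumes "sq_integrable M f"
  shows "wnorm f \<le> sq_norm M f * sq_norm M w"
  using sq_Hoelder(2)[OF assms w_sq] by (simp add: wnorm_def)

lemma wnorm_mult: "wnorm (\<lambda>x. c * f x) = \<bar>c\<bar> * wnorm f"
  unfolding wnorm_def by (simp add: abs_mult mult.assoc)

lemma wnorm_diff_abs:
  assumes f: "sq_integrable M f" and g: "sq_integrable M g"
  shows "\<bar>wnorm f - wnorm g\<bar> \<le> wnorm (\<lambda>x. f x - g x)"
proof -
  have int: "integrable M (\<lambda>x. \<bar>f x\<bar> * w x)" "integrable M (\<lambda>x. \<bar>g x\<bar> * w x)" "integrable M (\<lambda>x. \<bar>f x - g x\<bar> * w x)"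
    by (intro wnorm_integrable f g sq_integrable_diff)+
  have "wnorm f - wnorm g = (LINT x|M. \<bar>f x\<bar> * w x - \<bar>g x\<bar> * w x)"
    unfolding wnorm_def using int by simp
  then have "\<bar>wnorm f - wnorm g\<bar> \<le> (LINT x|M. \<bar>\<bar>f x\<bar> * w x - \<bar>g x\<bar> * w x\<bar>)"
    using integral_abs_bound[of M "\<lambda>x. \<bar>f x\<bar> * w x - \<bar>g x\<bar> * w x"] by simp
  also have "\<dots> \<le> wnorm (\<lambda>x. f x - g x)"
    unfolding wnorm_def
  proof (intro integral_mono integrable_abs Bochner_Integration.integrable_diff int)
    fix x
    have "\<bar>\<bar>f x\<bar> * w x - \<bar>g x\<bar> * w x\<bar> = \<bar>\<bar>f x\<bar> - \<bar>g x\<bar>\<bar> * w x"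
      by (simp add: left_diff_distrib[symmetric] abs_mult)
    also have "\<dots> \<le> \<bar>f x - g x\<bar> * w x"
      by (intro mult_right_mono abs_triangle_ineq3) auto
    finally show "\<bar>\<bar>f x\<bar> * w x - \<bar>g x\<bar> * w x\<bar> \<le> \<bar>f x - g x\<bar> * w x" .
  qed
  finally show ?thesis .
qed

lemma wnorm_limit:
  assumes f: "\<And>n. sq_integrable M (f n)" and g: "sq_integrable M g"
    and lim: "(\<lambda>n. sq_norm M (\<lambda>x. f n x - g x)) \<longlonglongrightarrow> 0"
  shows "(\<lambda>n. wnorm (f n)) \<longlonglongrightarrow> wnorm g"
proof -
  have z: "(\<lambda>n. sq_norm M (\<lambda>x. f n x - g x) * sq_norm M w) \<longlonglongrightarrow> 0"
    by (rule tendsto_mult_left_zero[OF lim])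
  have "\<bar>wnorm (f n) - wnorm g\<bar> \<le> sq_norm M (\<lambda>x. f n x - g x) * sq_norm M w" for n
    using wnorm_diff_abs[OF f g] wnorm_le_sq_norm[OF sq_integrable_diff(1)[OF f g]] order_trans by blast
  then have "(\<lambda>n. \<bar>wnorm (f n) - wnorm g\<bar>) \<longlonglongrightarrow> 0"
    by (intro tendsto_sandwich[OF _ _ tendsto_const z]) auto
  then show ?thesis by (simp add: LIM_zero_iff tendsto_rabs_zero_iff)
qed

lemma integral_Tr_w:
  assumes f: "sq_integrable M f"
  shows "(LINT x|M. Tr f x * w x) = r * (LINT x|M. f x * w x)"
proof -
  have [measurable]: "f \<in> borel_measurable M" "Tr' w \<in> borel_measurable M"
    using f Tr'_sq_integrable[OF w_sq] by auto
  have "(LINT x|M. Tr f x * w x) = (LINT x|M. f x * Tr' w x)" by (rule Tr_duality[OF f w_sq])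
  also have "\<dots> = r * (LINT x|M. f x * w x)"
    unfolding integral_mult_right_zero[symmetric]
    using w_eigen by (intro integral_cong_AE) (auto elim!: eventually_mono)
  finally show ?thesis .
qed

lemma Tr_abs: "\<bar>Tr f y\<bar> \<le> Tr (\<lambda>x. \<bar>f x\<bar>) y"
proof -
  have "\<bar>Tr f y\<bar> \<le> (LINT x|M. \<bar>K x y * f x\<bar>)" unfolding Tr_def by (rule integral_abs_bound)
  then show ?thesis by (simp add: Tr_def abs_mult)
qed

lemma wnorm_Tr:
  assumes f: "sq_integrable M f"
  shows "wnorm (Tr f) \<le> r * wnorm f"
proof -
  have "wnorm (Tr f) \<le> (LINT x|M. Tr (\<lambda>x. \<bar>f x\<bar>) x * w x)"
    unfolding wnorm_def
    by (intro integral_mono mult_integrable abs_sq_integrable Tr_sq_integrable f w_sq mult_right_mono Tr_abs) auto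
  also have "\<dots> = r * wnorm f" unfolding wnorm_def by (rule integral_Tr_w[OF abs_sq_integrable[OF f]])
  finally show ?thesis .
qed

text \<open>The kernel is positive, so equality in \<open>\<bar>T h\<bar> \<le> T \<bar>h\<bar>\<close> forces a constant sign.\<close>

lemma wnorm_Tr_strict:
  assumes h: "sq_integrable M h" and mean: "(LINT x|M. h x * w x) = 0" and eq: "wnorm (Tr h) = r * wnorm h"
  shows "wnorm h = 0"
proof -
  have ah: "sq_integrable M (\<lambda>x. \<bar>h x\<bar>)" by (rule abs_sq_integrable[OF h])
  have d0: "AE x in M. 0 \<le> (Tr (\<lambda>x. \<bar>h x\<bar>) x - \<bar>Tr h x\<bar>)" using Tr_abs[of h] by simp
  have dsq: "sq_integrable M (\<lambda>x. Tr (\<lambda>x. \<bar>h x\<bar>) x - \<bar>Tr h x\<bar>)"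
    by (intro sq_integrable_diff abs_sq_integrable Tr_sq_integrable h)
  have "(LINT x|M. (Tr (\<lambda>x. \<bar>h x\<bar>) x - \<bar>Tr h x\<bar>) * w x) = (LINT x|M. Tr (\<lambda>x. \<bar>h x\<bar>) x * w x) - wnorm (Tr h)"
    unfolding left_diff_distrib wnorm_def
    by (intro Bochner_Integration.integral_diff mult_integrable abs_sq_integrable Tr_sq_integrable h w_sq)
  also have "\<dots> = 0" unfolding integral_Tr_w[OF ah] eq by (simp add: wnorm_def)
  finally have "AE x in M. Tr (\<lambda>x. \<bar>h x\<bar>) x - \<bar>Tr h x\<bar> = 0"
    using integral_mult_pos(2)[OF dsq w_sq d0] w_pos by simp
  then have "AE y in M. (AE x in M. 0 \<le> h x) \<or> (AE x in M. h x \<le> 0)"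
    using Tr_integrable[OF h] Tr_integrable[OF ah]
  proof eventually_elim
    case (elim y)
    have sgn: "AE x in M. 0 \<le> s * h x" if s: "s = 1 \<or> s = -1" and e: "Tr (\<lambda>x. \<bar>h x\<bar>) y = s * Tr h y" for s :: real
    proof -
      have int: "integrable M (\<lambda>x. K x y * \<bar>h x\<bar> - s * (K x y * h x))"
        using elim by simp
      have 0: "AE x in M. 0 \<le> K x y * \<bar>h x\<bar> - s * (K x y * h x)"
      proof (rule AE_I2)
        fix x
        have "K x y * (\<bar>h x\<bar> - s * h x) \<ge> 0" using s by (intro mult_nonneg_nonneg) auto
        then show "0 \<le> K x y * \<bar>h x\<bar> - s * (K x y * h x)" by (simp add: algebra_simps)
      qed
      have "(LINT x|M. K x y * \<bar>h x\<bar> - s * (K x y * h x)) = Tr (\<lambda>x. \<bar>h x\<bar>) y - s * Tr h y"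
        using elim unfolding Tr_def by simp
      also have "\<dots> = 0" using e by simp
      finally have "AE x in M. K x y * \<bar>h x\<bar> - s * (K x y * h x) = 0"
        using integral_nonneg_eq_0_iff_AE[OF int 0] by simp
      then show ?thesis
      proof eventually_elim
        case (elim x)
        then have "K x y * (\<bar>h x\<bar> - s * h x) = 0" by (simp add: algebra_simps)
        then have "\<bar>h x\<bar> = s * h x" by simp
        then show ?case by (metis abs_ge_zero)
      qed
    qed
    show ?case
    proof (cases "0 \<le> Tr h y")
      case True
      then show ?thesis using sgn[of 1] elim(1) by simp
    next
      case False
      then show ?thesis using sgn[of "-1"] elim(1) by simp
    qed
  qed
  \<comment> \<open>The disjunction does not mention \<open>y\<close>; since \<open>M\<close> is not
    null, holding for almost every \<open>y\<close> means holding.\<close>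
  then have "(AE x in M. 0 \<le> h x) \<or> (AE x in M. h x \<le> 0)"
    using not_null by (auto elim!: eventually_mono)
  then have "AE x in M. h x = 0"
  proof
    assume "AE x in M. 0 \<le> h x"
    from integral_mult_pos(2)[OF h w_sq this] mean w_pos show ?thesis by simp
  next
    assume "AE x in M. h x \<le> 0"
    then have "AE x in M. 0 \<le> - h x" by simp
    from integral_mult_pos(2)[OF sq_integrable_uminus(1)[OF h] w_sq this] mean w_pos show ?thesis by simp
  qed
  then have "AE x in M. \<bar>h x\<bar> * w x = 0" by eventually_elim simp
  then have "wnorm h = (LINT x|M. 0)" unfolding wnorm_def
    using h by (intro integral_cong_AE) auto
  then show ?thesis by simp
qed

lemma sq_integrable_v_bound:
  assumes "g \<in> borel_measurable M" "AE x in M. \<bar>g x\<bar> \<le> L * v x"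
  shows "sq_integrable M g" "sq_norm M g \<le> sq_norm M (\<lambda>x. L * v x)"
proof -
  have le: "AE x in M. norm (g x) \<le> norm (L * v x)"
    using assms(2) by eventually_elim (simp add: abs_le_iff)
  show "sq_integrable M g" "sq_norm M g \<le> sq_norm M (\<lambda>x. L * v x)"
    by (rule sq_integrable_bound[OF sq_integrable_mult(1)[OF v_sq] assms(1) le])+
qed

text \<open>Domination by \<open>L * v\<close> is inherited by the normalised iterates and keeps
  them in a bounded set of \<open>L2\<close>. Their weighted norms decrease to some
  \<open>l\<close>. A limit \<open>h\<close> of images along a subsequence keeps mean zero and loses
  no weighted norm under one more application of \<open>T / r\<close>, so strictness forces
  \<open>h = 0\<close> and hence \<open>l = 0\<close>.\<close>

lemma mixing_bounded:
  assumes g: "g \<in> borel_measurable M" "AE x in M. \<bar>g x\<bar> \<le> L * v x" and mean: "(LINT x|M. g x * w x) = 0"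
  shows "(\<lambda>n. wnorm ((Tr ^^ n) g) / r ^ n) \<longlonglongrightarrow> 0"
proof -
  have g_sq: "sq_integrable M g" by (rule sq_integrable_v_bound[OF g])
  define a where "a n x = (1 / r ^ n) * (Tr ^^ n) g x" for n x
  have a: "sq_integrable M (a n)" for n
    unfolding a_def by (intro sq_integrable_mult Tr_pow_sq_integrable g_sq)
  have Ta: "Tr (a n) x = r * a (Suc n) x" for n x
    unfolding a_def Tr_mult by simp
  have bound: "AE x in M. \<bar>a n x\<bar> \<le> L * v x" for n
  proof (induction n)
    case 0
    show ?case using g(2) by (simp add: a_def)
  next
    case (Suc n)
    have "AE x in M. Tr (\<lambda>x. \<bar>a n x\<bar>) x \<le> Tr (\<lambda>x. L * v x) x"
      by (intro Tr_mono abs_sq_integrable a sq_integrable_mult v_sq Suc)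
    with v_eigen show ?case
    proof eventually_elim
      case (elim x)
      have "r * \<bar>a (Suc n) x\<bar> = \<bar>Tr (a n) x\<bar>" unfolding Ta by (simp add: abs_mult)
      also have "\<dots> \<le> r * (L * v x)" using Tr_abs[of "a n" x] elim by (simp add: Tr_mult mult_ac)
      finally show ?case using r_pos by simp
    qed
  qed
  have mean_a: "(LINT x|M. a n x * w x) = 0" for n
  proof (induction n)
    case (Suc n)
    have "r * (LINT x|M. a (Suc n) x * w x) = (LINT x|M. Tr (a n) x * w x)"
      unfolding Ta by (simp add: mult.assoc)
    also have "\<dots> = 0" unfolding integral_Tr_w[OF a] Suc by simp
    finally show ?case by simp
  qed (simp add: a_def mean)
  have dec: "decseq (\<lambda>n. wnorm (a n))"
  proof (rule decseq_SucI)
    fix n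
    have "r * wnorm (a (Suc n)) = wnorm (Tr (a n))" unfolding Ta wnorm_mult by simp
    also have "\<dots> \<le> r * wnorm (a n)" by (rule wnorm_Tr[OF a])
    finally show "wnorm (a (Suc n)) \<le> wnorm (a n)" using r_pos by simp
  qed
  obtain l where l: "(\<lambda>n. wnorm (a n)) \<longlonglongrightarrow> l"
    using decseq_convergent[OF dec, of 0] wnorm_nonneg by blast
  obtain h and k :: "nat \<Rightarrow> nat" where h: "sq_integrable M h" and k: "strict_mono k"
    and lim: "(\<lambda>n. sq_norm M (\<lambda>x. Tr (a (k n)) x - h x)) \<longlonglongrightarrow> 0"
    by (rule Tr_compact[of a "sq_norm M (\<lambda>x. L * v x)"])
      (auto intro: a sq_integrable_v_bound(2)[OF _ bound] sq_integrable_measurable)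
  have Tsq: "sq_integrable M (Tr (a (k n)))" for n by (intro Tr_sq_integrable a)
  \<comment> \<open>Along the subsequence, the indices shifted by one and by two lead to the same
    limit \<open>l\<close>; this turns into equality in
    \<open>wnorm (T h) \<le> r wnorm h\<close>.\<close>
  have lk: "(\<lambda>n. wnorm (a (Suc (k n)))) \<longlonglongrightarrow> l" "(\<lambda>n. wnorm (a (Suc (Suc (k n))))) \<longlonglongrightarrow> l"
    using LIMSEQ_subseq_LIMSEQ[OF LIMSEQ_Suc[OF l] k] LIMSEQ_subseq_LIMSEQ[OF LIMSEQ_Suc[OF LIMSEQ_Suc[OF l]] k]
    by (simp_all add: o_def)
  have "(\<lambda>n. wnorm (Tr (a (k n)))) \<longlonglongrightarrow> wnorm h" by (rule wnorm_limit[OF Tsq h lim])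
  moreover have "(\<lambda>n. wnorm (Tr (a (k n)))) \<longlonglongrightarrow> r * l"
    unfolding Ta wnorm_mult using lk(1) by (intro tendsto_mult) auto
  ultimately have hl: "wnorm h = r * l" by (rule LIMSEQ_unique)
  have "(\<lambda>n. wnorm (Tr (Tr (a (k n))))) \<longlonglongrightarrow> wnorm (Tr h)"
    by (rule wnorm_limit[OF Tr_sq_integrable[OF Tsq] Tr_sq_integrable[OF h] Tr_limit[OF Tsq h lim]])
  moreover have "(\<lambda>n. wnorm (Tr (Tr (a (k n))))) \<longlonglongrightarrow> r * (r * l)"
  proof -
    have e: "Tr (Tr (a (k n))) = (\<lambda>x. r * (r * a (Suc (Suc (k n))) x))" for n
      unfolding Ta[abs_def] by (simp add: fun_eq_iff Tr_mult Ta)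
    show ?thesis unfolding e wnorm_mult using lk(2) by (intro tendsto_mult) auto
  qed
  ultimately have "wnorm (Tr h) = r * (r * l)" by (rule LIMSEQ_unique)
  then have eq: "wnorm (Tr h) = r * wnorm h" unfolding hl .
  \<comment> \<open>Pairing with \<open>w\<close> is continuous in the \<open>L2\<close> norm and
    vanishes on all \<open>T (a (k n))\<close>.\<close>
  have mean_h: "(LINT x|M. h x * w x) = 0"
  proof -
    have "\<bar>LINT x|M. h x * w x\<bar> \<le> sq_norm M (\<lambda>x. Tr (a (k n)) x - h x) * sq_norm M w" for n
    proof -
      have "(LINT x|M. Tr (a (k n)) x * w x) = 0" unfolding integral_Tr_w[OF a] mean_a by simp
      then have "(LINT x|M. (Tr (a (k n)) x - h x) * w x) = - (LINT x|M. h x * w x)"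
        unfolding left_diff_distrib using mult_integrable[OF Tsq w_sq] mult_integrable[OF h w_sq] by simp
      moreover have "\<bar>LINT x|M. (Tr (a (k n)) x - h x) * w x\<bar> \<le> (LINT x|M. \<bar>(Tr (a (k n)) x - h x) * w x\<bar>)"
        by (rule integral_abs_bound)
      moreover have "(LINT x|M. \<bar>(Tr (a (k n)) x - h x) * w x\<bar>) = wnorm (\<lambda>x. Tr (a (k n)) x - h x)"
        by (simp add: wnorm_def abs_mult)
      ultimately show ?thesis
        using wnorm_le_sq_norm[OF sq_integrable_diff(1)[OF Tsq[of n] h]] by linarith
    qed
    then have "\<bar>LINT x|M. h x * w x\<bar> \<le> 0"
      using LIMSEQ_le_const[OF tendsto_mult_left_zero[OF lim, of "sq_norm M w"]] by blast
    then show ?thesis by simp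
  qed
  have "wnorm h = 0" by (rule wnorm_Tr_strict[OF h mean_h eq])
  with hl have "l = 0" by simp
  moreover have "wnorm (a n) = wnorm ((Tr ^^ n) g) / r ^ n" for n
    unfolding a_def wnorm_mult by simp
  ultimately show ?thesis using l by simp
qed

section \<open>Convergence in measure under the one-time law\<close>

definition \<pi> :: "'x measure" where
  "\<pi> = density M (\<lambda>x. ennreal (v x * w x))"

lemma sets_\<pi> [measurable_cong, simp]: "sets \<pi> = sets M" and space_\<pi> [simp]: "space \<pi> = space M"
  by (simp_all add: \<pi>_def)

lemma nn_integral_\<pi>:
  assumes [measurable]: "f \<in> borel_measurable M"
  shows "(\<integral>\<^sup>+x. f x \<partial>\<pi>) = (\<integral>\<^sup>+x. ennreal (v x * w x) * f x \<partial>M)"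
  unfolding \<pi>_def by (rule nn_integral_density) auto

lemma vw_nn: "(\<integral>\<^sup>+x. ennreal (v x * w x) \<partial>M) = 1"
proof -
  have "(\<integral>\<^sup>+x. ennreal (v x * w x) \<partial>M) = ennreal (LINT x|M. v x * w x)"
    by (intro nn_integral_eq_integral mult_integrable v_sq w_sq) auto
  then show ?thesis by (simp add: vw_integral)
qed

lemma prob_space_\<pi>: "prob_space \<pi>"
proof
  show "emeasure \<pi> (space \<pi>) = 1"
    using nn_integral_\<pi>[of "\<lambda>_. 1"] by (simp add: vw_nn)
qed

lemma nT_v: "AE y in M. nT (\<lambda>x. ennreal (v x)) y = ennreal (r * v y)"
  using nT_eq_Tr[OF v_sq vw_nonneg(1)] v_eigen by eventually_elim simp

lemma nT'_w: "AE x in M. nT' (\<lambda>y. ennreal (w y)) x = ennreal (r * w x)"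
proof -
  interpret tr: positive_kernel M "\<lambda>x y. K y x" by (rule transpose)
  have e: "tr.nT = nT'" by (simp add: fun_eq_iff tr.nT_def nT'_def)
  show ?thesis
    using tr.nT_eq_Tr[OF w_sq vw_nonneg(2)] w_eigen unfolding transpose_Tr e by eventually_elim simp
qed

lemma nT_pow_measurable: "f \<in> borel_measurable M \<Longrightarrow> (nT ^^ n) f \<in> borel_measurable M"
proof (induction n)
  case (Suc n)
  then have [measurable]: "(nT ^^ n) f \<in> borel_measurable M" by simp
  show ?case by simp
qed simp

lemma nT_w:
  assumes [measurable]: "f \<in> borel_measurable M"
  shows "(\<integral>\<^sup>+x. nT f x * ennreal (w x) \<partial>M) = ennreal r * (\<integral>\<^sup>+x. f x * ennreal (w x) \<partial>M)"
proof -
  have "(\<integral>\<^sup>+x. nT f x * ennreal (w x) \<partial>M) = (\<integral>\<^sup>+x. f x * nT' (\<lambda>y. ennreal (w y)) x \<partial>M)"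
    by (rule nT_duality) auto
  also have "\<dots> = (\<integral>\<^sup>+x. ennreal r * (f x * ennreal (w x)) \<partial>M)"
    using nT'_w by (intro nn_integral_cong_AE) (auto elim!: eventually_mono simp: ennreal_mult' mult_ac)
  also have "\<dots> = ennreal r * (\<integral>\<^sup>+x. f x * ennreal (w x) \<partial>M)"
    by (rule nn_integral_cmult) auto
  finally show ?thesis .
qed

lemma nT_pow_w:
  assumes "f \<in> borel_measurable M"
  shows "(\<integral>\<^sup>+x. (nT ^^ n) f x * ennreal (w x) \<partial>M) = ennreal (r ^ n) * (\<integral>\<^sup>+x. f x * ennreal (w x) \<partial>M)"
proof (induction n)
  case (Suc n)
  then show ?case
    using nT_w[OF nT_pow_measurable[OF assms, of n]] by (simp add: ennreal_mult' mult.assoc)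
qed simp

lemma nT_cong_AE:
  assumes "AE x in M. f x = g x"
  shows "nT f = nT g"
  unfolding nT_def fun_eq_iff using assms by (auto intro!: nn_integral_cong_AE elim!: eventually_mono)

lemma nT_add:
  assumes [measurable]: "f \<in> borel_measurable M" "g \<in> borel_measurable M"
  assumes "y \<in> space M"
  shows "nT (\<lambda>x. f x + g x) y = nT f y + nT g y"
  unfolding nT_def using assms(3) by (simp add: distrib_left nn_integral_add)

lemma nT_pow_add:
  assumes f: "f \<in> borel_measurable M" and g: "g \<in> borel_measurable M" and "y \<in> space M"
  shows "(nT ^^ n) (\<lambda>x. f x + g x) y = (nT ^^ n) f y + (nT ^^ n) g y"
  using assms(3)
proof (induction n arbitrary: y)
  case (Suc n)
  have "nT ((nT ^^ n) (\<lambda>x. f x + g x)) = nT (\<lambda>x. (nT ^^ n) f x + (nT ^^ n) g x)"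
    by (rule nT_cong_AE) (auto intro!: AE_I2 Suc.IH)
  with nT_add[OF nT_pow_measurable[OF f, of n] nT_pow_measurable[OF g, of n] Suc.prems] show ?case by simp
qed simp

lemma nT_pow_eq_Tr:
  assumes f: "sq_integrable M f" and pos: "\<And>x. 0 \<le> f x"
  shows "AE y in M. (nT ^^ n) (\<lambda>x. ennreal (f x)) y = ennreal ((Tr ^^ n) f y)"
proof (induction n)
  case (Suc n)
  have p: "0 \<le> (Tr ^^ n) f x" for x by (cases n) (auto intro: pos Tr_nonneg Tr_pow_nonneg)
  have "nT ((nT ^^ n) (\<lambda>x. ennreal (f x))) = nT (\<lambda>y. ennreal ((Tr ^^ n) f y))"
    by (rule nT_cong_AE[OF Suc])
  with nT_eq_Tr[OF Tr_pow_sq_integrable[OF f] p] show ?case by simp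
qed simp

text \<open>Subtracting the component \<open>c v\<close> leaves a function of mean zero, still
  dominated by a multiple of \<open>v\<close>, to which \<open>mixing_bounded\<close> applies; on
  \<open>v\<close> itself \<open>T\<close> acts by the factor \<open>r\<close>.\<close>

lemma nn_integral_Tr_pow_diff:
  assumes f: "f \<in> borel_measurable M" "\<And>x. 0 \<le> f x" "\<And>x. f x \<le> L * v x"
  shows "(\<lambda>n. \<integral>\<^sup>+x. ennreal (\<bar>(Tr ^^ n) f x / r ^ n - (LINT x|M. f x * w x) * v x\<bar> * w x) \<partial>M) \<longlonglongrightarrow> 0"
proof -
  have f_sq: "sq_integrable M f" using sq_integrable_v_bound(1)[OF f(1), of L] f(2,3) by simp
  define c where "c = (LINT x|M. f x * w x)"
  define g where "g x = f x - c * v x" for x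
  have [measurable]: "g \<in> borel_measurable M" unfolding g_def using f(1) by measurable
  have g_sq: "sq_integrable M g" unfolding g_def by (intro sq_integrable_diff sq_integrable_mult f_sq v_sq)
  have gb: "AE x in M. \<bar>g x\<bar> \<le> (L + \<bar>c\<bar>) * v x"
  proof (rule AE_I2)
    fix x
    have "\<bar>g x\<bar> \<le> \<bar>f x\<bar> + \<bar>c * v x\<bar>" unfolding g_def by (rule abs_triangle_ineq4)
    also have "\<dots> \<le> (L + \<bar>c\<bar>) * v x" using f(2,3)[of x] by (simp add: abs_mult distrib_right)
    finally show "\<bar>g x\<bar> \<le> (L + \<bar>c\<bar>) * v x" .
  qed
  have mean: "(LINT x|M. g x * w x) = 0"
  proof -
    have "(LINT x|M. g x * w x) = (LINT x|M. f x * w x - c * (v x * w x))"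
      unfolding g_def by (simp add: left_diff_distrib mult.assoc)
    also have "\<dots> = c - c * 1"
      using mult_integrable[OF f_sq w_sq] mult_integrable[OF v_sq w_sq] by (simp add: c_def vw_integral)
    finally show ?thesis by simp
  qed
  have Tg: "AE x in M. (Tr ^^ n) g x = (Tr ^^ n) f x - r ^ n * c * v x" for n
  proof (induction n)
    case (Suc n)
    define q where "q = r ^ n * c"
    have sq: "sq_integrable M ((Tr ^^ n) f)" "sq_integrable M (\<lambda>x. q * v x)" "sq_integrable M ((Tr ^^ n) g)"
      by (intro Tr_pow_sq_integrable sq_integrable_mult f_sq v_sq g_sq)+
    have "AE x in M. Tr ((Tr ^^ n) g) x = Tr (\<lambda>x. (Tr ^^ n) f x - q * v x) x"
      using Suc sq unfolding q_def by (intro Tr_cong_AE) auto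
    with Tr_diff[OF sq(1,2)] v_eigen show ?case
    proof eventually_elim
      case (elim x)
      then show ?case unfolding Tr_mult by (simp add: q_def mult_ac)
    qed
  qed (simp add: g_def)
  have "(\<integral>\<^sup>+x. ennreal (\<bar>(Tr ^^ n) f x / r ^ n - c * v x\<bar> * w x) \<partial>M) = ennreal (wnorm ((Tr ^^ n) g) / r ^ n)" for n
  proof -
    have "AE x in M. \<bar>(Tr ^^ n) f x / r ^ n - c * v x\<bar> * w x = \<bar>(Tr ^^ n) g x\<bar> * w x / r ^ n"
      using Tg[of n]
    proof eventually_elim
      case (elim x)
      have "(Tr ^^ n) f x / r ^ n - c * v x = (Tr ^^ n) g x / r ^ n" unfolding elim by (simp add: diff_divide_distrib)
      then show ?case by (simp add: abs_divide)
    qed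
    then have "(\<integral>\<^sup>+x. ennreal (\<bar>(Tr ^^ n) f x / r ^ n - c * v x\<bar> * w x) \<partial>M)
        = (\<integral>\<^sup>+x. ennreal (\<bar>(Tr ^^ n) g x\<bar> * w x / r ^ n) \<partial>M)"
      by (intro nn_integral_cong_AE) (auto elim!: eventually_mono)
    also have "\<dots> = ennreal (LINT x|M. \<bar>(Tr ^^ n) g x\<bar> * w x / r ^ n)"
      by (intro nn_integral_eq_integral integrable_divide wnorm_integrable Tr_pow_sq_integrable g_sq) auto
    finally show ?thesis by (simp add: wnorm_def)
  qed
  moreover have "(\<lambda>n. ennreal (wnorm ((Tr ^^ n) g) / r ^ n)) \<longlonglongrightarrow> ennreal 0"
    by (intro tendsto_ennrealI mixing_bounded[OF _ gb mean]) measurable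
  ultimately show ?thesis unfolding c_def by simp
qed

text \<open>Markov's inequality for \<open>u / v\<close>: where \<open>d v \<le> u\<close>, the
  density \<open>v w\<close> is at most \<open>u w / d\<close>. The weight \<open>w\<close> on the
  right is the one under which \<open>T / r\<close> preserves mass.\<close>

lemma emeasure_\<pi>_Markov:
  assumes [measurable]: "u \<in> borel_measurable M" and "0 < d"
  shows "emeasure \<pi> {x\<in>space M. ennreal (d * v x) \<le> u x} \<le> (\<integral>\<^sup>+x. u x * ennreal (w x) \<partial>M) / ennreal d"
proof -
  have "emeasure \<pi> {x\<in>space M. ennreal (d * v x) \<le> u x}
      = (\<integral>\<^sup>+x. ennreal (v x * w x) * indicator {x\<in>space M. ennreal (d * v x) \<le> u x} x \<partial>M)"
    unfolding \<pi>_def by (rule emeasure_density) auto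
  also have "\<dots> \<le> (\<integral>\<^sup>+x. (u x * ennreal (w x)) / ennreal d \<partial>M)"
  proof (rule nn_integral_mono)
    fix x
    have "ennreal (v x * w x) \<le> u x * ennreal (w x) / ennreal d" if le: "ennreal (d * v x) \<le> u x"
    proof -
      have "ennreal (v x * w x) = ennreal (d * v x) * ennreal (w x) / ennreal d"
        using \<open>0 < d\<close> by (simp add: ennreal_mult'[symmetric] divide_ennreal)
      also have "\<dots> \<le> u x * ennreal (w x) / ennreal d"
        by (intro divide_right_mono_ennreal mult_right_mono le) auto
      finally show ?thesis .
    qed
    then show "ennreal (v x * w x) * indicator {x\<in>space M. ennreal (d * v x) \<le> u x} x \<le> u x * ennreal (w x) / ennreal d"
      by (auto simp: indicator_def)
  qed
  also have "\<dots> = (\<integral>\<^sup>+x. u x * ennreal (w x) \<partial>M) / ennreal d"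
    by (intro nn_integral_divide) auto
  finally show ?thesis .
qed

text \<open>Truncating \<open>f\<close> at \<open>L v\<close> reduces the claim to functions dominated by \<open>v\<close>; the remainder has small
  \<open>w\<close>-mass, which \<open>T / r\<close> preserves.\<close>

theorem mixing:
  assumes f[measurable]: "f \<in> borel_measurable M" and f0: "\<And>x. 0 \<le> f x" and c: "0 < c"
    and fw: "(\<integral>\<^sup>+x. ennreal (f x * w x) \<partial>M) = ennreal c" and d: "0 < d"
  shows "(\<lambda>n. emeasure \<pi> {x\<in>space M. \<not> (ennreal ((c - d) * r ^ n * v x) \<le> (nT ^^ n) (\<lambda>x. ennreal (f x)) x \<and>
      (nT ^^ n) (\<lambda>x. ennreal (f x)) x \<le> ennreal ((c + d) * r ^ n * v x))}) \<longlonglongrightarrow> 0"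
    (is "(\<lambda>n. emeasure \<pi> (?B n)) \<longlonglongrightarrow> 0")
proof -
  have pi: "finite_measure \<pi>" using prob_space_\<pi> by (simp add: prob_space_def)
  define fL where "fL L x = min (f x) (real L * v x)" for L x
  define gL where "gL L x = f x - fL L x" for L x
  have [measurable]: "fL L \<in> borel_measurable M" "gL L \<in> borel_measurable M" for L
    unfolding fL_def gL_def by measurable
  have fL: "0 \<le> fL L x" "fL L x \<le> real L * v x" "fL L x \<le> f x" "0 \<le> gL L x" for L x
    unfolding fL_def gL_def using f0[of x] by auto
  have fL_sq: "sq_integrable M (fL L)" for L
    using sq_integrable_v_bound(1)[of "fL L" "real L"] fL by simp
  define cL where "cL L = (LINT x|M. fL L x * w x)" for L
  have fLw: "(\<integral>\<^sup>+x. ennreal (fL L x * w x) \<partial>M) = ennreal (cL L)" for L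
    unfolding cL_def by (intro nn_integral_eq_integral mult_integrable fL_sq w_sq) (auto simp: fL)
  have intf: "integrable M (\<lambda>x. f x * w x)" "(LINT x|M. f x * w x) = c"
  proof -
    show *: "integrable M (\<lambda>x. f x * w x)" by (rule integrableI_nn_integral_finite[OF _ _ fw]) (auto simp: f0)
    show "(LINT x|M. f x * w x) = c"
      using fw c by (subst (asm) nn_integral_eq_integral[OF *]) (auto simp: f0 intro!: integral_nonneg_AE)
  qed
  have cL_lim: "cL \<longlonglongrightarrow> c"
    unfolding cL_def intf(2)[symmetric]
  proof (rule integral_dominated_convergence[where w="\<lambda>x. f x * w x"])
    show "AE x in M. (\<lambda>L. fL L x * w x) \<longlonglongrightarrow> f x * w x"
    proof (rule AE_I2)
      fix x
      obtain N :: nat where N: "f x / v x \<le> real N" using real_arch_simple by blast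
      have "fL L x = f x" if "L \<ge> N" for L
      proof -
        have "f x \<le> real N * v x" using N v_pos[of x] by (simp add: pos_divide_le_eq)
        also have "\<dots> \<le> real L * v x" using that by (intro mult_right_mono) auto
        finally show ?thesis unfolding fL_def by simp
      qed
      then have "\<forall>\<^sub>F L in sequentially. f x * w x = fL L x * w x"
        by (intro eventually_sequentiallyI[of N]) simp
      then show "(\<lambda>L. fL L x * w x) \<longlonglongrightarrow> f x * w x"
        by (rule Lim_transform_eventually[OF tendsto_const])
    qed
    show "AE x in M. norm (fL L x * w x) \<le> f x * w x" for L
      using fL by (intro AE_I2) (simp add: abs_mult mult_right_mono)
  qed (use intf in auto)
  have cL_le: "cL L \<le> c" for L
    unfolding cL_def intf(2)[symmetric]
    by (intro integral_mono mult_integrable fL_sq w_sq intf mult_right_mono fL) auto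
  have gLw: "(\<integral>\<^sup>+x. ennreal (gL L x) * ennreal (w x) \<partial>M) = ennreal (c - cL L)" for L
  proof -
    have "(\<integral>\<^sup>+x. ennreal (gL L x) * ennreal (w x) \<partial>M) = (\<integral>\<^sup>+x. ennreal (f x * w x - fL L x * w x) \<partial>M)"
      using fL(4)[of L] by (simp add: ennreal_mult'[symmetric] gL_def left_diff_distrib)
    also have "\<dots> = ennreal (LINT x|M. f x * w x - fL L x * w x)"
      using intf(1) mult_integrable[OF fL_sq w_sq, of L]
      by (intro nn_integral_eq_integral Bochner_Integration.integrable_diff) (auto intro!: mult_right_mono fL)
    finally show ?thesis
      using intf mult_integrable[OF fL_sq w_sq, of L] by (simp add: cL_def)
  qed
  define E where "E L n = (\<integral>\<^sup>+x. ennreal (\<bar>(Tr ^^ n) (fL L) x / r ^ n - cL L * v x\<bar> * w x) \<partial>M)" for L n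
  have E_lim: "E L \<longlonglongrightarrow> 0" for L
    unfolding E_def cL_def by (intro nn_integral_Tr_pow_diff[where L="real L"]) (auto simp: fL)
  have bound: "emeasure \<pi> (?B n) \<le> E L n / ennreal (d/3) + ennreal (c - cL L) / ennreal (d/3)" if L: "c - cL L < d/3" for L n
  proof -
    define u1 where "u1 x = ennreal \<bar>(Tr ^^ n) (fL L) x / r ^ n - cL L * v x\<bar>" for x
    define u2 where "u2 x = (nT ^^ n) (\<lambda>x. ennreal (gL L x)) x / ennreal (r ^ n)" for x
    have Tm[measurable]: "(Tr ^^ n) (fL L) \<in> borel_measurable M" using Tr_pow_sq_integrable[OF fL_sq, of n] by auto
    have Nm[measurable]: "(nT ^^ n) (\<lambda>x. ennreal (gL L x)) \<in> borel_measurable M" "(nT ^^ n) (\<lambda>x. ennreal (f x)) \<in> borel_measurable M"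
      by (intro nT_pow_measurable; measurable)+
    have [measurable]: "u1 \<in> borel_measurable M" "u2 \<in> borel_measurable M" unfolding u1_def u2_def by measurable
    \<comment> \<open>A deviation beyond \<open>d * v\<close> has three possible sources, each
      granted a third: the truncated part (\<open>?B1\<close>), the remainder (\<open>?B2\<close>),
      and the gap \<open>c - cL L\<close> between the means, which is below \<open>d/3\<close> by
      assumption.\<close>
    let ?B1 = "{x\<in>space M. ennreal (d/3 * v x) \<le> u1 x}" and ?B2 = "{x\<in>space M. ennreal (d/3 * v x) \<le> u2 x}"
    have sub: "AE x in M. x \<in> ?B n \<longrightarrow> x \<in> ?B1 \<union> ?B2"
      using nT_pow_eq_Tr[OF fL_sq fL(1), of n L] AE_space
    proof eventually_elim
      case (elim x)
      have "(nT ^^ n) (\<lambda>x. ennreal (f x)) x = (nT ^^ n) (\<lambda>x. ennreal (fL L x) + ennreal (gL L x)) x"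
        using fL[of L] by (simp add: ennreal_plus[symmetric] gL_def del: ennreal_plus)
      also have "\<dots> = ennreal ((Tr ^^ n) (fL L) x) + (nT ^^ n) (\<lambda>x. ennreal (gL L x)) x"
        using elim by (subst nT_pow_add) auto
      finally have dec: "(nT ^^ n) (\<lambda>x. ennreal (f x)) x = ennreal ((Tr ^^ n) (fL L) x) + (nT ^^ n) (\<lambda>x. ennreal (gL L x)) x" .
      show ?case
      proof (intro impI, rule ccontr)
        assume B: "x \<in> ?B n" and nB: "x \<notin> ?B1 \<union> ?B2"
        have s1: "\<bar>(Tr ^^ n) (fL L) x / r ^ n - cL L * v x\<bar> < d/3 * v x" using nB elim(2) by (auto simp: u1_def not_le)
        have s2: "u2 x < ennreal (d/3 * v x)" using nB elim(2) by auto
        then obtain y where y: "(nT ^^ n) (\<lambda>x. ennreal (gL L x)) x = ennreal y" "0 \<le> y"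
          unfolding u2_def by (cases "(nT ^^ n) (\<lambda>x. ennreal (gL L x)) x") (auto simp: ennreal_top_divide)
        have s3: "y / r ^ n < d/3 * v x" using s2 y unfolding u2_def by (simp add: divide_ennreal r_pos ennreal_less_iff)
        define t where "t = (Tr ^^ n) (fL L) x / r ^ n"
        have t0: "0 \<le> (Tr ^^ n) (fL L) x" by (cases n) (auto intro: fL Tr_nonneg Tr_pow_nonneg)
        have tt: "(Tr ^^ n) (fL L) x = t * r ^ n" unfolding t_def by simp
        have yy: "y = (y / r ^ n) * r ^ n" by simp
        have dec': "(nT ^^ n) (\<lambda>x. ennreal (f x)) x = ennreal ((t + y / r ^ n) * r ^ n)"
          unfolding dec y using t0 y(2) by (simp add: ennreal_plus[symmetric] distrib_right tt del: ennreal_plus)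
        have cv: "(c - d/3) * v x \<le> cL L * v x" "cL L * v x \<le> c * v x"
          using L cL_le[of L] by (intro mult_right_mono; simp)+
        have yr: "0 \<le> y / r ^ n" using y(2) by simp
        have s1': "- (d/3 * v x) < t - cL L * v x" "t - cL L * v x < d/3 * v x"
          using s1 unfolding t_def[symmetric] by linarith+
        have dv: "0 \<le> d * v x" using d by simp
        have b1: "(c - d) * v x \<le> t + y / r ^ n"
          using s1' yr cv(1) dv unfolding left_diff_distrib by simp
        have b2: "t + y / r ^ n \<le> (c + d) * v x"
          using s1' s3 cv(2) dv unfolding distrib_right by simp
        have "(c - d) * r ^ n * v x \<le> (t + y / r ^ n) * r ^ n" "(t + y / r ^ n) * r ^ n \<le> (c + d) * r ^ n * v x"
          using mult_right_mono[OF b1, of "r ^ n"] mult_right_mono[OF b2, of "r ^ n"] by (simp_all add: mult_ac)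
        then have "ennreal ((c - d) * r ^ n * v x) \<le> (nT ^^ n) (\<lambda>x. ennreal (f x)) x"
          "(nT ^^ n) (\<lambda>x. ennreal (f x)) x \<le> ennreal ((c + d) * r ^ n * v x)"
          unfolding dec' by (simp_all only: ennreal_leI)
        with B show False by simp
      qed
    qed
    have "emeasure \<pi> (?B n) \<le> emeasure \<pi> (?B1 \<union> ?B2)"
    proof (rule emeasure_mono_AE)
      have "absolutely_continuous M \<pi>" unfolding \<pi>_def by (rule absolutely_continuousI_density) auto
      from absolutely_continuous_AE[OF _ this sub] show "AE x in \<pi>. x \<in> ?B n \<longrightarrow> x \<in> ?B1 \<union> ?B2" by simp
    qed measurable
    also have "\<dots> \<le> emeasure \<pi> ?B1 + emeasure \<pi> ?B2"
      by (rule emeasure_subadditive) measurable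
    also have "\<dots> \<le> (\<integral>\<^sup>+x. u1 x * ennreal (w x) \<partial>M) / ennreal (d/3) + (\<integral>\<^sup>+x. u2 x * ennreal (w x) \<partial>M) / ennreal (d/3)"
      using d by (intro add_mono emeasure_\<pi>_Markov) auto
    also have "(\<integral>\<^sup>+x. u1 x * ennreal (w x) \<partial>M) = E L n"
      unfolding E_def u1_def by (simp add: ennreal_mult')
    also have "(\<integral>\<^sup>+x. u2 x * ennreal (w x) \<partial>M) = ennreal (c - cL L)"
    proof -
      have "(\<integral>\<^sup>+x. u2 x * ennreal (w x) \<partial>M) = (\<integral>\<^sup>+x. ((nT ^^ n) (\<lambda>x. ennreal (gL L x)) x * ennreal (w x)) / ennreal (r ^ n) \<partial>M)"
        unfolding u2_def by (simp add: divide_ennreal_def mult_ac)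
      also have "\<dots> = ennreal (r ^ n) * ennreal (c - cL L) / ennreal (r ^ n)"
        by (subst nn_integral_divide) (auto simp: nT_pow_w gLw)
      also have "\<dots> = ennreal (c - cL L)"
        using r_pos cL_le[of L] by (simp add: ennreal_mult'[symmetric] divide_ennreal)
      finally show ?thesis .
    qed
    finally show ?thesis .
  qed
  show ?thesis
  proof (rule order_tendstoI)
    fix a :: ennreal assume "0 < a"
    then obtain b where b: "0 < b" "b < a" using dense by blast
    then obtain e where e: "0 < e" "ennreal e < a" by (cases b) auto
    have "(\<lambda>L. c - cL L) \<longlonglongrightarrow> c - c" by (intro tendsto_intros cL_lim)
    then have "(\<lambda>L. c - cL L) \<longlonglongrightarrow> 0" by simp
    \<comment> \<open>The first bound is the premise of \<open>bound\<close>; the second makes the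
      remainder contribute at most \<open>e/2\<close> after division by \<open>d/3\<close>. The
      level \<open>L\<close> is fixed before \<open>n\<close> grows.\<close>
    then have "\<forall>\<^sub>F L in sequentially. c - cL L < min (d/3) (e * (d/3) / 2)"
      by (rule order_tendstoD) (use d e in auto)
    then obtain L where L: "c - cL L < d/3" "c - cL L < e * (d/3) / 2"
      by (auto simp: eventually_sequentially)
    have "\<forall>\<^sub>F n in sequentially. E L n < ennreal (e/2 * (d/3))"
      by (rule order_tendstoD[OF E_lim]) (use e d in auto)
    then show "\<forall>\<^sub>F n in sequentially. emeasure \<pi> (?B n) < a"
    proof eventually_elim
      case (elim n)
      have "emeasure \<pi> (?B n) \<le> E L n / ennreal (d/3) + ennreal (c - cL L) / ennreal (d/3)" by (rule bound[OF L(1)])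
      also have "\<dots> \<le> ennreal (e/2) + ennreal (e/2)"
      proof (rule add_mono)
        have "ennreal (c - cL L) / ennreal (d/3) = ennreal ((c - cL L) / (d/3))"
          using cL_le[of L] d by (simp add: divide_ennreal)
        also have "\<dots> \<le> ennreal (e/2)"
        proof (rule ennreal_leI)
          have "(c - cL L) / (d/3) \<le> (e * (d/3) / 2) / (d/3)" using L(2) d by (intro divide_right_mono) auto
          then show "(c - cL L) / (d/3) \<le> e/2" using d by simp
        qed
        finally show "ennreal (c - cL L) / ennreal (d/3) \<le> ennreal (e/2)" .
      next
        have "E L n / ennreal (d/3) \<le> ennreal (e/2 * (d/3)) / ennreal (d/3)"
          using elim by (intro divide_right_mono_ennreal) simp
        also have "\<dots> = ennreal (e/2)" using d e by (simp add: divide_ennreal)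
        finally show "E L n / ennreal (d/3) \<le> ennreal (e/2)" .
      qed
      also have "\<dots> = ennreal e" using e by (simp add: ennreal_plus[symmetric] del: ennreal_plus)
      finally show ?case using e(2) by simp
    qed
  qed simp
qed

end

section \<open>The stationary chain\<close>

text \<open>Renaming of indices in a product of copies of one measure. It serves for shifting a
  window in time and for passing from a window of integers to the index set \<open>{1..n}\<close> of
  naturals.\<close>

lemma distr_PiM_bij:
  fixes f :: "'i \<Rightarrow> 'j"
  assumes sf: "sigma_finite_measure M" and I: "finite I" and f: "bij_betw f I J"
  shows "distr (PiM J (\<lambda>_. M)) (PiM I (\<lambda>_. M)) (\<lambda>x. \<lambda>i\<in>I. x (f i)) = PiM I (\<lambda>_. M)"
proof -
  interpret I: product_sigma_finite "\<lambda>_::'i. M" by (rule product_sigma_finite.intro) (rule sf)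
  interpret J: product_sigma_finite "\<lambda>_::'j. M" by (rule product_sigma_finite.intro) (rule sf)
  have J: "finite J" using I f bij_betw_finite by blast
  have fI: "f i \<in> J" if "i \<in> I" for i using f that by (auto simp: bij_betw_def)
  have m: "(\<lambda>x. \<lambda>i\<in>I. x (f i)) \<in> measurable (PiM J (\<lambda>_. M)) (PiM I (\<lambda>_. M))"
    by (intro measurable_restrict measurable_component_singleton fI)
  show ?thesis
  proof (rule I.PiM_eqI[OF I])
    fix A assume A: "\<And>i. i \<in> I \<Longrightarrow> A i \<in> sets M"
    define g where "g = the_inv_into I f"
    have gf: "g (f i) = i" if "i \<in> I" for i unfolding g_def using f that by (auto simp: bij_betw_def the_inv_into_f_f)
    have gJ: "g j \<in> I" "f (g j) = j" if "j \<in> J" for j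
      unfolding g_def using f that by (auto simp: bij_betw_def the_inv_into_into f_the_inv_into_f)
    have Ag: "A (g j) \<in> sets M" if "j \<in> J" for j using A gJ that by auto
    have "(\<lambda>x. \<lambda>i\<in>I. x (f i)) -` Pi\<^sub>E I A \<inter> space (PiM J (\<lambda>_. M)) = Pi\<^sub>E J (\<lambda>j. A (g j))"
    proof (intro set_eqI iffI)
      fix x assume x: "x \<in> (\<lambda>x. \<lambda>i\<in>I. x (f i)) -` Pi\<^sub>E I A \<inter> space (PiM J (\<lambda>_. M))"
      have "x j \<in> A (g j)" if "j \<in> J" for j
        using x gJ[OF that] by (auto simp: PiE_iff)
      then show "x \<in> Pi\<^sub>E J (\<lambda>j. A (g j))" using x by (auto simp: space_PiM PiE_iff)
    next
      fix x assume x: "x \<in> Pi\<^sub>E J (\<lambda>j. A (g j))"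
      then have "x \<in> space (PiM J (\<lambda>_. M))"
        using sets.sets_into_space[OF Ag] by (auto simp: space_PiM PiE_iff)
      then show "x \<in> (\<lambda>x. \<lambda>i\<in>I. x (f i)) -` Pi\<^sub>E I A \<inter> space (PiM J (\<lambda>_. M))"
        using x fI gf by (fastforce simp: PiE_iff)
    qed
    then have "emeasure (distr (PiM J (\<lambda>_. M)) (PiM I (\<lambda>_. M)) (\<lambda>x. \<lambda>i\<in>I. x (f i))) (Pi\<^sub>E I A)
      = emeasure (PiM J (\<lambda>_. M)) (Pi\<^sub>E J (\<lambda>j. A (g j)))"
      using A I by (subst emeasure_distr[OF m]) (auto intro!: sets_PiM_I_finite)
    also have "\<dots> = (\<Prod>j\<in>J. emeasure M (A (g j)))" by (rule J.emeasure_PiM[OF J Ag])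
    also have "\<dots> = (\<Prod>i\<in>I. emeasure M (A i))"
      using prod.reindex_bij_betw[OF f, of "\<lambda>j. emeasure M (A (g j))"] gf by simp
    finally show "emeasure (distr (PiM J (\<lambda>_. M)) (PiM I (\<lambda>_. M)) (\<lambda>x. \<lambda>i\<in>I. x (f i))) (Pi\<^sub>E I A)
      = (\<Prod>i\<in>I. emeasure M (A i))" .
  qed simp
qed

section \<open>Path integrals over windows of time\<close>

context positive_kernel
begin

sublocale P: product_sigma_finite "\<lambda>_::int. M"
  by standard

text \<open>Each step is indexed by its right end, so the weight from \<open>a\<close> to
  \<open>b\<close> has \<open>b - a\<close> factors and is 1 for a single site.\<close>

definition path_weight :: "int \<Rightarrow> int \<Rightarrow> (int \<Rightarrow> 'x) \<Rightarrow> real" where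
  "path_weight a b x = (\<Prod>t\<in>{a+1..b}. K (x (t - 1)) (x t))"

lemma path_weight_pos: "0 < path_weight a b x"
  unfolding path_weight_def by (intro prod_pos) (simp add: K_pos)

lemma path_weight_nonneg [simp]: "0 \<le> path_weight a b x" "path_weight a b x \<noteq> 0"
  using path_weight_pos[of a b x] by simp_all

lemma path_weight_same [simp]: "path_weight a a x = 1"
  by (simp add: path_weight_def)

lemma path_weight_left:
  assumes "a < b"
  shows "path_weight a b x = K (x a) (x (a + 1)) * path_weight (a + 1) b x"
proof -
  have "{a+1..b} = insert (a+1) {a+1+1..b}" using assms by auto
  then show ?thesis by (simp add: path_weight_def)
qed

lemma path_weight_right:
  assumes "a \<le> b"
  shows "path_weight a (b + 1) x = path_weight a b x * K (x b) (x (b + 1))"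
proof -
  have "{a+1..b+1} = insert (b+1) {a+1..b}" using assms by auto
  then show ?thesis by (simp add: path_weight_def mult.commute)
qed

lemma path_weight_cong:
  assumes "\<And>t. a \<le> t \<Longrightarrow> t \<le> b \<Longrightarrow> x t = y t"
  shows "path_weight a b x = path_weight a b y"
  unfolding path_weight_def using assms by (intro prod.cong) auto

lemma path_weight_split:
  assumes "a \<le> c" "c \<le> b"
  shows "path_weight a b x = path_weight a c x * path_weight c b x"
proof -
  have "{a+1..b} = {a+1..c} \<union> {c+1..b}" "{a+1..c} \<inter> {c+1..b} = {}" using assms by auto
  then show ?thesis unfolding path_weight_def by (simp add: prod.union_disjoint)
qed

lemma path_weight_measurable [measurable (raw)]:
  assumes [measurable]: "\<And>t. a \<le> t \<Longrightarrow> t \<le> b \<Longrightarrow> (\<lambda>z. f z t) \<in> measurable N M"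
  shows "(\<lambda>z. path_weight a b (f z)) \<in> borel_measurable N"
  unfolding path_weight_def
proof (rule borel_measurable_prod)
  fix t assume "t \<in> {a+1..b}"
  then have [measurable]: "(\<lambda>z. f z (t - 1)) \<in> measurable N M" "(\<lambda>z. f z t) \<in> measurable N M" by auto
  show "(\<lambda>z. K (f z (t - 1)) (f z t)) \<in> borel_measurable N" by measurable
qed

text \<open>The leftmost coordinate enters only through \<open>k\<close> and the first kernel
  factor, so integrating it out replaces \<open>k\<close> by \<open>nT k\<close> one site further to
  the right. Iterating gives \<open>path_left\<close>.\<close>

lemma path_left_step:
  assumes ab: "a < b" and k[measurable]: "k \<in> borel_measurable M"
    and phi[measurable]: "\<phi> \<in> borel_measurable (PiM {a+1..b} (\<lambda>_. M))"
  shows "(\<integral>\<^sup>+x. k (x a) * ennreal (path_weight a b x) * \<phi> (restrict x {a+1..b}) \<partial>PiM {a..b} (\<lambda>_. M))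
    = (\<integral>\<^sup>+x. nT k (x (a+1)) * ennreal (path_weight (a+1) b x) * \<phi> x \<partial>PiM {a+1..b} (\<lambda>_. M))"
proof -
  have ins: "{a..b} = insert a {a+1..b}" using ab by auto
  have mem: "a \<in> {a..b}" "a + 1 \<in> {a+1..b}" "{a+1..b} \<subseteq> {a..b}" using ab by auto
  have [measurable]: "(\<lambda>x. restrict x {a+1..b}) \<in> measurable (PiM {a..b} (\<lambda>_. M)) (PiM {a+1..b} (\<lambda>_. M))"
    by (rule measurable_restrict_subset[OF mem(3)])
  have meas: "(\<lambda>x. k (x a) * ennreal (path_weight a b x) * \<phi> (restrict x {a+1..b})) \<in> borel_measurable (PiM (insert a {a+1..b}) (\<lambda>_. M))"
    unfolding ins[symmetric] using mem(1) by measurable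
  show ?thesis
    unfolding ins
  proof (subst P.product_nn_integral_insert[OF _ _ meas], simp, simp, rule nn_integral_cong)
    fix x assume x: "x \<in> space (PiM {a+1..b} (\<lambda>_. M))"
    have [measurable]: "x (a+1) \<in> space M" using x mem(2) by (auto simp: space_PiM)
    have e: "k ((x(a := y)) a) * ennreal (path_weight a b (x(a := y))) * \<phi> (restrict (x(a := y)) {a+1..b})
       = ennreal (K y (x (a+1))) * k y * (ennreal (path_weight (a+1) b x) * \<phi> x)" for y
    proof -
      have r1: "restrict (x(a := y)) {a+1..b} = x"
        using x by (auto simp: space_PiM PiE_iff extensional_def restrict_def)
      have "path_weight (a+1) b (x(a := y)) = path_weight (a+1) b x" by (rule path_weight_cong) auto
      then show ?thesis unfolding r1 path_weight_left[OF ab] by (simp add: ennreal_mult' mult_ac)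
    qed
    have "(\<integral>\<^sup>+y. k ((x(a := y)) a) * ennreal (path_weight a b (x(a := y))) * \<phi> (restrict (x(a := y)) {a+1..b}) \<partial>M)
      = nT k (x (a+1)) * (ennreal (path_weight (a+1) b x) * \<phi> x)"
      unfolding e nT_def by (rule nn_integral_multc) measurable
    then show "(\<integral>\<^sup>+y. k ((x(a := y)) a) * ennreal (path_weight a b (x(a := y))) * \<phi> (restrict (x(a := y)) {a+1..b}) \<partial>M)
      = nT k (x (a+1)) * ennreal (path_weight (a+1) b x) * \<phi> x" by (simp add: mult.assoc)
  qed
qed

lemma path_left:
  assumes ab: "a \<le> b" and k: "k \<in> borel_measurable M"
    and phi: "\<phi> \<in> borel_measurable (PiM {a..b} (\<lambda>_. M))"
  shows "(\<integral>\<^sup>+x. k (x (a - int n)) * ennreal (path_weight (a - int n) b x) * \<phi> (restrict x {a..b}) \<partial>PiM {a - int n..b} (\<lambda>_. M))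
    = (\<integral>\<^sup>+x. (nT ^^ n) k (x a) * ennreal (path_weight a b x) * \<phi> x \<partial>PiM {a..b} (\<lambda>_. M))"
  using k
proof (induction n arbitrary: k)
  case 0
  have rs: "restrict x {a..b} = x" if "x \<in> space (PiM {a..b} (\<lambda>_. M))" for x
    using that by (auto simp: space_PiM PiE_iff extensional_restrict)
  show ?case
    unfolding of_nat_0 diff_0_right add_0_right funpow_0 by (intro nn_integral_cong) (simp only: rs)
next
  case (Suc n)
  define c where "c = a - int (Suc n)"
  have c: "c < b" "c + 1 = a - int n" unfolding c_def using ab by auto
  have sub: "{a..b} \<subseteq> {c+1..b}" unfolding c by auto
  have rr: "restrict (restrict x {c+1..b}) {a..b} = restrict x {a..b}" for x :: "int \<Rightarrow> 'x"
    unfolding restrict_restrict Int_absorb1[OF sub] ..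
  have "(\<integral>\<^sup>+x. k (x c) * ennreal (path_weight c b x) * \<phi> (restrict x {a..b}) \<partial>PiM {c..b} (\<lambda>_. M))
    = (\<integral>\<^sup>+x. k (x c) * ennreal (path_weight c b x) * (\<lambda>x. \<phi> (restrict x {a..b})) (restrict x {c+1..b}) \<partial>PiM {c..b} (\<lambda>_. M))"
    by (simp only: rr)
  also have "\<dots> = (\<integral>\<^sup>+x. nT k (x (c+1)) * ennreal (path_weight (c+1) b x) * \<phi> (restrict x {a..b}) \<partial>PiM {c+1..b} (\<lambda>_. M))"
    by (rule path_left_step[OF c(1) Suc.prems measurable_compose[OF measurable_restrict_subset[OF sub] phi]])
  also have "\<dots> = (\<integral>\<^sup>+x. (nT ^^ n) (nT k) (x a) * ennreal (path_weight a b x) * \<phi> x \<partial>PiM {a..b} (\<lambda>_. M))"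
    unfolding c(2) by (rule Suc.IH) (use Suc.prems in measurable)
  finally show ?case unfolding c_def funpow_Suc_right by (simp only: o_apply)
qed

lemma path_right_step:
  assumes ab: "a \<le> b" and k[measurable]: "k \<in> borel_measurable M"
    and phi[measurable]: "\<phi> \<in> borel_measurable (PiM {a..b} (\<lambda>_. M))"
  shows "(\<integral>\<^sup>+x. k (x (b+1)) * ennreal (path_weight a (b+1) x) * \<phi> (restrict x {a..b}) \<partial>PiM {a..b+1} (\<lambda>_. M))
    = (\<integral>\<^sup>+x. nT' k (x b) * ennreal (path_weight a b x) * \<phi> x \<partial>PiM {a..b} (\<lambda>_. M))"
proof -
  have ins: "{a..b+1} = insert (b+1) {a..b}" using ab by auto
  have mem: "b+1 \<in> {a..b+1}" "b \<in> {a..b}" "{a..b} \<subseteq> {a..b+1}" using ab by auto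
  have [measurable]: "(\<lambda>x. restrict x {a..b}) \<in> measurable (PiM {a..b+1} (\<lambda>_. M)) (PiM {a..b} (\<lambda>_. M))"
    by (rule measurable_restrict_subset[OF mem(3)])
  have meas: "(\<lambda>x. k (x (b+1)) * ennreal (path_weight a (b+1) x) * \<phi> (restrict x {a..b})) \<in> borel_measurable (PiM (insert (b+1) {a..b}) (\<lambda>_. M))"
    unfolding ins[symmetric] using mem(1) by measurable
  show ?thesis
    unfolding ins
  proof (subst P.product_nn_integral_insert[OF _ _ meas], simp, simp, rule nn_integral_cong)
    fix x assume x: "x \<in> space (PiM {a..b} (\<lambda>_. M))"
    have [measurable]: "x b \<in> space M" using x mem(2) by (auto simp: space_PiM)
    let ?u = "\<lambda>y. x(b+1 := y)"
    have e: "k (?u y (b+1)) * ennreal (path_weight a (b+1) (?u y)) * \<phi> (restrict (?u y) {a..b})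
       = ennreal (K (x b) y) * k y * (ennreal (path_weight a b x) * \<phi> x)" for y
    proof -
      have r1: "restrict (?u y) {a..b} = x"
        using x by (auto simp: space_PiM PiE_iff extensional_def restrict_def)
      have "path_weight a b (?u y) = path_weight a b x" by (rule path_weight_cong) auto
      then show ?thesis unfolding r1 path_weight_right[OF ab] by (simp add: ennreal_mult' mult_ac)
    qed
    have "(\<integral>\<^sup>+y. k (?u y (b+1)) * ennreal (path_weight a (b+1) (?u y)) * \<phi> (restrict (?u y) {a..b}) \<partial>M)
      = nT' k (x b) * (ennreal (path_weight a b x) * \<phi> x)"
      unfolding e nT'_def by (rule nn_integral_multc) measurable
    then show "(\<integral>\<^sup>+y. k (?u y (b+1)) * ennreal (path_weight a (b+1) (?u y)) * \<phi> (restrict (?u y) {a..b}) \<partial>M)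
      = nT' k (x b) * ennreal (path_weight a b x) * \<phi> x" by (simp add: mult.assoc)
  qed
qed

lemma path_right:
  assumes ab: "a \<le> b" and k: "k \<in> borel_measurable M"
    and phi: "\<phi> \<in> borel_measurable (PiM {a..b} (\<lambda>_. M))"
  shows "(\<integral>\<^sup>+x. k (x (b + int n)) * ennreal (path_weight a (b + int n) x) * \<phi> (restrict x {a..b}) \<partial>PiM {a..b + int n} (\<lambda>_. M))
    = (\<integral>\<^sup>+x. (nT' ^^ n) k (x b) * ennreal (path_weight a b x) * \<phi> x \<partial>PiM {a..b} (\<lambda>_. M))"
  using k
proof (induction n arbitrary: k)
  case 0
  have rs: "restrict x {a..b} = x" if "x \<in> space (PiM {a..b} (\<lambda>_. M))" for x
    using that by (auto simp: space_PiM PiE_iff extensional_restrict)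
  show ?case
    unfolding of_nat_0 diff_0_right add_0_right funpow_0 by (intro nn_integral_cong) (simp only: rs)
next
  case (Suc n)
  define c where "c = b + int n"
  have c: "a \<le> c" "c + 1 = b + int (Suc n)" unfolding c_def using ab by auto
  have sub: "{a..b} \<subseteq> {a..c}" unfolding c_def by auto
  have rr: "restrict (restrict x {a..c}) {a..b} = restrict x {a..b}" for x :: "int \<Rightarrow> 'x"
    unfolding restrict_restrict Int_absorb1[OF sub] ..
  have "(\<integral>\<^sup>+x. k (x (c+1)) * ennreal (path_weight a (c+1) x) * \<phi> (restrict x {a..b}) \<partial>PiM {a..c+1} (\<lambda>_. M))
    = (\<integral>\<^sup>+x. k (x (c+1)) * ennreal (path_weight a (c+1) x) * (\<lambda>x. \<phi> (restrict x {a..b})) (restrict x {a..c}) \<partial>PiM {a..c+1} (\<lambda>_. M))"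
    by (simp only: rr)
  also have "\<dots> = (\<integral>\<^sup>+x. nT' k (x c) * ennreal (path_weight a c x) * \<phi> (restrict x {a..b}) \<partial>PiM {a..c} (\<lambda>_. M))"
    by (rule path_right_step[OF c(1) Suc.prems measurable_compose[OF measurable_restrict_subset[OF sub] phi]])
  also have "\<dots> = (\<integral>\<^sup>+x. (nT' ^^ n) (nT' k) (x b) * ennreal (path_weight a b x) * \<phi> x \<partial>PiM {a..b} (\<lambda>_. M))"
    unfolding c_def by (rule Suc.IH) (use Suc.prems in measurable)
  finally show ?case unfolding c(2) funpow_Suc_right by (simp only: o_apply)
qed

end

section \<open>Consistent window laws and their extension to all times\<close>

context principal_pair
begin

text \<open>The power of \<open>r\<close> counts the kernel factors: each end coordinate integrated
  out releases one factor \<open>r\<close>, which is what makes these measures consistent.\<close>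

definition chain :: "int \<Rightarrow> int \<Rightarrow> (int \<Rightarrow> 'x) measure" where
  "chain a b = density (PiM {a..b} (\<lambda>_. M))
     (\<lambda>x. ennreal (v (x a) * path_weight a b x * w (x b) / r ^ nat (b - a)))"

lemma sets_chain [measurable_cong, simp]: "sets (chain a b) = sets (PiM {a..b} (\<lambda>_. M))"
  and space_chain [simp]: "space (chain a b) = space (PiM {a..b} (\<lambda>_. M))"
  by (simp_all add: chain_def)

lemma chain_density_measurable [measurable]:
  assumes "a \<le> b"
  shows "(\<lambda>x. v (x a) * path_weight a b x * w (x b) / r ^ nat (b - a)) \<in> borel_measurable (PiM {a..b} (\<lambda>_. M))"
proof -
  have mem: "a \<in> {a..b}" "b \<in> {a..b}" using assms by auto
  show ?thesis using mem by measurable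
qed

lemma nn_integral_chain:
  assumes ab: "a \<le> b" and [measurable]: "\<phi> \<in> borel_measurable (PiM {a..b} (\<lambda>_. M))"
  shows "(\<integral>\<^sup>+x. \<phi> x \<partial>chain a b) =
    (\<integral>\<^sup>+x. ennreal (v (x a) * path_weight a b x * w (x b) / r ^ nat (b - a)) * \<phi> x \<partial>PiM {a..b} (\<lambda>_. M))"
  unfolding chain_def using ab by (intro nn_integral_density) measurable

lemma AE_component:
  assumes I: "finite I" "i \<in> I" and ae: "AE x in M. Q x"
  shows "AE x in PiM I (\<lambda>_::int. M). Q (x i)"
proof -
  obtain N where N: "N \<in> null_sets M" "{x\<in>space M. \<not> Q x} \<subseteq> N" using ae by (auto simp: eventually_ae_filter)
  have [measurable]: "N \<in> sets M" using N by auto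
  let ?A = "\<lambda>j. if j = i then N else space M"
  have "emeasure (PiM I (\<lambda>_. M)) (Pi\<^sub>E I ?A) = (\<Prod>j\<in>I. emeasure M (?A j))"
    by (rule P.emeasure_PiM[OF I(1)]) auto
  also have "\<dots> = 0" using I N by (intro prod_zero) auto
  finally have "Pi\<^sub>E I ?A \<in> null_sets (PiM I (\<lambda>_. M))"
    using I by (intro null_setsI) (auto intro!: sets_PiM_I_finite)
  then show ?thesis
    by (rule AE_I') (use N(2) I in \<open>auto simp: space_PiM PiE_iff extensional_def\<close>)
qed

text \<open>Integrating out the leftmost site turns \<open>v\<close> into \<open>nT v\<close>, which
  is \<open>r v\<close> almost everywhere; the factor \<open>r\<close> cancels the surplus power in
  the denominator. The right end works alike with \<open>w\<close>.\<close>

lemma chain_left: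
  assumes ab: "a \<le> b" and [measurable]: "\<phi> \<in> borel_measurable (PiM {a..b} (\<lambda>_. M))"
  shows "(\<integral>\<^sup>+x. \<phi> (restrict x {a..b}) \<partial>chain (a - 1) b) = (\<integral>\<^sup>+x. \<phi> x \<partial>chain a b)"
proof -
  have sub: "{a..b} \<subseteq> {a-1..b}" and mem: "a \<in> {a..b}" "b \<in> {a..b}" using ab by auto
  have [measurable]: "(\<lambda>x. restrict x {a..b}) \<in> measurable (PiM {a-1..b} (\<lambda>_. M)) (PiM {a..b} (\<lambda>_. M))"
    by (rule measurable_restrict_subset[OF sub])
  define R where "R = r ^ nat (b - a)"
  have R: "r ^ nat (b - (a - 1)) = r * R" "0 < R"
    using ab r_pos by (simp_all add: R_def nat_diff_distrib' power_Suc[symmetric] del: power_Suc) (simp add: Suc_nat_eq_nat_zadd1 algebra_simps)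
  let ?\<psi> = "\<lambda>x. ennreal (w (x b) / (r * R)) * \<phi> x"
  have "(\<integral>\<^sup>+x. \<phi> (restrict x {a..b}) \<partial>chain (a - 1) b)
    = (\<integral>\<^sup>+x. ennreal (v (x (a - int 1))) * ennreal (path_weight (a - int 1) b x) * ?\<psi> (restrict x {a..b}) \<partial>PiM {a - int 1..b} (\<lambda>_. M))"
    using ab R(2) r_pos by (subst nn_integral_chain) (auto simp: R(1) ennreal_mult'[symmetric] mult_ac intro!: nn_integral_cong)
  also have "\<dots> = (\<integral>\<^sup>+x. (nT ^^ 1) (\<lambda>x. ennreal (v x)) (x a) * ennreal (path_weight a b x) * ?\<psi> x \<partial>PiM {a..b} (\<lambda>_. M))"
    using ab by (intro path_left) measurable
  also have "\<dots> = (\<integral>\<^sup>+x. ennreal (v (x a) * path_weight a b x * w (x b) / R) * \<phi> x \<partial>PiM {a..b} (\<lambda>_. M))"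
  proof (rule nn_integral_cong_AE, use AE_component[OF finite_atLeastAtMost_int mem(1) nT_v] in eventually_elim)
    fix x assume "nT (\<lambda>x. ennreal (v x)) (x a) = ennreal (r * v (x a))"
    then show "(nT ^^ 1) (\<lambda>x. ennreal (v x)) (x a) * ennreal (path_weight a b x) * ?\<psi> x
      = ennreal (v (x a) * path_weight a b x * w (x b) / R) * \<phi> x"
      using R(2) r_pos by (simp add: ennreal_mult'[symmetric] mult_ac)
  qed
  also have "\<dots> = (\<integral>\<^sup>+x. \<phi> x \<partial>chain a b)"
    unfolding R_def using ab by (subst nn_integral_chain) auto
  finally show ?thesis .
qed

lemma chain_right:
  assumes ab: "a \<le> b" and [measurable]: "\<phi> \<in> borel_measurable (PiM {a..b} (\<lambda>_. M))"
  shows "(\<integral>\<^sup>+x. \<phi> (restrict x {a..b}) \<partial>chain a (b + 1)) = (\<integral>\<^sup>+x. \<phi> x \<partial>chain a b)"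
proof -
  have sub: "{a..b} \<subseteq> {a..b+1}" and mem: "a \<in> {a..b}" "b \<in> {a..b}" using ab by auto
  have [measurable]: "(\<lambda>x. restrict x {a..b}) \<in> measurable (PiM {a..b+1} (\<lambda>_. M)) (PiM {a..b} (\<lambda>_. M))"
    by (rule measurable_restrict_subset[OF sub])
  define R where "R = r ^ nat (b - a)"
  have R: "r ^ nat (b + 1 - a) = r * R" "0 < R"
    using ab r_pos by (simp_all add: R_def power_Suc[symmetric] del: power_Suc) (simp add: Suc_nat_eq_nat_zadd1 algebra_simps)
  let ?\<psi> = "\<lambda>x. ennreal (v (x a) / (r * R)) * \<phi> x"
  have "(\<integral>\<^sup>+x. \<phi> (restrict x {a..b}) \<partial>chain a (b + 1))
    = (\<integral>\<^sup>+x. ennreal (w (x (b + int 1))) * ennreal (path_weight a (b + int 1) x) * ?\<psi> (restrict x {a..b}) \<partial>PiM {a..b + int 1} (\<lambda>_. M))"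
    using ab R(2) r_pos by (subst nn_integral_chain) (auto simp: R(1) ennreal_mult'[symmetric] mult_ac intro!: nn_integral_cong)
  also have "\<dots> = (\<integral>\<^sup>+x. (nT' ^^ 1) (\<lambda>x. ennreal (w x)) (x b) * ennreal (path_weight a b x) * ?\<psi> x \<partial>PiM {a..b} (\<lambda>_. M))"
    using mem by (intro path_right ab) measurable
  also have "\<dots> = (\<integral>\<^sup>+x. ennreal (v (x a) * path_weight a b x * w (x b) / R) * \<phi> x \<partial>PiM {a..b} (\<lambda>_. M))"
  proof (rule nn_integral_cong_AE, use AE_component[OF finite_atLeastAtMost_int mem(2) nT'_w] in eventually_elim)
    fix x assume "nT' (\<lambda>x. ennreal (w x)) (x b) = ennreal (r * w (x b))"
    then show "(nT' ^^ 1) (\<lambda>x. ennreal (w x)) (x b) * ennreal (path_weight a b x) * ?\<psi> x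
      = ennreal (v (x a) * path_weight a b x * w (x b) / R) * \<phi> x"
      using R(2) r_pos by (simp add: ennreal_mult'[symmetric] mult_ac)
  qed
  also have "\<dots> = (\<integral>\<^sup>+x. \<phi> x \<partial>chain a b)"
    unfolding R_def using ab by (subst nn_integral_chain) auto
  finally show ?thesis .
qed

lemma chain_restrict_aux:
  assumes ab: "a \<le> b" and phi: "\<phi> \<in> borel_measurable (PiM {a..b} (\<lambda>_. M))"
  shows "(\<integral>\<^sup>+x. \<phi> (restrict x {a..b}) \<partial>chain (a - int m) (b + int n)) = (\<integral>\<^sup>+x. \<phi> x \<partial>chain a b)"
proof (induction n)
  case 0
  show ?case
  proof (induction m)
    case 0
    have rs: "restrict x {a..b} = x" if "x \<in> space (chain a b)" for x
      using that by (auto simp: space_PiM PiE_iff extensional_restrict)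
    show ?case
      unfolding of_nat_0 diff_0_right add_0_right by (intro nn_integral_cong) (simp only: rs)
  next
    case (Suc m)
    define c where "c = a - int m"
    have c: "c \<le> b" "a - int (Suc m) = c - 1" unfolding c_def using ab by auto
    have sub: "{a..b} \<subseteq> {c..b}" unfolding c_def by auto
    have rr: "restrict (restrict x {c..b}) {a..b} = restrict x {a..b}" for x :: "int \<Rightarrow> 'x"
      unfolding restrict_restrict Int_absorb1[OF sub] ..
    have "(\<integral>\<^sup>+x. \<phi> (restrict (restrict x {c..b}) {a..b}) \<partial>chain (c - 1) b) = (\<integral>\<^sup>+x. \<phi> (restrict x {a..b}) \<partial>chain c b)"
      by (rule chain_left[OF c(1) measurable_compose[OF measurable_restrict_subset[OF sub] phi]])
    with Suc show ?case unfolding rr c(2) of_nat_0 add_0_right c_def[symmetric] by (simp only:)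
  qed
next
  case (Suc n)
  define c where "c = b + int n"
  define d where "d = a - int m"
  have c: "d \<le> c" "b + int (Suc n) = c + 1" unfolding c_def d_def using ab by auto
  have sub: "{a..b} \<subseteq> {d..c}" unfolding c_def d_def by auto
  have rr: "restrict (restrict x {d..c}) {a..b} = restrict x {a..b}" for x :: "int \<Rightarrow> 'x"
    unfolding restrict_restrict Int_absorb1[OF sub] ..
  have "(\<integral>\<^sup>+x. \<phi> (restrict (restrict x {d..c}) {a..b}) \<partial>chain d (c + 1)) = (\<integral>\<^sup>+x. \<phi> (restrict x {a..b}) \<partial>chain d c)"
    by (rule chain_right[OF c(1) measurable_compose[OF measurable_restrict_subset[OF sub] phi]])
  with Suc show ?case unfolding rr c(2) c_def[symmetric] d_def[symmetric] by (simp only:)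
qed

lemma chain_restrict:
  assumes "a' \<le> a" "a \<le> b" "b \<le> b'" and phi: "\<phi> \<in> borel_measurable (PiM {a..b} (\<lambda>_. M))"
  shows "(\<integral>\<^sup>+x. \<phi> (restrict x {a..b}) \<partial>chain a' b') = (\<integral>\<^sup>+x. \<phi> x \<partial>chain a b)"
  using chain_restrict_aux[OF assms(2) phi, of "nat (a - a')" "nat (b' - b)"] assms by simp

lemma distr_chain:
  assumes "a' \<le> a" "a \<le> b" "b \<le> b'"
  shows "distr (chain a' b') (PiM {a..b} (\<lambda>_. M)) (\<lambda>x. restrict x {a..b}) = chain a b"
proof (rule measure_eqI)
  have sub: "{a..b} \<subseteq> {a'..b'}" using assms by auto
  have m: "(\<lambda>x. restrict x {a..b}) \<in> measurable (chain a' b') (PiM {a..b} (\<lambda>_. M))"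
    using measurable_restrict_subset[OF sub] by (simp cong: measurable_cong_sets)
  fix A assume "A \<in> sets (distr (chain a' b') (PiM {a..b} (\<lambda>_. M)) (\<lambda>x. restrict x {a..b}))"
  then have [measurable]: "A \<in> sets (PiM {a..b} (\<lambda>_. M))" by simp
  have "emeasure (distr (chain a' b') (PiM {a..b} (\<lambda>_. M)) (\<lambda>x. restrict x {a..b})) A
    = (\<integral>\<^sup>+x. indicator A x \<partial>distr (chain a' b') (PiM {a..b} (\<lambda>_. M)) (\<lambda>x. restrict x {a..b}))"
    by simp
  also have "\<dots> = (\<integral>\<^sup>+x. indicator A (restrict x {a..b}) \<partial>chain a' b')"
    by (rule nn_integral_distr[OF m]) simp
  also have "\<dots> = (\<integral>\<^sup>+x. indicator A x \<partial>chain a b)"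
    by (rule chain_restrict[OF assms]) simp
  finally show "emeasure (distr (chain a' b') (PiM {a..b} (\<lambda>_. M)) (\<lambda>x. restrict x {a..b})) A = emeasure (chain a b) A"
    by simp
qed simp

lemma chain_marginal:
  assumes "a \<le> t" "t \<le> b" and f[measurable]: "f \<in> borel_measurable M"
  shows "(\<integral>\<^sup>+x. f (x t) \<partial>chain a b) = (\<integral>\<^sup>+x. f x \<partial>\<pi>)"
proof -
  have mem: "t \<in> {t..t}" by simp
  have m: "(\<lambda>x. f (x t)) \<in> borel_measurable (PiM {t..t} (\<lambda>_. M))" using mem by measurable
  have "(\<integral>\<^sup>+x. f (x t) \<partial>chain a b) = (\<integral>\<^sup>+x. f (restrict x {t..t} t) \<partial>chain a b)" by simp
  also have "\<dots> = (\<integral>\<^sup>+x. f (x t) \<partial>chain t t)"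
    by (rule chain_restrict[OF assms(1) order_refl assms(2) m])
  also have "\<dots> = (\<integral>\<^sup>+x. ennreal (v (x t) * w (x t)) * f (x t) \<partial>PiM {t} (\<lambda>_. M))"
    using m by (subst nn_integral_chain) auto
  also have "\<dots> = (\<integral>\<^sup>+x. ennreal (v x * w x) * f x \<partial>M)"
    by (rule P.product_nn_integral_singleton) measurable
  finally show ?thesis by (simp add: nn_integral_\<pi>)
qed

lemma prob_space_chain:
  assumes "a \<le> b"
  shows "prob_space (chain a b)"
proof
  have "emeasure (chain a b) (space (chain a b)) = (\<integral>\<^sup>+x. 1 \<partial>chain a b)" by simp
  also have "\<dots> = (\<integral>\<^sup>+x. 1 \<partial>\<pi>)"
    using chain_marginal[of a a b "\<lambda>_. 1"] assms by simp
  also have "\<dots> = 1" using prob_space.emeasure_space_1[OF prob_space_\<pi>] by simp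
  finally show "emeasure (chain a b) (space (chain a b)) = 1" .
qed

lemma distr_chain_shift:
  assumes "a \<le> b"
  shows "distr (chain (a + h) (b + h)) (PiM {a..b} (\<lambda>_. M)) (\<lambda>x. \<lambda>t\<in>{a..b}. x (t + h)) = chain a b"
proof -
  let ?S = "\<lambda>x. \<lambda>t\<in>{a..b}. x (t + h)"
  have bij: "bij_betw (\<lambda>t. t + h) {a..b} {a+h..b+h}"
    by (intro bij_betw_byWitness[where f'="\<lambda>t. t - h"]) auto
  have m[measurable]: "?S \<in> measurable (PiM {a+h..b+h} (\<lambda>_. M)) (PiM {a..b} (\<lambda>_. M))"
    by (intro measurable_restrict measurable_component_singleton) auto
  let ?g = "\<lambda>x. ennreal (v (x a) * path_weight a b x * w (x b) / r ^ nat (b - a))"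
  have [measurable]: "?g \<in> borel_measurable (PiM {a..b} (\<lambda>_. M))"
    using assms by measurable
  have pw: "path_weight a b (?S x) = path_weight (a + h) (b + h) x" for x
  proof -
    have "(\<Prod>t\<in>{a+h+1..b+h}. K (x (t - 1)) (x t)) = (\<Prod>t\<in>{a+1..b}. K (x (t + h - 1)) (x (t + h)))"
      by (rule prod.reindex_bij_witness[where i="\<lambda>t. t + h" and j="\<lambda>t. t - h"]) auto
    also have "\<dots> = (\<Prod>t\<in>{a+1..b}. K (?S x (t - 1)) (?S x t))"
      by (intro prod.cong) (auto simp: algebra_simps)
    finally show ?thesis by (simp add: path_weight_def)
  qed
  have "chain a b = density (distr (PiM {a+h..b+h} (\<lambda>_. M)) (PiM {a..b} (\<lambda>_. M)) ?S) ?g"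
    unfolding chain_def distr_PiM_bij[OF sigma_finite finite_atLeastAtMost_int bij] ..
  also have "\<dots> = distr (density (PiM {a+h..b+h} (\<lambda>_. M)) (\<lambda>x. ?g (?S x))) (PiM {a..b} (\<lambda>_. M)) ?S"
    by (rule density_distr) measurable
  also have "density (PiM {a+h..b+h} (\<lambda>_. M)) (\<lambda>x. ?g (?S x)) = chain (a + h) (b + h)"
    unfolding chain_def pw using assms by (simp add: add.commute)
  finally show ?thesis ..
qed

end

text \<open>Kolmogorov's extension applies to Borel measures on a Polish space, whereas
  \<open>M\<close> lives on the Borel subset \<open>\<Omega>\<close>. So the window laws are first
  regarded as laws on the whole space, extended, and finally pulled back into
  \<open>\<Omega>\<close>.\<close>

lemma exists_stationary_chain:
  fixes M :: "('x::polish_space) measure"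
  assumes pair: "principal_pair M K r v w"
    and \<Omega>: "\<Omega> \<in> sets borel" "space M = \<Omega>" "sets M = sets (restrict_space borel \<Omega>)"
  shows "\<exists>(P :: (int \<Rightarrow> 'x) measure) X. prob_space P \<and> (\<forall>t. X t \<in> measurable P M) \<and>
    (\<forall>a b. a \<le> b \<longrightarrow> distr P (PiM {a..b} (\<lambda>_. M)) (\<lambda>\<omega>. \<lambda>t\<in>{a..b}. X t \<omega>) = principal_pair.chain M K r v w a b)"
proof -
  interpret principal_pair M K r v w by (rule pair)
  have idm: "(\<lambda>x. x) \<in> measurable M borel"
    using measurable_restrict_space1[of "\<lambda>x. x" borel borel \<Omega>] \<Omega>(3) by (simp cong: measurable_cong_sets)
  have rm[measurable]: "(\<lambda>x. restrict x J) \<in> measurable (PiM I (\<lambda>_. M)) (PiM J (\<lambda>_. borel))" if "J \<subseteq> I" for I J :: "int set"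
  proof (intro measurable_restrict)
    fix t assume "t \<in> J"
    then have "(\<lambda>x. x t) \<in> measurable (PiM I (\<lambda>_. M)) M" using that by (intro measurable_component_singleton) auto
    from measurable_compose[OF this idm] show "(\<lambda>x. x t) \<in> measurable (PiM I (\<lambda>_. M)) borel" .
  qed
  \<comment> \<open>Half-length of a symmetric window containing \<open>J\<close>; inserting 0
    covers the empty set.\<close>
  define N where "N J = Max (insert 0 (abs ` J))" for J :: "int set"
  have N: "0 \<le> N J" "J \<subseteq> {- N J..N J}" if "finite J" for J
  proof -
    show "0 \<le> N J" unfolding N_def using that by (intro Max_ge) auto
    have "\<bar>j\<bar> \<le> N J" if "j \<in> J" for j unfolding N_def using that \<open>finite J\<close> by (intro Max_ge) auto
    then show "J \<subseteq> {- N J..N J}" by (force simp: abs_le_iff)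
  qed
  have N_mono: "N J \<le> N H" if "J \<subseteq> H" "finite H" for J H
    unfolding N_def using that by (intro Max_mono) (auto intro: finite_subset)
  define PJ where "PJ J = distr (chain (- N J) (N J)) (PiM J (\<lambda>_. borel)) (\<lambda>x. restrict x J)" for J
  have rc: "(\<lambda>x. restrict x J) \<in> measurable (chain a b) (PiM J (\<lambda>_. borel))" if "J \<subseteq> {a..b}" for a b J
    using rm[OF that] by (simp cong: measurable_cong_sets)
  \<comment> \<open>The law on \<open>J\<close> may be computed in any larger window; consistency
    needs this since \<open>J \<subseteq> H\<close> come with windows of different lengths.\<close>
  have PJ_eq: "distr (chain a b) (PiM J (\<lambda>_. borel)) (\<lambda>x. restrict x J) = PJ J"
    if J: "finite J" and n: "a \<le> - N J" "N J \<le> b" for J a b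
  proof -
    have le: "- N J \<le> N J" using N(1)[OF J] by simp
    have sub: "{- N J..N J} \<subseteq> {a..b}" using n by auto
    have m: "(\<lambda>x. restrict x {- N J..N J}) \<in> measurable (chain a b) (PiM {- N J..N J} (\<lambda>_. M))"
      using measurable_restrict_subset[OF sub] by (simp cong: measurable_cong_sets)
    have "PJ J = distr (distr (chain a b) (PiM {- N J..N J} (\<lambda>_. M)) (\<lambda>x. restrict x {- N J..N J})) (PiM J (\<lambda>_. borel)) (\<lambda>x. restrict x J)"
      unfolding PJ_def distr_chain[OF n(1) le n(2)] ..
    also have "\<dots> = distr (chain a b) (PiM J (\<lambda>_. borel)) ((\<lambda>x. restrict x J) \<circ> (\<lambda>x. restrict x {- N J..N J}))"
      by (rule distr_distr[OF rm[OF N(2)[OF J]] m])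
    also have "((\<lambda>x. restrict x J) \<circ> (\<lambda>x. restrict x {- N J..N J})) = (\<lambda>x. restrict x J)"
      unfolding o_def restrict_restrict Int_absorb1[OF N(2)[OF J]] ..
    finally show ?thesis ..
  qed
  interpret PF: polish_projective UNIV PJ
  proof (intro polish_projective.intro projective_family.intro)
    fix J H :: "int set" assume JH: "J \<subseteq> H" "finite H"
    then have J: "finite J" by (auto intro: finite_subset)
    have mr: "(\<lambda>x. restrict x J) \<in> measurable (PiM H (\<lambda>_. borel)) (PiM J (\<lambda>_. borel :: 'x measure))"
      by (rule measurable_restrict_subset[OF JH(1)])
    have "distr (PJ H) (PiM J (\<lambda>_. borel)) (\<lambda>x. restrict x J)
      = distr (chain (- N H) (N H)) (PiM J (\<lambda>_. borel)) ((\<lambda>x. restrict x J) \<circ> (\<lambda>x. restrict x H))"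
      unfolding PJ_def by (rule distr_distr[OF mr rc[OF N(2)[OF JH(2)]]])
    also have "((\<lambda>x. restrict x J) \<circ> (\<lambda>x. restrict x H)) = (\<lambda>x :: int \<Rightarrow> 'x. restrict x J)"
      unfolding o_def restrict_restrict Int_absorb1[OF JH(1)] ..
    also have "distr (chain (- N H) (N H)) (PiM J (\<lambda>_. borel)) (\<lambda>x. restrict x J) = PJ J"
      using N_mono[OF JH] by (intro PJ_eq J) auto
    finally show "PJ J = distr (PJ H) (PiM J (\<lambda>_. borel)) (\<lambda>x. restrict x J)" ..
  next
    fix J :: "int set" assume J: "finite J"
    show "prob_space (PJ J)"
      unfolding PJ_def
      by (rule prob_space.prob_space_distr[OF prob_space_chain rc[OF N(2)[OF J]]]) (use N(1)[OF J] in simp)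
  qed
  have lim: "distr PF.lim (PiM J (\<lambda>_. borel)) (\<lambda>x. restrict x J) = PJ J" if J: "finite J" for J
  proof (rule measure_eqI)
    have m: "(\<lambda>x. restrict x J) \<in> measurable PF.lim (PiM J (\<lambda>_. borel))"
      using measurable_restrict_subset[of J UNIV] by (simp cong: measurable_cong_sets)
    fix A assume "A \<in> sets (distr PF.lim (PiM J (\<lambda>_. borel)) (\<lambda>x. restrict x J))"
    then have A: "A \<in> sets (PiM J (\<lambda>_. borel))" by simp
    have "emeasure (distr PF.lim (PiM J (\<lambda>_. borel)) (\<lambda>x. restrict x J)) A
      = emeasure PF.lim (prod_emb UNIV (\<lambda>_. borel) J A)"
      by (subst emeasure_distr[OF m A]) (simp add: prod_emb_def space_PiM)
    also have "\<dots> = emeasure (PJ J) A" by (rule PF.emeasure_lim_emb) (use J A in auto)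
    finally show "emeasure (distr PF.lim (PiM J (\<lambda>_. borel)) (\<lambda>x. restrict x J)) A = emeasure (PJ J) A" .
  qed (simp add: PJ_def)
  obtain x0 where x0: "x0 \<in> \<Omega>"
    using prob_space.not_empty[OF prob_space_\<pi>] \<Omega>(2) by auto
  \<comment> \<open>A measurable retraction onto \<open>\<Omega>\<close>. The finite-dimensional
    laws are carried by \<open>\<Omega>\<close>, where it is the identity, so applying it to each
    coordinate leaves the window laws unchanged.\<close>
  define c where "c x = (if x \<in> \<Omega> then x else x0)" for x
  have c: "c \<in> measurable borel M"
  proof -
    have "c \<in> measurable borel (restrict_space borel \<Omega>)"
      unfolding c_def using \<Omega>(1) x0 by (intro measurable_restrict_space2) auto
    then show ?thesis using \<Omega>(3) by (simp cong: measurable_cong_sets)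
  qed
  define X where "X t \<omega> = c (\<omega> t)" for t :: int and \<omega> :: "int \<Rightarrow> 'x"
  have X: "X t \<in> measurable PF.lim M" for t
  proof -
    have "(\<lambda>x. x t) \<in> measurable (PiM UNIV (\<lambda>_. borel)) borel" by (intro measurable_component_singleton) simp
    from measurable_compose[OF this c] show ?thesis
      unfolding X_def by (simp cong: measurable_cong_sets)
  qed
  have "distr PF.lim (PiM {a..b} (\<lambda>_. M)) (\<lambda>\<omega>. \<lambda>t\<in>{a..b}. X t \<omega>) = chain a b" if ab: "a \<le> b" for a b
  proof -
    let ?I = "{a..b}"
    define g where "g x = (\<lambda>t\<in>?I. c (x t))" for x :: "int \<Rightarrow> 'x"
    have g: "g \<in> measurable (PiM ?I (\<lambda>_. borel)) (PiM ?I (\<lambda>_. M))"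
      unfolding g_def
    proof (intro measurable_restrict)
      fix t assume "t \<in> ?I"
      then have "(\<lambda>x. x t) \<in> measurable (PiM ?I (\<lambda>_. borel)) borel" by (intro measurable_component_singleton)
      from measurable_compose[OF this c] show "(\<lambda>x. c (x t)) \<in> measurable (PiM ?I (\<lambda>_. borel)) M" .
    qed
    have m: "(\<lambda>x. restrict x ?I) \<in> measurable PF.lim (PiM ?I (\<lambda>_. borel))"
      using measurable_restrict_subset[of ?I UNIV] by (simp cong: measurable_cong_sets)
    define n where "n = max (N ?I) (max \<bar>a\<bar> \<bar>b\<bar>)"
    have n: "- n \<le> - N ?I" "N ?I \<le> n" "- n \<le> a" "b \<le> n" unfolding n_def by auto
    have In: "?I \<subseteq> {- n..n}" using n by auto
    have "distr PF.lim (PiM ?I (\<lambda>_. M)) (\<lambda>\<omega>. \<lambda>t\<in>?I. X t \<omega>) = distr PF.lim (PiM ?I (\<lambda>_. M)) (g \<circ> (\<lambda>x. restrict x ?I))"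
      by (intro distr_cong) (auto simp: g_def X_def fun_eq_iff)
    also have "\<dots> = distr (distr PF.lim (PiM ?I (\<lambda>_. borel)) (\<lambda>x. restrict x ?I)) (PiM ?I (\<lambda>_. M)) g"
      by (rule distr_distr[OF g m, symmetric])
    also have "\<dots> = distr (distr (chain (- n) n) (PiM ?I (\<lambda>_. borel)) (\<lambda>x. restrict x ?I)) (PiM ?I (\<lambda>_. M)) g"
      by (simp only: lim[OF finite_atLeastAtMost_int] PJ_eq[OF finite_atLeastAtMost_int n(1,2)])
    also have "\<dots> = distr (chain (- n) n) (PiM ?I (\<lambda>_. M)) (g \<circ> (\<lambda>x. restrict x ?I))"
      by (rule distr_distr[OF g rc[OF In]])
    also have "\<dots> = distr (chain (- n) n) (PiM ?I (\<lambda>_. M)) (\<lambda>x. restrict x ?I)"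
    proof (rule distr_cong)
      fix x assume x: "x \<in> space (chain (- n) n)"
      have "x t \<in> \<Omega>" if "t \<in> ?I" for t using x that In \<Omega>(2) by (auto simp: space_PiM PiE_iff)
      then show "(g \<circ> (\<lambda>x. restrict x ?I)) x = restrict x ?I"
        by (auto simp: g_def c_def fun_eq_iff)
    qed auto
    also have "\<dots> = chain a b" by (rule distr_chain[OF n(3) ab n(4)])
    finally show ?thesis .
  qed
  then show ?thesis using X PF.P.prob_space_axioms by blast
qed

section \<open>Uniqueness of stationary Gibbs processes\<close>

text \<open>Absolute continuity of the integral for an unbounded density: above a high level
  \<open>L\<close> the density has little mass altogether, and below it the integral over
  \<open>B n\<close> is at most \<open>L\<close> times the measure of \<open>B n\<close>.\<close>

lemma nn_integral_small_sets:
  assumes [measurable]: "D \<in> borel_measurable N" and fin: "(\<integral>\<^sup>+x. D x \<partial>N) < \<infinity>"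
    and B[measurable]: "\<And>n. B n \<in> sets N" and lim: "(\<lambda>n. emeasure N (B n)) \<longlonglongrightarrow> 0"
  shows "(\<lambda>n. \<integral>\<^sup>+x. D x * indicator (B n) x \<partial>N) \<longlonglongrightarrow> 0"
proof (rule order_tendstoI)
  fix a :: ennreal assume "0 < a"
  then obtain b where b: "0 < b" "b < a" using dense by blast
  then obtain e where e: "0 < e" "ennreal e < a" by (cases b) auto
  have ae: "AE x in N. D x \<noteq> \<infinity>" using fin by (intro nn_integral_PInf_AE) auto
  have "(\<lambda>L. \<integral>\<^sup>+x. (D x - min (D x) (of_nat L)) \<partial>N) \<longlonglongrightarrow> (\<integral>\<^sup>+x. 0 \<partial>N)"
  proof (rule nn_integral_dominated_convergence[where w=D])
    show "AE x in N. (\<lambda>L. D x - min (D x) (of_nat L)) \<longlonglongrightarrow> 0"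
      using ae
    proof eventually_elim
      case (elim x)
      then obtain d where d: "D x = ennreal d" "0 \<le> d" by (cases "D x") auto
      obtain L0 :: nat where L0: "d \<le> real L0" using real_arch_simple by blast
      have "D x - min (D x) (of_nat L) = 0" if "L \<ge> L0" for L
        using d L0 that by (simp add: min_def ennreal_of_nat_eq_real_of_nat)
      then have "\<forall>\<^sub>F L in sequentially. 0 = D x - min (D x) (of_nat L)"
        by (intro eventually_sequentiallyI[of L0]) simp
      then show ?case by (rule Lim_transform_eventually[OF tendsto_const])
    qed
    show "AE x in N. D x - min (D x) (of_nat L) \<le> D x" for L by (simp add: diff_le_self_ennreal)
  qed (use fin in auto)
  then have "(\<lambda>L. \<integral>\<^sup>+x. (D x - min (D x) (of_nat L)) \<partial>N) \<longlonglongrightarrow> 0" by simp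
  then have "\<forall>\<^sub>F L in sequentially. (\<integral>\<^sup>+x. (D x - min (D x) (of_nat L)) \<partial>N) < ennreal (e/2)"
    by (rule order_tendstoD) (use e in auto)
  then obtain L where L: "(\<integral>\<^sup>+x. (D x - min (D x) (of_nat L)) \<partial>N) < ennreal (e/2)"
    by (auto simp: eventually_sequentially)
  \<comment> \<open>\<open>L\<close> times this bound is at most \<open>e/2\<close>; the added 1
    covers \<open>L = 0\<close>.\<close>
  have "\<forall>\<^sub>F n in sequentially. emeasure N (B n) < ennreal (e / (2 * (real L + 1)))"
    by (rule order_tendstoD[OF lim]) (use e in auto)
  then show "\<forall>\<^sub>F n in sequentially. (\<integral>\<^sup>+x. D x * indicator (B n) x \<partial>N) < a"
  proof eventually_elim
    case (elim n)
    have "(\<integral>\<^sup>+x. D x * indicator (B n) x \<partial>N) \<le> (\<integral>\<^sup>+x. (D x - min (D x) (of_nat L)) + of_nat L * indicator (B n) x \<partial>N)"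
    proof (rule nn_integral_mono)
      fix x
      have "D x \<le> (D x - min (D x) (of_nat L)) + of_nat L"
        by (cases "D x") (auto simp: min_def ennreal_of_nat_eq_real_of_nat ennreal_minus ennreal_plus[symmetric] simp del: ennreal_plus)
      then show "D x * indicator (B n) x \<le> (D x - min (D x) (of_nat L)) + of_nat L * indicator (B n) x"
        by (auto simp: indicator_def)
    qed
    also have "\<dots> = (\<integral>\<^sup>+x. (D x - min (D x) (of_nat L)) \<partial>N) + of_nat L * emeasure N (B n)"
      by (subst nn_integral_add) (auto simp: nn_integral_cmult)
    also have "\<dots> \<le> ennreal (e/2) + ennreal (e/2)"
    proof (rule add_mono)
      have "of_nat L * emeasure N (B n) \<le> ennreal (real L) * ennreal (e / (2 * (real L + 1)))"
        using elim by (intro mult_mono) (auto simp: ennreal_of_nat_eq_real_of_nat)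
      also have "\<dots> = ennreal (real L * (e / (2 * (real L + 1))))" using e by (simp add: ennreal_mult'[symmetric])
      also have "\<dots> \<le> ennreal (e/2)" using e by (intro ennreal_leI) (simp add: field_simps)
      finally show "of_nat L * emeasure N (B n) \<le> ennreal (e/2)" .
    qed (use L in simp)
    also have "\<dots> = ennreal e" using e by (simp add: ennreal_plus[symmetric] del: ennreal_plus)
    finally show ?case using e(2) by simp
  qed
qed simp

definition override :: "int set \<Rightarrow> (int \<Rightarrow> 'x) \<Rightarrow> (int \<Rightarrow> 'x) \<Rightarrow> int \<Rightarrow> 'x" where
  "override J x z t = (if t \<in> J then z t else x t)"

section \<open>Block conditional laws and iterated kernels\<close>

context positive_kernel
begin

text \<open>The block between times \<open>l\<close> and \<open>u\<close> has, given everything else, a density proportional to the path weight.\<close>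

definition gibbs :: "'w measure \<Rightarrow> (int \<Rightarrow> 'w \<Rightarrow> 'x) \<Rightarrow> bool" where
  "gibbs Q X \<longleftrightarrow> prob_space Q \<and> (\<forall>t. X t \<in> measurable Q M) \<and> (\<forall>t. distr Q M (X t) = distr Q M (X 0)) \<and>
    (\<forall>l u. l < u \<longrightarrow> (\<exists>H\<in>borel_measurable Q. \<forall>\<phi>\<in>borel_measurable (PiM UNIV (\<lambda>_::int. M)).
      (\<integral>\<^sup>+\<omega>. \<phi> (\<lambda>t. X t \<omega>) \<partial>Q) =
      (\<integral>\<^sup>+\<omega>. H \<omega> * (\<integral>\<^sup>+z. ennreal (path_weight l u (override {l+1..u-1} (\<lambda>t. X t \<omega>) z)) *
         \<phi> (override {l+1..u-1} (\<lambda>t. X t \<omega>) z) \<partial>PiM {l+1..u-1} (\<lambda>_. M)) \<partial>Q)))"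

text \<open>The iterated kernel from a boundary value \<open>x\<close> on the left: \<open>n\<close>
  integrated sites, hence \<open>n + 1\<close> kernel factors. \<open>kr\<close> is its mirror image
  for a boundary value on the right.\<close>

definition kl :: "nat \<Rightarrow> 'x \<Rightarrow> 'x \<Rightarrow> ennreal" where
  "kl n x = (nT ^^ n) (\<lambda>y. ennreal (K x y))"

definition kr :: "nat \<Rightarrow> 'x \<Rightarrow> 'x \<Rightarrow> ennreal" where
  "kr n y = (nT' ^^ n) (\<lambda>x. ennreal (K x y))"

lemma kl_measurable_pair: "(\<lambda>p. kl n (fst p) (snd p)) \<in> borel_measurable (M \<Otimes>\<^sub>M M)"
proof (induction n)
  case (Suc n)
  have [measurable]: "(\<lambda>p. kl n (fst p) (snd p)) \<in> borel_measurable (M \<Otimes>\<^sub>M M)" by (rule Suc)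
  have "(\<lambda>p. kl n (fst (fst p)) (snd p)) \<in> borel_measurable ((M \<Otimes>\<^sub>M M) \<Otimes>\<^sub>M M)"
    using measurable_compose[of "\<lambda>p. (fst (fst p), snd p)" "(M \<Otimes>\<^sub>M M) \<Otimes>\<^sub>M M" "M \<Otimes>\<^sub>M M", OF _ Suc] by simp
  then have "(\<lambda>p. nT (kl n (fst p)) (snd p)) \<in> borel_measurable (M \<Otimes>\<^sub>M M)"
    by (intro nT_measurable) (auto simp: split_beta)
  then show ?case by (simp add: kl_def)
qed (simp add: kl_def)

lemma kr_measurable_pair: "(\<lambda>p. kr n (fst p) (snd p)) \<in> borel_measurable (M \<Otimes>\<^sub>M M)"
proof (induction n)
  case (Suc n)
  have [measurable]: "(\<lambda>p. kr n (fst p) (snd p)) \<in> borel_measurable (M \<Otimes>\<^sub>M M)" by (rule Suc)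
  have "(\<lambda>p. kr n (fst (fst p)) (snd p)) \<in> borel_measurable ((M \<Otimes>\<^sub>M M) \<Otimes>\<^sub>M M)"
    using measurable_compose[of "\<lambda>p. (fst (fst p), snd p)" "(M \<Otimes>\<^sub>M M) \<Otimes>\<^sub>M M" "M \<Otimes>\<^sub>M M", OF _ Suc] by simp
  then have "(\<lambda>p. nT' (kr n (fst p)) (snd p)) \<in> borel_measurable (M \<Otimes>\<^sub>M M)"
    by (intro nT_measurable) (auto simp: split_beta)
  then show ?case by (simp add: kr_def)
qed (simp add: kr_def)

lemma kl_measurable [measurable (raw)]:
  "f \<in> measurable N M \<Longrightarrow> g \<in> measurable N M \<Longrightarrow> (\<lambda>z. kl n (f z) (g z)) \<in> borel_measurable N"
  using measurable_compose[of "\<lambda>z. (f z, g z)" N "M \<Otimes>\<^sub>M M", OF _ kl_measurable_pair] by simp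

lemma kr_measurable [measurable (raw)]:
  "f \<in> measurable N M \<Longrightarrow> g \<in> measurable N M \<Longrightarrow> (\<lambda>z. kr n (f z) (g z)) \<in> borel_measurable N"
  using measurable_compose[of "\<lambda>z. (f z, g z)" N "M \<Otimes>\<^sub>M M", OF _ kr_measurable_pair] by simp

text \<open>The \<open>n\<close> sites on either side of the block do not enter
  \<open>\<phi>\<close>; integrating them out condenses the path weight outside
  \<open>{a..b}\<close> to the two iterated kernels.\<close>

lemma gap_integral:
  assumes ab: "a \<le> b" and x[measurable]: "x \<in> space M" and y[measurable]: "y \<in> space M"
    and phi[measurable]: "\<phi> \<in> borel_measurable (PiM {a..b} (\<lambda>_. M))"
  shows "(\<integral>\<^sup>+z. ennreal (K x (z (a - int n))) * ennreal (path_weight (a - int n) (b + int n) z) * ennreal (K (z (b + int n)) y)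
      * \<phi> (restrict z {a..b}) \<partial>PiM {a - int n..b + int n} (\<lambda>_. M))
    = (\<integral>\<^sup>+z. kl n x (z a) * kr n y (z b) * ennreal (path_weight a b z) * \<phi> z \<partial>PiM {a..b} (\<lambda>_. M))"
proof -
  let ?c = "a - int n"
  have sub: "{a..b} \<subseteq> {?c..b}" and mem: "a \<in> {a..b}" "b \<in> {a..b}" "?c \<in> {?c..b}" using ab by auto
  have [measurable]: "(\<lambda>x. restrict x {a..b}) \<in> measurable (PiM {?c..b} (\<lambda>_. M)) (PiM {a..b} (\<lambda>_. M))"
    by (rule measurable_restrict_subset[OF sub])
  have rr: "restrict (restrict x {?c..b}) {a..b} = restrict x {a..b}" for x :: "int \<Rightarrow> 'x"
    unfolding restrict_restrict Int_absorb1[OF sub] ..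
  have cb: "?c \<le> b" using ab by simp
  have rc: "restrict z {?c..b} ?c = z ?c" "restrict z {a..b} b = z b" for z :: "int \<Rightarrow> 'x" using cb ab by simp_all
  have "(\<integral>\<^sup>+z. ennreal (K x (z ?c)) * ennreal (path_weight ?c (b + int n) z) * ennreal (K (z (b + int n)) y)
      * \<phi> (restrict z {a..b}) \<partial>PiM {?c..b + int n} (\<lambda>_. M))
    = (\<integral>\<^sup>+z. ennreal (K (z (b + int n)) y) * ennreal (path_weight ?c (b + int n) z) *
       (\<lambda>z. ennreal (K x (z ?c)) * \<phi> (restrict z {a..b})) (restrict z {?c..b}) \<partial>PiM {?c..b + int n} (\<lambda>_. M))"
    unfolding rr rc by (simp add: mult_ac)
  also have "\<dots> = (\<integral>\<^sup>+z. kr n y (z b) * ennreal (path_weight ?c b z) * (ennreal (K x (z ?c)) * \<phi> (restrict z {a..b})) \<partial>PiM {?c..b} (\<lambda>_. M))"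
    unfolding kr_def using mem by (intro path_right cb) measurable
  also have "\<dots> = (\<integral>\<^sup>+z. ennreal (K x (z ?c)) * ennreal (path_weight ?c b z) * (\<lambda>z. kr n y (z b) * \<phi> z) (restrict z {a..b}) \<partial>PiM {?c..b} (\<lambda>_. M))"
    unfolding rc by (simp add: mult_ac)
  also have "\<dots> = (\<integral>\<^sup>+z. kl n x (z a) * ennreal (path_weight a b z) * (kr n y (z b) * \<phi> z) \<partial>PiM {a..b} (\<lambda>_. M))"
    unfolding kl_def using mem by (intro path_left ab) measurable
  finally show ?thesis by (simp add: mult_ac)
qed

text \<open>\<open>H\<close> is chosen before \<open>l\<close>, \<open>u\<close> and
  \<open>\<phi>\<close>. So for \<open>n = 0\<close> one and the same \<open>H\<close> serves test
  functions of arbitrarily distant boundary values, and this yields a density common to all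
  distances.\<close>

lemma gibbs_block:
  assumes g: "gibbs Q X" and ab: "a \<le> b"
  shows "\<exists>H\<in>borel_measurable Q. \<forall>l u \<phi>. l \<le> a - 1 - int n \<longrightarrow> b + 1 + int n \<le> u \<longrightarrow>
    (\<lambda>p. \<phi> (fst p) (fst (snd p)) (snd (snd p))) \<in> borel_measurable (M \<Otimes>\<^sub>M (M \<Otimes>\<^sub>M PiM {a..b} (\<lambda>_. M))) \<longrightarrow>
    (\<integral>\<^sup>+\<omega>. \<phi> (X l \<omega>) (X u \<omega>) (\<lambda>t\<in>{a..b}. X t \<omega>) \<partial>Q) =
    (\<integral>\<^sup>+\<omega>. H \<omega> * (\<integral>\<^sup>+z. kl n (X (a - 1 - int n) \<omega>) (z a) * kr n (X (b + 1 + int n) \<omega>) (z b) * ennreal (path_weight a b z) *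
       \<phi> (X l \<omega>) (X u \<omega>) z \<partial>PiM {a..b} (\<lambda>_. M)) \<partial>Q)"
proof -
  let ?l = "a - 1 - int n" and ?u = "b + 1 + int n"
  let ?J = "{?l+1..?u-1}"
  have lu: "?l < ?u" using ab by simp
  have X[measurable]: "X t \<in> measurable Q M" for t using g by (simp add: gibbs_def)
  obtain H where H: "H \<in> borel_measurable Q" and eq: "\<And>\<phi>. \<phi> \<in> borel_measurable (PiM UNIV (\<lambda>_::int. M)) \<Longrightarrow>
      (\<integral>\<^sup>+\<omega>. \<phi> (\<lambda>t. X t \<omega>) \<partial>Q) =
      (\<integral>\<^sup>+\<omega>. H \<omega> * (\<integral>\<^sup>+z. ennreal (path_weight ?l ?u (override ?J (\<lambda>t. X t \<omega>) z)) *
         \<phi> (override ?J (\<lambda>t. X t \<omega>) z) \<partial>PiM ?J (\<lambda>_. M)) \<partial>Q)"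
    using g lu unfolding gibbs_def by blast
  show ?thesis
  proof (intro bexI[OF _ H] allI impI)
    fix l u and \<phi> :: "'x \<Rightarrow> 'x \<Rightarrow> (int \<Rightarrow> 'x) \<Rightarrow> ennreal"
    assume l: "l \<le> ?l" and u: "?u \<le> u"
      and phi: "(\<lambda>p. \<phi> (fst p) (fst (snd p)) (snd (snd p))) \<in> borel_measurable (M \<Otimes>\<^sub>M (M \<Otimes>\<^sub>M PiM {a..b} (\<lambda>_. M)))"
    define \<psi> where "\<psi> x = \<phi> (x l) (x u) (restrict x {a..b})" for x
    have "(\<lambda>x. (x l, x u, restrict x {a..b})) \<in> measurable (PiM UNIV (\<lambda>_::int. M)) (M \<Otimes>\<^sub>M (M \<Otimes>\<^sub>M PiM {a..b} (\<lambda>_. M)))"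
      by (intro measurable_Pair measurable_restrict_subset measurable_component_singleton) auto
    from measurable_compose[OF this phi] have psi: "\<psi> \<in> borel_measurable (PiM UNIV (\<lambda>_::int. M))"
      by (simp add: \<psi>_def[abs_def])
    have JJ: "?J = {a - int n..b + int n}" by auto
    have sub: "{a..b} \<subseteq> ?J" by auto
    have "(\<integral>\<^sup>+\<omega>. \<phi> (X l \<omega>) (X u \<omega>) (\<lambda>t\<in>{a..b}. X t \<omega>) \<partial>Q) = (\<integral>\<^sup>+\<omega>. \<psi> (\<lambda>t. X t \<omega>) \<partial>Q)"
      by (simp add: \<psi>_def)
    also have "\<dots> = (\<integral>\<^sup>+\<omega>. H \<omega> * (\<integral>\<^sup>+z. ennreal (path_weight ?l ?u (override ?J (\<lambda>t. X t \<omega>) z)) *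
         \<psi> (override ?J (\<lambda>t. X t \<omega>) z) \<partial>PiM ?J (\<lambda>_. M)) \<partial>Q)"
      by (rule eq[OF psi])
    also have "\<dots> = (\<integral>\<^sup>+\<omega>. H \<omega> * (\<integral>\<^sup>+z. kl n (X ?l \<omega>) (z a) * kr n (X ?u \<omega>) (z b) * ennreal (path_weight a b z) *
       \<phi> (X l \<omega>) (X u \<omega>) z \<partial>PiM {a..b} (\<lambda>_. M)) \<partial>Q)"
    proof (rule nn_integral_cong, rule arg_cong[where f="(*) _"])
      fix \<omega> assume w: "\<omega> \<in> space Q"
      have sp[measurable]: "X t \<omega> \<in> space M" for t using measurable_space[OF X w] .
      have pm: "\<phi> (X l \<omega>) (X u \<omega>) \<in> borel_measurable (PiM {a..b} (\<lambda>_. M))"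
      proof -
        have "(\<lambda>z. (X l \<omega>, X u \<omega>, z)) \<in> measurable (PiM {a..b} (\<lambda>_. M)) (M \<Otimes>\<^sub>M (M \<Otimes>\<^sub>M PiM {a..b} (\<lambda>_. M)))"
          by measurable
        from measurable_compose[OF this phi] show ?thesis by simp
      qed
      have e: "ennreal (path_weight ?l ?u (override ?J (\<lambda>t. X t \<omega>) z)) * \<psi> (override ?J (\<lambda>t. X t \<omega>) z)
        = ennreal (K (X ?l \<omega>) (z (a - int n))) * ennreal (path_weight (a - int n) (b + int n) z) * ennreal (K (z (b + int n)) (X ?u \<omega>))
          * \<phi> (X l \<omega>) (X u \<omega>) (restrict z {a..b})" for z
      proof -
        let ?o = "override ?J (\<lambda>t. X t \<omega>) z"
        have ol: "?o ?l = X ?l \<omega>" "?o ?u = X ?u \<omega>" "?o (a - int n) = z (a - int n)" "?o (b + int n) = z (b + int n)"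
          "?o l = X l \<omega>" "?o u = X u \<omega>"
          using ab l u by (auto simp: override_def)
        have orr: "restrict ?o {a..b} = restrict z {a..b}" using sub by (auto simp: override_def restrict_def fun_eq_iff)
        have pw: "path_weight (a - int n) (b + int n) ?o = path_weight (a - int n) (b + int n) z"
          by (rule path_weight_cong) (auto simp: override_def)
        have e1: "?l + 1 = a - int n" and e2: "b + int n + 1 = ?u" by simp_all
        have pl: "path_weight ?l ?u ?o = K (?o ?l) (?o (a - int n)) * path_weight (a - int n) ?u ?o"
          using path_weight_left[OF lu, of ?o] unfolding e1 .
        have "a - int n \<le> b + int n" using ab by simp
        from path_weight_right[OF this, of ?o]
        have pr: "path_weight (a - int n) ?u ?o = path_weight (a - int n) (b + int n) ?o * K (?o (b + int n)) (?o ?u)"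
          unfolding e2 .
        have "path_weight ?l ?u ?o = K (X ?l \<omega>) (z (a - int n)) * (path_weight (a - int n) (b + int n) z * K (z (b + int n)) (X ?u \<omega>))"
          unfolding pl pr ol pw ..
        then show ?thesis unfolding \<psi>_def ol orr by (simp add: ennreal_mult' mult_ac)
      qed
      show "(\<integral>\<^sup>+z. ennreal (path_weight ?l ?u (override ?J (\<lambda>t. X t \<omega>) z)) * \<psi> (override ?J (\<lambda>t. X t \<omega>) z) \<partial>PiM ?J (\<lambda>_. M))
        = (\<integral>\<^sup>+z. kl n (X ?l \<omega>) (z a) * kr n (X ?u \<omega>) (z b) * ennreal (path_weight a b z) * \<phi> (X l \<omega>) (X u \<omega>) z \<partial>PiM {a..b} (\<lambda>_. M))"
        unfolding e unfolding JJ by (rule gap_integral[OF ab sp sp pm])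
    qed
    finally show "(\<integral>\<^sup>+\<omega>. \<phi> (X l \<omega>) (X u \<omega>) (\<lambda>t\<in>{a..b}. X t \<omega>) \<partial>Q) =
      (\<integral>\<^sup>+\<omega>. H \<omega> * (\<integral>\<^sup>+z. kl n (X ?l \<omega>) (z a) * kr n (X ?u \<omega>) (z b) * ennreal (path_weight a b z) *
       \<phi> (X l \<omega>) (X u \<omega>) z \<partial>PiM {a..b} (\<lambda>_. M)) \<partial>Q)" .
  qed
qed

end

context principal_pair
begin

text \<open>For a block of one site the Gibbs formula integrates against \<open>M\<close>, so null
  sets of \<open>M\<close> get probability 0. This is what allows statements true for almost every
  boundary value under \<open>M\<close> to be applied to the random ones.\<close>

lemma gibbs_absolutely_continuous:
  assumes g: "gibbs Q X"
  shows "absolutely_continuous M (distr Q M (X t))"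
  unfolding absolutely_continuous_def
proof
  fix N assume N: "N \<in> null_sets M"
  have X[measurable]: "X t \<in> measurable Q M" for t using g by (simp add: gibbs_def)
  have [measurable]: "N \<in> sets M" using N by auto
  obtain H where H: "\<And>\<phi>. (\<lambda>p. \<phi> (fst p) (fst (snd p)) (snd (snd p))) \<in> borel_measurable (M \<Otimes>\<^sub>M (M \<Otimes>\<^sub>M PiM {t..t} (\<lambda>_. M))) \<Longrightarrow>
    (\<integral>\<^sup>+\<omega>. \<phi> (X (t-1) \<omega>) (X (t+1) \<omega>) (\<lambda>t\<in>{t..t}. X t \<omega>) \<partial>Q) =
    (\<integral>\<^sup>+\<omega>. H \<omega> * (\<integral>\<^sup>+z. kl 0 (X (t - 1 - int 0) \<omega>) (z t) * kr 0 (X (t + 1 + int 0) \<omega>) (z t) * ennreal (path_weight t t z) *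
       \<phi> (X (t-1) \<omega>) (X (t+1) \<omega>) z \<partial>PiM {t..t} (\<lambda>_. M)) \<partial>Q)"
    using gibbs_block[OF g order_refl, of t 0] by auto
  have mem: "t \<in> {t..t}" by simp
  have ae: "AE z in PiM {t..t} (\<lambda>_. M). z t \<notin> N"
    using N by (intro AE_component) (auto intro: AE_not_in)
  have "emeasure (distr Q M (X t)) N = (\<integral>\<^sup>+\<omega>. indicator N (X t \<omega>) \<partial>Q)"
    by (subst nn_integral_distr[OF X, of "indicator N", symmetric]) auto
  also have "\<dots> = (\<integral>\<^sup>+\<omega>. (\<lambda>x y z. indicator N (z t)) (X (t-1) \<omega>) (X (t+1) \<omega>) (\<lambda>t\<in>{t..t}. X t \<omega>) \<partial>Q)" by simp
  also have "\<dots> = (\<integral>\<^sup>+\<omega>. H \<omega> * (\<integral>\<^sup>+z. kl 0 (X (t - 1 - int 0) \<omega>) (z t) * kr 0 (X (t + 1 + int 0) \<omega>) (z t) * ennreal (path_weight t t z) *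
       indicator N (z t) \<partial>PiM {t..t} (\<lambda>_. M)) \<partial>Q)"
    using mem by (intro H) measurable
  also have "\<dots> = (\<integral>\<^sup>+\<omega>. H \<omega> * (\<integral>\<^sup>+z. 0 \<partial>PiM {t..t} (\<lambda>_. M)) \<partial>Q)"
    using ae by (intro nn_integral_cong arg_cong[where f="(*) _"] nn_integral_cong_AE) (auto elim!: eventually_mono)
  finally have "emeasure (distr Q M (X t)) N = 0" by simp
  then show "N \<in> null_sets (distr Q M (X t))" by (intro null_setsI) auto
qed

text \<open>The limiting profile is \<open>\<langle>K x, w\<rangle> r\<^sup>n v\<close>, and the
  pairing of the section \<open>K x\<close> with \<open>w\<close> is \<open>T' w\<close> at
  \<open>x\<close>, that is \<open>r * w x\<close>; \<open>d\<close> is the relative error.\<close>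

definition good :: "real \<Rightarrow> nat \<Rightarrow> 'x \<Rightarrow> 'x \<Rightarrow> bool" where
  "good d n x z \<longleftrightarrow> ennreal ((1 - d) * (r * w x) * r ^ n * v z) \<le> kl n x z \<and>
     kl n x z \<le> ennreal ((1 + d) * (r * w x) * r ^ n * v z)"

lemma good_measurable [measurable]: "Measurable.pred (M \<Otimes>\<^sub>M M) (\<lambda>p. good d n (fst p) (snd p))"
  unfolding good_def by measurable

text \<open>For almost every \<open>x\<close> this is \<open>mixing\<close> for the section
  \<open>K x\<close>, with the absolute error \<open>d * (r * w x)\<close>. The masses are at most
  1, so dominated convergence gives the integrated form.\<close>

lemma good_limit:
  assumes "prob_space \<rho>" and sets[measurable_cong]: "sets \<rho> = sets M" and ac: "absolutely_continuous M \<rho>" and d: "0 < d"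
  shows "(\<lambda>n. \<integral>\<^sup>+x. emeasure \<pi> {z\<in>space M. \<not> good d n x z} \<partial>\<rho>) \<longlonglongrightarrow> 0"
proof -
  interpret \<rho>: prob_space \<rho> by fact
  interpret \<pi>: prob_space \<pi> by (rule prob_space_\<pi>)
  have m: "(\<lambda>x. emeasure \<pi> {z\<in>space M. \<not> good d n x z}) \<in> borel_measurable M" for n
  proof -
    have "{p \<in> space (M \<Otimes>\<^sub>M \<pi>). \<not> good d n (fst p) (snd p)} \<in> sets (M \<Otimes>\<^sub>M \<pi>)" by measurable
    from \<pi>.measurable_emeasure_Pair[OF this] show ?thesis
      by (rule measurable_cong[THEN iffD1, rotated]) (auto intro!: arg_cong[where f="emeasure \<pi>"] simp: space_pair_measure)
  qed
  have "AE x in M. (\<lambda>n. emeasure \<pi> {z\<in>space M. \<not> good d n x z}) \<longlonglongrightarrow> 0"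
    using nT'_w AE_space
  proof eventually_elim
    case (elim x)
    have [measurable]: "x \<in> space M" by fact
    have Kw: "(\<integral>\<^sup>+y. ennreal (K x y * w y) \<partial>M) = ennreal (r * w x)"
      using elim(1) by (simp add: nT'_def ennreal_mult')
    have e: "r * w x - d * (r * w x) = (1 - d) * (r * w x)" "r * w x + d * (r * w x) = (1 + d) * (r * w x)"
      by (simp_all add: algebra_simps)
    have c: "0 < r * w x" using r_pos w_pos[of x] by simp
    show ?case
      using mixing[OF _ _ c Kw, of "d * (r * w x)"] d c unfolding e good_def kl_def by simp
  qed
  then have "AE x in \<rho>. (\<lambda>n. emeasure \<pi> {z\<in>space M. \<not> good d n x z}) \<longlonglongrightarrow> 0"
    using absolutely_continuous_AE[OF sets ac] by blast
  then have "(\<lambda>n. \<integral>\<^sup>+x. emeasure \<pi> {z\<in>space M. \<not> good d n x z} \<partial>\<rho>) \<longlonglongrightarrow> (\<integral>\<^sup>+x. 0 \<partial>\<rho>)"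
    using m by (intro nn_integral_dominated_convergence[where w="\<lambda>_. 1"]) (auto intro: \<pi>.emeasure_le_1 simp: \<rho>.emeasure_space_1 cong: measurable_cong_sets)
  then show ?thesis by simp
qed

text \<open>Up to events whose probability vanishes as the boundary recedes, the law of the block is
  at most \<open>(1 + d)\<^sup>2 / (1 - d)\<^sup>3\<close> times \<open>chain a b\<close>. Letting
  \<open>d\<close> tend to 0 leaves an inequality between probability measures.\<close>

theorem gibbs_unique:
  assumes g: "gibbs Q X" and ab: "a \<le> b"
  shows "distr Q (PiM {a..b} (\<lambda>_. M)) (\<lambda>\<omega>. \<lambda>t\<in>{a..b}. X t \<omega>) = chain a b"
proof -
  interpret Q: prob_space Q using g by (simp add: gibbs_def)
  interpret tr: principal_pair M "\<lambda>x y. K y x" r w v by (rule transpose_pair)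
  interpret \<Pi>: prob_space "chain a b" by (rule prob_space_chain[OF ab])
  interpret Q\<Pi>: pair_sigma_finite Q "chain a b" ..
  have trT: "tr.nT = nT'" by (simp add: fun_eq_iff tr.nT_def nT'_def)
  have trkl: "tr.kl n y z = kr n y z" for n y z by (simp add: tr.kl_def kr_def trT)
  have tr\<pi>: "tr.\<pi> = \<pi>" by (simp add: tr.\<pi>_def \<pi>_def mult.commute)
  have X[measurable]: "X t \<in> measurable Q M" for t using g by (simp add: gibbs_def)
  define \<rho> where "\<rho> = distr Q M (X 0)"
  have X\<rho>: "distr Q M (X t) = \<rho>" for t using g by (simp add: gibbs_def \<rho>_def)
  have \<rho>: "prob_space \<rho>" unfolding \<rho>_def by (rule Q.prob_space_distr) simp
  have ac: "absolutely_continuous M \<rho>" unfolding \<rho>_def by (rule gibbs_absolutely_continuous[OF g])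
  have [simp]: "sets \<rho> = sets M" by (simp add: \<rho>_def)
  let ?P = "PiM {a..b} (\<lambda>_. M)"
  define B where "B \<omega> = (\<lambda>t\<in>{a..b}. X t \<omega>)" for \<omega>
  have B[measurable]: "B \<in> measurable Q ?P" unfolding B_def by measurable
  have memI: "a \<in> {a..b}" "b \<in> {a..b}" using ab by auto
  have mem[measurable]: "(\<lambda>z. z a) \<in> measurable ?P M" "(\<lambda>z. z b) \<in> measurable ?P M"
    using memI by (auto intro: measurable_component_singleton)
  define L where "L n = a - 1 - int n" for n
  define U where "U n = b + 1 + int n" for n
  txt \<open>\<open>Good\<close>: seen from the boundary values \<open>x\<close>, \<open>y\<close> at distance \<open>n\<close>, both iterated kernels are within a
    factor \<open>1 \<plusminus> d\<close> of their limits at the ends of the block \<open>z\<close>.\<close>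
  define Good where "Good d n x y z \<longleftrightarrow> good d n x (z a) \<and> tr.good d n y (z b)" for d n x y and z :: "int \<Rightarrow> 'x"
  have Good_m[measurable (raw)]: "Measurable.pred N (\<lambda>p. Good d n (f1 p) (f2 p) (f3 p))"
    if [measurable]: "f1 \<in> measurable N M" "f2 \<in> measurable N M" "f3 \<in> measurable N ?P" for N d n f1 f2 f3
    unfolding Good_def good_def tr.good_def trkl by measurable
  \<comment> \<open>Probability under the chain, not under \<open>Q\<close>, that the block fails to
    be good for fixed boundary values; \<open>bad\<close> inserts the random ones.\<close>
  define \<beta> where "\<beta> d n x y = emeasure (chain a b) {z\<in>space ?P. \<not> Good d n x y z}" for d n x y
  have \<beta>_m[measurable]: "(\<lambda>p. \<beta> d n (fst p) (snd p)) \<in> borel_measurable (M \<Otimes>\<^sub>M M)" for d n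
  proof -
    have "{p \<in> space ((M \<Otimes>\<^sub>M M) \<Otimes>\<^sub>M chain a b). \<not> Good d n (fst (fst p)) (snd (fst p)) (snd p)} \<in> sets ((M \<Otimes>\<^sub>M M) \<Otimes>\<^sub>M chain a b)"
      by measurable
    from \<Pi>.measurable_emeasure_Pair[OF this] show ?thesis
      unfolding \<beta>_def
      by (rule measurable_cong[THEN iffD1, rotated]) (auto intro!: arg_cong[where f="emeasure (chain a b)"] simp: space_pair_measure)
  qed
  have \<beta>_m2[measurable (raw)]: "(\<lambda>p. \<beta> d n (f1 p) (f2 p)) \<in> borel_measurable N"
    if "f1 \<in> measurable N M" "f2 \<in> measurable N M" for N d n f1 f2
    using measurable_compose[OF measurable_Pair[OF that] \<beta>_m] by simp
  define bad where "bad d n \<omega> = \<beta> d n (X (L n) \<omega>) (X (U n) \<omega>)" for d n \<omega>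
  have bad_m[measurable]: "bad d n \<in> borel_measurable Q" for d n unfolding bad_def by measurable
  have marg: "emeasure (chain a b) {z\<in>space ?P. R (z t)} = emeasure \<pi> {x\<in>space M. R x}"
    if t: "a \<le> t" "t \<le> b" and [measurable]: "Measurable.pred M R" for R t
  proof -
    have tm: "(\<lambda>z. z t) \<in> measurable ?P M" using t by (intro measurable_component_singleton) auto
    note tm[measurable]
    have "emeasure (chain a b) {z\<in>space ?P. R (z t)} = (\<integral>\<^sup>+z. indicator {z\<in>space ?P. R (z t)} z \<partial>chain a b)"
      by (subst nn_integral_indicator) auto
    also have "\<dots> = (\<integral>\<^sup>+z. indicator {x\<in>space M. R x} (z t) \<partial>chain a b)"
      using measurable_space[OF tm] by (intro nn_integral_cong) (auto simp: indicator_def)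
    also have "\<dots> = (\<integral>\<^sup>+x. indicator {x\<in>space M. R x} x \<partial>\<pi>)"
      by (rule chain_marginal[OF t]) measurable
    also have "\<dots> = emeasure \<pi> {x\<in>space M. R x}" by (subst nn_integral_indicator) auto
    finally show ?thesis .
  qed
  \<comment> \<open>A union bound splits the two ends of the block. Each half depends on one
    boundary value only, whose law is \<open>\<rho>\<close> at every distance by stationarity, so
    \<open>good_limit\<close> applies.\<close>
  have bad_lim: "(\<lambda>n. \<integral>\<^sup>+\<omega>. bad d n \<omega> \<partial>Q) \<longlonglongrightarrow> 0" if d: "0 < d" for d
  proof -
    let ?l = "\<lambda>n x. emeasure \<pi> {z\<in>space M. \<not> good d n x z}"
    let ?u = "\<lambda>n y. emeasure \<pi> {z\<in>space M. \<not> tr.good d n y z}"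
    interpret \<pi>: prob_space \<pi> by (rule prob_space_\<pi>)
    have tgm[measurable]: "Measurable.pred (M \<Otimes>\<^sub>M M) (\<lambda>p. tr.good d n (fst p) (snd p))" for n
      by (rule tr.good_measurable)
    have lm: "?l n \<in> borel_measurable M" "?u n \<in> borel_measurable M" for n
    proof -
      have "{p \<in> space (M \<Otimes>\<^sub>M \<pi>). \<not> good d n (fst p) (snd p)} \<in> sets (M \<Otimes>\<^sub>M \<pi>)" by measurable
      from \<pi>.measurable_emeasure_Pair[OF this] show "?l n \<in> borel_measurable M"
        by (rule measurable_cong[THEN iffD1, rotated]) (auto intro!: arg_cong[where f="emeasure \<pi>"] simp: space_pair_measure)
      have "{p \<in> space (M \<Otimes>\<^sub>M \<pi>). \<not> tr.good d n (fst p) (snd p)} \<in> sets (M \<Otimes>\<^sub>M \<pi>)" by measurable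
      from \<pi>.measurable_emeasure_Pair[OF this] show "?u n \<in> borel_measurable M"
        by (rule measurable_cong[THEN iffD1, rotated]) (auto intro!: arg_cong[where f="emeasure \<pi>"] simp: space_pair_measure)
    qed
    have le: "(\<integral>\<^sup>+\<omega>. bad d n \<omega> \<partial>Q) \<le> (\<integral>\<^sup>+x. ?l n x \<partial>\<rho>) + (\<integral>\<^sup>+y. ?u n y \<partial>\<rho>)" for n
    proof -
      have "(\<integral>\<^sup>+\<omega>. bad d n \<omega> \<partial>Q) \<le> (\<integral>\<^sup>+\<omega>. ?l n (X (L n) \<omega>) + ?u n (X (U n) \<omega>) \<partial>Q)"
      proof (rule nn_integral_mono)
        fix \<omega> assume w: "\<omega> \<in> space Q"
        have [measurable]: "X t \<omega> \<in> space M" for t using measurable_space[OF X w] .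
        have gm: "Measurable.pred M (\<lambda>z. \<not> good d n (X (L n) \<omega>) z)" "Measurable.pred M (\<lambda>z. \<not> tr.good d n (X (U n) \<omega>) z)"
          using measurable_compose[of "\<lambda>z. (X (L n) \<omega>, z)" M "M \<Otimes>\<^sub>M M", OF _ good_measurable[of d n]]
            measurable_compose[of "\<lambda>z. (X (U n) \<omega>, z)" M "M \<Otimes>\<^sub>M M", OF _ tgm[of n]] by simp_all
        have gma: "{z\<in>space ?P. \<not> good d n (X (L n) \<omega>) (z a)} \<in> sets (chain a b)"
          using measurable_compose[OF mem(1) gm(1)] by (simp add: pred_def)
        have gmb: "{z\<in>space ?P. \<not> tr.good d n (X (U n) \<omega>) (z b)} \<in> sets (chain a b)"
          using measurable_compose[OF mem(2) gm(2)] by (simp add: pred_def)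
        have "bad d n \<omega> \<le> emeasure (chain a b) ({z\<in>space ?P. \<not> good d n (X (L n) \<omega>) (z a)} \<union> {z\<in>space ?P. \<not> tr.good d n (X (U n) \<omega>) (z b)})"
          unfolding bad_def \<beta>_def using gma gmb by (intro emeasure_mono) (auto simp: Good_def)
        also have "\<dots> \<le> emeasure (chain a b) {z\<in>space ?P. \<not> good d n (X (L n) \<omega>) (z a)} + emeasure (chain a b) {z\<in>space ?P. \<not> tr.good d n (X (U n) \<omega>) (z b)}"
          by (rule emeasure_subadditive[OF gma gmb])
        also have "\<dots> = ?l n (X (L n) \<omega>) + ?u n (X (U n) \<omega>)"
          using marg[OF order_refl ab gm(1)] marg[OF ab order_refl gm(2)] by simp
        finally show "bad d n \<omega> \<le> ?l n (X (L n) \<omega>) + ?u n (X (U n) \<omega>)" .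
      qed
      also have "\<dots> = (\<integral>\<^sup>+\<omega>. ?l n (X (L n) \<omega>) \<partial>Q) + (\<integral>\<^sup>+\<omega>. ?u n (X (U n) \<omega>) \<partial>Q)"
        by (intro nn_integral_add measurable_compose[OF X lm(1)] measurable_compose[OF X lm(2)])
      also have "\<dots> = (\<integral>\<^sup>+x. ?l n x \<partial>distr Q M (X (L n))) + (\<integral>\<^sup>+y. ?u n y \<partial>distr Q M (X (U n)))"
        using lm by (simp add: nn_integral_distr)
      finally show ?thesis unfolding X\<rho> .
    qed
    have "(\<lambda>n. (\<integral>\<^sup>+x. ?l n x \<partial>\<rho>) + (\<integral>\<^sup>+y. ?u n y \<partial>\<rho>)) \<longlonglongrightarrow> 0 + 0"
      using good_limit[OF \<rho> _ ac d] tr.good_limit[OF \<rho> _ ac d] unfolding tr\<pi> by (intro tendsto_add) simp_all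
    then have z: "(\<lambda>n. (\<integral>\<^sup>+x. ?l n x \<partial>\<rho>) + (\<integral>\<^sup>+y. ?u n y \<partial>\<rho>)) \<longlonglongrightarrow> 0" by simp
    show ?thesis by (rule tendsto_sandwich[OF _ _ tendsto_const z]) (simp_all add: le)
  qed
  \<comment> \<open>Here boundary and block are taken jointly under \<open>Q\<close>; they may be
    dependent, so \<open>bad_lim\<close> alone says nothing about this probability.\<close>
  define p where "p d n = (\<integral>\<^sup>+\<omega>. (if Good d n (X (L n) \<omega>) (X (U n) \<omega>) (B \<omega>) then 0 else 1) \<partial>Q)" for d n
  obtain H0 where H0[measurable]: "H0 \<in> borel_measurable Q" and H0_eq: "\<And>l u \<phi>. l \<le> a - 1 - int 0 \<Longrightarrow> b + 1 + int 0 \<le> u \<Longrightarrow>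
    (\<lambda>p. \<phi> (fst p) (fst (snd p)) (snd (snd p))) \<in> borel_measurable (M \<Otimes>\<^sub>M (M \<Otimes>\<^sub>M ?P)) \<Longrightarrow>
    (\<integral>\<^sup>+\<omega>. \<phi> (X l \<omega>) (X u \<omega>) (\<lambda>t\<in>{a..b}. X t \<omega>) \<partial>Q) =
    (\<integral>\<^sup>+\<omega>. H0 \<omega> * (\<integral>\<^sup>+z. kl 0 (X (a - 1 - int 0) \<omega>) (z a) * kr 0 (X (b + 1 + int 0) \<omega>) (z b) * ennreal (path_weight a b z) *
       \<phi> (X l \<omega>) (X u \<omega>) z \<partial>?P) \<partial>Q)"
    using gibbs_block[OF g ab, of 0] by blast
  define rr where "rr = r ^ nat (b - a)"
  have rr: "0 < rr" unfolding rr_def using r_pos by simp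
  txt \<open>The joint law of the far boundary and the block has one density \<open>D\<close> with respect to \<open>Q \<Otimes> chain a b\<close> for
    all distances \<open>n\<close>, so sets that are small for the product are small under \<open>Q\<close>.\<close>
  define D where "D q = H0 (fst q) * (kl 0 (X (a - 1) (fst q)) (snd q a) * kr 0 (X (b + 1) (fst q)) (snd q b) * ennreal (rr / (v (snd q a) * w (snd q b))))" for q
  have mem2[measurable]: "(\<lambda>q. snd q a) \<in> measurable (Q \<Otimes>\<^sub>M chain a b) M" "(\<lambda>q. snd q b) \<in> measurable (Q \<Otimes>\<^sub>M chain a b) M"
    using measurable_compose[OF measurable_snd mem(1), of Q] measurable_compose[OF measurable_snd mem(2), of Q]
    by (simp_all cong: measurable_cong_sets)
  have D_m[measurable]: "D \<in> borel_measurable (Q \<Otimes>\<^sub>M chain a b)" unfolding D_def by measurable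
  have sndP[measurable]: "snd \<in> measurable (Q \<Otimes>\<^sub>M chain a b) ?P"
    using measurable_snd[of Q "chain a b"] by (simp cong: measurable_cong_sets)
  have D_eq: "(\<integral>\<^sup>+\<omega>. \<phi> (X l \<omega>) (X u \<omega>) (B \<omega>) \<partial>Q) = (\<integral>\<^sup>+q. D q * \<phi> (X l (fst q)) (X u (fst q)) (snd q) \<partial>(Q \<Otimes>\<^sub>M chain a b))"
    if l: "l \<le> a - 1" and u: "b + 1 \<le> u"
      and phi: "(\<lambda>p. \<phi> (fst p) (fst (snd p)) (snd (snd p))) \<in> borel_measurable (M \<Otimes>\<^sub>M (M \<Otimes>\<^sub>M ?P))" for l u \<phi>
  proof -
    have pm[measurable]: "(\<lambda>q. \<phi> (X l (fst q)) (X u (fst q)) (snd q)) \<in> borel_measurable (Q \<Otimes>\<^sub>M chain a b)"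
      using measurable_compose[of "\<lambda>q. (X l (fst q), (X u (fst q), snd q))" "Q \<Otimes>\<^sub>M chain a b", OF _ phi] by simp
    have "(\<integral>\<^sup>+q. D q * \<phi> (X l (fst q)) (X u (fst q)) (snd q) \<partial>(Q \<Otimes>\<^sub>M chain a b))
      = (\<integral>\<^sup>+\<omega>. \<integral>\<^sup>+z. D (\<omega>, z) * \<phi> (X l \<omega>) (X u \<omega>) z \<partial>chain a b \<partial>Q)"
      by (subst \<Pi>.nn_integral_fst[symmetric]) simp_all
    also have "\<dots> = (\<integral>\<^sup>+\<omega>. H0 \<omega> * (\<integral>\<^sup>+z. kl 0 (X (a - 1 - int 0) \<omega>) (z a) * kr 0 (X (b + 1 + int 0) \<omega>) (z b) * ennreal (path_weight a b z) *
       \<phi> (X l \<omega>) (X u \<omega>) z \<partial>?P) \<partial>Q)"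
    proof (rule nn_integral_cong)
      fix \<omega> assume w: "\<omega> \<in> space Q"
      have [measurable]: "X t \<omega> \<in> space M" for t using measurable_space[OF X w] .
      have pm2[measurable]: "(\<lambda>z. \<phi> (X l \<omega>) (X u \<omega>) z) \<in> borel_measurable ?P"
        using measurable_compose[of "\<lambda>z. (X l \<omega>, (X u \<omega>, z))" ?P, OF _ phi] by simp
      have Dm: "(\<lambda>z. D (\<omega>, z) * \<phi> (X l \<omega>) (X u \<omega>) z) \<in> borel_measurable ?P"
        unfolding D_def fst_conv snd_conv by measurable
      have "(\<integral>\<^sup>+z. D (\<omega>, z) * \<phi> (X l \<omega>) (X u \<omega>) z \<partial>chain a b)
        = (\<integral>\<^sup>+z. ennreal (v (z a) * path_weight a b z * w (z b) / rr) * (D (\<omega>, z) * \<phi> (X l \<omega>) (X u \<omega>) z) \<partial>?P)"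
        unfolding rr_def by (rule nn_integral_chain[OF ab Dm])
      also have "\<dots> = (\<integral>\<^sup>+z. H0 \<omega> * (kl 0 (X (a - 1) \<omega>) (z a) * kr 0 (X (b + 1) \<omega>) (z b) * ennreal (path_weight a b z) * \<phi> (X l \<omega>) (X u \<omega>) z) \<partial>?P)"
      proof (rule nn_integral_cong)
        fix z
        \<comment> \<open>The factor \<open>rr / (v w)\<close> in \<open>D\<close> strips the chain
          density down to the bare path weight.\<close>
        have "ennreal (v (z a) * path_weight a b z * w (z b) / rr) * ennreal (rr / (v (z a) * w (z b))) = ennreal (path_weight a b z)"
          using rr by (simp add: ennreal_mult''[symmetric])
        then show "ennreal (v (z a) * path_weight a b z * w (z b) / rr) * (D (\<omega>, z) * \<phi> (X l \<omega>) (X u \<omega>) z)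
          = H0 \<omega> * (kl 0 (X (a - 1) \<omega>) (z a) * kr 0 (X (b + 1) \<omega>) (z b) * ennreal (path_weight a b z) * \<phi> (X l \<omega>) (X u \<omega>) z)"
          unfolding D_def fst_conv snd_conv by (metis (no_types, lifting) mult.commute mult.left_commute)
      qed
      also have "\<dots> = H0 \<omega> * (\<integral>\<^sup>+z. kl 0 (X (a - 1) \<omega>) (z a) * kr 0 (X (b + 1) \<omega>) (z b) * ennreal (path_weight a b z) * \<phi> (X l \<omega>) (X u \<omega>) z \<partial>?P)"
        by (rule nn_integral_cmult) measurable
      finally show "(\<integral>\<^sup>+z. D (\<omega>, z) * \<phi> (X l \<omega>) (X u \<omega>) z \<partial>chain a b)
        = H0 \<omega> * (\<integral>\<^sup>+z. kl 0 (X (a - 1 - int 0) \<omega>) (z a) * kr 0 (X (b + 1 + int 0) \<omega>) (z b) * ennreal (path_weight a b z) *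
       \<phi> (X l \<omega>) (X u \<omega>) z \<partial>?P)" by simp
    qed
    also have "\<dots> = (\<integral>\<^sup>+\<omega>. \<phi> (X l \<omega>) (X u \<omega>) (B \<omega>) \<partial>Q)"
      unfolding B_def by (rule H0_eq[symmetric]) (use l u phi in auto)
    finally show ?thesis ..
  qed
  have Lm: "L n \<le> a - 1" "b + 1 \<le> U n" for n by (auto simp: L_def U_def)
  have p_lim: "p d \<longlonglongrightarrow> 0" if d: "0 < d" for d
  proof -
    let ?B = "\<lambda>n. {q\<in>space (Q \<Otimes>\<^sub>M chain a b). \<not> Good d n (X (L n) (fst q)) (X (U n) (fst q)) (snd q)}"
    have Bm: "?B n \<in> sets (Q \<Otimes>\<^sub>M chain a b)" for n by measurable
    have "(\<integral>\<^sup>+q. D q \<partial>(Q \<Otimes>\<^sub>M chain a b)) = (\<integral>\<^sup>+\<omega>. 1 \<partial>Q)"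
      using D_eq[OF order_refl order_refl, of "\<lambda>_ _ _. 1"] by simp
    then have fin: "(\<integral>\<^sup>+q. D q \<partial>(Q \<Otimes>\<^sub>M chain a b)) < \<infinity>" by (simp add: Q.emeasure_space_1)
    have eB: "emeasure (Q \<Otimes>\<^sub>M chain a b) (?B n) = (\<integral>\<^sup>+\<omega>. bad d n \<omega> \<partial>Q)" for n
      unfolding bad_def \<beta>_def
      by (subst \<Pi>.emeasure_pair_measure_alt[OF Bm]) (auto intro!: nn_integral_cong arg_cong[where f="emeasure (chain a b)"] simp: space_pair_measure)
    have "(\<lambda>n. \<integral>\<^sup>+q. D q * indicator (?B n) q \<partial>(Q \<Otimes>\<^sub>M chain a b)) \<longlonglongrightarrow> 0"
      by (rule nn_integral_small_sets[OF D_m fin Bm]) (use bad_lim[OF d] in \<open>simp only: eB\<close>)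
    moreover have "(\<integral>\<^sup>+q. D q * indicator (?B n) q \<partial>(Q \<Otimes>\<^sub>M chain a b)) = p d n" for n
    proof -
      have "p d n = (\<integral>\<^sup>+q. D q * (if Good d n (X (L n) (fst q)) (X (U n) (fst q)) (snd q) then 0 else 1) \<partial>(Q \<Otimes>\<^sub>M chain a b))"
        unfolding p_def by (rule D_eq[OF Lm, of "\<lambda>x y z. if Good d n x y z then 0 else 1" n n]) measurable
      also have "\<dots> = (\<integral>\<^sup>+q. D q * indicator (?B n) q \<partial>(Q \<Otimes>\<^sub>M chain a b))"
        by (intro nn_integral_cong) (auto simp: indicator_def)
      finally show ?thesis ..
    qed
    ultimately show ?thesis by simp
  qed
  txt \<open>On good configurations the block density is \<open>chain a b\<close> times a function of the boundary, up to
    \<open>1 \<plusminus> d\<close>; total mass at most \<open>1\<close> bounds the integral \<open>\<alpha>\<close> of that function.\<close>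
  have upper: "emeasure (distr Q ?P B) S \<le> ennreal ((1 + d)\<^sup>2 / (1 - d)^3) * emeasure (chain a b) S"
    if S[measurable]: "S \<in> sets ?P" and d: "0 < d" "d < 1" for S d
  proof -
    \<comment> \<open>Probability of a boundary for which bad blocks have chain mass above
      \<open>d\<close>; it vanishes by Markov's inequality.\<close>
    define e where "e n = (\<integral>\<^sup>+\<omega>. (if bad d n \<omega> \<le> ennreal d then 0 else 1) \<partial>Q)" for n
    have e_lim: "e \<longlonglongrightarrow> 0"
    proof -
      have le: "e n \<le> (\<integral>\<^sup>+\<omega>. bad d n \<omega> \<partial>Q) * ennreal (1 / d)" for n
      proof -
        have "e n \<le> (\<integral>\<^sup>+\<omega>. bad d n \<omega> * ennreal (1 / d) \<partial>Q)"
          unfolding e_def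
        proof (rule nn_integral_mono)
          fix \<omega>
          have "1 \<le> bad d n \<omega> * ennreal (1 / d)" if "\<not> bad d n \<omega> \<le> ennreal d"
          proof -
            have "1 = ennreal d * ennreal (1 / d)" using d by (simp add: ennreal_mult'[symmetric])
            also have "\<dots> \<le> bad d n \<omega> * ennreal (1 / d)" using that by (intro mult_right_mono) auto
            finally show ?thesis .
          qed
          then show "(if bad d n \<omega> \<le> ennreal d then 0 else 1) \<le> bad d n \<omega> * ennreal (1 / d)" by simp
        qed
        also have "\<dots> = (\<integral>\<^sup>+\<omega>. bad d n \<omega> \<partial>Q) * ennreal (1 / d)" by (rule nn_integral_multc) measurable
        finally show ?thesis .
      qed
      have "(\<lambda>n. ennreal (1 / d) * (\<integral>\<^sup>+\<omega>. bad d n \<omega> \<partial>Q)) \<longlonglongrightarrow> ennreal (1 / d) * 0"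
        by (intro ennreal_tendsto_cmult bad_lim d) simp
      then have z: "(\<lambda>n. (\<integral>\<^sup>+\<omega>. bad d n \<omega> \<partial>Q) * ennreal (1 / d)) \<longlonglongrightarrow> 0" by (simp add: mult.commute)
      show ?thesis by (rule tendsto_sandwich[OF _ _ tendsto_const z]) (simp_all add: le)
    qed
    have main: "emeasure (distr Q ?P B) S \<le> (p d n + e n) + ennreal ((1 + d)\<^sup>2 / (1 - d)^3) * emeasure (chain a b) S" for n
    proof -
      obtain H where H[measurable]: "H \<in> borel_measurable Q" and H_eq: "\<And>\<phi>.
        (\<lambda>p. \<phi> (fst p) (fst (snd p)) (snd (snd p))) \<in> borel_measurable (M \<Otimes>\<^sub>M (M \<Otimes>\<^sub>M ?P)) \<Longrightarrow>
        (\<integral>\<^sup>+\<omega>. \<phi> (X (L n) \<omega>) (X (U n) \<omega>) (B \<omega>) \<partial>Q) =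
        (\<integral>\<^sup>+\<omega>. H \<omega> * (\<integral>\<^sup>+z. kl n (X (L n) \<omega>) (z a) * kr n (X (U n) \<omega>) (z b) * ennreal (path_weight a b z) *
           \<phi> (X (L n) \<omega>) (X (U n) \<omega>) z \<partial>?P) \<partial>Q)"
        using gibbs_block[OF g ab, of n] unfolding L_def U_def B_def by blast
      \<comment> \<open>The part of the limiting block density that depends on the boundary alone.
        The factor \<open>rr\<close> compensates the power of \<open>r\<close> in the density of
        \<open>chain a b\<close>.\<close>
      define c where "c \<omega> = (r * w (X (L n) \<omega>)) * r ^ n * ((r * v (X (U n) \<omega>)) * r ^ n) * rr" for \<omega>
      have c0: "0 \<le> c \<omega>" for \<omega> unfolding c_def using rr by (intro mult_nonneg_nonneg) auto
      have [measurable]: "c \<in> borel_measurable Q" unfolding c_def by measurable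
      define \<phi> where "\<phi> A x y z = (if \<beta> d n x y \<le> ennreal d \<and> Good d n x y z then indicator A z else 0 :: ennreal)" for A x y z
      have phi_m: "(\<lambda>p. \<phi> A (fst p) (fst (snd p)) (snd (snd p))) \<in> borel_measurable (M \<Otimes>\<^sub>M (M \<Otimes>\<^sub>M ?P))"
        if [measurable]: "A \<in> sets ?P" for A
        unfolding \<phi>_def by measurable
      define q where "q \<omega> = (if bad d n \<omega> \<le> ennreal d then 1 else 0 :: ennreal)" for \<omega>
      have [measurable]: "q \<in> borel_measurable Q" unfolding q_def by measurable
      define \<alpha> where "\<alpha> = (\<integral>\<^sup>+\<omega>. H \<omega> * (ennreal (c \<omega>) * q \<omega>) \<partial>Q)"
      have chain_c: "(\<integral>\<^sup>+z. ennreal (k * c \<omega> * (v (z a) * path_weight a b z * w (z b) / rr)) * indicator A z \<partial>?P) = ennreal (k * c \<omega>) * emeasure (chain a b) A"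
        if [measurable]: "A \<in> sets ?P" and k: "0 \<le> k" for k \<omega> A
      proof -
        have "emeasure (chain a b) A = (\<integral>\<^sup>+z. ennreal (v (z a) * path_weight a b z * w (z b) / rr) * indicator A z \<partial>?P)"
          unfolding rr_def using nn_integral_chain[OF ab, of "indicator A"] by simp
        then have "ennreal (k * c \<omega>) * emeasure (chain a b) A
          = (\<integral>\<^sup>+z. ennreal (k * c \<omega>) * (ennreal (v (z a) * path_weight a b z * w (z b) / rr) * indicator A z) \<partial>?P)"
          by (simp only:) (rule nn_integral_cmult[symmetric], measurable)
        then show ?thesis
          using k c0[of \<omega>] rr by (simp add: ennreal_mult''[symmetric] mult.assoc[symmetric])
      qed
      have up: "(\<integral>\<^sup>+\<omega>. \<phi> S (X (L n) \<omega>) (X (U n) \<omega>) (B \<omega>) \<partial>Q) \<le> ennreal ((1 + d)\<^sup>2) * emeasure (chain a b) S * \<alpha>"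
      proof -
        have "(\<integral>\<^sup>+\<omega>. \<phi> S (X (L n) \<omega>) (X (U n) \<omega>) (B \<omega>) \<partial>Q) \<le> (\<integral>\<^sup>+\<omega>. (ennreal ((1 + d)\<^sup>2) * emeasure (chain a b) S) * (H \<omega> * (ennreal (c \<omega>) * q \<omega>)) \<partial>Q)"
          unfolding H_eq[OF phi_m[OF S]]
        proof (rule nn_integral_mono)
          fix \<omega>
          have "(\<integral>\<^sup>+z. kl n (X (L n) \<omega>) (z a) * kr n (X (U n) \<omega>) (z b) * ennreal (path_weight a b z) * \<phi> S (X (L n) \<omega>) (X (U n) \<omega>) z \<partial>?P)
            \<le> (\<integral>\<^sup>+z. ennreal ((1 + d)\<^sup>2 * c \<omega> * (v (z a) * path_weight a b z * w (z b) / rr)) * indicator S z \<partial>?P)"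
          proof (rule nn_integral_mono)
            fix z
            show "kl n (X (L n) \<omega>) (z a) * kr n (X (U n) \<omega>) (z b) * ennreal (path_weight a b z) * \<phi> S (X (L n) \<omega>) (X (U n) \<omega>) z
              \<le> ennreal ((1 + d)\<^sup>2 * c \<omega> * (v (z a) * path_weight a b z * w (z b) / rr)) * indicator S z"
            proof (cases "Good d n (X (L n) \<omega>) (X (U n) \<omega>) z")
              case True
              then have "kl n (X (L n) \<omega>) (z a) * kr n (X (U n) \<omega>) (z b) \<le>
                ennreal ((1 + d) * (r * w (X (L n) \<omega>)) * r ^ n * v (z a)) * ennreal ((1 + d) * (r * v (X (U n) \<omega>)) * r ^ n * w (z b))"
                unfolding Good_def good_def tr.good_def trkl by (intro mult_mono) auto
              then have "kl n (X (L n) \<omega>) (z a) * kr n (X (U n) \<omega>) (z b) * ennreal (path_weight a b z) \<le>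
                ennreal ((1 + d) * (r * w (X (L n) \<omega>)) * r ^ n * v (z a)) * ennreal ((1 + d) * (r * v (X (U n) \<omega>)) * r ^ n * w (z b)) * ennreal (path_weight a b z)"
                by (rule mult_right_mono) simp
              also have "\<dots> = ennreal ((1 + d)\<^sup>2 * c \<omega> * (v (z a) * path_weight a b z * w (z b) / rr))"
                using d rr unfolding c_def by (simp add: ennreal_mult'[symmetric] power2_eq_square mult_ac)
              finally show ?thesis
                unfolding \<phi>_def by (intro mult_mono) auto
            qed (simp add: \<phi>_def)
          qed
          also have "\<dots> = ennreal ((1 + d)\<^sup>2 * c \<omega>) * emeasure (chain a b) S" by (rule chain_c) auto
          finally have le: "(\<integral>\<^sup>+z. kl n (X (L n) \<omega>) (z a) * kr n (X (U n) \<omega>) (z b) * ennreal (path_weight a b z) * \<phi> S (X (L n) \<omega>) (X (U n) \<omega>) z \<partial>?P)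
            \<le> ennreal ((1 + d)\<^sup>2 * c \<omega>) * emeasure (chain a b) S" .
          show "H \<omega> * (\<integral>\<^sup>+z. kl n (X (L n) \<omega>) (z a) * kr n (X (U n) \<omega>) (z b) * ennreal (path_weight a b z) * \<phi> S (X (L n) \<omega>) (X (U n) \<omega>) z \<partial>?P)
            \<le> (ennreal ((1 + d)\<^sup>2) * emeasure (chain a b) S) * (H \<omega> * (ennreal (c \<omega>) * q \<omega>))"
          proof (cases "bad d n \<omega> \<le> ennreal d")
            case True
            then have "q \<omega> = 1" by (simp add: q_def)
            then show ?thesis using mult_left_mono[OF le, of "H \<omega>"] c0[of \<omega>] by (simp add: ennreal_mult' mult_ac)
          next
            case False
            then show ?thesis by (simp add: \<phi>_def bad_def[symmetric])
          qed
        qed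
        also have "\<dots> = ennreal ((1 + d)\<^sup>2) * emeasure (chain a b) S * \<alpha>"
          unfolding \<alpha>_def by (rule nn_integral_cmult) measurable
        finally show ?thesis .
      qed
      \<comment> \<open>Two factors \<open>1 - d\<close> come from the kernels at the two ends, the
        third from the chain mass of the good blocks, which is at least \<open>1 - d\<close> where
        \<open>bad\<close> is at most \<open>d\<close>.\<close>
      have low: "ennreal ((1 - d)^3) * \<alpha> \<le> 1"
      proof -
        have "ennreal ((1 - d)^3) * \<alpha> = (\<integral>\<^sup>+\<omega>. ennreal ((1 - d)^3) * (H \<omega> * (ennreal (c \<omega>) * q \<omega>)) \<partial>Q)"
          unfolding \<alpha>_def by (rule nn_integral_cmult[symmetric]) measurable
        also have "\<dots> \<le> (\<integral>\<^sup>+\<omega>. \<phi> (space ?P) (X (L n) \<omega>) (X (U n) \<omega>) (B \<omega>) \<partial>Q)"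
          unfolding H_eq[OF phi_m[OF sets.top]]
        proof (rule nn_integral_mono)
          fix \<omega> assume w: "\<omega> \<in> space Q"
          have [measurable]: "X t \<omega> \<in> space M" for t using measurable_space[OF X w] .
          let ?G = "{z\<in>space ?P. Good d n (X (L n) \<omega>) (X (U n) \<omega>) z}"
          have G[measurable]: "?G \<in> sets ?P" by measurable
          show "ennreal ((1 - d)^3) * (H \<omega> * (ennreal (c \<omega>) * q \<omega>)) \<le>
            H \<omega> * (\<integral>\<^sup>+z. kl n (X (L n) \<omega>) (z a) * kr n (X (U n) \<omega>) (z b) * ennreal (path_weight a b z) * \<phi> (space ?P) (X (L n) \<omega>) (X (U n) \<omega>) z \<partial>?P)"
          proof (cases "bad d n \<omega> \<le> ennreal d")
            case True
            then have q1: "q \<omega> = 1" by (simp add: q_def)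
            have "emeasure (chain a b) (space (chain a b) - ?G) = bad d n \<omega>"
              unfolding bad_def \<beta>_def by (intro arg_cong[where f="emeasure (chain a b)"]) auto
            moreover have "bad d n \<omega> \<noteq> top" using True by (auto simp: top_unique)
            ultimately have "1 - bad d n \<omega> = emeasure (chain a b) ?G"
              using emeasure_compl[of "space (chain a b) - ?G" "chain a b"] G \<Pi>.emeasure_space_1 \<Pi>.emeasure_finite
              by (simp add: double_diff)
            moreover have "ennreal (1 - d) \<le> 1 - bad d n \<omega>"
            proof -
              have "ennreal (1 - d) = 1 - ennreal d" using d by (simp add: ennreal_minus[symmetric] ennreal_1[symmetric] del: ennreal_1)
              also have "\<dots> \<le> 1 - bad d n \<omega>" using True by (intro ennreal_minus_mono) auto
              finally show ?thesis .
            qed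
            ultimately have Gd: "ennreal (1 - d) \<le> emeasure (chain a b) ?G" by simp
            have "ennreal ((1 - d)^3 * c \<omega>) = ennreal ((1 - d)\<^sup>2 * c \<omega>) * ennreal (1 - d)"
              using d c0[of \<omega>] by (simp add: ennreal_mult'[symmetric] power2_eq_square power3_eq_cube mult_ac)
            also have "\<dots> \<le> ennreal ((1 - d)\<^sup>2 * c \<omega>) * emeasure (chain a b) ?G"
              by (rule mult_left_mono[OF Gd]) simp
            also have "\<dots> = (\<integral>\<^sup>+z. ennreal ((1 - d)\<^sup>2 * c \<omega> * (v (z a) * path_weight a b z * w (z b) / rr)) * indicator ?G z \<partial>?P)"
              by (rule chain_c[symmetric, OF G]) simp
            also have "\<dots> \<le> (\<integral>\<^sup>+z. kl n (X (L n) \<omega>) (z a) * kr n (X (U n) \<omega>) (z b) * ennreal (path_weight a b z) * \<phi> (space ?P) (X (L n) \<omega>) (X (U n) \<omega>) z \<partial>?P)"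
            proof (rule nn_integral_mono)
              fix z assume z: "z \<in> space ?P"
              show "ennreal ((1 - d)\<^sup>2 * c \<omega> * (v (z a) * path_weight a b z * w (z b) / rr)) * indicator ?G z
                \<le> kl n (X (L n) \<omega>) (z a) * kr n (X (U n) \<omega>) (z b) * ennreal (path_weight a b z) * \<phi> (space ?P) (X (L n) \<omega>) (X (U n) \<omega>) z"
              proof (cases "Good d n (X (L n) \<omega>) (X (U n) \<omega>) z")
                case G: True
                have "ennreal ((1 - d)\<^sup>2 * c \<omega> * (v (z a) * path_weight a b z * w (z b) / rr))
                  = ennreal ((1 - d) * (r * w (X (L n) \<omega>)) * r ^ n * v (z a)) * ennreal ((1 - d) * (r * v (X (U n) \<omega>)) * r ^ n * w (z b)) * ennreal (path_weight a b z)"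
                  using d rr unfolding c_def by (simp add: ennreal_mult'[symmetric] power2_eq_square mult_ac)
                also have "\<dots> \<le> kl n (X (L n) \<omega>) (z a) * kr n (X (U n) \<omega>) (z b) * ennreal (path_weight a b z)"
                  using G unfolding Good_def good_def tr.good_def trkl by (intro mult_mono) auto
                finally show ?thesis using G True z by (simp add: \<phi>_def bad_def)
              qed simp
            qed
            finally have "ennreal ((1 - d)^3 * c \<omega>) \<le> (\<integral>\<^sup>+z. kl n (X (L n) \<omega>) (z a) * kr n (X (U n) \<omega>) (z b) * ennreal (path_weight a b z) * \<phi> (space ?P) (X (L n) \<omega>) (X (U n) \<omega>) z \<partial>?P)" .
            from mult_left_mono[OF this, of "H \<omega>"] show ?thesis
              using d c0[of \<omega>] unfolding q1 by (simp add: ennreal_mult' mult_ac)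
          qed (simp add: q_def)
        qed
        also have "\<dots> \<le> (\<integral>\<^sup>+\<omega>. 1 \<partial>Q)"
          by (intro nn_integral_mono) (auto simp: \<phi>_def indicator_def)
        finally show ?thesis by (simp add: Q.emeasure_space_1)
      qed
      have "emeasure (distr Q ?P B) S = (\<integral>\<^sup>+\<omega>. indicator S (B \<omega>) \<partial>Q)"
        by (subst nn_integral_distr[OF B, of "indicator S", symmetric]) auto
      also have "\<dots> \<le> (\<integral>\<^sup>+\<omega>. ((if Good d n (X (L n) \<omega>) (X (U n) \<omega>) (B \<omega>) then 0 else 1) + (if bad d n \<omega> \<le> ennreal d then 0 else 1))
          + \<phi> S (X (L n) \<omega>) (X (U n) \<omega>) (B \<omega>) \<partial>Q)"
        by (intro nn_integral_mono) (auto simp: \<phi>_def bad_def indicator_def)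
      also have "\<dots> = (p d n + e n) + (\<integral>\<^sup>+\<omega>. \<phi> S (X (L n) \<omega>) (X (U n) \<omega>) (B \<omega>) \<partial>Q)"
      proof -
        have phm: "(\<lambda>\<omega>. \<phi> S (X (L n) \<omega>) (X (U n) \<omega>) (B \<omega>)) \<in> borel_measurable Q"
          using measurable_compose[of "\<lambda>\<omega>. (X (L n) \<omega>, (X (U n) \<omega>, B \<omega>))" Q, OF _ phi_m[OF S]] by simp
        have "(\<integral>\<^sup>+\<omega>. (if Good d n (X (L n) \<omega>) (X (U n) \<omega>) (B \<omega>) then 0 else 1) + (if bad d n \<omega> \<le> ennreal d then 0 else 1) \<partial>Q) = p d n + e n"
          unfolding p_def e_def by (rule nn_integral_add) measurable
        then show ?thesis
          using nn_integral_add[OF _ phm, of "\<lambda>\<omega>. (if Good d n (X (L n) \<omega>) (X (U n) \<omega>) (B \<omega>) then 0 else 1) + (if bad d n \<omega> \<le> ennreal d then 0 else 1)"]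
          by simp
      qed
      also have "\<dots> \<le> (p d n + e n) + ennreal ((1 + d)\<^sup>2 / (1 - d)^3) * emeasure (chain a b) S"
      proof (rule add_left_mono)
        have "\<alpha> = ennreal (1 / (1 - d)^3) * (ennreal ((1 - d)^3) * \<alpha>)"
          using d by (simp add: mult.assoc[symmetric] ennreal_mult'[symmetric])
        also have "\<dots> \<le> ennreal (1 / (1 - d)^3) * 1" by (rule mult_left_mono[OF low]) simp
        finally have \<alpha>: "\<alpha> \<le> ennreal (1 / (1 - d)^3)" by simp
        have "ennreal ((1 + d)\<^sup>2) * emeasure (chain a b) S * \<alpha> \<le> ennreal ((1 + d)\<^sup>2) * emeasure (chain a b) S * ennreal (1 / (1 - d)^3)"
          by (rule mult_left_mono[OF \<alpha>]) simp
        also have "\<dots> = (ennreal ((1 + d)\<^sup>2) * ennreal (1 / (1 - d)^3)) * emeasure (chain a b) S" by (simp only: mult_ac)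
        also have "ennreal ((1 + d)\<^sup>2) * ennreal (1 / (1 - d)^3) = ennreal ((1 + d)\<^sup>2 / (1 - d)^3)"
          using d by (simp add: ennreal_mult'[symmetric])
        finally show "(\<integral>\<^sup>+\<omega>. \<phi> S (X (L n) \<omega>) (X (U n) \<omega>) (B \<omega>) \<partial>Q) \<le> ennreal ((1 + d)\<^sup>2 / (1 - d)^3) * emeasure (chain a b) S"
          using up by (rule order_trans[rotated])
      qed
      finally show ?thesis .
    qed
    have "(\<lambda>n. (p d n + e n) + ennreal ((1 + d)\<^sup>2 / (1 - d)^3) * emeasure (chain a b) S) \<longlonglongrightarrow> (0 + 0) + ennreal ((1 + d)\<^sup>2 / (1 - d)^3) * emeasure (chain a b) S"
      by (intro tendsto_add tendsto_const e_lim p_lim d)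
    then show ?thesis using LIMSEQ_le_const[of _ _ "emeasure (distr Q ?P B) S"] main by fastforce
  qed
  \<comment> \<open>The values \<open>1 / (k + 2)\<close> tend to 0 and stay below 1, as
    \<open>upper\<close> demands.\<close>
  have upper': "emeasure (distr Q ?P B) S \<le> emeasure (chain a b) S" if S: "S \<in> sets ?P" for S
  proof -
    have fin: "emeasure (chain a b) S < top" using \<Pi>.emeasure_le_1[of S] by (auto simp: less_top[symmetric] top_unique)
    have "(\<lambda>k. (1 + 1 / real (Suc (Suc k)))\<^sup>2 / (1 - 1 / real (Suc (Suc k)))^3) \<longlonglongrightarrow> (1 + 0)\<^sup>2 / (1 - 0)^3"
      by (intro tendsto_intros LIMSEQ_Suc[OF LIMSEQ_Suc[OF lim_1_over_n]]) auto
    then have "(\<lambda>k. ennreal ((1 + 1 / real (Suc (Suc k)))\<^sup>2 / (1 - 1 / real (Suc (Suc k)))^3)) \<longlonglongrightarrow> ennreal 1"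
      by (intro tendsto_ennrealI) simp
    from ennreal_tendsto_cmult[OF fin this]
    have "(\<lambda>k. emeasure (chain a b) S * ennreal ((1 + 1 / real (Suc (Suc k)))\<^sup>2 / (1 - 1 / real (Suc (Suc k)))^3)) \<longlonglongrightarrow> emeasure (chain a b) S"
      by simp
    then show ?thesis
    proof (rule LIMSEQ_le_const, intro exI allI impI)
      fix k
      show "emeasure (distr Q ?P B) S \<le> emeasure (chain a b) S * ennreal ((1 + 1 / real (Suc (Suc k)))\<^sup>2 / (1 - 1 / real (Suc (Suc k)))^3)"
        using upper[OF S, of "1 / real (Suc (Suc k))"] by (simp add: mult.commute)
    qed
  qed
  interpret BB: prob_space "distr Q ?P B" by (rule Q.prob_space_distr[OF B])
  have "distr Q ?P B = chain a b"
  proof (rule measure_eqI)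
    fix S assume "S \<in> sets (distr Q ?P B)"
    then have S: "S \<in> sets ?P" by simp
    have c: "space ?P - S \<in> sets ?P" using S by auto
    have 1: "measure (distr Q ?P B) S \<le> measure (chain a b) S"
      using upper'[OF S] unfolding BB.emeasure_eq_measure \<Pi>.emeasure_eq_measure by simp
    have 2: "measure (distr Q ?P B) (space ?P - S) \<le> measure (chain a b) (space ?P - S)"
      using upper'[OF c] unfolding BB.emeasure_eq_measure \<Pi>.emeasure_eq_measure by simp
    \<comment> \<open>Both measures have total mass 1, so the inequality for the complement is the
      reverse inequality for \<open>S\<close>.\<close>
    have "measure (distr Q ?P B) S = measure (chain a b) S"
      using 1 2 BB.prob_compl[of S] \<Pi>.prob_compl[of S] S by simp
    then show "emeasure (distr Q ?P B) S = emeasure (chain a b) S"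
      unfolding BB.emeasure_eq_measure \<Pi>.emeasure_eq_measure by simp
  qed simp
  then show ?thesis unfolding B_def .
qed

end

section \<open>Single-site conditional densities\<close>

text \<open>Induction over the sites, each step exchanging one more. The access functions
  \<open>get\<close>, \<open>upd\<close>, \<open>put\<close> are kept abstract because the lemma is
  applied at two levels: to the coordinates at one time, and to the times of a window.\<close>

lemma resample:
  fixes get :: "'c \<Rightarrow> 'i \<Rightarrow> 'y" and upd :: "'c \<Rightarrow> 'i \<Rightarrow> 'y \<Rightarrow> 'c" and put :: "'c \<Rightarrow> 'i set \<Rightarrow> ('i \<Rightarrow> 'y) \<Rightarrow> 'c"
    and N :: "'c measure" and K :: "'i \<Rightarrow> 'y measure" and C :: "'i \<Rightarrow> ennreal"
  assumes K: "product_sigma_finite K" and J: "finite J"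
    and get[measurable]: "\<And>i. i \<in> J \<Longrightarrow> (\<lambda>x. get x i) \<in> measurable N (K i)"
    and put: "\<And>I. I \<subseteq> J \<Longrightarrow> (\<lambda>p. put (fst p) I (snd p)) \<in> measurable (N \<Otimes>\<^sub>M PiM I K) N"
    and upd: "\<And>i. i \<in> J \<Longrightarrow> (\<lambda>p. upd (fst p) i (snd p)) \<in> measurable (N \<Otimes>\<^sub>M K i) N"
    and put_empty: "\<And>x ys. put x {} ys = x"
    and put_insert: "\<And>x i y I ys. i \<notin> I \<Longrightarrow> put (upd x i y) I ys = put x (insert i I) (ys(i := y))"
    and get_upd: "\<And>x i j y. i \<noteq> j \<Longrightarrow> get (upd x i y) j = get x j"
    and A[measurable]: "\<And>i. i \<in> J \<Longrightarrow> A i \<in> sets (K i)"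
    and swap: "\<And>i \<phi>. i \<in> J \<Longrightarrow> \<phi> \<in> borel_measurable N \<Longrightarrow>
      (\<integral>\<^sup>+x. \<phi> x \<partial>N) = (\<integral>\<^sup>+x. C i * indicator (A i) (get x i) * (\<integral>\<^sup>+y. \<phi> (upd x i y) \<partial>K i) \<partial>N)"
    and phi: "\<phi> \<in> borel_measurable N"
  shows "(\<integral>\<^sup>+x. \<phi> x \<partial>N) = (\<integral>\<^sup>+x. (\<Prod>i\<in>J. C i * indicator (A i) (get x i)) * (\<integral>\<^sup>+ys. \<phi> (put x J ys) \<partial>PiM J K) \<partial>N)"
proof -
  interpret K: product_sigma_finite K by (rule K)
  have "(\<integral>\<^sup>+x. \<phi> x \<partial>N) = (\<integral>\<^sup>+x. (\<Prod>i\<in>I. C i * indicator (A i) (get x i)) * (\<integral>\<^sup>+ys. \<phi> (put x I ys) \<partial>PiM I K) \<partial>N)"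
    if "finite I" "I \<subseteq> J" for I
    using that
  proof (induction I rule: finite_induct)
    case empty
    show ?case by (simp add: put_empty space_PiM_empty)
  next
    case (insert j I)
    have j[simp]: "j \<in> J" and I: "I \<subseteq> J" using insert by auto
    interpret I: finite_product_sigma_finite K I by standard fact
    define \<Phi> where "\<Phi> x = (\<integral>\<^sup>+ys. \<phi> (put x I ys) \<partial>PiM I K)" for x
    have "(\<lambda>p. \<phi> (put (fst p) I (snd p))) \<in> borel_measurable (N \<Otimes>\<^sub>M PiM I K)"
      by (rule measurable_compose[OF put[OF I] phi])
    then have [measurable]: "\<Phi> \<in> borel_measurable N"
      unfolding \<Phi>_def by (intro I.borel_measurable_nn_integral) (simp add: split_beta)
    define \<Psi> where "\<Psi> x = (\<Prod>i\<in>I. C i * indicator (A i) (get x i)) * \<Phi> x" for x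
    have prod_m: "(\<lambda>x. \<Prod>i\<in>I. C i * indicator (A i) (get x i)) \<in> borel_measurable N"
    proof (rule borel_measurable_prod_ennreal)
      fix i assume "i \<in> I"
      then have [measurable]: "(\<lambda>x. get x i) \<in> measurable N (K i)" "A i \<in> sets (K i)" using I get A by auto
      show "(\<lambda>x. C i * indicator (A i) (get x i)) \<in> borel_measurable N" by measurable
    qed
    then have Psi: "\<Psi> \<in> borel_measurable N" unfolding \<Psi>_def by measurable
    have "(\<integral>\<^sup>+x. \<phi> x \<partial>N) = (\<integral>\<^sup>+x. \<Psi> x \<partial>N)"
      unfolding \<Psi>_def \<Phi>_def by (rule insert.IH[OF I])
    also have "\<dots> = (\<integral>\<^sup>+x. C j * indicator (A j) (get x j) * (\<integral>\<^sup>+y. \<Psi> (upd x j y) \<partial>K j) \<partial>N)"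
      by (rule swap[OF j Psi])
    also have "\<dots> = (\<integral>\<^sup>+x. (\<Prod>i\<in>insert j I. C i * indicator (A i) (get x i)) * (\<integral>\<^sup>+ys. \<phi> (put x (insert j I) ys) \<partial>PiM (insert j I) K) \<partial>N)"
    proof (rule nn_integral_cong)
      fix x assume x: "x \<in> space N"
      have "(\<lambda>y. (x, y)) \<in> measurable (K j) (N \<Otimes>\<^sub>M K j)" using x by measurable
      from measurable_compose[OF this upd[OF j]]
      have u[measurable]: "(\<lambda>y. upd x j y) \<in> measurable (K j) N" by simp
      have "(\<lambda>ys. (x, ys)) \<in> measurable (PiM (insert j I) K) (N \<Otimes>\<^sub>M PiM (insert j I) K)" using x by measurable
      from measurable_compose[OF measurable_compose[OF this put[OF insert.prems]] phi]
      have pm: "(\<lambda>ys. \<phi> (put x (insert j I) ys)) \<in> borel_measurable (PiM (insert j I) K)" by simp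
      \<comment> \<open>The factors collected for the sites in \<open>I\<close> do not see the new
        value at \<open>j\<close> and can leave the integral over it.\<close>
      have g: "(\<Prod>i\<in>I. C i * indicator (A i) (get (upd x j y) i)) = (\<Prod>i\<in>I. C i * indicator (A i) (get x i))" for y
        using insert.hyps(2) by (intro prod.cong refl) (metis get_upd)
      have "(\<integral>\<^sup>+y. \<Psi> (upd x j y) \<partial>K j) = (\<Prod>i\<in>I. C i * indicator (A i) (get x i)) * (\<integral>\<^sup>+y. \<Phi> (upd x j y) \<partial>K j)"
        unfolding \<Psi>_def g by (rule nn_integral_cmult) measurable
      also have "(\<integral>\<^sup>+y. \<Phi> (upd x j y) \<partial>K j) = (\<integral>\<^sup>+ys. \<phi> (put x (insert j I) ys) \<partial>PiM (insert j I) K)"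
        unfolding \<Phi>_def put_insert[OF insert.hyps(2)]
        by (rule K.product_nn_integral_insert_rev[OF insert.hyps pm, symmetric])
      finally show "C j * indicator (A j) (get x j) * (\<integral>\<^sup>+y. \<Psi> (upd x j y) \<partial>K j)
        = (\<Prod>i\<in>insert j I. C i * indicator (A i) (get x i)) * (\<integral>\<^sup>+ys. \<phi> (put x (insert j I) ys) \<partial>PiM (insert j I) K)"
        using insert.hyps by (simp add: mult_ac)
    qed
    finally show ?case .
  qed
  from this[OF J order_refl] show ?thesis .
qed

text \<open>\<open>cond_density_propto\<close> speaks about one event of \<open>Y\<close> at a time,
  with an exceptional set depending on it. Testing it against the conditioning events generated by
  \<open>Z\<close> identifies the joint law of \<open>(Z, Y)\<close> on rectangles, and these
  determine the measure; so arbitrary joint test functions become available.\<close>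

lemma cond_density_disintegration:
  fixes f :: "'w \<Rightarrow> 'y \<Rightarrow> real"
  assumes P: "prob_space P" and F: "subalgebra P F" and \<nu>: "sigma_finite_measure \<nu>"
    and Y[measurable]: "Y \<in> measurable P \<nu>" and Z: "Z \<in> measurable F N"
    and f[measurable]: "(\<lambda>(\<omega>, y). f \<omega> y) \<in> borel_measurable (P \<Otimes>\<^sub>M \<nu>)"
    and cd: "cond_density_propto P F Y \<nu> f" and f0: "\<And>\<omega> y. 0 \<le> f \<omega> y"
    and phi[measurable]: "\<phi> \<in> borel_measurable (N \<Otimes>\<^sub>M \<nu>)"
  shows "(\<integral>\<^sup>+\<omega>. \<phi> (Z \<omega>, Y \<omega>) \<partial>P) = (\<integral>\<^sup>+\<omega>. \<integral>\<^sup>+y. \<phi> (Z \<omega>, y) * ennreal (f \<omega> y / (LINT z|\<nu>. f \<omega> z)) \<partial>\<nu> \<partial>P)"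
proof -
  interpret P: prob_space P by (rule P)
  interpret \<nu>: sigma_finite_measure \<nu> by (rule \<nu>)
  interpret P\<nu>: pair_sigma_finite P \<nu> ..
  interpret F: finite_measure_subalgebra P F
    using F by (unfold_locales)
  have Z'[measurable]: "Z \<in> measurable P N" by (rule measurable_from_subalg[OF F Z])
  define k where "k p = ennreal (f (fst p) (snd p) / (LINT z|\<nu>. f (fst p) z))" for p
  have [measurable]: "(\<lambda>\<omega>. LINT z|\<nu>. f \<omega> z) \<in> borel_measurable P" by measurable
  have f'[measurable]: "(\<lambda>p. f (fst p) (snd p)) \<in> borel_measurable (P \<Otimes>\<^sub>M \<nu>)" using f by (simp add: split_beta)
  have k[measurable]: "k \<in> borel_measurable (P \<Otimes>\<^sub>M \<nu>)" unfolding k_def by measurable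
  have ZY[measurable]: "(\<lambda>\<omega>. (Z \<omega>, Y \<omega>)) \<in> measurable P (N \<Otimes>\<^sub>M \<nu>)" by measurable
  have Zs[measurable]: "(\<lambda>p. (Z (fst p), snd p)) \<in> measurable (P \<Otimes>\<^sub>M \<nu>) (N \<Otimes>\<^sub>M \<nu>)" by measurable
  define m1 where "m1 = distr P (N \<Otimes>\<^sub>M \<nu>) (\<lambda>\<omega>. (Z \<omega>, Y \<omega>))"
  define m2 where "m2 = distr (density (P \<Otimes>\<^sub>M \<nu>) k) (N \<Otimes>\<^sub>M \<nu>) (\<lambda>p. (Z (fst p), snd p))"
  have norm: "AE \<omega> in P. integrable \<nu> (f \<omega>) \<and> 0 < (LINT z|\<nu>. f \<omega> z)"
    using cd by (auto simp: cond_density_propto_def elim: eventually_mono)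
  have rect: "emeasure m1 (A \<times> B) = emeasure m2 (A \<times> B)" if A[measurable]: "A \<in> sets N" and B[measurable]: "B \<in> sets \<nu>" for A B
  proof -
    let ?A = "Z -` A \<inter> space P" and ?B = "Y -` B \<inter> space P"
    have spF: "space F = space P" using F by (simp add: subalgebra_def)
    have AF: "?A \<in> sets F" using measurable_sets[OF Z A] by (simp add: spF)
    have [measurable]: "?A \<in> sets P" "?B \<in> sets P" by measurable
    have ce: "AE \<omega> in P. real_cond_exp P F (indicator ?B) \<omega> = (LINT y:B|\<nu>. f \<omega> y / (LINT z|\<nu>. f \<omega> z))"
      using cd B by (simp add: cond_density_propto_def)
    have intB: "integrable P (indicator ?B :: 'w \<Rightarrow> real)"
      by (rule integrable_real_indicator) (auto simp: less_top[symmetric])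
    have cei: "integrable P (real_cond_exp P F (indicator ?B))" by (rule F.real_cond_exp_int(1)[OF intB])
    have ce0: "AE \<omega> in P. 0 \<le> real_cond_exp P F (indicator ?B) \<omega>" by (rule F.real_cond_exp_pos) auto
    have "emeasure m1 (A \<times> B) = emeasure P (?A \<inter> ?B)"
      unfolding m1_def by (subst emeasure_distr) (auto intro!: arg_cong[where f="emeasure P"])
    also have "\<dots> = ennreal (LINT \<omega>:?A|P. indicator ?B \<omega>)"
    proof -
      have "(LINT \<omega>:?A|P. (indicator ?B \<omega> :: real)) = (LINT \<omega>|P. indicator (?A \<inter> ?B) \<omega>)"
        unfolding set_lebesgue_integral_def by (intro Bochner_Integration.integral_cong) (auto simp: indicator_def)
      also have "\<dots> = measure P (?A \<inter> ?B)" by (simp add: Int_assoc Int_absorb2)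
      finally show ?thesis by (simp add: P.emeasure_eq_measure)
    qed
    also have "(LINT \<omega>:?A|P. (indicator ?B \<omega> :: real)) = (LINT \<omega>:?A|P. real_cond_exp P F (indicator ?B) \<omega>)"
      by (rule F.real_cond_exp_intA[OF intB AF])
    also have "ennreal \<dots> = (\<integral>\<^sup>+\<omega>. ennreal (indicator ?A \<omega> * real_cond_exp P F (indicator ?B) \<omega>) \<partial>P)"
      unfolding set_lebesgue_integral_def using integrable_mult_indicator[OF _ cei, of ?A] ce0
      by (subst nn_integral_eq_integral) (auto elim!: eventually_mono simp: mult.commute)
    also have "\<dots> = (\<integral>\<^sup>+\<omega>. \<integral>\<^sup>+y. k (\<omega>, y) * indicator (A \<times> B) (Z \<omega>, y) \<partial>\<nu> \<partial>P)"
    proof (rule nn_integral_cong_AE)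
      show "AE \<omega> in P. ennreal (indicator ?A \<omega> * real_cond_exp P F (indicator ?B) \<omega>) = (\<integral>\<^sup>+y. k (\<omega>, y) * indicator (A \<times> B) (Z \<omega>, y) \<partial>\<nu>)"
        using ce norm AE_space
      proof eventually_elim
        case (elim \<omega>)
        let ?I = "LINT z|\<nu>. f \<omega> z"
        have i: "integrable \<nu> (\<lambda>y. indicator B y * (f \<omega> y / ?I))"
          using elim(2) integrable_mult_indicator[OF B, of "\<lambda>y. f \<omega> y / ?I"] by simp
        have "(\<integral>\<^sup>+y. k (\<omega>, y) * indicator (A \<times> B) (Z \<omega>, y) \<partial>\<nu>) = (\<integral>\<^sup>+y. indicator ?A \<omega> * ennreal (indicator B y * (f \<omega> y / ?I)) \<partial>\<nu>)"
          using elim(3) by (intro nn_integral_cong) (auto simp: k_def indicator_def)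
        also have "\<dots> = indicator ?A \<omega> * (\<integral>\<^sup>+y. ennreal (indicator B y * (f \<omega> y / ?I)) \<partial>\<nu>)"
          using i by (intro nn_integral_cmult) auto
        also have "(\<integral>\<^sup>+y. ennreal (indicator B y * (f \<omega> y / ?I)) \<partial>\<nu>) = ennreal (LINT y:B|\<nu>. f \<omega> y / ?I)"
          unfolding set_lebesgue_integral_def using i elim(2) f0 by (subst nn_integral_eq_integral) auto
        finally show ?case unfolding elim(1) by (auto simp: indicator_def)
      qed
    qed
    also have "\<dots> = (\<integral>\<^sup>+p. k p * indicator (A \<times> B) (Z (fst p), snd p) \<partial>(P \<Otimes>\<^sub>M \<nu>))"
      by (subst \<nu>.nn_integral_fst[symmetric]) auto
    also have "\<dots> = emeasure m2 (A \<times> B)"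
    proof -
      have "emeasure m2 (A \<times> B) = (\<integral>\<^sup>+p. indicator (A \<times> B) p \<partial>m2)"
        using A B by (subst nn_integral_indicator) (auto simp: m2_def)
      also have "\<dots> = (\<integral>\<^sup>+p. k p * indicator (A \<times> B) (Z (fst p), snd p) \<partial>(P \<Otimes>\<^sub>M \<nu>))"
        unfolding m2_def by (subst nn_integral_distr) (auto simp: nn_integral_density)
      finally show ?thesis ..
    qed
    finally show ?thesis .
  qed
  have "m1 = m2"
  proof (rule measure_eqI_generator_eq[OF Int_stable_pair_measure_generator[of N \<nu>], where \<Omega>="space N \<times> space \<nu>" and A="\<lambda>_. space N \<times> space \<nu>"])
    show "{a \<times> b |a b. a \<in> sets N \<and> b \<in> sets \<nu>} \<subseteq> Pow (space N \<times> space \<nu>)" by (rule pair_measure_closed)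
    show "sets m1 = sigma_sets (space N \<times> space \<nu>) {a \<times> b |a b. a \<in> sets N \<and> b \<in> sets \<nu>}"
      "sets m2 = sigma_sets (space N \<times> space \<nu>) {a \<times> b |a b. a \<in> sets N \<and> b \<in> sets \<nu>}"
      by (simp_all add: m1_def m2_def sets_pair_measure)
    show "emeasure m1 (space N \<times> space \<nu>) \<noteq> \<infinity>" for i :: nat
    proof -
      interpret m1: prob_space m1 unfolding m1_def by (rule P.prob_space_distr) measurable
      show ?thesis by simp
    qed
  qed (use rect in auto)
  then have "(\<integral>\<^sup>+p. \<phi> p \<partial>m1) = (\<integral>\<^sup>+p. \<phi> p \<partial>m2)" by simp
  also have "(\<integral>\<^sup>+p. \<phi> p \<partial>m1) = (\<integral>\<^sup>+\<omega>. \<phi> (Z \<omega>, Y \<omega>) \<partial>P)"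
    unfolding m1_def by (rule nn_integral_distr) measurable
  also have "(\<integral>\<^sup>+p. \<phi> p \<partial>m2) = (\<integral>\<^sup>+p. k p * \<phi> (Z (fst p), snd p) \<partial>(P \<Otimes>\<^sub>M \<nu>))"
    unfolding m2_def by (subst nn_integral_distr) (auto simp: nn_integral_density)
  also have "\<dots> = (\<integral>\<^sup>+\<omega>. \<integral>\<^sup>+y. \<phi> (Z \<omega>, y) * k (\<omega>, y) \<partial>\<nu> \<partial>P)"
    by (subst \<nu>.nn_integral_fst[symmetric]) (auto simp: mult.commute)
  finally show ?thesis by (simp add: k_def)
qed

text \<open>Once coordinate \<open>i\<close> is split off, both it and \<open>y\<close> are
  integrated against \<open>K i\<close>, and Tonelli permits exchanging the two.\<close>

lemma PiM_swap:
  assumes K: "product_sigma_finite K" and I: "finite I" "i \<in> I"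
    and F: "(\<lambda>p. F (fst p) (snd p)) \<in> borel_measurable (PiM I K \<Otimes>\<^sub>M K i)"
  shows "(\<integral>\<^sup>+x. \<integral>\<^sup>+y. F x y \<partial>K i \<partial>PiM I K) = (\<integral>\<^sup>+x. \<integral>\<^sup>+y. F (x(i := y)) (x i) \<partial>K i \<partial>PiM I K)"
proof -
  interpret K: product_sigma_finite K by (rule K)
  interpret Ki: sigma_finite_measure "K i" by (rule K.sigma_finite_measures)
  interpret KK: pair_sigma_finite "K i" "K i" ..
  define J where "J = I - {i}"
  have J: "finite J" "i \<notin> J" "I = insert i J" using I by (auto simp: J_def)
  have F1: "(\<lambda>x. \<integral>\<^sup>+y. F x y \<partial>K i) \<in> borel_measurable (PiM (insert i J) K)"
    using F unfolding J(3) by (intro sigma_finite_measure.borel_measurable_nn_integral[OF K.sigma_finite_measures]) (simp add: split_beta)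
  have up: "(\<lambda>p. (fst p)(i := snd p)) \<in> measurable (PiM I K \<Otimes>\<^sub>M K i) (PiM I K)"
  proof -
    have "(\<lambda>p. (restrict (fst p) J)(i := snd p)) \<in> measurable (PiM I K \<Otimes>\<^sub>M K i) (PiM I K)"
      unfolding J(3) using measurable_compose[of "\<lambda>p. (restrict (fst p) J, snd p)" "PiM (insert i J) K \<Otimes>\<^sub>M K i" "PiM J K \<Otimes>\<^sub>M K i", OF _ measurable_add_dim[of i J K]]
        measurable_compose[OF measurable_fst measurable_restrict_subset[of J "insert i J" K]] by (auto simp: split_beta)
    then show ?thesis
      by (rule measurable_cong[THEN iffD1, rotated])
        (auto simp: space_pair_measure space_PiM PiE_iff extensional_def fun_eq_iff J_def)
  qed
  have F2: "(\<lambda>x. \<integral>\<^sup>+y. F (x(i := y)) (x i) \<partial>K i) \<in> borel_measurable (PiM (insert i J) K)"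
  proof -
    have "(\<lambda>p. ((fst p)(i := snd p), fst p i)) \<in> measurable (PiM I K \<Otimes>\<^sub>M K i) (PiM I K \<Otimes>\<^sub>M K i)"
      using up I(2) by measurable
    from measurable_compose[OF this F] show ?thesis
      unfolding J(3)[symmetric] by (intro sigma_finite_measure.borel_measurable_nn_integral[OF K.sigma_finite_measures]) (simp add: split_beta)
  qed
  show ?thesis
    unfolding J(3) K.product_nn_integral_insert[OF J(1,2) F1] K.product_nn_integral_insert[OF J(1,2) F2]
  proof (rule nn_integral_cong)
    fix x assume x: "x \<in> space (PiM J K)"
    have "(\<lambda>p. (x(i := fst p), snd p)) \<in> measurable (K i \<Otimes>\<^sub>M K i) (PiM I K \<Otimes>\<^sub>M K i)"
      unfolding J(3) using measurable_compose[OF measurable_fst measurable_component_update[OF x J(2)]] by (intro measurable_Pair) auto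
    from measurable_compose[OF this F] have m: "(\<lambda>(u, y). F (x(i := u)) y) \<in> borel_measurable (K i \<Otimes>\<^sub>M K i)"
      by (simp add: split_beta)
    have "(\<integral>\<^sup>+u. \<integral>\<^sup>+y. F (x(i := u)) y \<partial>K i \<partial>K i) = (\<integral>\<^sup>+y. \<integral>\<^sup>+u. F (x(i := u)) y \<partial>K i \<partial>K i)"
      by (rule KK.Fubini'[OF m, symmetric])
    then show "(\<integral>\<^sup>+u. \<integral>\<^sup>+y. F (x(i := u)) y \<partial>K i \<partial>K i) = (\<integral>\<^sup>+u. \<integral>\<^sup>+y. F ((x(i := u))(i := y)) ((x(i := u)) i) \<partial>K i \<partial>K i)"
      by simp
  qed
qed

section \<open>The conditional specification\<close>

text \<open>The standing assumptions on state spaces, reference measures and parameters. With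
  \<open>\<mu>_nonzero\<close> the normalising integrals are positive and the product
  \<open>M\<close> is not the null measure.\<close>

locale conditional_spec =
  fixes \<X> :: "'p::finite \<Rightarrow> real set"
    and \<mu> :: "'p \<Rightarrow> real measure"
    and s c :: "'p \<Rightarrow> real \<Rightarrow> real"
    and \<theta> :: "real ^ 'p"
    and \<Phi>m \<Phi>0 \<Phi>1 :: "real ^ 'p ^ 'p"
  assumes X_borel: "\<And>a. \<X> a \<in> sets borel"
    and space_\<mu>: "\<And>a. space (\<mu> a) = \<X> a"
    and sets_\<mu>: "\<And>a. sets (\<mu> a) = sets (restrict_space borel (\<X> a))"
    and sf_\<mu>: "\<And>a. sigma_finite_measure (\<mu> a)"
    and \<mu>_nonzero: "\<And>a. emeasure (\<mu> a) (\<X> a) \<noteq> 0"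
    and s_measurable [measurable]: "\<And>a. s a \<in> borel_measurable (\<mu> a)"
    and c_measurable [measurable]: "\<And>a. c a \<in> borel_measurable (\<mu> a)"
    and \<Phi>0_symmetric: "transpose \<Phi>0 = \<Phi>0"
    and \<Phi>0_diagonal: "\<And>a. \<Phi>0 $ a $ a = 0"
    and \<Phi>m_eq: "\<Phi>m = transpose \<Phi>1"
begin

sublocale \<mu>: product_sigma_finite \<mu>
  by (rule product_sigma_finite.intro) (rule sf_\<mu>)

abbreviation "M \<equiv> Pi\<^sub>M (UNIV :: 'p set) \<mu>"
abbreviation "R \<equiv> R_kernel \<theta> s c \<Phi>0 \<Phi>1"

definition site :: "'p \<Rightarrow> real \<Rightarrow> real \<Rightarrow> real" where
  "site a h y = exp (\<theta> $ a * s a y + y * h + c a y)"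

text \<open>\<open>Theta_fun\<close> as a function of the states one time before, at, and one time
  after the site; together with \<open>site\<close> it expresses (CS) without reference to a
  process.\<close>

definition field :: "('p \<Rightarrow> real) \<Rightarrow> ('p \<Rightarrow> real) \<Rightarrow> ('p \<Rightarrow> real) \<Rightarrow> 'p \<Rightarrow> real" where
  "field u x z a = (\<Sum>b\<in>UNIV - {a}. \<Phi>0 $ a $ b * x b) + (\<Sum>b\<in>UNIV. \<Phi>m $ a $ b * u b + \<Phi>1 $ a $ b * z b)"

lemma site_pos: "0 < site a h y"
  by (simp add: site_def)

lemma field_upd [simp]: "field u (x(a := y)) z a = field u x z a"
  unfolding field_def by (intro arg_cong2[where f="(+)"] sum.cong) auto

text \<open>Symmetry of \<open>\<Phi>0\<close> doubles the terms linear in \<open>x a\<close>, and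
  the zero diagonal removes the square of \<open>x a\<close>. The factor 2 cancels against the
  \<open>1/2\<close> in the kernel, which is why (CS) carries \<open>\<Phi>0\<close> without a
  factor.\<close>

lemma quadratic_split:
  "(\<Sum>b\<in>UNIV. \<Sum>d\<in>UNIV. x b * (\<Phi>0 $ b $ d * x d)) =
    2 * x a * (\<Sum>b\<in>UNIV - {a}. \<Phi>0 $ a $ b * x b) + (\<Sum>b\<in>UNIV - {a}. \<Sum>d\<in>UNIV - {a}. x b * (\<Phi>0 $ b $ d * x d))"
proof -
  have sym: "\<Phi>0 $ b $ a = \<Phi>0 $ a $ b" for b
    using \<Phi>0_symmetric by (metis transpose_def vec_lambda_beta)
  have split: "(\<Sum>b\<in>UNIV. f b) = f a + (\<Sum>b\<in>UNIV - {a}. f b)" for f :: "'p \<Rightarrow> real"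
    by (rule sum.remove) auto
  have "(\<Sum>b\<in>UNIV. \<Sum>d\<in>UNIV. x b * (\<Phi>0 $ b $ d * x d))
    = (\<Sum>d\<in>UNIV - {a}. x a * (\<Phi>0 $ a $ d * x d)) + (\<Sum>b\<in>UNIV - {a}. x b * (\<Phi>0 $ b $ a * x a) + (\<Sum>d\<in>UNIV - {a}. x b * (\<Phi>0 $ b $ d * x d)))"
    unfolding split by (simp add: \<Phi>0_diagonal)
  also have "\<dots> = 2 * (\<Sum>b\<in>UNIV - {a}. x a * (\<Phi>0 $ a $ b * x b)) + (\<Sum>b\<in>UNIV - {a}. \<Sum>d\<in>UNIV - {a}. x b * (\<Phi>0 $ b $ d * x d))"
    unfolding sym sum.distrib by (simp add: mult_ac)
  finally show ?thesis by (simp add: sum_distrib_left mult.assoc)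
qed

text \<open>The exponent of the part of \<open>R u x * R x z\<close> that involves the middle state
  \<open>x\<close>.\<close>

definition log_weight :: "('p \<Rightarrow> real) \<Rightarrow> ('p \<Rightarrow> real) \<Rightarrow> ('p \<Rightarrow> real) \<Rightarrow> real" where
  "log_weight u x z = (\<Sum>b\<in>UNIV. \<theta> $ b * s b (x b)) + (\<Sum>b\<in>UNIV. c b (x b))
    + 1/2 * (\<Sum>b\<in>UNIV. \<Sum>d\<in>UNIV. x b * (\<Phi>0 $ b $ d * x d))
    + (\<Sum>b\<in>UNIV. x b * (\<Sum>d\<in>UNIV. \<Phi>m $ b $ d * u d)) + (\<Sum>b\<in>UNIV. x b * (\<Sum>d\<in>UNIV. \<Phi>1 $ b $ d * z d))"

text \<open>The exponent is the single-site exponent at \<open>a\<close> plus a \<open>rest\<close>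
  free of \<open>x a\<close>. The identity is kept as a cross sum, so that its exponential is a
  product identity without division.\<close>

lemma log_weight_upd:
  "log_weight u (x(a := y)) z + (\<theta> $ a * s a (x a) + x a * field u x z a + c a (x a))
    = log_weight u x z + (\<theta> $ a * s a y + y * field u x z a + c a y)"
proof -
  have split: "(\<Sum>b\<in>UNIV. f b) = f a + (\<Sum>b\<in>UNIV - {a}. f b)" for f :: "'p \<Rightarrow> real"
    by (rule sum.remove) auto
  define rest where "rest x = (\<Sum>b\<in>UNIV - {a}. \<theta> $ b * s b (x b)) + (\<Sum>b\<in>UNIV - {a}. c b (x b))
    + 1/2 * (\<Sum>b\<in>UNIV - {a}. \<Sum>d\<in>UNIV - {a}. x b * (\<Phi>0 $ b $ d * x d))
    + (\<Sum>b\<in>UNIV - {a}. x b * (\<Sum>d\<in>UNIV. \<Phi>m $ b $ d * u d)) + (\<Sum>b\<in>UNIV - {a}. x b * (\<Sum>d\<in>UNIV. \<Phi>1 $ b $ d * z d))" for x :: "'p \<Rightarrow> real"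
  have lw: "log_weight u x z = \<theta> $ a * s a (x a) + x a * field u x z a + c a (x a) + rest x" for x
  proof -
    have "log_weight u x z = (\<theta> $ a * s a (x a) + (\<Sum>b\<in>UNIV - {a}. \<theta> $ b * s b (x b)))
      + (c a (x a) + (\<Sum>b\<in>UNIV - {a}. c b (x b)))
      + 1/2 * (2 * x a * (\<Sum>b\<in>UNIV - {a}. \<Phi>0 $ a $ b * x b) + (\<Sum>b\<in>UNIV - {a}. \<Sum>d\<in>UNIV - {a}. x b * (\<Phi>0 $ b $ d * x d)))
      + (x a * (\<Sum>d\<in>UNIV. \<Phi>m $ a $ d * u d) + (\<Sum>b\<in>UNIV - {a}. x b * (\<Sum>d\<in>UNIV. \<Phi>m $ b $ d * u d)))
      + (x a * (\<Sum>d\<in>UNIV. \<Phi>1 $ a $ d * z d) + (\<Sum>b\<in>UNIV - {a}. x b * (\<Sum>d\<in>UNIV. \<Phi>1 $ b $ d * z d)))"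
      unfolding log_weight_def quadratic_split[of x a]
      using split[of "\<lambda>b. \<theta> $ b * s b (x b)"] split[of "\<lambda>b. c b (x b)"]
        split[of "\<lambda>b. x b * (\<Sum>d\<in>UNIV. \<Phi>m $ b $ d * u d)"] split[of "\<lambda>b. x b * (\<Sum>d\<in>UNIV. \<Phi>1 $ b $ d * z d)"]
      by simp
    then show ?thesis unfolding rest_def field_def sum.distrib by (simp add: distrib_left)
  qed
  have "rest (x(a := y)) = rest x"
    unfolding rest_def by (intro arg_cong2[where f="(+)"] arg_cong2[where f="(*)"] refl sum.cong) auto
  then show ?thesis unfolding lw[of "x(a := y)"] lw[of x] by simp
qed

lemma R_pos: "0 < R u x"
  unfolding R_kernel_def G_fun_def H_fun_def by simp

text \<open>The two half powers of \<open>G\<close> at the middle state combine to a full one, and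
  \<open>\<Phi>m = transpose \<Phi>1\<close> rewrites the coupling to the preceding state as a term
  linear in \<open>x\<close>.\<close>

lemma R_prod: "R u x * R x z = sqrt (G_fun \<theta> s c \<Phi>0 u) * exp (log_weight u x z) * sqrt (G_fun \<theta> s c \<Phi>0 z)"
proof -
  have H1: "H_fun \<Phi>1 u x = exp (\<Sum>b\<in>UNIV. x b * (\<Sum>d\<in>UNIV. \<Phi>m $ b $ d * u d))"
  proof -
    have "(\<Sum>d\<in>UNIV. u d * (\<Sum>b\<in>UNIV. \<Phi>1 $ d $ b * x b)) = (\<Sum>d\<in>UNIV. \<Sum>b\<in>UNIV. x b * (\<Phi>m $ b $ d * u d))"
      unfolding \<Phi>m_eq transpose_def by (simp add: sum_distrib_left mult_ac)
    also have "\<dots> = (\<Sum>b\<in>UNIV. x b * (\<Sum>d\<in>UNIV. \<Phi>m $ b $ d * u d))"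
      by (subst sum.swap) (simp add: sum_distrib_left)
    finally show ?thesis by (simp add: H_fun_def inner_vec_def matrix_vector_mult_def)
  qed
  have H2: "H_fun \<Phi>1 x z = exp (\<Sum>b\<in>UNIV. x b * (\<Sum>d\<in>UNIV. \<Phi>1 $ b $ d * z d))"
    by (simp add: H_fun_def inner_vec_def matrix_vector_mult_def)
  have G: "G_fun \<theta> s c \<Phi>0 x = exp ((\<Sum>b\<in>UNIV. \<theta> $ b * s b (x b)) + (\<Sum>b\<in>UNIV. c b (x b))
    + 1/2 * (\<Sum>b\<in>UNIV. \<Sum>d\<in>UNIV. x b * (\<Phi>0 $ b $ d * x d)))"
    by (simp add: G_fun_def inner_vec_def matrix_vector_mult_def sum_distrib_left)
  have "R u x * R x z = sqrt (G_fun \<theta> s c \<Phi>0 u) * (H_fun \<Phi>1 u x * (sqrt (G_fun \<theta> s c \<Phi>0 x) * sqrt (G_fun \<theta> s c \<Phi>0 x)) * H_fun \<Phi>1 x z) * sqrt (G_fun \<theta> s c \<Phi>0 z)"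
    unfolding R_kernel_def by (simp only: mult_ac)
  also have "sqrt (G_fun \<theta> s c \<Phi>0 x) * sqrt (G_fun \<theta> s c \<Phi>0 x) = G_fun \<theta> s c \<Phi>0 x"
    by (simp add: G_fun_def)
  also have "H_fun \<Phi>1 u x * G_fun \<theta> s c \<Phi>0 x * H_fun \<Phi>1 x z = exp (log_weight u x z)"
    unfolding H1 H2 G log_weight_def exp_add by (simp only: mult_ac)
  finally show ?thesis .
qed

lemma R_upd:
  "R u (x(a := y)) * R (x(a := y)) z * site a (field u x z a) (x a) = R u x * R x z * site a (field u x z a) y"
proof -
  have "exp (log_weight u (x(a := y)) z) * site a (field u x z a) (x a) = exp (log_weight u x z) * site a (field u x z a) y"
    unfolding site_def exp_add[symmetric] log_weight_upd ..
  then show ?thesis unfolding R_prod by (simp add: mult_ac)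
qed

lemma id_measurable: "(\<lambda>x. x) \<in> measurable (\<mu> a) borel"
  using measurable_restrict_space1[of "\<lambda>x. x" borel borel "\<X> a"] sets_\<mu>[of a] by (simp cong: measurable_cong_sets)

lemma coordinate_measurable: "(\<lambda>x. x a) \<in> measurable M (\<mu> a)"
  by (rule measurable_component_singleton) simp

lemma coordinate_borel [measurable]: "(\<lambda>x. x a) \<in> borel_measurable M"
  by (rule measurable_compose[OF coordinate_measurable id_measurable])

lemma s_coordinate [measurable]: "(\<lambda>x. s a (x a)) \<in> borel_measurable M" "(\<lambda>x. c a (x a)) \<in> borel_measurable M"
  by (rule measurable_compose[OF coordinate_measurable s_measurable], rule measurable_compose[OF coordinate_measurable c_measurable])

lemma G_measurable [measurable]: "G_fun \<theta> s c \<Phi>0 \<in> borel_measurable M"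
  unfolding G_fun_def inner_vec_def matrix_vector_mult_def by simp

lemma R_measurable: "(\<lambda>(x, y). R x y) \<in> borel_measurable (M \<Otimes>\<^sub>M M)"
proof -
  have [measurable]: "(\<lambda>p. fst p a) \<in> borel_measurable (M \<Otimes>\<^sub>M M)" "(\<lambda>p. snd p a) \<in> borel_measurable (M \<Otimes>\<^sub>M M)" for a
    by (rule measurable_compose[OF measurable_fst coordinate_borel], rule measurable_compose[OF measurable_snd coordinate_borel])
  have [measurable]: "(\<lambda>p. H_fun \<Phi>1 (fst p) (snd p)) \<in> borel_measurable (M \<Otimes>\<^sub>M M)"
    unfolding H_fun_def inner_vec_def matrix_vector_mult_def by simp
  show ?thesis unfolding R_kernel_def split_beta by measurable
qed

lemma sigma_finite_M: "sigma_finite_measure M"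
  by (rule \<mu>.sigma_finite) simp

lemma M_nonzero: "emeasure M (space M) \<noteq> 0"
proof -
  have "emeasure M (space M) = (\<Prod>a\<in>UNIV. emeasure (\<mu> a) (space (\<mu> a)))"
    unfolding space_PiM by (rule \<mu>.emeasure_PiM) auto
  then show ?thesis using \<mu>_nonzero by (simp add: space_\<mu>)
qed

text \<open>The space is exhausted by sets of finite measure on which all coordinates are bounded by
  \<open>k\<close> and \<open>sqrt G\<close> is at least \<open>1 / (k + 1)\<close>; there the
  exponent of \<open>H\<close> is bounded below as well. As \<open>M\<close> is not null, one of
  these sets has positive measure.\<close>

lemma R_lower_bound:
  "\<exists>A\<in>sets M. 0 < emeasure M A \<and> emeasure M A < \<infinity> \<and> (\<exists>e>0. \<forall>x\<in>A. \<forall>y\<in>A. e \<le> R x y)"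
proof -
  interpret M: sigma_finite_measure M by (rule sigma_finite_M)
  obtain F :: "nat \<Rightarrow> ('p \<Rightarrow> real) set" where F: "range F \<subseteq> sets M" "(\<Union>i. F i) = space M" "\<And>i. emeasure M (F i) \<noteq> \<infinity>" "incseq F"
    using M.sigma_finite_incseq by blast
  have [measurable]: "F k \<in> sets M" for k using F(1) by auto
  define A where "A k = F k \<inter> {x\<in>space M. (\<forall>a. \<bar>x a\<bar> \<le> real k) \<and> 1 / real (Suc k) \<le> sqrt (G_fun \<theta> s c \<Phi>0 x)}" for k
  have [measurable]: "A k \<in> sets M" for k unfolding A_def by measurable
  have "space M \<subseteq> (\<Union>k. A k)"
  proof
    fix x assume x: "x \<in> space M"
    obtain k1 where k1: "x \<in> F k1" using F(2) x by auto
    obtain k2 :: nat where k2: "Max (range (\<lambda>a. \<bar>x a\<bar>)) \<le> real k2" using real_arch_simple by blast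
    have G: "0 < sqrt (G_fun \<theta> s c \<Phi>0 x)" by (simp add: G_fun_def)
    obtain k3 where k3: "1 / real (Suc k3) < sqrt (G_fun \<theta> s c \<Phi>0 x)"
      using reals_Archimedean[OF G] by (auto simp: inverse_eq_divide)
    define k where "k = max k1 (max k2 k3)"
    have "x \<in> F k" using k1 F(4) unfolding k_def incseq_def by (meson max.cobounded1 subsetD)
    moreover have "\<bar>x a\<bar> \<le> real k" for a
    proof -
      have "\<bar>x a\<bar> \<le> Max (range (\<lambda>a. \<bar>x a\<bar>))" by (rule Max_ge) auto
      moreover have "real k2 \<le> real k" by (simp add: k_def)
      ultimately show ?thesis using k2 by linarith
    qed
    moreover have "1 / real (Suc k) \<le> sqrt (G_fun \<theta> s c \<Phi>0 x)"
    proof -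
      have "1 / real (Suc k) \<le> 1 / real (Suc k3)" unfolding k_def by (simp add: frac_le)
      then show ?thesis using k3 by simp
    qed
    ultimately show "x \<in> (\<Union>k. A k)" using x unfolding A_def by auto
  qed
  then have "(\<Union>k. A k) = space M" using sets.sets_into_space[of "A k" M for k] unfolding A_def by auto
  moreover have "emeasure M (\<Union>k. A k) = 0" if "\<forall>k. emeasure M (A k) = 0"
    by (rule emeasure_UN_eq_0) (use that \<open>\<And>k. A k \<in> sets M\<close> in auto)
  ultimately have "\<exists>k. emeasure M (A k) \<noteq> 0"
    using M_nonzero by metis
  then obtain k where k: "emeasure M (A k) \<noteq> 0" by blast
  define B where "B = (\<Sum>a\<in>UNIV. \<Sum>b\<in>UNIV. real k * (\<bar>\<Phi>1 $ a $ b\<bar> * real k))"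
  have low: "1 / real (Suc k) * exp (- B) * (1 / real (Suc k)) \<le> R x y" if x: "x \<in> A k" and y: "y \<in> A k" for x y
  proof -
    have "- (\<Sum>a\<in>UNIV. x a * (\<Sum>b\<in>UNIV. \<Phi>1 $ a $ b * y b)) \<le> B"
      unfolding B_def sum_negf[symmetric] sum_distrib_left
    proof (intro sum_mono)
      fix a b
      have "- (x a * (\<Phi>1 $ a $ b * y b)) \<le> \<bar>x a\<bar> * (\<bar>\<Phi>1 $ a $ b\<bar> * \<bar>y b\<bar>)"
        by (metis abs_ge_minus_self abs_mult)
      also have "\<dots> \<le> real k * (\<bar>\<Phi>1 $ a $ b\<bar> * real k)"
        using x y unfolding A_def by (intro mult_mono) auto
      finally show "- (x a * (\<Phi>1 $ a $ b * y b)) \<le> real k * (\<bar>\<Phi>1 $ a $ b\<bar> * real k)" .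
    qed
    then have "exp (- B) \<le> H_fun \<Phi>1 x y"
      by (simp add: H_fun_def inner_vec_def matrix_vector_mult_def)
    then show ?thesis
      using x y unfolding R_kernel_def A_def by (intro mult_mono) (auto simp: G_fun_def H_fun_def)
  qed
  have "emeasure M (A k) \<le> emeasure M (F k)" unfolding A_def by (intro emeasure_mono) auto
  then have "emeasure M (A k) < \<infinity>" using F(3)[of k] by (simp add: less_top le_less_trans)
  moreover have "\<exists>e>0. \<forall>x\<in>A k. \<forall>y\<in>A k. e \<le> R x y"
    by (rule exI[of _ "1 / real (Suc k) * exp (- B) * (1 / real (Suc k))"]) (use low in \<open>auto simp del: of_nat_Suc\<close>)
  ultimately show ?thesis
    using k by (intro bexI[of _ "A k"]) (auto simp: zero_less_iff_neq_zero)
qed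

lemma positive_kernelI:
  assumes "integral_op_on_L2 M R" "compact_op M (integral_op M R)"
  shows "positive_kernel M R"
  by (rule positive_kernel.intro[OF sigma_finite_M R_measurable R_pos assms R_lower_bound])

end

lemma conf_measurable:
  assumes "process P M X"
  shows "(\<lambda>\<omega> t. X t \<omega>) \<in> measurable P (Pi\<^sub>M UNIV (\<lambda>_::int. M))"
proof (rule measurable_PiM_single')
  show "(\<lambda>\<omega>. X t \<omega>) \<in> measurable P M" for t using assms by (simp add: process_def)
  show "(\<lambda>\<omega> t. X t \<omega>) \<in> space P \<rightarrow> (\<Pi>\<^sub>E i\<in>UNIV. space M)"
    using assms by (auto simp: process_def PiE_iff intro: measurable_space)
qed

section \<open>From single-site conditional densities to blocks\<close>

locale spec_pair = conditional_spec \<X> \<mu> s c \<theta> \<Phi>m \<Phi>0 \<Phi>1 +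
  PK: principal_pair "Pi\<^sub>M UNIV \<mu>" "R_kernel \<theta> s c \<Phi>0 \<Phi>1" r v w
  for \<X> :: "'p::finite \<Rightarrow> real set" and \<mu> s c \<theta> \<Phi>m \<Phi>0 \<Phi>1 r v w
begin

abbreviation "Conf \<equiv> Pi\<^sub>M UNIV (\<lambda>_::int. M)"

definition upd2 :: "(int \<Rightarrow> 'p \<Rightarrow> real) \<Rightarrow> int \<Rightarrow> 'p \<Rightarrow> real \<Rightarrow> int \<Rightarrow> 'p \<Rightarrow> real" where
  "upd2 x t a y = x(t := (x t)(a := y))"

lemma upd2_simps [simp]: "upd2 x t a y t a = y" "upd2 (upd2 x t a y) t a y' = upd2 x t a y'" "upd2 x t a (x t a) = x"
  by (simp_all add: upd2_def)

lemma upd2_other: "(b, \<tau>) \<noteq> (a, t) \<Longrightarrow> upd2 x t a y \<tau> b = x \<tau> b"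
  by (auto simp: upd2_def)

lemma upd_coordinate_measurable:
  assumes f: "f \<in> measurable N M" and g: "g \<in> measurable N (\<mu> a)"
  shows "(\<lambda>p. (f p)(a := g p)) \<in> measurable N M"
proof -
  have "(\<lambda>p b. if b = a then g p else f p b) \<in> measurable N M"
  proof (rule measurable_abs_UNIV)
    fix b
    show "(\<lambda>p. if b = a then g p else f p b) \<in> measurable N (\<mu> b)"
      using g measurable_compose[OF f coordinate_measurable[of b]] by (cases "b = a") auto
  qed
  then show ?thesis by (simp add: fun_upd_def)
qed

lemma upd_time_measurable:
  assumes f: "f \<in> measurable N Conf" and g: "g \<in> measurable N M"
  shows "(\<lambda>p. (f p)(t := g p)) \<in> measurable N Conf"
proof -
  have "(\<lambda>p \<tau>. if \<tau> = t then g p else f p \<tau>) \<in> measurable N Conf"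
  proof (rule measurable_abs_UNIV)
    fix \<tau> :: int
    have "(\<lambda>x. x \<tau>) \<in> measurable Conf M" by (rule measurable_component_singleton) simp
    from measurable_compose[OF f this] show "(\<lambda>p. if \<tau> = t then g p else f p \<tau>) \<in> measurable N M"
      using g by (cases "\<tau> = t") auto
  qed
  then show ?thesis by (simp add: fun_upd_def)
qed

lemma time_measurable: "(\<lambda>x. x \<tau>) \<in> measurable Conf M"
  by (rule measurable_component_singleton) simp

lemma upd2_measurable:
  assumes f: "f \<in> measurable N Conf" and g: "g \<in> measurable N (\<mu> a)"
  shows "(\<lambda>p. upd2 (f p) t a (g p)) \<in> measurable N Conf"
  unfolding upd2_def
  by (intro upd_time_measurable upd_coordinate_measurable f g measurable_compose[OF f time_measurable])

text \<open>Only the steps into and out of time \<open>t\<close> involve \<open>x t\<close>. The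
  strict inequalities guarantee that both belong to the weight, and \<open>R_upd\<close> treats the
  two together.\<close>

lemma path_weight_upd2:
  assumes "l < t" "t < u"
  shows "PK.path_weight l u (upd2 x t a y) * site a (field (x (t - 1)) (x t) (x (t + 1)) a) (x t a)
    = PK.path_weight l u x * site a (field (x (t - 1)) (x t) (x (t + 1)) a) y"
proof -
  have two: "PK.path_weight (t - 1) (t + 1) z = R (z (t - 1)) (z t) * R (z t) (z (t + 1))" for z
    using PK.path_weight_left[of "t - 1" "t + 1" z] PK.path_weight_left[of t "t + 1" z] by simp
  have split: "PK.path_weight l u z = PK.path_weight l (t - 1) z * (PK.path_weight (t - 1) (t + 1) z * PK.path_weight (t + 1) u z)" for z
    using PK.path_weight_split[of l "t - 1" u z] PK.path_weight_split[of "t - 1" "t + 1" u z] assms by simp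
  have e: "PK.path_weight l (t - 1) (upd2 x t a y) = PK.path_weight l (t - 1) x"
    "PK.path_weight (t + 1) u (upd2 x t a y) = PK.path_weight (t + 1) u x"
    by (rule PK.path_weight_cong, simp add: upd2_def)+
  have "R (x (t - 1)) ((x t)(a := y)) * R ((x t)(a := y)) (x (t + 1)) * site a (field (x (t - 1)) (x t) (x (t + 1)) a) (x t a)
    = R (x (t - 1)) (x t) * R (x t) (x (t + 1)) * site a (field (x (t - 1)) (x t) (x (t + 1)) a) y"
    by (rule R_upd)
  then have "PK.path_weight (t - 1) (t + 1) (upd2 x t a y) * site a (field (x (t - 1)) (x t) (x (t + 1)) a) (x t a)
    = PK.path_weight (t - 1) (t + 1) x * site a (field (x (t - 1)) (x t) (x (t + 1)) a) y"
    unfolding two by (simp add: upd2_def)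
  then show ?thesis unfolding split e by (simp add: mult_ac)
qed

lemma X_coordinate_measurable:
  assumes "process P M X"
  shows "(\<lambda>\<omega>. X t \<omega> a) \<in> measurable P (\<mu> a)"
  using assms by (intro measurable_compose[OF _ coordinate_measurable]) (simp add: process_def)

lemma others_subalgebra:
  assumes "process P M X"
  shows "subalgebra P (others P X a t)"
proof -
  have "{(\<lambda>\<omega>. X \<tau> \<omega> b) -` B \<inter> space P | b \<tau> B. (b, \<tau>) \<noteq> (a, t) \<and> B \<in> sets borel} \<subseteq> sets P"
    using measurable_sets[OF measurable_compose[OF X_coordinate_measurable[OF assms] id_measurable]] by auto
  then have "sigma_sets (space P) {(\<lambda>\<omega>. X \<tau> \<omega> b) -` B \<inter> space P | b \<tau> B. (b, \<tau>) \<noteq> (a, t) \<and> B \<in> sets borel} \<subseteq> sets P"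
    by (rule sets.sigma_sets_subset)
  then show ?thesis
    unfolding subalgebra_def others_def by (subst sets_measure_of) (auto simp: space_measure_of_conv)
qed

lemma space_others [simp]: "space (others P X a t) = space P"
  by (simp add: others_def space_measure_of_conv)

lemma X_space:
  assumes "process P M X" "\<omega> \<in> space P"
  shows "X t \<omega> \<in> space M" "X t \<omega> a \<in> \<X> a"
proof -
  show *: "X t \<omega> \<in> space M" using assms by (auto simp: process_def intro: measurable_space)
  show "X t \<omega> a \<in> \<X> a" using measurable_space[OF coordinate_measurable *] by (simp add: space_\<mu>)
qed

lemma others_measurable:
  assumes proc: "process P M X" and ne: "(b, \<tau>) \<noteq> (a, t)"
  shows "(\<lambda>\<omega>. X \<tau> \<omega> b) \<in> measurable (others P X a t) (\<mu> b)"
proof -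
  let ?G = "{(\<lambda>\<omega>. X \<tau> \<omega> b) -` B \<inter> space P | b \<tau> B. (b, \<tau>) \<noteq> (a, t) \<and> B \<in> sets borel}"
  have sub: "?G \<subseteq> Pow (space P)" by auto
  have "(\<lambda>\<omega>. X \<tau> \<omega> b) \<in> borel_measurable (others P X a t)"
  proof (rule measurableI)
    fix B :: "real set" assume "B \<in> sets borel"
    then have "(\<lambda>\<omega>. X \<tau> \<omega> b) -` B \<inter> space P \<in> ?G" using ne by blast
    then show "(\<lambda>\<omega>. X \<tau> \<omega> b) -` B \<inter> space (others P X a t) \<in> sets (others P X a t)"
      unfolding space_others unfolding others_def sets_measure_of[OF sub] by (rule sigma_sets.Basic)
  qed simp
  then have "(\<lambda>\<omega>. X \<tau> \<omega> b) \<in> measurable (others P X a t) (restrict_space borel (\<X> b))"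
    using X_space(2)[OF proc] by (intro measurable_restrict_space2) auto
  then show ?thesis using sets_\<mu>[of b] by (simp cong: measurable_cong_sets)
qed

text \<open>Freezing the excluded coordinate at a fixed \<open>y0\<close> packs all the remaining
  ones into a single configuration measurable for \<open>others\<close>. It plays the part of
  \<open>Z\<close> in \<open>cond_density_disintegration\<close>.\<close>

lemma others_conf_measurable:
  assumes proc: "process P M X" and y0: "y0 \<in> \<X> a"
  shows "(\<lambda>\<omega>. upd2 (\<lambda>t. X t \<omega>) t a y0) \<in> measurable (others P X a t) Conf"
proof (rule measurable_abs_UNIV, rule measurable_abs_UNIV)
  fix \<tau> b
  show "(\<lambda>\<omega>. upd2 (\<lambda>t. X t \<omega>) t a y0 \<tau> b) \<in> measurable (others P X a t) (\<mu> b)"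
  proof (cases "(b, \<tau>) = (a, t)")
    case True
    then show ?thesis using y0 by (simp add: space_\<mu>)
  next
    case False
    then show ?thesis unfolding upd2_other[OF False] by (rule others_measurable[OF proc])
  qed
qed

lemma field_measurable:
  assumes "\<And>b. (\<lambda>p. u p b) \<in> borel_measurable N" "\<And>b. b \<noteq> a \<Longrightarrow> (\<lambda>p. x p b) \<in> borel_measurable N" "\<And>b. (\<lambda>p. z p b) \<in> borel_measurable N"
  shows "(\<lambda>p. field (u p) (x p) (z p) a) \<in> borel_measurable N"
  unfolding field_def using assms by (intro borel_measurable_add borel_measurable_sum borel_measurable_times borel_measurable_const) auto

lemma field_others_measurable:
  assumes "process P M X"
  shows "(\<lambda>\<omega>. field (X (t - 1) \<omega>) (X t \<omega>) (X (t + 1) \<omega>) a) \<in> borel_measurable (others P X a t)"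
  by (intro field_measurable measurable_compose[OF others_measurable[OF assms] id_measurable]) auto

lemma site_measurable:
  assumes [measurable]: "h \<in> borel_measurable N" and y: "y \<in> measurable N (\<mu> a)"
  shows "(\<lambda>p. site a (h p) (y p)) \<in> borel_measurable N"
proof -
  have [measurable]: "(\<lambda>p. s a (y p)) \<in> borel_measurable N" "(\<lambda>p. c a (y p)) \<in> borel_measurable N" "y \<in> borel_measurable N"
    using measurable_compose[OF y s_measurable] measurable_compose[OF y c_measurable] measurable_compose[OF y id_measurable] by auto
  show ?thesis unfolding site_def by measurable
qed

lemma CS_iff: "satisfies_CS \<mu> \<theta> s c \<Phi>m \<Phi>0 \<Phi>1 P X \<longleftrightarrow>
  (\<forall>a t. cond_density_propto P (others P X a t) (\<lambda>\<omega>. X t \<omega> a) (\<mu> a)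
     (\<lambda>\<omega> y. site a (field (X (t - 1) \<omega>) (X t \<omega>) (X (t + 1) \<omega>) a) y))"
  by (simp add: satisfies_CS_def site_def field_def Theta_fun_def)

text \<open>Weighting by \<open>1 / path_weight\<close> turns the conditional law of one coordinate into the reference measure,
  so that this coordinate can be resampled from it.\<close>

definition flat :: "'w measure \<Rightarrow> (int \<Rightarrow> 'w \<Rightarrow> 'p \<Rightarrow> real) \<Rightarrow> int \<Rightarrow> int \<Rightarrow> (int \<Rightarrow> 'p \<Rightarrow> real) measure" where
  "flat P X l u = density (distr P Conf (\<lambda>\<omega> t. X t \<omega>)) (\<lambda>x. ennreal (1 / PK.path_weight l u x))"

lemma sets_flat [measurable_cong, simp]: "sets (flat P X l u) = sets Conf" and space_flat [simp]: "space (flat P X l u) = space Conf"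
  by (simp_all add: flat_def)

lemma path_weight_Conf: "(\<lambda>x. PK.path_weight l u x) \<in> borel_measurable Conf"
  by (rule PK.path_weight_measurable) (rule time_measurable)

lemma nn_integral_flat:
  assumes proc: "process P M X" and phi: "\<phi> \<in> borel_measurable Conf"
  shows "(\<integral>\<^sup>+x. \<phi> x \<partial>flat P X l u) = (\<integral>\<^sup>+\<omega>. ennreal (1 / PK.path_weight l u (\<lambda>t. X t \<omega>)) * \<phi> (\<lambda>t. X t \<omega>) \<partial>P)"
proof -
  have w: "(\<lambda>x. ennreal (1 / PK.path_weight l u x)) \<in> borel_measurable Conf"
    using path_weight_Conf by simp
  have "(\<integral>\<^sup>+x. \<phi> x \<partial>flat P X l u) = (\<integral>\<^sup>+x. ennreal (1 / PK.path_weight l u x) * \<phi> x \<partial>distr P Conf (\<lambda>\<omega> t. X t \<omega>))"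
    unfolding flat_def using w phi by (intro nn_integral_density) (auto cong: measurable_cong_sets)
  also have "\<dots> = (\<integral>\<^sup>+\<omega>. ennreal (1 / PK.path_weight l u (\<lambda>t. X t \<omega>)) * \<phi> (\<lambda>t. X t \<omega>) \<partial>P)"
    using w phi by (intro nn_integral_distr conf_measurable[OF proc]) auto
  finally show ?thesis .
qed

text \<open>Under \<open>flat\<close> the weight \<open>1 / path_weight\<close> cancels the
  single-site density, up to a factor independent of the value at \<open>(a, t)\<close>. Both sides
  reduce to the same integral: on the left the coordinate is integrated freely, on the right its
  observed value contributes \<open>\<mu> a\<close>-mass of \<open>A\<close> divided by
  itself.\<close>

lemma site_swap:
  assumes proc: "process P M X" and cs: "satisfies_CS \<mu> \<theta> s c \<Phi>m \<Phi>0 \<Phi>1 P X"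
    and lu: "l < t" "t < u" and A: "A \<in> sets (\<mu> a)" "emeasure (\<mu> a) A \<noteq> 0" "emeasure (\<mu> a) A \<noteq> \<infinity>"
    and phi: "\<phi> \<in> borel_measurable Conf"
  shows "(\<integral>\<^sup>+x. \<phi> x \<partial>flat P X l u)
    = (\<integral>\<^sup>+x. inverse (emeasure (\<mu> a) A) * indicator A (x t a) * (\<integral>\<^sup>+y. \<phi> (upd2 x t a y) \<partial>\<mu> a) \<partial>flat P X l u)"
proof -
  interpret P: prob_space P using proc by (simp add: process_def)
  define conf where "conf \<omega> = (\<lambda>t. X t \<omega>)" for \<omega>
  define Y where "Y \<omega> = X t \<omega> a" for \<omega>
  define h where "h \<omega> = field (X (t - 1) \<omega>) (X t \<omega>) (X (t + 1) \<omega>) a" for \<omega>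
  define I where "I \<omega> = (LINT y|\<mu> a. site a (h \<omega>) y)" for \<omega>
  let ?F = "others P X a t"
  obtain y0 where y0: "y0 \<in> \<X> a" using \<mu>_nonzero[of a] by fastforce
  define Z where "Z \<omega> = upd2 (conf \<omega>) t a y0" for \<omega>
  have sub: "subalgebra P ?F" by (rule others_subalgebra[OF proc])
  have Z: "Z \<in> measurable ?F Conf" unfolding Z_def conf_def by (rule others_conf_measurable[OF proc y0])
  have Y: "Y \<in> measurable P (\<mu> a)" unfolding Y_def by (rule X_coordinate_measurable[OF proc])
  have cd: "cond_density_propto P ?F Y (\<mu> a) (\<lambda>\<omega>. site a (h \<omega>))"
    using cs unfolding CS_iff Y_def[abs_def] h_def by simp
  have h: "h \<in> borel_measurable P"
    unfolding h_def by (rule measurable_from_subalg[OF sub field_others_measurable[OF proc]])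
  have f: "(\<lambda>(\<omega>, y). site a (h \<omega>) y) \<in> borel_measurable (P \<Otimes>\<^sub>M \<mu> a)"
    unfolding split_beta by (intro site_measurable measurable_compose[OF measurable_fst h] measurable_snd)
  have norm: "AE \<omega> in P. integrable (\<mu> a) (site a (h \<omega>)) \<and> 0 < I \<omega>"
    using cd unfolding I_def by (auto simp: cond_density_propto_def elim: eventually_mono)
  note dis = cond_density_disintegration[OF P.prob_space_axioms sub sf_\<mu> Y Z f cd less_imp_le[OF site_pos]]
  have Zu: "upd2 (Z \<omega>) t a y = upd2 (conf \<omega>) t a y" for \<omega> y unfolding Z_def by simp
  have Zc: "upd2 (Z \<omega>) t a (Y \<omega>) = conf \<omega>" for \<omega>
    unfolding Zu Y_def conf_def using upd2_simps(3)[of "\<lambda>t. X t \<omega>" t a] .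
  \<comment> \<open>By \<open>path_weight_upd2\<close> this quotient is unchanged when the value at
    \<open>(a, t)\<close> is replaced, so the path weight factors as in \<open>pw\<close> for every
    \<open>y\<close>.\<close>
  define D0 where "D0 \<omega> = PK.path_weight l u (conf \<omega>) / site a (h \<omega>) (Y \<omega>)" for \<omega>
  have D0: "0 < D0 \<omega>" for \<omega> unfolding D0_def using PK.path_weight_pos site_pos by simp
  have pw: "PK.path_weight l u (upd2 (conf \<omega>) t a y) = D0 \<omega> * site a (h \<omega>) y" for \<omega> y
    using path_weight_upd2[OF lu, of "conf \<omega>" a y] site_pos[of a "h \<omega>" "Y \<omega>"]
    unfolding D0_def Y_def h_def conf_def by (simp add: field_simps)
  have um: "(\<lambda>p. upd2 (fst p) t a (snd p)) \<in> measurable (Conf \<Otimes>\<^sub>M \<mu> a) Conf"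
    by (intro upd2_measurable measurable_fst measurable_snd)
  have pm: "(\<lambda>p. \<phi> (upd2 (fst p) t a (snd p))) \<in> borel_measurable (Conf \<Otimes>\<^sub>M \<mu> a)"
    by (rule measurable_compose[OF um phi])
  have wm: "(\<lambda>p. ennreal (1 / PK.path_weight l u (upd2 (fst p) t a (snd p)))) \<in> borel_measurable (Conf \<Otimes>\<^sub>M \<mu> a)"
    using measurable_compose[OF um path_weight_Conf[of l u]] by simp
  define G where "G x = (\<integral>\<^sup>+y. \<phi> (upd2 x t a y) \<partial>\<mu> a)" for x
  have Gm: "G \<in> borel_measurable Conf"
    unfolding G_def using pm by (intro sigma_finite_measure.borel_measurable_nn_integral sf_\<mu>) (simp add: split_beta)
  have Gu: "G (upd2 x t a y) = G x" for x y unfolding G_def by simp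
  have ker: "ennreal (1 / PK.path_weight l u (upd2 (conf \<omega>) t a y)) * ennreal (site a (h \<omega>) y / I \<omega>) = ennreal (1 / (D0 \<omega> * I \<omega>))"
    if "0 < I \<omega>" for \<omega> y
    unfolding pw using D0[of \<omega>] site_pos[of a "h \<omega>" y] that by (simp add: ennreal_mult'[symmetric])
  have pu: "(\<lambda>y. \<phi> (upd2 (conf \<omega>) t a y)) \<in> borel_measurable (\<mu> a)" if w: "\<omega> \<in> space P" for \<omega>
  proof -
    have "conf \<omega> \<in> space Conf" unfolding conf_def by (rule measurable_space[OF conf_measurable[OF proc] w])
    then have "(\<lambda>y. (conf \<omega>, y)) \<in> measurable (\<mu> a) (Conf \<Otimes>\<^sub>M \<mu> a)" by measurable
    from measurable_compose[OF this pm] show ?thesis by simp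
  qed
  have "(\<integral>\<^sup>+x. \<phi> x \<partial>flat P X l u) = (\<integral>\<^sup>+\<omega>. ennreal (1 / PK.path_weight l u (conf \<omega>)) * \<phi> (conf \<omega>) \<partial>P)"
    unfolding conf_def by (rule nn_integral_flat[OF proc phi])
  also have "\<dots> = (\<integral>\<^sup>+\<omega>. (\<lambda>p. ennreal (1 / PK.path_weight l u (upd2 (fst p) t a (snd p))) * \<phi> (upd2 (fst p) t a (snd p))) (Z \<omega>, Y \<omega>) \<partial>P)"
    by (simp add: Zc)
  also have "\<dots> = (\<integral>\<^sup>+\<omega>. \<integral>\<^sup>+y. (\<lambda>p. ennreal (1 / PK.path_weight l u (upd2 (fst p) t a (snd p))) * \<phi> (upd2 (fst p) t a (snd p))) (Z \<omega>, y) * ennreal (site a (h \<omega>) y / I \<omega>) \<partial>\<mu> a \<partial>P)"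
    unfolding I_def by (rule dis[OF borel_measurable_times_ennreal[OF wm pm]])
  also have "\<dots> = (\<integral>\<^sup>+\<omega>. ennreal (1 / (D0 \<omega> * I \<omega>)) * G (conf \<omega>) \<partial>P)"
  proof (rule nn_integral_cong_AE)
    show "AE \<omega> in P. (\<integral>\<^sup>+y. (\<lambda>p. ennreal (1 / PK.path_weight l u (upd2 (fst p) t a (snd p))) * \<phi> (upd2 (fst p) t a (snd p))) (Z \<omega>, y) * ennreal (site a (h \<omega>) y / I \<omega>) \<partial>\<mu> a)
      = ennreal (1 / (D0 \<omega> * I \<omega>)) * G (conf \<omega>)"
      using norm AE_space
    proof eventually_elim
      case (elim \<omega>)
      have I0: "0 < I \<omega>" using elim by simp
      have "(\<integral>\<^sup>+y. (\<lambda>p. ennreal (1 / PK.path_weight l u (upd2 (fst p) t a (snd p))) * \<phi> (upd2 (fst p) t a (snd p))) (Z \<omega>, y) * ennreal (site a (h \<omega>) y / I \<omega>) \<partial>\<mu> a)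
        = (\<integral>\<^sup>+y. ennreal (1 / (D0 \<omega> * I \<omega>)) * \<phi> (upd2 (conf \<omega>) t a y) \<partial>\<mu> a)"
      proof (rule nn_integral_cong)
        fix y
        show "(\<lambda>p. ennreal (1 / PK.path_weight l u (upd2 (fst p) t a (snd p))) * \<phi> (upd2 (fst p) t a (snd p))) (Z \<omega>, y) * ennreal (site a (h \<omega>) y / I \<omega>)
          = ennreal (1 / (D0 \<omega> * I \<omega>)) * \<phi> (upd2 (conf \<omega>) t a y)"
          unfolding fst_conv snd_conv Zu ker[OF I0, of y, symmetric] by (simp only: mult_ac)
      qed
      also have "\<dots> = ennreal (1 / (D0 \<omega> * I \<omega>)) * G (conf \<omega>)"
        unfolding G_def by (rule nn_integral_cmult[OF pu[OF elim(2)]])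
      finally show ?case .
    qed
  qed
  finally have L: "(\<integral>\<^sup>+x. \<phi> x \<partial>flat P X l u) = (\<integral>\<^sup>+\<omega>. ennreal (1 / (D0 \<omega> * I \<omega>)) * G (conf \<omega>) \<partial>P)" .
  \<comment> \<open>Since \<open>\<mu> a\<close> may be infinite, the resampling of the coordinate
    is normalised on a piece \<open>A\<close> of finite positive measure.\<close>
  define iA where "iA = inverse (emeasure (\<mu> a) A)"
  have tam: "(\<lambda>x. x t a) \<in> measurable Conf (\<mu> a)" by (rule measurable_compose[OF time_measurable coordinate_measurable])
  have indm: "(\<lambda>x. indicator A (x t a) :: ennreal) \<in> borel_measurable Conf"
    by (rule measurable_compose[OF tam]) (use A in simp)
  have indm2: "(\<lambda>p. indicator A (snd p) :: ennreal) \<in> borel_measurable (Conf \<Otimes>\<^sub>M \<mu> a)"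
    by (rule measurable_compose[OF measurable_snd]) (use A in simp)
  have Gm2: "(\<lambda>p. G (fst p)) \<in> borel_measurable (Conf \<Otimes>\<^sub>M \<mu> a)" by (rule measurable_compose[OF measurable_fst Gm])
  have "(\<integral>\<^sup>+x. iA * indicator A (x t a) * G x \<partial>flat P X l u)
    = (\<integral>\<^sup>+\<omega>. ennreal (1 / PK.path_weight l u (conf \<omega>)) * (iA * indicator A (conf \<omega> t a) * G (conf \<omega>)) \<partial>P)"
    unfolding conf_def
    by (rule nn_integral_flat[OF proc]) (intro borel_measurable_times_ennreal indm Gm borel_measurable_const)
  also have "\<dots> = (\<integral>\<^sup>+\<omega>. (\<lambda>p. ennreal (1 / PK.path_weight l u (upd2 (fst p) t a (snd p))) * (iA * indicator A (snd p) * G (fst p))) (Z \<omega>, Y \<omega>) \<partial>P)"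
  proof -
    have "G (Z \<omega>) = G (conf \<omega>)" for \<omega> unfolding Z_def by (rule Gu)
    moreover have "conf \<omega> t a = Y \<omega>" for \<omega> by (simp add: conf_def Y_def)
    ultimately show ?thesis by (simp add: Zc)
  qed
  also have "\<dots> = (\<integral>\<^sup>+\<omega>. \<integral>\<^sup>+y. (\<lambda>p. ennreal (1 / PK.path_weight l u (upd2 (fst p) t a (snd p))) * (iA * indicator A (snd p) * G (fst p))) (Z \<omega>, y) * ennreal (site a (h \<omega>) y / I \<omega>) \<partial>\<mu> a \<partial>P)"
    unfolding I_def by (rule dis) (intro borel_measurable_times_ennreal wm indm2 Gm2 borel_measurable_const)
  also have "\<dots> = (\<integral>\<^sup>+\<omega>. ennreal (1 / (D0 \<omega> * I \<omega>)) * G (conf \<omega>) \<partial>P)"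
  proof (rule nn_integral_cong_AE)
    show "AE \<omega> in P. (\<integral>\<^sup>+y. (\<lambda>p. ennreal (1 / PK.path_weight l u (upd2 (fst p) t a (snd p))) * (iA * indicator A (snd p) * G (fst p))) (Z \<omega>, y) * ennreal (site a (h \<omega>) y / I \<omega>) \<partial>\<mu> a)
      = ennreal (1 / (D0 \<omega> * I \<omega>)) * G (conf \<omega>)"
      using norm
    proof eventually_elim
      case (elim \<omega>)
      have I0: "0 < I \<omega>" using elim by simp
      have GZ: "G (Z \<omega>) = G (conf \<omega>)" unfolding Z_def by (rule Gu)
      have "(\<integral>\<^sup>+y. (\<lambda>p. ennreal (1 / PK.path_weight l u (upd2 (fst p) t a (snd p))) * (iA * indicator A (snd p) * G (fst p))) (Z \<omega>, y) * ennreal (site a (h \<omega>) y / I \<omega>) \<partial>\<mu> a)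
        = (\<integral>\<^sup>+y. (ennreal (1 / (D0 \<omega> * I \<omega>)) * iA * G (conf \<omega>)) * indicator A y \<partial>\<mu> a)"
      proof (rule nn_integral_cong)
        fix y
        show "(\<lambda>p. ennreal (1 / PK.path_weight l u (upd2 (fst p) t a (snd p))) * (iA * indicator A (snd p) * G (fst p))) (Z \<omega>, y) * ennreal (site a (h \<omega>) y / I \<omega>)
          = ennreal (1 / (D0 \<omega> * I \<omega>)) * iA * G (conf \<omega>) * indicator A y"
          unfolding fst_conv snd_conv Zu ker[OF I0, of y, symmetric] GZ by (simp only: mult_ac)
      qed
      also have "\<dots> = (ennreal (1 / (D0 \<omega> * I \<omega>)) * iA * G (conf \<omega>)) * emeasure (\<mu> a) A"
        using A by (simp add: nn_integral_cmult)
      also have "\<dots> = (ennreal (1 / (D0 \<omega> * I \<omega>)) * G (conf \<omega>)) * (iA * emeasure (\<mu> a) A)" by (simp only: mult_ac)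
      also have "iA * emeasure (\<mu> a) A = 1"
        unfolding iA_def using A by (simp add: divide_ennreal_def[symmetric] mult.commute less_top)
      finally show ?case by simp
    qed
  qed
  finally show ?thesis unfolding L G_def iA_def ..
qed

lemma finite_piece: "\<exists>A\<in>sets (\<mu> a). emeasure (\<mu> a) A \<noteq> 0 \<and> emeasure (\<mu> a) A \<noteq> \<infinity>"
proof -
  obtain F :: "nat \<Rightarrow> real set" where F: "range F \<subseteq> sets (\<mu> a)" "(\<Union>i. F i) = space (\<mu> a)" "\<And>i. emeasure (\<mu> a) (F i) \<noteq> \<infinity>"
    using sigma_finite_measure.sigma_finite[OF sf_\<mu>[of a]] by metis
  have "emeasure (\<mu> a) (\<Union>i. F i) = 0" if "\<forall>i. emeasure (\<mu> a) (F i) = 0"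
    by (rule emeasure_UN_eq_0) (use that F(1) in auto)
  then have "\<exists>i. emeasure (\<mu> a) (F i) \<noteq> 0"
    using F(2) \<mu>_nonzero[of a] space_\<mu>[of a] by metis
  then show ?thesis using F by auto
qed

text \<open>\<open>resample\<close> over the coordinates at one time. \<open>C\<close> and
  \<open>A\<close> are found before \<open>l\<close>, \<open>t\<close>, \<open>u\<close>, so one
  choice serves all times of every window.\<close>

lemma time_swap:
  assumes proc: "process P M X" and cs: "satisfies_CS \<mu> \<theta> s c \<Phi>m \<Phi>0 \<Phi>1 P X"
  shows "\<exists>C::ennreal. \<exists>A\<in>sets M. \<forall>(l::int) t u. \<forall>\<phi> \<in> (borel_measurable Conf :: ((int \<Rightarrow> 'p \<Rightarrow> real) \<Rightarrow> ennreal) set). l < t \<longrightarrow> t < u \<longrightarrow>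
    (\<integral>\<^sup>+x. \<phi> x \<partial>flat P X l u) = (\<integral>\<^sup>+x. C * indicator A (x t) * (\<integral>\<^sup>+y. \<phi> (x(t := y)) \<partial>M) \<partial>flat P X l u)"
proof -
  have "\<forall>a. \<exists>A\<in>sets (\<mu> a). emeasure (\<mu> a) A \<noteq> 0 \<and> emeasure (\<mu> a) A \<noteq> \<infinity>" using finite_piece by blast
  then obtain A where A: "\<And>a. A a \<in> sets (\<mu> a)" "\<And>a. emeasure (\<mu> a) (A a) \<noteq> 0" "\<And>a. emeasure (\<mu> a) (A a) \<noteq> \<infinity>"
    by metis
  let ?C = "\<Prod>a\<in>UNIV. inverse (emeasure (\<mu> a) (A a))"
  let ?A = "Pi\<^sub>E UNIV A"
  have Am: "?A \<in> sets M" using A by (intro sets_PiM_I_finite) auto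
  show ?thesis
  proof (intro exI[of _ ?C] bexI[OF _ Am] allI ballI impI)
    fix l t u :: int and \<phi> :: "(int \<Rightarrow> 'p \<Rightarrow> real) \<Rightarrow> ennreal"
    assume phi: "\<phi> \<in> borel_measurable Conf" and lu: "l < t" "t < u"
    define put where "put x I ys = x(t := \<lambda>a. if a \<in> I then ys a else x t a)" for x :: "int \<Rightarrow> 'p \<Rightarrow> real" and I :: "'p set" and ys
    have fm: "fst \<in> measurable (flat P X l u \<Otimes>\<^sub>M N) Conf" for N :: "'z measure"
      using measurable_fst[of "flat P X l u" N] by (simp cong: measurable_cong_sets)
    have "(\<integral>\<^sup>+x. \<phi> x \<partial>flat P X l u) = (\<integral>\<^sup>+x. (\<Prod>a\<in>UNIV. inverse (emeasure (\<mu> a) (A a)) * indicator (A a) (x t a)) * (\<integral>\<^sup>+ys. \<phi> (put x UNIV ys) \<partial>PiM UNIV \<mu>) \<partial>flat P X l u)"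
    proof (rule resample[where get="\<lambda>x a. x t a" and upd="\<lambda>x a y. upd2 x t a y" and put=put])
      show "product_sigma_finite \<mu>" by (rule \<mu>.product_sigma_finite_axioms)
      show "(\<lambda>x. x t a) \<in> measurable (flat P X l u) (\<mu> a)" for a
        using measurable_compose[OF time_measurable[of t] coordinate_measurable[of a]] by (simp cong: measurable_cong_sets)
      show "(\<lambda>p. upd2 (fst p) t a (snd p)) \<in> measurable (flat P X l u \<Otimes>\<^sub>M \<mu> a) (flat P X l u)" for a
        using upd2_measurable[OF fm measurable_snd] by (simp cong: measurable_cong_sets)
      show "(\<lambda>p. put (fst p) I (snd p)) \<in> measurable (flat P X l u \<Otimes>\<^sub>M PiM I \<mu>) (flat P X l u)" for I
      proof -
        have "(\<lambda>p a. if a \<in> I then snd p a else fst p t a) \<in> measurable (flat P X l u \<Otimes>\<^sub>M PiM I \<mu>) M"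
        proof (rule measurable_abs_UNIV)
          fix a
          have 1: "(\<lambda>p. fst p t a) \<in> measurable (flat P X l u \<Otimes>\<^sub>M PiM I \<mu>) (\<mu> a)"
            by (rule measurable_compose[OF measurable_compose[OF fm time_measurable] coordinate_measurable])
          have 2: "(\<lambda>p. snd p a) \<in> measurable (flat P X l u \<Otimes>\<^sub>M PiM I \<mu>) (\<mu> a)" if "a \<in> I"
            by (rule measurable_compose[OF measurable_snd measurable_component_singleton[OF that]])
          show "(\<lambda>p. if a \<in> I then snd p a else fst p t a) \<in> measurable (flat P X l u \<Otimes>\<^sub>M PiM I \<mu>) (\<mu> a)"
            using 1 2 by (cases "a \<in> I") auto
        qed
        from upd_time_measurable[OF fm this] show ?thesis unfolding put_def by (simp cong: measurable_cong_sets)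
      qed
      show "put x {} ys = x" for x ys by (simp add: put_def)
      show "put (upd2 x t i y) I ys = put x (insert i I) (ys(i := y))" if "i \<notin> I" for x i y I ys
        using that by (auto simp: put_def upd2_def fun_eq_iff)
      show "upd2 x t i y t j = x t j" if "i \<noteq> j" for x i j y using that by (simp add: upd2_def)
      show "\<phi> \<in> borel_measurable (flat P X l u)" using phi by (simp cong: measurable_cong_sets)
      fix a and \<psi> :: "(int \<Rightarrow> 'p \<Rightarrow> real) \<Rightarrow> ennreal" assume "\<psi> \<in> borel_measurable (flat P X l u)"
      then have "\<psi> \<in> borel_measurable Conf" by (simp cong: measurable_cong_sets)
      from site_swap[OF proc cs lu A this]
      show "(\<integral>\<^sup>+x. \<psi> x \<partial>flat P X l u) = (\<integral>\<^sup>+x. inverse (emeasure (\<mu> a) (A a)) * indicator (A a) (x t a) * (\<integral>\<^sup>+y. \<psi> (upd2 x t a y) \<partial>\<mu> a) \<partial>flat P X l u)" .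
    qed (use A in auto)
    also have "\<dots> = (\<integral>\<^sup>+x. ?C * indicator ?A (x t) * (\<integral>\<^sup>+y. \<phi> (x(t := y)) \<partial>M) \<partial>flat P X l u)"
    proof -
      have "(\<Prod>a\<in>UNIV. inverse (emeasure (\<mu> a) (A a)) * indicator (A a) (x t a)) = ?C * indicator ?A (x t)" for x :: "int \<Rightarrow> 'p \<Rightarrow> real"
        unfolding prod.distrib by (auto simp: indicator_def PiE_iff intro!: prod_zero)
      then show ?thesis by (simp add: put_def)
    qed
    finally show "(\<integral>\<^sup>+x. \<phi> x \<partial>flat P X l u) = (\<integral>\<^sup>+x. ?C * indicator ?A (x t) * (\<integral>\<^sup>+y. \<phi> (x(t := y)) \<partial>M) \<partial>flat P X l u)" .
  qed
qed

lemma marginals_equal: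
  assumes proc: "process P M X" and st: "strictly_stationary P M X"
  shows "distr P M (X t) = distr P M (X 0)"
proof -
  have X: "X t \<in> measurable P M" for t using proc by (simp add: process_def)
  have m: "(\<lambda>\<omega>. \<lambda>\<tau>\<in>{0::int}. X (\<tau> + h) \<omega>) \<in> measurable P (PiM {0} (\<lambda>_. M))" for h
    by (intro measurable_restrict X)
  have "distr P M (X h) = distr (distr P (PiM {0} (\<lambda>_. M)) (\<lambda>\<omega>. \<lambda>\<tau>\<in>{0::int}. X (\<tau> + h) \<omega>)) M (\<lambda>x. x 0)" for h
    by (subst distr_distr[OF measurable_component_singleton m]) (auto intro!: distr_cong)
  moreover have "distr P (PiM {0} (\<lambda>_. M)) (\<lambda>\<omega>. \<lambda>\<tau>\<in>{0::int}. X (\<tau> + t) \<omega>) = distr P (PiM {0} (\<lambda>_. M)) (\<lambda>\<omega>. \<lambda>\<tau>\<in>{0::int}. X (\<tau> + 0) \<omega>)"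
    using st unfolding strictly_stationary_def by simp
  ultimately show ?thesis by metis
qed

text \<open>A second use of \<open>resample\<close>, now over the times strictly inside the window,
  replaces the whole block under \<open>flat\<close> by a sample from the product of
  \<open>M\<close>.\<close>

theorem CS_gibbs:
  assumes proc: "process P M X" and st: "strictly_stationary P M X" and cs: "satisfies_CS \<mu> \<theta> s c \<Phi>m \<Phi>0 \<Phi>1 P X"
  shows "PK.gibbs P X"
  unfolding PK.gibbs_def
proof (intro conjI allI impI)
  show "prob_space P" "X t \<in> measurable P M" for t using proc by (auto simp: process_def)
  show "distr P M (X t) = distr P M (X 0)" for t by (rule marginals_equal[OF proc st])
next
  fix l u :: int assume "l < u"
  let ?J = "{l+1..u-1}"
  obtain C A where A: "A \<in> sets M" and swap: "\<And>(l::int) t u (\<phi> :: (int \<Rightarrow> 'p \<Rightarrow> real) \<Rightarrow> ennreal). \<phi> \<in> borel_measurable Conf \<Longrightarrow> l < t \<Longrightarrow> t < u \<Longrightarrow>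
    (\<integral>\<^sup>+x. \<phi> x \<partial>flat P X l u) = (\<integral>\<^sup>+x. C * indicator A (x t) * (\<integral>\<^sup>+y. \<phi> (x(t := y)) \<partial>M) \<partial>flat P X l u)"
    using time_swap[OF proc cs] by blast
  define H0 where "H0 x = (\<Prod>t\<in>?J. C * indicator A (x t))" for x :: "int \<Rightarrow> 'p \<Rightarrow> real"
  have H0: "H0 \<in> borel_measurable Conf"
  proof -
    have "(\<lambda>x. indicator A (x t) :: ennreal) \<in> borel_measurable Conf" for t
      by (rule measurable_compose[OF time_measurable]) (use A in simp)
    then show ?thesis unfolding H0_def by (intro borel_measurable_prod_ennreal borel_measurable_times_ennreal borel_measurable_const)
  qed
  have ovm: "(\<lambda>p. override I (fst p) (snd p)) \<in> measurable (flat P X l u \<Otimes>\<^sub>M PiM I (\<lambda>_. M)) Conf" for I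
    unfolding override_def[abs_def]
  proof (rule measurable_abs_UNIV)
    fix t
    have fm: "fst \<in> measurable (flat P X l u \<Otimes>\<^sub>M PiM I (\<lambda>_. M)) Conf"
      using measurable_fst[of "flat P X l u" "PiM I (\<lambda>_. M)"] by (simp cong: measurable_cong_sets)
    have 2: "(\<lambda>p. snd p t) \<in> measurable (flat P X l u \<Otimes>\<^sub>M PiM I (\<lambda>_. M)) M" if "t \<in> I"
      by (rule measurable_compose[OF measurable_snd measurable_component_singleton[OF that]])
    show "(\<lambda>p. if t \<in> I then snd p t else fst p t) \<in> measurable (flat P X l u \<Otimes>\<^sub>M PiM I (\<lambda>_. M)) M"
      using measurable_compose[OF fm time_measurable[of t]] 2 by (cases "t \<in> I") auto
  qed
  have main: "(\<integral>\<^sup>+x. \<psi> x \<partial>flat P X l u) = (\<integral>\<^sup>+x. H0 x * (\<integral>\<^sup>+z. \<psi> (override ?J x z) \<partial>PiM ?J (\<lambda>_. M)) \<partial>flat P X l u)"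
    if psi: "\<psi> \<in> borel_measurable Conf" for \<psi>
    unfolding H0_def
  proof (rule resample[where get="\<lambda>x t. x t" and upd="\<lambda>x t y. x(t := y)" and put="\<lambda>x I z. override I x z"])
    show "product_sigma_finite (\<lambda>_::int. M)" by (rule PK.P.product_sigma_finite_axioms)
    show "(\<lambda>x. x t) \<in> measurable (flat P X l u) M" for t
      using time_measurable[of t] by (simp cong: measurable_cong_sets)
    show "(\<lambda>p. override I (fst p) (snd p)) \<in> measurable (flat P X l u \<Otimes>\<^sub>M PiM I (\<lambda>_. M)) (flat P X l u)" for I
      using ovm by (simp cong: measurable_cong_sets)
    show "(\<lambda>p. (fst p)(t := snd p)) \<in> measurable (flat P X l u \<Otimes>\<^sub>M M) (flat P X l u)" for t
    proof -
      have "fst \<in> measurable (flat P X l u \<Otimes>\<^sub>M M) Conf"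
        using measurable_fst[of "flat P X l u" M] by (simp cong: measurable_cong_sets)
      from upd_time_measurable[OF this measurable_snd] show ?thesis by (simp cong: measurable_cong_sets)
    qed
    show "override {} x z = x" for x z :: "int \<Rightarrow> 'p \<Rightarrow> real" by (auto simp: override_def)
    show "override I (x(i := y)) z = override (insert i I) x (z(i := y))" if "i \<notin> I" for x z :: "int \<Rightarrow> 'p \<Rightarrow> real" and i y I
      using that by (auto simp: override_def fun_eq_iff)
    show "\<psi> \<in> borel_measurable (flat P X l u)" using psi by (simp cong: measurable_cong_sets)
    fix t and \<phi> :: "(int \<Rightarrow> 'p \<Rightarrow> real) \<Rightarrow> ennreal" assume t: "t \<in> ?J" and "\<phi> \<in> borel_measurable (flat P X l u)"
    then have "\<phi> \<in> borel_measurable Conf" by (simp cong: measurable_cong_sets)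
    from swap[OF this, of l t u] t show "(\<integral>\<^sup>+x. \<phi> x \<partial>flat P X l u) = (\<integral>\<^sup>+x. C * indicator A (x t) * (\<integral>\<^sup>+y. \<phi> (x(t := y)) \<partial>M) \<partial>flat P X l u)"
      by simp
  qed (use A in auto)
  \<comment> \<open>Built from the observed configuration and the window alone, hence independent of
    the test function, as \<open>gibbs\<close> requires.\<close>
  define H where "H \<omega> = ennreal (1 / PK.path_weight l u (\<lambda>t. X t \<omega>)) * H0 (\<lambda>t. X t \<omega>)" for \<omega>
  have wm: "(\<lambda>x. ennreal (1 / PK.path_weight l u x)) \<in> borel_measurable Conf" using path_weight_Conf by simp
  have wm': "(\<lambda>x. ennreal (PK.path_weight l u x)) \<in> borel_measurable Conf" using path_weight_Conf by simp
  have H: "H \<in> borel_measurable P"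
    unfolding H_def
    by (intro borel_measurable_times_ennreal measurable_compose[OF conf_measurable[OF proc] wm] measurable_compose[OF conf_measurable[OF proc] H0])
  interpret J: finite_product_sigma_finite "\<lambda>_::int. M" ?J by standard simp
  show "\<exists>H\<in>borel_measurable P. \<forall>\<phi>\<in>borel_measurable Conf. (\<integral>\<^sup>+\<omega>. \<phi> (\<lambda>t. X t \<omega>) \<partial>P) =
      (\<integral>\<^sup>+\<omega>. H \<omega> * (\<integral>\<^sup>+z. ennreal (PK.path_weight l u (override ?J (\<lambda>t. X t \<omega>) z)) *
         \<phi> (override ?J (\<lambda>t. X t \<omega>) z) \<partial>PiM ?J (\<lambda>_. M)) \<partial>P)"
  proof (rule bexI[OF _ H], rule ballI)
    fix \<phi> :: "(int \<Rightarrow> 'p \<Rightarrow> real) \<Rightarrow> ennreal" assume phi: "\<phi> \<in> borel_measurable Conf"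
    \<comment> \<open>The extra path weight cancels the density of \<open>flat\<close> on the left
      and reappears, at the resampled block, inside the inner integral on the right.\<close>
    define \<psi> where "\<psi> x = ennreal (PK.path_weight l u x) * \<phi> x" for x
    have psi: "\<psi> \<in> borel_measurable Conf" unfolding \<psi>_def by (intro borel_measurable_times_ennreal wm' phi)
    have "(\<integral>\<^sup>+\<omega>. \<phi> (\<lambda>t. X t \<omega>) \<partial>P) = (\<integral>\<^sup>+\<omega>. ennreal (1 / PK.path_weight l u (\<lambda>t. X t \<omega>)) * \<psi> (\<lambda>t. X t \<omega>) \<partial>P)"
      unfolding \<psi>_def by (simp add: mult.assoc[symmetric] ennreal_mult'[symmetric])
    also have "\<dots> = (\<integral>\<^sup>+x. \<psi> x \<partial>flat P X l u)" by (rule nn_integral_flat[OF proc psi, symmetric])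
    also have "\<dots> = (\<integral>\<^sup>+x. H0 x * (\<integral>\<^sup>+z. \<psi> (override ?J x z) \<partial>PiM ?J (\<lambda>_. M)) \<partial>flat P X l u)" by (rule main[OF psi])
    also have "\<dots> = (\<integral>\<^sup>+\<omega>. ennreal (1 / PK.path_weight l u (\<lambda>t. X t \<omega>)) * (H0 (\<lambda>t. X t \<omega>) * (\<integral>\<^sup>+z. \<psi> (override ?J (\<lambda>t. X t \<omega>) z) \<partial>PiM ?J (\<lambda>_. M))) \<partial>P)"
    proof (rule nn_integral_flat[OF proc])
      have "(\<lambda>p. \<psi> (override ?J (fst p) (snd p))) \<in> borel_measurable (flat P X l u \<Otimes>\<^sub>M PiM ?J (\<lambda>_. M))"
        by (rule measurable_compose[OF ovm psi])
      then have "(\<lambda>x. \<integral>\<^sup>+z. \<psi> (override ?J x z) \<partial>PiM ?J (\<lambda>_. M)) \<in> borel_measurable (flat P X l u)"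
        by (intro J.borel_measurable_nn_integral) (simp add: split_beta)
      then show "(\<lambda>x. H0 x * (\<integral>\<^sup>+z. \<psi> (override ?J x z) \<partial>PiM ?J (\<lambda>_. M))) \<in> borel_measurable Conf"
        using H0 by (intro borel_measurable_times_ennreal) (simp_all cong: measurable_cong_sets)
    qed
    finally show "(\<integral>\<^sup>+\<omega>. \<phi> (\<lambda>t. X t \<omega>) \<partial>P) =
      (\<integral>\<^sup>+\<omega>. H \<omega> * (\<integral>\<^sup>+z. ennreal (PK.path_weight l u (override ?J (\<lambda>t. X t \<omega>) z)) *
         \<phi> (override ?J (\<lambda>t. X t \<omega>) z) \<partial>PiM ?J (\<lambda>_. M)) \<partial>P)"
      unfolding H_def \<psi>_def by (simp only: mult.assoc)
  qed
qed

end

section \<open>Processes determined by their window laws\<close>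

lemma measure_eqI_windows:
  fixes N1 N2 :: "(int \<Rightarrow> 'x) measure"
  assumes sets: "sets N1 = sets (PiM UNIV (\<lambda>_. M))" "sets N2 = sets (PiM UNIV (\<lambda>_. M))"
    and fin: "finite_measure N1"
    and eq: "\<And>l u E. l < t \<Longrightarrow> t < u \<Longrightarrow> E \<in> sets (PiM {l..u} (\<lambda>_. M)) \<Longrightarrow>
      emeasure N1 {x\<in>space (PiM UNIV (\<lambda>_. M)). restrict x {l..u} \<in> E} = emeasure N2 {x\<in>space (PiM UNIV (\<lambda>_. M)). restrict x {l..u} \<in> E}"
  shows "N1 = N2"
proof (rule measure_eqI_PiM_infinite[OF sets _ fin])
  fix A :: "int \<Rightarrow> 'x set" and J :: "int set"
  assume J: "finite J" "J \<subseteq> UNIV" and A: "\<And>i. i \<in> J \<Longrightarrow> A i \<in> sets M"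
  \<comment> \<open>The margin of one on either side makes \<open>t\<close> an interior time, so
    that both of its neighbours lie in the window.\<close>
  define l where "l = Min (insert t J) - 1"
  define u where "u = Max (insert t J) + 1"
  have lu: "l < t" "t < u" and sub: "J \<subseteq> {l..u}"
  proof -
    have "Min (insert t J) \<le> j" "j \<le> Max (insert t J)" if "j \<in> insert t J" for j
      using that J by auto
    then show "l < t" "t < u" "J \<subseteq> {l..u}" unfolding l_def u_def by force+
  qed
  let ?E = "prod_emb {l..u} (\<lambda>_. M) J (Pi\<^sub>E J A)"
  have E: "?E \<in> sets (PiM {l..u} (\<lambda>_. M))" using J A sub by (intro measurable_prod_emb sets_PiM_I_finite) auto
  have "prod_emb UNIV (\<lambda>_. M) J (Pi\<^sub>E J A) = {x\<in>space (PiM UNIV (\<lambda>_. M)). restrict x {l..u} \<in> ?E}"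
    using sub by (auto simp: prod_emb_def space_PiM PiE_iff Int_absorb1)
  then show "emeasure N1 (prod_emb UNIV (\<lambda>_. M) J (Pi\<^sub>E J A)) = emeasure N2 (prod_emb UNIV (\<lambda>_. M) J (Pi\<^sub>E J A))"
    using eq[OF lu E] by simp
qed

context principal_pair
begin

text \<open>Description by laws of windows only. It will turn out to be equivalent to
  \<open>stationary_CS_process\<close>, which brings existence, uniqueness and the densities
  together.\<close>

definition chain_process :: "'w measure \<Rightarrow> (int \<Rightarrow> 'w \<Rightarrow> 'x) \<Rightarrow> bool" where
  "chain_process P X \<longleftrightarrow> process P M X \<and>
    (\<forall>a b. a \<le> b \<longrightarrow> distr P (PiM {a..b} (\<lambda>_. M)) (\<lambda>\<omega>. \<lambda>t\<in>{a..b}. X t \<omega>) = chain a b)"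

lemma restrict_process_measurable:
  assumes "process P M X"
  shows "(\<lambda>\<omega>. \<lambda>t\<in>J. X (t + h) \<omega>) \<in> measurable P (PiM J (\<lambda>_. M))" "(\<lambda>\<omega>. \<lambda>t\<in>J. X t \<omega>) \<in> measurable P (PiM J (\<lambda>_. M))"
  using assms by (auto simp: process_def intro!: measurable_restrict)

lemma chain_process_stationary:
  assumes cp: "chain_process P X"
  shows "strictly_stationary P M X"
  unfolding strictly_stationary_def
proof (intro allI impI)
  fix J :: "int set" and h assume J: "finite J"
  have proc: "process P M X" using cp by (simp add: chain_process_def)
  define a where "a = Min (insert 0 J)"
  define b where "b = Max (insert 0 J)"
  have ab: "a \<le> b" and sub: "J \<subseteq> {a..b}"
  proof -
    have "a \<le> j \<and> j \<le> b" if "j \<in> insert 0 J" for j unfolding a_def b_def using that J by auto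
    then show "a \<le> b" "J \<subseteq> {a..b}" by force+
  qed
  have rm: "(\<lambda>x. restrict x J) \<in> measurable (PiM {a..b} (\<lambda>_. M)) (PiM J (\<lambda>_. M))"
    by (rule measurable_restrict_subset[OF sub])
  have sm: "(\<lambda>x. \<lambda>t\<in>{a..b}. x (t + k)) \<in> measurable (PiM {a+k..b+k} (\<lambda>_. M)) (PiM {a..b} (\<lambda>_. M))" for k
    by (intro measurable_restrict measurable_component_singleton) auto
  have "distr P (PiM J (\<lambda>_. M)) (\<lambda>\<omega>. \<lambda>t\<in>J. X (t + k) \<omega>) = distr (chain a b) (PiM J (\<lambda>_. M)) (\<lambda>x. restrict x J)" for k
  proof -
    have "chain (a + k) (b + k) = distr P (PiM {a+k..b+k} (\<lambda>_. M)) (\<lambda>\<omega>. \<lambda>t\<in>{a+k..b+k}. X t \<omega>)"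
      using cp ab by (simp add: chain_process_def)
    then have "chain a b = distr P (PiM {a..b} (\<lambda>_. M)) ((\<lambda>x. \<lambda>t\<in>{a..b}. x (t + k)) \<circ> (\<lambda>\<omega>. \<lambda>t\<in>{a+k..b+k}. X t \<omega>))"
      using distr_chain_shift[OF ab, of k] by (simp add: distr_distr[OF sm restrict_process_measurable(2)[OF proc]])
    also have "((\<lambda>x. \<lambda>t\<in>{a..b}. x (t + k)) \<circ> (\<lambda>\<omega>. \<lambda>t\<in>{a+k..b+k}. X t \<omega>)) = (\<lambda>\<omega>. \<lambda>t\<in>{a..b}. X (t + k) \<omega>)"
      by (auto simp: fun_eq_iff)
    finally have "distr (chain a b) (PiM J (\<lambda>_. M)) (\<lambda>x. restrict x J)
      = distr P (PiM J (\<lambda>_. M)) ((\<lambda>x. restrict x J) \<circ> (\<lambda>\<omega>. \<lambda>t\<in>{a..b}. X (t + k) \<omega>))"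
      by (simp only: distr_distr[OF rm restrict_process_measurable(1)[OF proc]])
    also have "((\<lambda>x. restrict x J) \<circ> (\<lambda>\<omega>. \<lambda>t\<in>{a..b}. X (t + k) \<omega>)) = (\<lambda>\<omega>. \<lambda>t\<in>J. X (t + k) \<omega>)"
      using sub by (auto simp: fun_eq_iff)
    finally show ?thesis ..
  qed
  from this[of h] this[of 0] show "distr P (PiM J (\<lambda>_. M)) (\<lambda>\<omega>. \<lambda>t\<in>J. X (t + h) \<omega>) = distr P (PiM J (\<lambda>_. M)) (\<lambda>\<omega>. \<lambda>t\<in>J. X t \<omega>)"
    by simp
qed

lemma nn_integral_chain_process:
  assumes cp: "chain_process P X" and "a \<le> b" and phi: "\<phi> \<in> borel_measurable (PiM {a..b} (\<lambda>_. M))"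
  shows "(\<integral>\<^sup>+\<omega>. \<phi> (\<lambda>t\<in>{a..b}. X t \<omega>) \<partial>P) = (\<integral>\<^sup>+x. \<phi> x \<partial>chain a b)"
proof -
  have proc: "process P M X" using cp by (simp add: chain_process_def)
  have "(\<integral>\<^sup>+x. \<phi> x \<partial>chain a b) = (\<integral>\<^sup>+x. \<phi> x \<partial>distr P (PiM {a..b} (\<lambda>_. M)) (\<lambda>\<omega>. \<lambda>t\<in>{a..b}. X t \<omega>))"
    using assms by (simp add: chain_process_def)
  also have "\<dots> = (\<integral>\<^sup>+\<omega>. \<phi> (\<lambda>t\<in>{a..b}. X t \<omega>) \<partial>P)"
    by (rule nn_integral_distr[OF restrict_process_measurable(2)[OF proc]])
      (use phi in simp)
  finally show ?thesis ..
qed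

lemma chain_process_law:
  assumes cp: "chain_process P X"
    and cq: "chain_process Q Y"
  shows "law P M X = law Q M Y"
proof -
  have em: "emeasure (law P M X) {x\<in>space (PiM UNIV (\<lambda>_. M)). restrict x {l..u} \<in> E} = emeasure (chain l u) E"
    if cp: "chain_process P X" and lu: "l < u" and E: "E \<in> sets (PiM {l..u} (\<lambda>_. M))"
    for P :: "'z measure" and X l u E
  proof -
    have proc: "process P M X" using cp by (simp add: chain_process_def)
    have rm: "(\<lambda>x. restrict x {l..u}) \<in> measurable (PiM UNIV (\<lambda>_. M)) (PiM {l..u} (\<lambda>_. M))"
      by (rule measurable_restrict_subset) simp
    let ?S = "{x\<in>space (PiM UNIV (\<lambda>_. M)). restrict x {l..u} \<in> E}"
    have S: "?S \<in> sets (PiM UNIV (\<lambda>_. M))"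
      using measurable_sets[OF rm E] by (simp add: vimage_def Int_def conj_commute)
    note cm = conf_measurable[OF proc]
    have "emeasure (law P M X) ?S = emeasure P ((\<lambda>\<omega> t. X t \<omega>) -` ?S \<inter> space P)"
      unfolding law_def by (rule emeasure_distr[OF cm S])
    also have "(\<lambda>\<omega> t. X t \<omega>) -` ?S \<inter> space P = (\<lambda>\<omega>. \<lambda>t\<in>{l..u}. X t \<omega>) -` E \<inter> space P"
      using measurable_space[OF cm] by auto
    also have "emeasure P \<dots> = emeasure (distr P (PiM {l..u} (\<lambda>_. M)) (\<lambda>\<omega>. \<lambda>t\<in>{l..u}. X t \<omega>)) E"
      by (rule emeasure_distr[OF restrict_process_measurable(2)[OF proc] E, symmetric])
    also have "\<dots> = emeasure (chain l u) E" using cp lu by (simp add: chain_process_def)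
    finally show ?thesis .
  qed
  interpret P: prob_space P using cp by (simp add: chain_process_def process_def)
  have "prob_space (law P M X)"
    unfolding law_def using cp by (intro P.prob_space_distr conf_measurable) (simp add: chain_process_def)
  then interpret L: prob_space "law P M X" .
  show ?thesis
  proof (rule measure_eqI_windows[where t=0])
    fix l u :: int and E assume *: "l < 0" "0 < u" and E: "E \<in> sets (PiM {l..u} (\<lambda>_. M))"
    then have "l < u" by simp
    from em[OF cp this E] em[OF cq this E]
    show "emeasure (law P M X) {x\<in>space (PiM UNIV (\<lambda>_. M)). restrict x {l..u} \<in> E} = emeasure (law Q M Y) {x\<in>space (PiM UNIV (\<lambda>_. M)). restrict x {l..u} \<in> E}"
      by simp
  qed (simp_all add: law_def[of P] law_def[of Q] L.finite_measure_axioms[unfolded law_def])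
qed

end

section \<open>The stationary chain satisfies the conditional specification\<close>

context spec_pair
begin

abbreviation "Win l u \<equiv> Pi\<^sub>M {l..u::int} (\<lambda>_. M)"

lemma upd2_window_measurable:
  assumes t: "t \<in> {l..u}" and f: "f \<in> measurable N (Win l u)" and g: "g \<in> measurable N (\<mu> a)"
  shows "(\<lambda>p. upd2 (f p) t a (g p)) \<in> measurable N (Win l u)"
proof -
  have "(\<lambda>p. (f p)(t := (f p t)(a := g p))) \<in> measurable N (Pi\<^sub>M (insert t {l..u}) (\<lambda>_. M))"
  proof (rule measurable_fun_upd[where J="{l..u}"])
    show "(\<lambda>p. (f p t)(a := g p)) \<in> measurable N M"
      by (rule upd_coordinate_measurable[OF measurable_compose[OF f measurable_component_singleton[OF t]] g])
  qed (use t f in auto)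
  moreover have "insert t {l..u} = {l..u}" using t by auto
  ultimately show ?thesis by (simp add: upd2_def)
qed

text \<open>\<open>PiM_swap\<close> for the coordinate \<open>a\<close> of the state at time
  \<open>t\<close>, after the remaining times have been split off by Tonelli.\<close>

lemma window_swap:
  assumes t: "t \<in> {l..u}"
    and F: "(\<lambda>p. F (fst p) (snd p)) \<in> borel_measurable (Win l u \<Otimes>\<^sub>M \<mu> a)"
  shows "(\<integral>\<^sup>+x. \<integral>\<^sup>+y. F x y \<partial>\<mu> a \<partial>Win l u) = (\<integral>\<^sup>+x. \<integral>\<^sup>+y. F (upd2 x t a y) (x t a) \<partial>\<mu> a \<partial>Win l u)"
proof -
  let ?I = "{l..u} - {t}"
  have ins: "insert t ?I = {l..u}" using t by auto
  have I: "finite ?I" "t \<notin> ?I" by auto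
  have G: "(\<lambda>p. F (upd2 (fst p) t a (snd p)) (fst p t a)) \<in> borel_measurable (Win l u \<Otimes>\<^sub>M \<mu> a)"
  proof -
    have 1: "(\<lambda>p. fst p t a) \<in> measurable (Win l u \<Otimes>\<^sub>M \<mu> a) (\<mu> a)"
      by (rule measurable_compose[OF measurable_compose[OF measurable_fst measurable_component_singleton[OF t]] coordinate_measurable])
    have "(\<lambda>p. (upd2 (fst p) t a (snd p), fst p t a)) \<in> measurable (Win l u \<Otimes>\<^sub>M \<mu> a) (Win l u \<Otimes>\<^sub>M \<mu> a)"
      by (rule measurable_Pair[OF upd2_window_measurable[OF t measurable_fst measurable_snd] 1])
    from measurable_compose[OF this F] show ?thesis by simp
  qed
  have split: "(\<integral>\<^sup>+x. f x \<partial>Win l u) = (\<integral>\<^sup>+x. \<integral>\<^sup>+z. f (x(t := z)) \<partial>M \<partial>Pi\<^sub>M ?I (\<lambda>_. M))"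
    if "f \<in> borel_measurable (Win l u)" for f
    using PK.P.product_nn_integral_insert[OF I, of f] that unfolding ins by simp
  have m1: "(\<lambda>x. \<integral>\<^sup>+y. F x y \<partial>\<mu> a) \<in> borel_measurable (Win l u)"
    using F by (intro sigma_finite_measure.borel_measurable_nn_integral sf_\<mu>) (simp add: split_beta)
  have m2: "(\<lambda>x. \<integral>\<^sup>+y. F (upd2 x t a y) (x t a) \<partial>\<mu> a) \<in> borel_measurable (Win l u)"
    using G by (intro sigma_finite_measure.borel_measurable_nn_integral sf_\<mu>) (simp add: split_beta)
  have "(\<integral>\<^sup>+x. \<integral>\<^sup>+y. F x y \<partial>\<mu> a \<partial>Win l u) = (\<integral>\<^sup>+x. \<integral>\<^sup>+z. \<integral>\<^sup>+y. F (x(t := z)) y \<partial>\<mu> a \<partial>M \<partial>Pi\<^sub>M ?I (\<lambda>_. M))"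
    by (rule split[OF m1])
  also have "\<dots> = (\<integral>\<^sup>+x. \<integral>\<^sup>+z. \<integral>\<^sup>+y. F (x(t := z(a := y))) (z a) \<partial>\<mu> a \<partial>M \<partial>Pi\<^sub>M ?I (\<lambda>_. M))"
  proof (rule nn_integral_cong)
    fix x assume x: "x \<in> space (Pi\<^sub>M ?I (\<lambda>_. M))"
    show "(\<integral>\<^sup>+z. \<integral>\<^sup>+y. F (x(t := z)) y \<partial>\<mu> a \<partial>M) = (\<integral>\<^sup>+z. \<integral>\<^sup>+y. F (x(t := z(a := y))) (z a) \<partial>\<mu> a \<partial>M)"
    proof (rule PiM_swap[where F="\<lambda>z y. F (x(t := z)) y"])
      show "product_sigma_finite \<mu>" by (rule \<mu>.product_sigma_finite_axioms)
      have "(\<lambda>p. x(t := fst p)) \<in> measurable (M \<Otimes>\<^sub>M \<mu> a) (Pi\<^sub>M (insert t ?I) (\<lambda>_. M))"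
        by (rule measurable_fun_upd[where J="?I"]) (use x in auto)
      then have "(\<lambda>p. (x(t := fst p), snd p)) \<in> measurable (M \<Otimes>\<^sub>M \<mu> a) (Win l u \<Otimes>\<^sub>M \<mu> a)"
        unfolding ins by (rule measurable_Pair[OF _ measurable_snd])
      from measurable_compose[OF this F]
      show "(\<lambda>p. F (x(t := fst p)) (snd p)) \<in> borel_measurable (M \<Otimes>\<^sub>M \<mu> a)" by simp
    qed auto
  qed
  also have "\<dots> = (\<integral>\<^sup>+x. \<integral>\<^sup>+y. F (upd2 x t a y) (x t a) \<partial>\<mu> a \<partial>Win l u)"
    by (subst split[OF m2]) (simp add: upd2_def)
  finally show ?thesis .
qed

lemma coordinate_window_measurable:
  assumes t: "t \<in> {l..u}"
  shows "(\<lambda>x. x t a) \<in> measurable (Win l u) (\<mu> a)"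
  by (rule measurable_compose[OF measurable_component_singleton[OF t] coordinate_measurable])

lemma coordinate_window_borel:
  assumes t: "t \<in> {l..u}"
  shows "(\<lambda>x. x t a) \<in> borel_measurable (Win l u)"
  by (rule measurable_compose[OF coordinate_window_measurable[OF t] id_measurable])

definition loc :: "'p \<Rightarrow> int \<Rightarrow> (int \<Rightarrow> 'p \<Rightarrow> real) \<Rightarrow> real" where
  "loc a t x = field (x (t - 1)) (x t) (x (t + 1)) a"

lemma loc_upd2 [simp]: "loc a t (upd2 x t a y) = loc a t x"
  by (simp add: loc_def upd2_def)

lemma loc_window_measurable:
  assumes "l < t" "t < u"
  shows "loc a t \<in> borel_measurable (Win l u)"
  unfolding loc_def[abs_def] using assms by (intro field_measurable coordinate_window_borel) auto

text \<open>The normalising integral of (CS), in \<open>ennreal\<close> because nothing yet prevents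
  it from being infinite for some values of the field.\<close>

definition mass :: "'p \<Rightarrow> real \<Rightarrow> ennreal" where
  "mass a h = (\<integral>\<^sup>+y. ennreal (site a h y) \<partial>\<mu> a)"

lemma site_pair_measurable: "(\<lambda>p. site a (fst p) (snd p)) \<in> borel_measurable (borel \<Otimes>\<^sub>M \<mu> a)"
  by (rule site_measurable) auto

lemma mass_measurable: "mass a \<in> borel_measurable borel"
proof -
  have "(\<lambda>p. ennreal (site a (fst p) (snd p))) \<in> borel_measurable (borel \<Otimes>\<^sub>M \<mu> a)"
    using site_pair_measurable by simp
  then show ?thesis
    unfolding mass_def[abs_def] by (intro sigma_finite_measure.borel_measurable_nn_integral sf_\<mu>) (simp add: split_beta)
qed

lemma site_meas1: "site a h \<in> borel_measurable (\<mu> a)"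
  by (rule site_measurable) auto

lemma mass_pos: "mass a h \<noteq> 0"
proof
  assume "mass a h = 0"
  then have "AE y in \<mu> a. ennreal (site a h y) = 0"
    unfolding mass_def using site_meas1 by (subst (asm) nn_integral_0_iff_AE) auto
  then have "AE y in \<mu> a. False" by (simp add: site_def)
  then have "emeasure (\<mu> a) (space (\<mu> a)) = 0" by (simp add: eventually_False ae_filter_eq_bot_iff)
  then show False using \<mu>_nonzero[of a] by (simp add: space_\<mu>)
qed

definition chain_density :: "int \<Rightarrow> int \<Rightarrow> (int \<Rightarrow> 'p \<Rightarrow> real) \<Rightarrow> real" where
  "chain_density l u x = v (x l) * PK.path_weight l u x * w (x u) / r ^ nat (u - l)"

lemma chain_density_pos: "0 < chain_density l u x"
  unfolding chain_density_def using PK.v_pos PK.w_pos PK.r_pos PK.path_weight_pos by simp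

lemma chain_density_upd2:
  assumes "l < t" "t < u"
  shows "ennreal (chain_density l u (upd2 x t a y)) * ennreal (site a (loc a t x) (x t a)) = ennreal (chain_density l u x) * ennreal (site a (loc a t x) y)"
proof -
  have "upd2 x t a y l = x l" "upd2 x t a y u = x u" using assms by (auto simp: upd2_def)
  then have "chain_density l u (upd2 x t a y) * site a (loc a t x) (x t a) = chain_density l u x * site a (loc a t x) y"
    using path_weight_upd2[OF assms, of x a y] unfolding chain_density_def loc_def by simp
  then show ?thesis
    using chain_density_pos[of l u] site_pos by (simp add: ennreal_mult'[symmetric] less_imp_le)
qed

lemma chain_density_meas:
  assumes "l \<le> u"
  shows "(\<lambda>x. ennreal (chain_density l u x)) \<in> borel_measurable (Win l u)"
  using PK.chain_density_measurable[OF assms] unfolding chain_density_def by simp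

lemma nn_integral_chain':
  assumes "l \<le> u" "\<phi> \<in> borel_measurable (Win l u)"
  shows "(\<integral>\<^sup>+x. \<phi> x \<partial>PK.chain l u) = (\<integral>\<^sup>+x. ennreal (chain_density l u x) * \<phi> x \<partial>Win l u)"
  unfolding chain_density_def by (rule PK.nn_integral_chain[OF assms])

text \<open>Exchanging the coordinate at \<open>(a, t)\<close> with an independent copy shows that
  the chain integral of \<open>mass / site\<close>, restricted to values in \<open>A\<close>, is
  exactly the measure of \<open>A\<close>. So the normaliser is finite almost surely where the
  coordinate lies in a set of finite measure, and countably many such sets cover everything.\<close>

lemma mass_finite_AE:
  assumes lu: "l < t" "t < u"
  shows "AE x in PK.chain l u. mass a (loc a t x) < \<infinity>"
proof -
  have lu': "l \<le> u" and t: "t \<in> {l..u}" using lu by auto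
  interpret C: prob_space "PK.chain l u" by (rule PK.prob_space_chain[OF lu'])
  note locm = loc_window_measurable[OF lu, of a]
  have massm: "(\<lambda>x. mass a (loc a t x)) \<in> borel_measurable (Win l u)"
    by (rule measurable_compose[OF locm mass_measurable])
  have sitem: "(\<lambda>x. ennreal (site a (loc a t x) (x t a))) \<in> borel_measurable (Win l u)"
    using site_measurable[OF locm coordinate_window_measurable[OF t]] by simp
  have piece: "AE x in PK.chain l u. x t a \<in> A \<longrightarrow> mass a (loc a t x) < \<infinity>"
    if A: "A \<in> sets (\<mu> a)" "emeasure (\<mu> a) A \<noteq> \<infinity>" for A
  proof -
    have indm: "(\<lambda>x. indicator A (x t a) :: ennreal) \<in> borel_measurable (Win l u)"
      by (rule measurable_compose[OF coordinate_window_measurable[OF t]]) (use A in simp)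
    define \<psi> where "\<psi> x = indicator A (x t a) * (mass a (loc a t x) / ennreal (site a (loc a t x) (x t a)))" for x
    have psim: "\<psi> \<in> borel_measurable (Win l u)"
      unfolding \<psi>_def using indm massm sitem by measurable
    have "(\<integral>\<^sup>+x. \<psi> x \<partial>PK.chain l u) = (\<integral>\<^sup>+x. ennreal (chain_density l u x) * \<psi> x \<partial>Win l u)"
      by (rule nn_integral_chain'[OF lu' psim])
    also have "\<dots> = (\<integral>\<^sup>+x. \<integral>\<^sup>+y. ennreal (chain_density l u (upd2 x t a y)) * indicator A (x t a) \<partial>\<mu> a \<partial>Win l u)"
    proof (rule nn_integral_cong)
      fix x
      let ?s = "ennreal (site a (loc a t x) (x t a))"
      have s: "?s \<noteq> 0" "?s \<noteq> \<infinity>" using site_pos[of a "loc a t x" "x t a"] by auto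
      have "ennreal (chain_density l u (upd2 x t a y)) * indicator A (x t a)
        = (ennreal (chain_density l u x) * indicator A (x t a) / ?s) * ennreal (site a (loc a t x) y)" for y
      proof -
        have "ennreal (chain_density l u (upd2 x t a y)) = ennreal (chain_density l u (upd2 x t a y)) * ?s / ?s"
          using s by (simp add: ennreal_mult_divide_eq)
        then show ?thesis unfolding chain_density_upd2[OF lu] by (simp add: divide_ennreal_def mult_ac)
      qed
      then have "(\<integral>\<^sup>+y. ennreal (chain_density l u (upd2 x t a y)) * indicator A (x t a) \<partial>\<mu> a)
        = (ennreal (chain_density l u x) * indicator A (x t a) / ?s) * mass a (loc a t x)"
        unfolding mass_def using site_meas1 by (simp add: nn_integral_cmult)
      then show "ennreal (chain_density l u x) * \<psi> x = (\<integral>\<^sup>+y. ennreal (chain_density l u (upd2 x t a y)) * indicator A (x t a) \<partial>\<mu> a)"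
        unfolding \<psi>_def by (simp add: divide_ennreal_def mult_ac)
    qed
    also have "\<dots> = (\<integral>\<^sup>+x. \<integral>\<^sup>+y. ennreal (chain_density l u x) * indicator A y \<partial>\<mu> a \<partial>Win l u)"
    proof (rule window_swap[OF t, symmetric])
      have "(\<lambda>p. ennreal (chain_density l u (fst p))) \<in> borel_measurable (Win l u \<Otimes>\<^sub>M \<mu> a)"
        by (rule measurable_compose[OF measurable_fst chain_density_meas[OF lu']])
      moreover have "(\<lambda>p. indicator A (snd p) :: ennreal) \<in> borel_measurable (Win l u \<Otimes>\<^sub>M \<mu> a)"
        by (rule measurable_compose[OF measurable_snd]) (use A in simp)
      ultimately show "(\<lambda>p. ennreal (chain_density l u (fst p)) * indicator A (snd p)) \<in> borel_measurable (Win l u \<Otimes>\<^sub>M \<mu> a)"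
        by (rule borel_measurable_times_ennreal)
    qed
    also have "\<dots> = (\<integral>\<^sup>+x. ennreal (chain_density l u x) * emeasure (\<mu> a) A \<partial>Win l u)"
      using A by (simp add: nn_integral_cmult)
    also have "\<dots> = (\<integral>\<^sup>+x. emeasure (\<mu> a) A \<partial>PK.chain l u)"
      by (rule nn_integral_chain'[OF lu', symmetric]) simp
    also have "\<dots> = emeasure (\<mu> a) A" using C.emeasure_space_1 by simp
    finally have "(\<integral>\<^sup>+x. \<psi> x \<partial>PK.chain l u) \<noteq> \<infinity>" using A by simp
    then have "AE x in PK.chain l u. \<psi> x \<noteq> \<infinity>"
      using psim by (intro nn_integral_noteq_infinite) (auto cong: measurable_cong_sets)
    then show ?thesis
    proof (rule eventually_mono)
      fix x assume *: "\<psi> x \<noteq> \<infinity>"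
      show "x t a \<in> A \<longrightarrow> mass a (loc a t x) < \<infinity>"
        using * site_pos[of a "loc a t x" "x t a"] unfolding \<psi>_def
        by (auto simp: less_top[symmetric] divide_ennreal_def ennreal_top_mult)
    qed
  qed
  obtain F :: "nat \<Rightarrow> real set" where F: "range F \<subseteq> sets (\<mu> a)" "(\<Union>i. F i) = space (\<mu> a)" "\<And>i. emeasure (\<mu> a) (F i) \<noteq> \<infinity>"
    using sigma_finite_measure.sigma_finite[OF sf_\<mu>[of a]] by metis
  have "AE x in PK.chain l u. \<forall>k. x t a \<in> F k \<longrightarrow> mass a (loc a t x) < \<infinity>"
    using piece[of "F k" for k] F by (subst AE_all_countable) auto
  then show ?thesis
  proof (rule AE_mp, intro AE_I2 impI)
    fix x assume x: "x \<in> space (PK.chain l u)" and *: "\<forall>k. x t a \<in> F k \<longrightarrow> mass a (loc a t x) < \<infinity>"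
    have "x t a \<in> space (\<mu> a)" using measurable_space[OF coordinate_window_measurable[OF t]] x by simp
    then show "mass a (loc a t x) < \<infinity>" using * F(2) by auto
  qed
qed

text \<open>A detailed balance argument: the chain density times the single-site density of a new
  value \<open>y\<close> is symmetric under exchanging \<open>y\<close> with the old value. After
  the exchange the integral over \<open>y\<close> is the normaliser and cancels.\<close>

lemma chain_resample:
  assumes lu: "l < t" "t < u" and B: "B \<in> sets (\<mu> a)"
    and phi: "\<phi> \<in> borel_measurable (Win l u)" and phi_upd: "\<And>x y. \<phi> (upd2 x t a y) = \<phi> x"
  shows "(\<integral>\<^sup>+x. \<phi> x * indicator B (x t a) \<partial>PK.chain l u)
    = (\<integral>\<^sup>+x. \<phi> x * ((\<integral>\<^sup>+y. ennreal (site a (loc a t x) y) * indicator B y \<partial>\<mu> a) / mass a (loc a t x)) \<partial>PK.chain l u)"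
proof -
  have lu': "l \<le> u" and t: "t \<in> {l..u}" using lu by auto
  note locm = loc_window_measurable[OF lu, of a]
  have massm: "(\<lambda>x. mass a (loc a t x)) \<in> borel_measurable (Win l u)"
    by (rule measurable_compose[OF locm mass_measurable])
  have indm: "(\<lambda>x. indicator B (x t a) :: ennreal) \<in> borel_measurable (Win l u)"
    by (rule measurable_compose[OF coordinate_window_measurable[OF t]]) (use B in simp)
  have indm2: "(\<lambda>p. indicator B (snd p) :: ennreal) \<in> borel_measurable (Win l u \<Otimes>\<^sub>M \<mu> a)"
    by (rule measurable_compose[OF measurable_snd]) (use B in simp)
  have sitem: "(\<lambda>p. ennreal (site a (loc a t (fst p)) (snd p))) \<in> borel_measurable (Win l u \<Otimes>\<^sub>M \<mu> a)"
    using site_measurable[OF measurable_compose[OF measurable_fst locm] measurable_snd] by simp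
  note fstm = measurable_compose[OF measurable_fst]
  \<comment> \<open>\<open>\<phi>\<close> and \<open>mass\<close> ignore the exchanged coordinate,
    so \<open>D\<close> transforms just like the chain density.\<close>
  define D where "D x = ennreal (chain_density l u x) * \<phi> x / mass a (loc a t x)" for x
  have Dm: "D \<in> borel_measurable (Win l u)"
    unfolding D_def using chain_density_meas[OF lu'] phi massm by measurable
  have innerm: "(\<lambda>x. \<integral>\<^sup>+y. ennreal (site a (loc a t x) y) * indicator B y \<partial>\<mu> a) \<in> borel_measurable (Win l u)"
    using borel_measurable_times_ennreal[OF sitem indm2] by (intro sigma_finite_measure.borel_measurable_nn_integral sf_\<mu>) (simp add: split_beta)
  have "(\<integral>\<^sup>+x. \<phi> x * ((\<integral>\<^sup>+y. ennreal (site a (loc a t x) y) * indicator B y \<partial>\<mu> a) / mass a (loc a t x)) \<partial>PK.chain l u)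
    = (\<integral>\<^sup>+x. ennreal (chain_density l u x) * (\<phi> x * ((\<integral>\<^sup>+y. ennreal (site a (loc a t x) y) * indicator B y \<partial>\<mu> a) / mass a (loc a t x))) \<partial>Win l u)"
    by (rule nn_integral_chain'[OF lu']) (use phi innerm massm in measurable)
  also have "\<dots> = (\<integral>\<^sup>+x. \<integral>\<^sup>+y. D x * (ennreal (site a (loc a t x) y) * indicator B y) \<partial>\<mu> a \<partial>Win l u)"
  proof (rule nn_integral_cong)
    fix x
    have "(\<integral>\<^sup>+y. D x * (ennreal (site a (loc a t x) y) * indicator B y) \<partial>\<mu> a)
      = D x * (\<integral>\<^sup>+y. ennreal (site a (loc a t x) y) * indicator B y \<partial>\<mu> a)"
      using site_meas1 B by (intro nn_integral_cmult) auto
    then show "ennreal (chain_density l u x) * (\<phi> x * ((\<integral>\<^sup>+y. ennreal (site a (loc a t x) y) * indicator B y \<partial>\<mu> a) / mass a (loc a t x)))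
      = (\<integral>\<^sup>+y. D x * (ennreal (site a (loc a t x) y) * indicator B y) \<partial>\<mu> a)"
      by (simp add: D_def divide_ennreal_def mult_ac)
  qed
  also have "\<dots> = (\<integral>\<^sup>+x. \<integral>\<^sup>+y. D (upd2 x t a y) * (ennreal (site a (loc a t (upd2 x t a y)) (x t a)) * indicator B (x t a)) \<partial>\<mu> a \<partial>Win l u)"
    by (rule window_swap[OF t]) (intro borel_measurable_times_ennreal fstm[OF Dm] sitem indm2)
  also have "\<dots> = (\<integral>\<^sup>+x. \<integral>\<^sup>+y. (D x * indicator B (x t a)) * ennreal (site a (loc a t x) y) \<partial>\<mu> a \<partial>Win l u)"
  proof (intro nn_integral_cong)
    fix x y
    have "D (upd2 x t a y) * ennreal (site a (loc a t x) (x t a))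
      = (ennreal (chain_density l u (upd2 x t a y)) * ennreal (site a (loc a t x) (x t a))) * \<phi> x / mass a (loc a t x)"
      unfolding D_def phi_upd loc_upd2 by (simp add: divide_ennreal_def mult_ac)
    also have "\<dots> = D x * ennreal (site a (loc a t x) y)"
      unfolding chain_density_upd2[OF lu] D_def by (simp add: divide_ennreal_def mult_ac)
    finally show "D (upd2 x t a y) * (ennreal (site a (loc a t (upd2 x t a y)) (x t a)) * indicator B (x t a))
      = (D x * indicator B (x t a)) * ennreal (site a (loc a t x) y)"
      unfolding loc_upd2 by (simp only: mult.assoc[symmetric]) (simp only: mult_ac)
  qed
  also have "\<dots> = (\<integral>\<^sup>+x. ennreal (chain_density l u x) * (\<phi> x * indicator B (x t a) * (mass a (loc a t x) / mass a (loc a t x))) \<partial>Win l u)"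
  proof (rule nn_integral_cong)
    fix x
    have "(\<integral>\<^sup>+y. (D x * indicator B (x t a)) * ennreal (site a (loc a t x) y) \<partial>\<mu> a) = (D x * indicator B (x t a)) * mass a (loc a t x)"
      unfolding mass_def using site_meas1 by (intro nn_integral_cmult) auto
    then show "(\<integral>\<^sup>+y. (D x * indicator B (x t a)) * ennreal (site a (loc a t x) y) \<partial>\<mu> a)
      = ennreal (chain_density l u x) * (\<phi> x * indicator B (x t a) * (mass a (loc a t x) / mass a (loc a t x)))"
      by (simp add: D_def divide_ennreal_def mult_ac)
  qed
  also have "\<dots> = (\<integral>\<^sup>+x. \<phi> x * indicator B (x t a) * (mass a (loc a t x) / mass a (loc a t x)) \<partial>PK.chain l u)"
    by (rule nn_integral_chain'[OF lu', symmetric]) (use phi indm massm in measurable)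
  also have "\<dots> = (\<integral>\<^sup>+x. \<phi> x * indicator B (x t a) \<partial>PK.chain l u)"
    \<comment> \<open>The quotient \<open>mass / mass\<close> is 1 only where the mass is neither 0
      nor infinite, hence almost everywhere.\<close>
    using mass_finite_AE[OF lu, of a] by (intro nn_integral_cong_AE) (auto elim!: eventually_mono simp: mass_pos)
  finally show ?thesis ..
qed

text \<open>The generators of \<open>others\<close> are preimages under the configuration frozen at
  \<open>y0\<close>, and such preimages form a \<open>\<sigma>\<close>-algebra.\<close>

lemma others_sets:
  assumes proc: "process P M X" and y0: "y0 \<in> \<X> a" and A: "A \<in> sets (others P X a t)"
  obtains A' where "A' \<in> sets Conf" "A = (\<lambda>\<omega>. upd2 (\<lambda>t. X t \<omega>) t a y0) -` A' \<inter> space P"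
proof -
  define Z where "Z \<omega> = upd2 (\<lambda>t. X t \<omega>) t a y0" for \<omega>
  have Z: "Z \<in> measurable P Conf"
    unfolding Z_def by (rule measurable_from_subalg[OF others_subalgebra[OF proc] others_conf_measurable[OF proc y0]])
  then have Zs: "Z \<in> space P \<rightarrow> space Conf" by (auto dest: measurable_space)
  let ?G = "{(\<lambda>\<omega>. X \<tau> \<omega> b) -` B \<inter> space P | b \<tau> B. (b, \<tau>) \<noteq> (a, t) \<and> B \<in> sets borel}"
  have "?G \<subseteq> sets (vimage_algebra (space P) Z Conf)"
  proof
    fix S assume "S \<in> ?G"
    then obtain b \<tau> B where ne: "(b, \<tau>) \<noteq> (a, t)" and B: "B \<in> sets borel" and S: "S = (\<lambda>\<omega>. X \<tau> \<omega> b) -` B \<inter> space P"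
      by blast
    have m: "(\<lambda>x. x \<tau> b) \<in> borel_measurable Conf"
      by (rule measurable_compose[OF time_measurable coordinate_borel])
    have "(\<lambda>\<omega>. X \<tau> \<omega> b) -` B \<inter> space P = Z -` ((\<lambda>x. x \<tau> b) -` B \<inter> space Conf) \<inter> space P"
      using Zs unfolding Z_def by (auto simp: upd2_other[OF ne])
    moreover have "(\<lambda>x. x \<tau> b) -` B \<inter> space Conf \<in> sets Conf" by (rule measurable_sets[OF m B])
    ultimately show "S \<in> sets (vimage_algebra (space P) Z Conf)"
      unfolding S sets_vimage_algebra2[OF Zs] by blast
  qed
  then have "sigma_sets (space P) ?G \<subseteq> sets (vimage_algebra (space P) Z Conf)"
    using sets.sigma_sets_subset[of ?G "vimage_algebra (space P) Z Conf"] by simp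
  moreover have "A \<in> sigma_sets (space P) ?G"
    using A unfolding others_def by (subst (asm) sets_measure_of) auto
  ultimately have "A \<in> {Z -` A' \<inter> space P | A'. A' \<in> sets Conf}" unfolding sets_vimage_algebra2[OF Zs] by blast
  then show ?thesis using that unfolding Z_def by blast
qed

text \<open>\<open>chain_resample\<close> covers events seen in a finite window; conditioning
  involves all times. Both sides, read as finite measures in \<open>A\<close>, agree on windows
  around \<open>t\<close> and are therefore equal.\<close>

lemma chain_process_resample:
  assumes cp: "PK.chain_process P X" and B: "B \<in> sets (\<mu> a)" and y0: "y0 \<in> \<X> a" and A: "A \<in> sets Conf"
  shows "(\<integral>\<^sup>+\<omega>. indicator B (X t \<omega> a) * indicator A (upd2 (\<lambda>t. X t \<omega>) t a y0) \<partial>P)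
    = (\<integral>\<^sup>+\<omega>. ((\<integral>\<^sup>+y. ennreal (site a (loc a t (\<lambda>t. X t \<omega>)) y) * indicator B y \<partial>\<mu> a) / mass a (loc a t (\<lambda>t. X t \<omega>)))
        * indicator A (upd2 (\<lambda>t. X t \<omega>) t a y0) \<partial>P)"
proof -
  have proc: "process P M X" using cp by (simp add: PK.chain_process_def)
  interpret P: prob_space P using proc by (simp add: process_def)
  define Z where "Z \<omega> = upd2 (\<lambda>t. X t \<omega>) t a y0" for \<omega>
  define k where "k h = (\<integral>\<^sup>+y. ennreal (site a h y) * indicator B y \<partial>\<mu> a) / mass a h" for h
  have Z: "Z \<in> measurable P Conf"
    unfolding Z_def by (rule measurable_from_subalg[OF others_subalgebra[OF proc] others_conf_measurable[OF proc y0]])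
  have km: "k \<in> borel_measurable borel"
  proof -
    have "(\<lambda>p. indicator B (snd p) :: ennreal) \<in> borel_measurable (borel \<Otimes>\<^sub>M \<mu> a)"
      by (rule measurable_compose[OF measurable_snd]) (use B in simp)
    moreover have "(\<lambda>p. ennreal (site a (fst p) (snd p))) \<in> borel_measurable (borel \<Otimes>\<^sub>M \<mu> a)"
      using site_pair_measurable by simp
    ultimately have "(\<lambda>p. ennreal (site a (fst p) (snd p)) * indicator B (snd p)) \<in> borel_measurable (borel \<Otimes>\<^sub>M \<mu> a)"
      by (rule borel_measurable_times_ennreal[rotated])
    then have "(\<lambda>h. \<integral>\<^sup>+y. ennreal (site a h y) * indicator B y \<partial>\<mu> a) \<in> borel_measurable borel"
      by (intro sigma_finite_measure.borel_measurable_nn_integral sf_\<mu>) (simp add: split_beta)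
    then show ?thesis unfolding k_def[abs_def] using mass_measurable[of a] by measurable
  qed
  define q1 where "q1 \<omega> = (indicator B (X t \<omega> a) :: ennreal)" for \<omega>
  define q2 where "q2 \<omega> = k (loc a t (\<lambda>t. X t \<omega>))" for \<omega>
  have q1: "q1 \<in> borel_measurable P"
    unfolding q1_def by (rule measurable_compose[OF X_coordinate_measurable[OF proc]]) (use B in simp)
  have q2: "q2 \<in> borel_measurable P"
    unfolding q2_def loc_def
    by (rule measurable_compose[OF measurable_from_subalg[OF others_subalgebra[OF proc] field_others_measurable[OF proc]] km])
  define N where "N q = distr (density P q) Conf Z" for q :: "_ \<Rightarrow> ennreal"
  have emN: "emeasure (N q) A' = (\<integral>\<^sup>+\<omega>. q \<omega> * indicator A' (Z \<omega>) \<partial>P)"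
    if q: "q \<in> borel_measurable P" and A': "A' \<in> sets Conf" for q A'
  proof -
    have "emeasure (N q) A' = emeasure (density P q) (Z -` A' \<inter> space P)"
      unfolding N_def using Z A' by (subst emeasure_distr) auto
    also have "\<dots> = (\<integral>\<^sup>+\<omega>. q \<omega> * indicator (Z -` A' \<inter> space P) \<omega> \<partial>P)"
      by (rule emeasure_density[OF q measurable_sets[OF Z A']])
    also have "\<dots> = (\<integral>\<^sup>+\<omega>. q \<omega> * indicator A' (Z \<omega>) \<partial>P)"
      by (intro nn_integral_cong) (auto simp: indicator_def)
    finally show ?thesis .
  qed
  have "N q1 = N q2"
  proof (rule measure_eqI_windows[where t=t])
    show "finite_measure (N q1)"
    proof
      have sp: "space (N q1) = space Conf" by (simp add: N_def)
      have "emeasure (N q1) (space Conf) \<le> (\<integral>\<^sup>+\<omega>. 1 \<partial>P)"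
        unfolding emN[OF q1 sets.top] by (intro nn_integral_mono) (auto simp: q1_def indicator_def)
      then show "emeasure (N q1) (space (N q1)) \<noteq> \<infinity>" unfolding sp using P.emeasure_space_1 by (auto simp: top_unique)
    qed
    fix l u E assume lu: "l < t" "t < u" and E: "E \<in> sets (Win l u)"
    have lu': "l \<le> u" and t: "t \<in> {l..u}" using lu by auto
    let ?S = "{x\<in>space Conf. restrict x {l..u} \<in> E}"
    have rm: "(\<lambda>x. restrict x {l..u}) \<in> measurable Conf (Win l u)"
      by (rule measurable_restrict_subset) simp
    have S: "?S \<in> sets Conf"
      using measurable_sets[OF rm E] by (simp add: vimage_def Int_def conj_commute)
    define \<phi> where "\<phi> x = (indicator E (upd2 x t a y0) :: ennreal)" for x
    have phi: "\<phi> \<in> borel_measurable (Win l u)"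
    proof -
      have "(\<lambda>x. upd2 x t a y0) \<in> measurable (Win l u) (Win l u)"
        by (rule upd2_window_measurable[OF t]) (use y0 in \<open>auto simp: space_\<mu>\<close>)
      then show ?thesis unfolding \<phi>_def by (rule measurable_compose) (use E in simp)
    qed
    have Sphi: "indicator ?S (Z \<omega>) = \<phi> (\<lambda>t\<in>{l..u}. X t \<omega>)" if "\<omega> \<in> space P" for \<omega>
    proof -
      have "restrict (Z \<omega>) {l..u} = upd2 (\<lambda>t\<in>{l..u}. X t \<omega>) t a y0"
        using t unfolding Z_def upd2_def by (auto simp: fun_eq_iff)
      then show ?thesis using measurable_space[OF Z that] by (simp add: \<phi>_def indicator_def)
    qed
    \<comment> \<open>The field at time \<open>t\<close> uses times \<open>t - 1\<close> and
      \<open>t + 1\<close>, which lie in the window because \<open>l < t < u\<close>.\<close>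
    have locw: "loc a t (\<lambda>t\<in>{l..u}. X t \<omega>) = loc a t (\<lambda>t. X t \<omega>)" for \<omega>
      using lu by (simp add: loc_def)
    have kl: "(\<lambda>x. k (loc a t x)) \<in> borel_measurable (Win l u)"
      by (rule measurable_compose[OF loc_window_measurable[OF lu] km])
    have ind: "(\<lambda>x. indicator B (x t a) :: ennreal) \<in> borel_measurable (Win l u)"
      by (rule measurable_compose[OF coordinate_window_measurable[OF t]]) (use B in simp)
    have "emeasure (N q1) ?S = (\<integral>\<^sup>+\<omega>. (\<lambda>x. \<phi> x * indicator B (x t a)) (\<lambda>t\<in>{l..u}. X t \<omega>) \<partial>P)"
      unfolding emN[OF q1 S] using t by (intro nn_integral_cong) (simp add: Sphi q1_def mult.commute)
    also have "\<dots> = (\<integral>\<^sup>+x. \<phi> x * indicator B (x t a) \<partial>PK.chain l u)"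
      by (rule PK.nn_integral_chain_process[OF cp lu' borel_measurable_times_ennreal[OF phi ind]])
    also have "\<dots> = (\<integral>\<^sup>+x. \<phi> x * k (loc a t x) \<partial>PK.chain l u)"
      unfolding k_def by (rule chain_resample[OF lu B phi]) (simp add: \<phi>_def)
    also have "\<dots> = (\<integral>\<^sup>+\<omega>. (\<lambda>x. \<phi> x * k (loc a t x)) (\<lambda>t\<in>{l..u}. X t \<omega>) \<partial>P)"
      by (rule PK.nn_integral_chain_process[OF cp lu' borel_measurable_times_ennreal[OF phi kl], symmetric])
    also have "\<dots> = emeasure (N q2) ?S"
      unfolding emN[OF q2 S] locw by (intro nn_integral_cong) (simp add: Sphi q2_def mult.commute)
    finally show "emeasure (N q1) ?S = emeasure (N q2) ?S" .
  qed (simp_all add: N_def)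
  then show ?thesis
    using emN[OF q1 A] emN[OF q2 A] unfolding q1_def q2_def k_def Z_def by simp
qed

lemma site_normalised:
  assumes "mass a h < \<infinity>"
  shows "integrable (\<mu> a) (site a h)" "0 < (LINT y|\<mu> a. site a h y)" "mass a h = ennreal (LINT y|\<mu> a. site a h y)"
proof -
  show int: "integrable (\<mu> a) (site a h)"
    using assms site_meas1 by (intro integrableI_nonneg) (auto simp: mass_def less_imp_le[OF site_pos])
  show m: "mass a h = ennreal (LINT y|\<mu> a. site a h y)"
    unfolding mass_def by (rule nn_integral_eq_integral[OF int]) (simp add: less_imp_le[OF site_pos])
  show "0 < (LINT y|\<mu> a. site a h y)"
    using mass_pos[of a h] unfolding m by (simp add: ennreal_eq_0_iff)
qed

text \<open>The normalised site integral is a version of the conditional probability: it is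
  measurable for \<open>others\<close>, as the field omits the coordinate itself, and
  \<open>chain_process_resample\<close> gives the defining equation on every event of that
  \<open>\<sigma>\<close>-algebra.\<close>

theorem chain_process_CS:
  assumes cp: "PK.chain_process P X"
  shows "satisfies_CS \<mu> \<theta> s c \<Phi>m \<Phi>0 \<Phi>1 P X"
  unfolding CS_iff cond_density_propto_def
proof (intro allI conjI ballI)
  fix a t
  have proc: "process P M X" using cp by (simp add: PK.chain_process_def)
  interpret P: prob_space P using proc by (simp add: process_def)
  obtain y0 where y0: "y0 \<in> \<X> a" using \<mu>_nonzero[of a] by fastforce
  define h where "h \<omega> = field (X (t - 1) \<omega>) (X t \<omega>) (X (t + 1) \<omega>) a" for \<omega>
  have hloc: "loc a t (\<lambda>t. X t \<omega>) = h \<omega>" for \<omega> by (simp add: loc_def h_def)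
  have fin: "AE \<omega> in P. mass a (h \<omega>) < \<infinity>"
  proof -
    have "AE x in distr P (Win (t - 1) (t + 1)) (\<lambda>\<omega>. \<lambda>\<tau>\<in>{t-1..t+1}. X \<tau> \<omega>). mass a (loc a t x) < \<infinity>"
    proof -
      have *: "distr P (Win (t - 1) (t + 1)) (\<lambda>\<omega>. \<lambda>\<tau>\<in>{t-1..t+1}. X \<tau> \<omega>) = PK.chain (t - 1) (t + 1)"
        using cp unfolding PK.chain_process_def by auto
      show ?thesis unfolding * by (rule mass_finite_AE) simp_all
    qed
    from AE_distrD[OF PK.restrict_process_measurable(2)[OF proc] this] show ?thesis
      by (simp add: loc_def h_def)
  qed
  show "AE \<omega> in P. integrable (\<mu> a) (site a (field (X (t - 1) \<omega>) (X t \<omega>) (X (t + 1) \<omega>) a)) \<and>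
      (AE y in \<mu> a. 0 \<le> site a (field (X (t - 1) \<omega>) (X t \<omega>) (X (t + 1) \<omega>) a) y) \<and>
      0 < (LINT y|\<mu> a. site a (field (X (t - 1) \<omega>) (X t \<omega>) (X (t + 1) \<omega>) a) y)"
    using fin unfolding h_def[symmetric] by (auto elim!: eventually_mono intro: site_normalised simp: less_imp_le[OF site_pos])
  fix B assume B: "B \<in> sets (\<mu> a)"
  let ?F = "others P X a t"
  have sub: "subalgebra P ?F" by (rule others_subalgebra[OF proc])
  interpret F: finite_measure_subalgebra P ?F using sub by unfold_locales
  define k where "k \<omega> = (\<integral>\<^sup>+y. ennreal (site a (h \<omega>) y) * indicator B y \<partial>\<mu> a) / mass a (h \<omega>)" for \<omega>
  define g where "g \<omega> = enn2real (k \<omega>)" for \<omega>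
  have hF: "h \<in> borel_measurable ?F" unfolding h_def by (rule field_others_measurable[OF proc])
  have kF: "k \<in> borel_measurable ?F"
  proof -
    have "(\<lambda>p. ennreal (site a (h (fst p)) (snd p)) * indicator B (snd p)) \<in> borel_measurable (?F \<Otimes>\<^sub>M \<mu> a)"
      using site_measurable[OF measurable_compose[OF measurable_fst hF] measurable_snd, of a] measurable_compose[OF measurable_snd borel_measurable_indicator[OF B], of ?F]
      by (intro borel_measurable_times_ennreal) simp_all
    then have "(\<lambda>\<omega>. \<integral>\<^sup>+y. ennreal (site a (h \<omega>) y) * indicator B y \<partial>\<mu> a) \<in> borel_measurable ?F"
      by (intro sigma_finite_measure.borel_measurable_nn_integral sf_\<mu>) (simp add: split_beta)
    then show ?thesis unfolding k_def[abs_def] using measurable_compose[OF hF mass_measurable] by measurable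
  qed
  have gF: "g \<in> borel_measurable ?F" unfolding g_def[abs_def] using kF by measurable
  have gP: "g \<in> borel_measurable P" by (rule measurable_from_subalg[OF sub gF])
  \<comment> \<open>Valid for every outcome: for infinite mass the quotient in
    \<open>ennreal\<close> is 0. Hence \<open>g\<close> is bounded and integrable with no
    exceptional set.\<close>
  have k1: "k \<omega> \<le> 1" for \<omega>
  proof -
    have "(\<integral>\<^sup>+y. ennreal (site a (h \<omega>) y) * indicator B y \<partial>\<mu> a) \<le> mass a (h \<omega>)"
      unfolding mass_def by (intro nn_integral_mono) (auto simp: indicator_def)
    then have "k \<omega> \<le> mass a (h \<omega>) / mass a (h \<omega>)" unfolding k_def by (rule divide_right_mono_ennreal)
    also have "\<dots> \<le> 1" using mass_pos[of a "h \<omega>"]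
      by (cases "mass a (h \<omega>) = \<infinity>") (auto simp: less_top ennreal_divide_self)
    finally show ?thesis .
  qed
  have gk: "ennreal (g \<omega>) = k \<omega>" for \<omega>
    unfolding g_def by (rule ennreal_enn2real, rule le_less_trans[OF k1]) simp
  have g01: "0 \<le> g \<omega>" "g \<omega> \<le> 1" for \<omega>
  proof -
    show "0 \<le> g \<omega>" by (simp add: g_def)
    show "g \<omega> \<le> 1" using k1[of \<omega>] unfolding gk[symmetric] by simp
  qed
  have gint: "integrable P g"
    by (rule P.integrable_const_bound[where B=1]) (use g01 gP in auto)
  let ?B = "(\<lambda>\<omega>. X t \<omega> a) -` B \<inter> space P"
  have Bm: "?B \<in> sets P" by (rule measurable_sets[OF X_coordinate_measurable[OF proc] B])
  have Bint: "integrable P (indicator ?B :: _ \<Rightarrow> real)"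
    using Bm by (intro integrable_real_indicator) (auto simp: less_top[symmetric])
  have ce: "AE \<omega> in P. real_cond_exp P ?F (indicator ?B) \<omega> = g \<omega>"
  proof (rule F.real_cond_exp_charact[OF _ Bint gint gF])
    fix A assume A: "A \<in> sets ?F"
    have AP: "A \<in> sets P" using A sub by (auto simp: subalgebra_def)
    obtain A' where A': "A' \<in> sets Conf" "A = (\<lambda>\<omega>. upd2 (\<lambda>t. X t \<omega>) t a y0) -` A' \<inter> space P"
      by (rule others_sets[OF proc y0 A])
    have i1: "integrable P (\<lambda>\<omega>. indicator A \<omega> * indicator ?B \<omega> :: real)"
      using integrable_mult_indicator[OF AP Bint] by simp
    have i2: "integrable P (\<lambda>\<omega>. indicator A \<omega> * g \<omega>)"
      using integrable_mult_indicator[OF AP gint] by simp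
    have "ennreal (LINT \<omega>|P. indicator A \<omega> * indicator ?B \<omega>) = (\<integral>\<^sup>+\<omega>. ennreal (indicator A \<omega> * indicator ?B \<omega>) \<partial>P)"
      by (rule nn_integral_eq_integral[OF i1, symmetric]) simp
    also have "\<dots> = (\<integral>\<^sup>+\<omega>. indicator B (X t \<omega> a) * indicator A' (upd2 (\<lambda>t. X t \<omega>) t a y0) \<partial>P)"
      unfolding A'(2) by (intro nn_integral_cong) (auto simp: indicator_def)
    also have "\<dots> = (\<integral>\<^sup>+\<omega>. k \<omega> * indicator A' (upd2 (\<lambda>t. X t \<omega>) t a y0) \<partial>P)"
      unfolding chain_process_resample[OF cp B y0 A'(1)] k_def hloc ..
    also have "\<dots> = (\<integral>\<^sup>+\<omega>. ennreal (indicator A \<omega> * g \<omega>) \<partial>P)"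
      unfolding A'(2) by (intro nn_integral_cong) (auto simp: indicator_def gk)
    also have "\<dots> = ennreal (LINT \<omega>|P. indicator A \<omega> * g \<omega>)"
      by (rule nn_integral_eq_integral[OF i2]) (simp add: g01)
    finally show "(LINT \<omega>:A|P. indicator ?B \<omega>) = (LINT \<omega>:A|P. g \<omega>)"
      unfolding set_lebesgue_integral_def real_scaleR_def
      by (subst (asm) ennreal_inj) (auto intro!: integral_nonneg_AE simp: g01)
  qed
  show "AE \<omega> in P. real_cond_exp P ?F (indicator ?B) \<omega> =
     (LINT y:B|\<mu> a. site a (field (X (t - 1) \<omega>) (X t \<omega>) (X (t + 1) \<omega>) a) y /
       (LINT z|\<mu> a. site a (field (X (t - 1) \<omega>) (X t \<omega>) (X (t + 1) \<omega>) a) z))"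
    using ce fin
  proof eventually_elim
    case (elim \<omega>)
    let ?I = "LINT z|\<mu> a. site a (h \<omega>) z"
    note sn = site_normalised[OF elim(2)]
    have iB: "integrable (\<mu> a) (\<lambda>y. indicator B y * site a (h \<omega>) y)"
      using integrable_mult_indicator[OF B sn(1)] by simp
    let ?J = "LINT y|\<mu> a. indicator B y * site a (h \<omega>) y"
    have J: "(\<integral>\<^sup>+y. ennreal (site a (h \<omega>) y) * indicator B y \<partial>\<mu> a) = ennreal ?J"
    proof -
      have "(\<integral>\<^sup>+y. ennreal (site a (h \<omega>) y) * indicator B y \<partial>\<mu> a) = (\<integral>\<^sup>+y. ennreal (indicator B y * site a (h \<omega>) y) \<partial>\<mu> a)"
        by (intro nn_integral_cong) (auto simp: indicator_def)
      also have "\<dots> = ennreal ?J"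
        by (rule nn_integral_eq_integral[OF iB]) (simp add: less_imp_le[OF site_pos])
      finally show ?thesis .
    qed
    have J0: "0 \<le> ?J" by (rule integral_nonneg_AE) (simp add: less_imp_le[OF site_pos])
    have "g \<omega> = ?J / ?I"
      unfolding g_def k_def J sn(3) using sn(2) J0 by (simp add: divide_ennreal)
    then show ?case
      unfolding elim(1) h_def[symmetric] set_lebesgue_integral_def by simp
  qed
qed

end

section \<open>Existence, uniqueness and the finite-dimensional densities\<close>

lemma AE_positive_of_real:
  fixes f :: "'x \<Rightarrow> real"
  assumes "AE x in M. 0 < f x"
  shows "AE_positive M (\<lambda>x. complex_of_real (f x))"
  using assms by (simp add: AE_positive_def)

lemma sq_integrable_cong_AE:
  assumes f: "sq_integrable M f" and g: "g \<in> borel_measurable M" and eq: "AE x in M. g x = f x"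
  shows "sq_integrable M g"
proof -
  have "integrable M (\<lambda>x. (norm (f x))\<^sup>2) \<longleftrightarrow> integrable M (\<lambda>x. (norm (g x))\<^sup>2)"
  proof (rule integrable_cong_AE)
    show "AE x in M. (norm (f x))\<^sup>2 = (norm (g x))\<^sup>2" using eq by eventually_elim simp
  qed (use f g in \<open>auto simp: sq_integrable_def\<close>)
  then show ?thesis using f g by (simp add: sq_integrable_def)
qed

context positive_kernel
begin

lemma eigenfunction_of_real:
  assumes v: "sq_integrable M v" "AE x in M. 0 < v x" "AE x in M. Tr v x = r * v x"
  shows "eigenfunction M T (of_real r) (\<lambda>x. complex_of_real (v x))"
  unfolding eigenfunction_def
proof (intro conjI)
  show "(\<lambda>x. complex_of_real (v x)) \<in> L2 M"
    unfolding L2_iff_sq_integrable using v(1) by (auto simp: sq_integrable_def)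
  show "\<not> (AE x in M. complex_of_real (v x) = 0)"
  proof
    assume "AE x in M. complex_of_real (v x) = 0"
    with v(2) have "AE x in M. False" by eventually_elim simp
    then show False using not_null by blast
  qed
  show "AE x in M. T (\<lambda>x. complex_of_real (v x)) x = complex_of_real r * complex_of_real (v x)"
    unfolding T_of_real using v(3) by eventually_elim simp
qed

lemma eigenfunction_Re:
  assumes ev: "eigenfunction M T (of_real r) v" and pos: "AE_positive M v"
  shows "sq_integrable M (\<lambda>x. Re (v x))" "AE x in M. 0 < Re (v x)" "AE x in M. Tr (\<lambda>x. Re (v x)) x = r * Re (v x)"
proof -
  have sq: "sq_integrable M v" using ev by (simp add: eigenfunction_def L2_iff_sq_integrable)
  then have vm[measurable]: "v \<in> borel_measurable M" by (simp add: sq_integrable_def)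
  have real: "AE x in M. v x = complex_of_real (Re (v x))"
    using pos unfolding AE_positive_def by (auto elim!: eventually_mono)
  show "AE x in M. 0 < Re (v x)" using pos unfolding AE_positive_def by (auto elim!: eventually_mono)
  have "sq_integrable M (\<lambda>x. complex_of_real (Re (v x)))"
    by (rule sq_integrable_cong_AE[OF sq]) (use real in \<open>auto elim!: eventually_mono\<close>)
  then show "sq_integrable M (\<lambda>x. Re (v x))" by (simp add: sq_integrable_def)
  have "AE x in M. T v x = complex_of_real r * v x" using ev by (simp add: eigenfunction_def)
  moreover have "AE x in M. T (\<lambda>x. complex_of_real (Re (v x))) x = T v x"
    by (rule T_cong_AE) (use real in \<open>auto elim!: eventually_mono\<close>)
  ultimately show "AE x in M. Tr (\<lambda>x. Re (v x)) x = r * Re (v x)"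
  proof eventually_elim
    case (elim x)
    then have "Re (complex_of_real (Tr (\<lambda>x. Re (v x)) x)) = Re (complex_of_real r * v x)" by (simp only: T_of_real)
    then show ?case by simp
  qed
qed

lemma L2_inner_Re:
  assumes v: "v \<in> borel_measurable M" "AE_positive M v" and w: "w \<in> borel_measurable M" "AE_positive M w"
  shows "L2_inner M v w = complex_of_real (LINT x|M. Re (v x) * Re (w x))"
proof -
  have [measurable]: "v \<in> borel_measurable M" "w \<in> borel_measurable M" using v w by auto
  have "L2_inner M v w = (LINT x|M. complex_of_real (Re (v x) * Re (w x)))"
    unfolding L2_inner_def
  proof (rule integral_cong_AE)
    show "AE x in M. v x * cnj (w x) = complex_of_real (Re (v x) * Re (w x))"
      using v(2) w(2) unfolding AE_positive_def
      by eventually_elim (auto simp: complex_eq_iff complex_is_Real_iff)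
  qed measurable
  then show ?thesis by (simp only: integral_complex_of_real)
qed

text \<open>Principal pairs are positive everywhere, so eigenfunctions are changed on a null set.\<close>

lemma principal_pairI:
  assumes r: "0 < r"
    and v: "sq_integrable M v" "AE x in M. 0 < v x" "AE x in M. Tr v x = r * v x"
    and w: "sq_integrable M w" "AE x in M. 0 < w x" "AE x in M. Tr' w x = r * w x"
    and vw: "(LINT x|M. v x * w x) = 1"
  shows "principal_pair M K r (\<lambda>x. if 0 < v x then v x else 1) (\<lambda>x. if 0 < w x then w x else 1)"
proof -
  interpret tr: positive_kernel M "\<lambda>x y. K y x" by (rule transpose)
  have [measurable]: "v \<in> borel_measurable M" "w \<in> borel_measurable M" using v w by (auto simp: sq_integrable_def)
  define v' where "v' x = (if 0 < v x then v x else 1)" for x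
  define w' where "w' x = (if 0 < w x then w x else 1)" for x
  have [measurable]: "v' \<in> borel_measurable M" "w' \<in> borel_measurable M" unfolding v'_def[abs_def] w'_def[abs_def] by measurable
  have v': "AE x in M. v' x = v x" using v(2) by eventually_elim (simp add: v'_def)
  have w': "AE x in M. w' x = w x" using w(2) by eventually_elim (simp add: w'_def)
  have "AE x in M. T (\<lambda>x. complex_of_real (v' x)) x = T (\<lambda>x. complex_of_real (v x)) x"
    by (rule T_cong_AE) (use v' in \<open>auto elim!: eventually_mono\<close>)
  then have Tv: "AE x in M. Tr v' x = Tr v x" by (simp add: T_of_real)
  have "AE x in M. T' (\<lambda>x. complex_of_real (w' x)) x = T' (\<lambda>x. complex_of_real (w x)) x"
    by (rule tr.T_cong_AE) (use w' in \<open>auto elim!: eventually_mono\<close>)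
  then have Tw: "AE x in M. Tr' w' x = Tr' w x" by (simp add: T'_of_real)
  have "principal_pair M K r v' w'"
  proof (intro principal_pair.intro principal_pair_axioms.intro)
    show "positive_kernel M K" by unfold_locales
    show "0 < v' x" "0 < w' x" for x by (simp_all add: v'_def w'_def)
    show "sq_integrable M v'" by (rule sq_integrable_cong_AE[OF v(1) _ v']) simp
    show "sq_integrable M w'" by (rule sq_integrable_cong_AE[OF w(1) _ w']) simp
    show "AE x in M. Tr v' x = r * v' x" using Tv v' v(3) by eventually_elim simp
    show "AE x in M. Tr' w' x = r * w' x" using Tw w' w(3) by eventually_elim simp
    have "(LINT x|M. v' x * w' x) = (LINT x|M. v x * w x)"
    proof (rule integral_cong_AE)
      show "AE x in M. v' x * w' x = v x * w x" using v' w' by eventually_elim simp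
    qed measurable
    then show "(LINT x|M. v' x * w' x) = 1" using vw by simp
  qed (rule r)
  then show ?thesis by (simp add: v'_def[abs_def] w'_def[abs_def])
qed

text \<open>The eigenfunctions come separately from the kernel and its transpose;
  \<open>principal_value_unique\<close> identifies their eigenvalues, and rescaling \<open>w\<close>
  alone achieves the normalisation.\<close>

lemma exists_principal_pair: "\<exists>r v w. principal_pair M K r v w"
proof -
  interpret tr: positive_kernel M "\<lambda>x y. K y x" by (rule transpose)
  obtain r v where r: "0 < r" and v: "sq_integrable M v" "AE x in M. 0 < v x" "AE x in M. Tr v x = r * v x"
    using principal_eigenfunction by blast
  obtain r' w where w: "sq_integrable M w" "AE x in M. 0 < w x" "AE x in M. Tr' w x = r' * w x"
    using tr.principal_eigenfunction unfolding transpose_Tr by blast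
  have r': "r' = r" using principal_value_unique[OF v w] by simp
  define k where "k = (LINT x|M. v x * w x)"
  have v0: "AE x in M. 0 \<le> v x" using v(2) by eventually_elim simp
  have "\<not> (AE x in M. v x = 0)"
  proof
    assume "AE x in M. v x = 0"
    with v(2) have "AE x in M. False" by eventually_elim simp
    then show False using not_null by blast
  qed
  then have k: "0 < k" using integral_mult_pos[OF v(1) w(1) v0 w(2)] unfolding k_def by (simp add: less_le)
  have "principal_pair M K r (\<lambda>x. if 0 < v x then v x else 1) (\<lambda>x. if 0 < w x / k then w x / k else 1)"
  proof (rule principal_pairI[OF r v])
    show "sq_integrable M (\<lambda>x. w x / k)"
      using w(1) by (auto simp: sq_integrable_def power_divide)
    show "AE x in M. 0 < w x / k" using w(2) by eventually_elim (use k in simp)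
    have "Tr' (\<lambda>x. w x / k) = (\<lambda>x. Tr' w x / k)" by (simp add: fun_eq_iff Tr'_def)
    then show "AE x in M. Tr' (\<lambda>x. w x / k) x = r * (w x / k)"
      using w(3) unfolding r' by (auto elim!: eventually_mono)
    show "(LINT x|M. v x * (w x / k)) = 1" using k by (simp add: k_def[symmetric])
  qed
  then show ?thesis by blast
qed

end

context principal_pair
begin

lemma spectral_radius: "spectral_radius M T = r"
  by (rule spectral_radius_eq[OF v_sq _ v_eigen w_sq _ w_eigen r_pos]) (simp_all add: v_pos w_pos)

text \<open>The functions \<open>v'\<close> and \<open>w'\<close> agree with \<open>v\<close> and
  \<open>w\<close> only almost everywhere, because the eigenfunctions of the statement may fail to
  be positive on a null set; in the density this changes nothing.\<close>

lemma chain_process_distributed: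
  assumes cp: "chain_process P X" and n: "1 \<le> n"
    and v': "v' \<in> borel_measurable M" "AE x in M. v' x = v x" and w': "w' \<in> borel_measurable M" "AE x in M. w' x = w x"
  shows "distributed P (Pi\<^sub>M {1..n} (\<lambda>_. M)) (\<lambda>\<omega>. \<lambda>i\<in>{1..n}. X (m + int i - 1) \<omega>)
     (\<lambda>x. ennreal (1 / r ^ (n - 1) * (v' (x 1) * (\<Prod>t=2..n. K (x (t - 1)) (x t)) * w' (x n))))"
proof -
  have proc: "process P M X" using cp by (simp add: chain_process_def)
  then have X[measurable]: "X t \<in> measurable P M" for t by (simp add: process_def)
  note [measurable] = v'(1) w'(1)
  define b where "b = m + int n - 1"
  \<comment> \<open>Position \<open>i\<close> in \<open>{1..n}\<close> corresponds to time
    \<open>m + i - 1\<close>, so 1 goes to \<open>m\<close> and \<open>n\<close> to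
    \<open>b\<close>.\<close>
  define f where "f i = m + int i - 1" for i :: nat
  define S where "S x = (\<lambda>i\<in>{1..n}. x (f i))" for x :: "int \<Rightarrow> 'x"
  define d where "d x = ennreal (1 / r ^ (n - 1) * (v' (x 1) * (\<Prod>t=2..n. K (x (t - 1)) (x t)) * w' (x n)))" for x
  let ?W = "Pi\<^sub>M {m..b} (\<lambda>_. M)" and ?N = "Pi\<^sub>M {1..n} (\<lambda>_. M)"
  have mb: "m \<le> b" using n by (simp add: b_def)
  have mem: "1 \<in> {1..n}" "n \<in> {1..n}" using n by auto
  have fb: "f i \<in> {m..b}" if "i \<in> {1..n}" for i using that by (auto simp: f_def b_def)
  have S: "S \<in> measurable ?W ?N"
    unfolding S_def[abs_def] by (intro measurable_restrict measurable_component_singleton fb)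
  have dm: "d \<in> borel_measurable ?N"
  proof -
    have "(\<lambda>x. \<Prod>t=2..n. K (x (t - 1)) (x t)) \<in> borel_measurable ?N"
    proof (rule borel_measurable_prod)
      fix t assume "t \<in> {2..n}"
      then have "t - 1 \<in> {1..n}" "t \<in> {1..n}" by auto
      then show "(\<lambda>x. K (x (t - 1)) (x t)) \<in> borel_measurable ?N"
        by (intro K_measurable_comp measurable_component_singleton)
    qed
    moreover have "(\<lambda>x. v' (x 1)) \<in> borel_measurable ?N" "(\<lambda>x. w' (x n)) \<in> borel_measurable ?N"
      by (rule measurable_compose[OF measurable_component_singleton[OF mem(1)] v'(1)],
          rule measurable_compose[OF measurable_component_singleton[OF mem(2)] w'(1)])
    ultimately show ?thesis unfolding d_def[abs_def] by measurable
  qed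
  have dS: "d (S x) = ennreal (v' (x m) * path_weight m b x * w' (x b) / r ^ nat (b - m))" for x
  proof -
    have bij: "bij_betw f {2..n} {m+1..b}"
      by (rule bij_betwI[where g="\<lambda>t. nat (t - m + 1)"]) (auto simp: f_def b_def)
    have "path_weight m b x = (\<Prod>i\<in>{2..n}. K (x (f i - 1)) (x (f i)))"
      unfolding path_weight_def by (rule prod.reindex_bij_betw[OF bij, symmetric])
    also have "\<dots> = (\<Prod>i=2..n. K (S x (i - 1)) (S x i))"
      by (rule prod.cong) (auto simp: S_def f_def of_nat_diff)
    finally have p: "(\<Prod>i=2..n. K (S x (i - 1)) (S x i)) = path_weight m b x" ..
    have "S x 1 = x m" "S x n = x b" using n by (auto simp: S_def f_def b_def)
    moreover have "nat (b - m) = n - 1" using n by (simp add: b_def nat_diff_distrib)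
    ultimately show ?thesis unfolding d_def p by simp
  qed
  have "chain m b = density ?W (\<lambda>x. d (S x))"
    unfolding chain_def
  proof (rule density_cong)
    show "(\<lambda>x. d (S x)) \<in> borel_measurable ?W" by (rule measurable_compose[OF S dm])
    show "(\<lambda>x. ennreal (v (x m) * path_weight m b x * w (x b) / r ^ nat (b - m))) \<in> borel_measurable ?W"
      using chain_density_measurable[OF mb] by simp
    have "AE x in ?W. v' (x m) = v (x m)" "AE x in ?W. w' (x b) = w (x b)"
      using mb by (auto intro!: AE_component[where Q="\<lambda>x. v' x = v x"] AE_component[where Q="\<lambda>x. w' x = w x"] v' w')
    then show "AE x in ?W. ennreal (v (x m) * path_weight m b x * w (x b) / r ^ nat (b - m)) = d (S x)"
      unfolding dS by eventually_elim simp
  qed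
  moreover have "chain m b = distr P ?W (\<lambda>\<omega>. \<lambda>t\<in>{m..b}. X t \<omega>)"
    using cp mb by (simp add: chain_process_def)
  ultimately have "distr (distr P ?W (\<lambda>\<omega>. \<lambda>t\<in>{m..b}. X t \<omega>)) ?N S = distr (density ?W (\<lambda>x. d (S x))) ?N S"
    by simp
  also have "\<dots> = density (distr ?W ?N S) d" by (rule density_distr[OF dm S, symmetric])
  also have "distr ?W ?N S = ?N"
    unfolding S_def[abs_def]
  proof (rule distr_PiM_bij)
    show "bij_betw f {1..n} {m..b}"
      by (rule bij_betwI[where g="\<lambda>t. nat (t - m + 1)"]) (auto simp: f_def b_def)
  qed (auto intro: sigma_finite)
  also have "distr (distr P ?W (\<lambda>\<omega>. \<lambda>t\<in>{m..b}. X t \<omega>)) ?N S = distr P ?N (S \<circ> (\<lambda>\<omega>. \<lambda>t\<in>{m..b}. X t \<omega>))"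
    by (rule distr_distr[OF S restrict_process_measurable(2)[OF proc]])
  also have "S \<circ> (\<lambda>\<omega>. \<lambda>t\<in>{m..b}. X t \<omega>) = (\<lambda>\<omega>. \<lambda>i\<in>{1..n}. X (m + int i - 1) \<omega>)"
    using fb by (auto simp: S_def fun_eq_iff f_def)
  finally show ?thesis
    unfolding distributed_def d_def[abs_def, symmetric] by (intro conjI measurable_restrict X dm)
qed

lemma chain_process_marginal:
  assumes cp: "chain_process P X"
    and v': "v' \<in> borel_measurable M" "AE x in M. v' x = v x" and w': "w' \<in> borel_measurable M" "AE x in M. w' x = w x"
  shows "distributed P M (X t) (\<lambda>x. ennreal (v' x * w' x))"
proof -
  note [measurable] = v'(1) w'(1)
  have proc: "process P M X" using cp by (simp add: chain_process_def)
  then have X[measurable]: "X t \<in> measurable P M" for t by (simp add: process_def)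
  have "distr P M (X t) = density M (\<lambda>x. ennreal (v x * w x))"
  proof (rule measure_eqI)
    fix A assume "A \<in> sets (distr P M (X t))"
    then have A[measurable]: "A \<in> sets M" by simp
    have t: "t \<in> {t..t}" by simp
    have "emeasure (distr P M (X t)) A = (\<integral>\<^sup>+\<omega>. (\<lambda>x. indicator A (x t)) (\<lambda>\<tau>\<in>{t..t}. X \<tau> \<omega>) \<partial>P)"
      using nn_integral_distr[OF X, of "indicator A" t] A by simp
    also have "\<dots> = (\<integral>\<^sup>+x. indicator A (x t) \<partial>chain t t)"
      by (rule nn_integral_chain_process[OF cp order_refl], rule measurable_compose[OF measurable_component_singleton[OF t]]) simp
    also have "\<dots> = emeasure \<pi> A"
      by (subst chain_marginal) (simp_all add: \<pi>_def)
    finally show "emeasure (distr P M (X t)) A = emeasure (density M (\<lambda>x. ennreal (v x * w x))) A"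
      by (simp add: \<pi>_def)
  qed simp
  also have "\<dots> = density M (\<lambda>x. ennreal (v' x * w' x))"
  proof (rule density_cong)
    show "AE x in M. ennreal (v x * w x) = ennreal (v' x * w' x)" using v'(2) w'(2) by eventually_elim simp
  qed measurable
  finally show ?thesis by (simp add: distributed_def)
qed

end

context spec_pair
begin

text \<open>For finitely many coordinates the product \<open>\<sigma>\<close>-algebra is the Borel
  one of the function space. This puts \<open>M\<close> in the form that the extension to all times
  asks for.\<close>

lemma sets_M: "sets M = sets (restrict_space borel (Pi\<^sub>E UNIV \<X>))"
proof -
  let ?B = "restrict_space borel (Pi\<^sub>E UNIV \<X>) :: ('p \<Rightarrow> real) measure"
  have spM: "space M = Pi\<^sub>E UNIV \<X>" by (simp add: space_PiM space_\<mu>)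
  have spB: "space ?B = Pi\<^sub>E UNIV \<X>" by (simp add: space_restrict_space)
  have coord: "(\<lambda>x. x a) \<in> borel_measurable (borel :: ('p \<Rightarrow> real) measure)" for a :: 'p
    using measurable_component_singleton[of a UNIV "\<lambda>_. borel :: real measure"]
    by (simp cong: measurable_cong_sets add: sets_PiM_equal_borel)
  have 1: "(\<lambda>x. x) \<in> measurable ?B M"
  proof (rule measurable_PiM_single')
    fix a :: 'p
    have "(\<lambda>x. x a) \<in> measurable ?B (restrict_space borel (\<X> a))"
      by (rule measurable_restrict_space2) (auto simp: spB PiE_iff intro: measurable_restrict_space1 coord)
    then show "(\<lambda>x. x a) \<in> measurable ?B (\<mu> a)" using sets_\<mu>[of a] by (simp cong: measurable_cong_sets)
  qed (auto simp: spB space_\<mu>)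
  have "(\<lambda>x. x) \<in> measurable M (Pi\<^sub>M UNIV (\<lambda>_. borel))"
    by (rule measurable_PiM_single') (auto intro: coordinate_borel)
  then have "(\<lambda>x. x) \<in> borel_measurable M" by (simp cong: measurable_cong_sets add: sets_PiM_equal_borel)
  then have 2: "(\<lambda>x. x) \<in> measurable M ?B"
    by (rule measurable_restrict_space2[rotated]) (auto simp: spM)
  show ?thesis
  proof
    show "sets M \<subseteq> sets ?B"
    proof
      fix A assume A: "A \<in> sets M"
      then have "A \<subseteq> Pi\<^sub>E UNIV \<X>" using sets.sets_into_space[OF A] by (simp add: spM)
      then show "A \<in> sets ?B" using measurable_sets[OF 1 A] by (simp add: spB Int_absorb2)
    qed
    show "sets ?B \<subseteq> sets M"
    proof
      fix A assume A: "A \<in> sets ?B"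
      then have "A \<subseteq> Pi\<^sub>E UNIV \<X>" using sets.sets_into_space[OF A] by (simp add: spB)
      then show "A \<in> sets M" using measurable_sets[OF 2 A] by (simp add: spM Int_absorb2)
    qed
  qed
qed

lemma exists_chain_process: "\<exists>(P :: (int \<Rightarrow> 'p \<Rightarrow> real) measure) X. PK.chain_process P X"
proof -
  have "Pi\<^sub>E UNIV \<X> \<in> sets (borel :: ('p \<Rightarrow> real) measure)"
    unfolding sets_PiM_equal_borel[symmetric] by (rule sets_PiM_I_finite) (auto simp: X_borel)
  moreover have "space M = Pi\<^sub>E UNIV \<X>" by (simp add: space_PiM space_\<mu>)
  ultimately show ?thesis
    using exists_stationary_chain[OF PK.principal_pair_axioms _ _ sets_M]
    unfolding PK.chain_process_def process_def by blast
qed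

text \<open>The right-hand side fixes all window laws in terms of the principal pair, so uniqueness
  and the density formula are read off from it, and existence reduces to consistency of the
  windows.\<close>

lemma stationary_CS_process_iff:
  "stationary_CS_process \<mu> \<theta> s c \<Phi>m \<Phi>0 \<Phi>1 P X \<longleftrightarrow> PK.chain_process P X"
proof
  assume *: "stationary_CS_process \<mu> \<theta> s c \<Phi>m \<Phi>0 \<Phi>1 P X"
  then have "PK.gibbs P X" by (intro CS_gibbs) (simp_all add: stationary_CS_process_def)
  with * show "PK.chain_process P X"
    by (simp add: PK.chain_process_def stationary_CS_process_def PK.gibbs_unique)
next
  assume *: "PK.chain_process P X"
  then show "stationary_CS_process \<mu> \<theta> s c \<Phi>m \<Phi>0 \<Phi>1 P X"
    unfolding stationary_CS_process_def
    using PK.chain_process_stationary[OF *] chain_process_CS[OF *] by (simp add: PK.chain_process_def)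
qed

end

theorem theorem2p3:
  fixes \<X> :: "'p::finite \<Rightarrow> real set"
    and \<mu> :: "'p \<Rightarrow> real measure"
    and s c :: "'p \<Rightarrow> real \<Rightarrow> real"
    and \<theta> :: "real ^ 'p"
    and \<Phi>m \<Phi>0 \<Phi>1 :: "real ^ 'p ^ 'p"
  defines "M \<equiv> Pi\<^sub>M UNIV \<mu>"
    and "R \<equiv> R_kernel \<theta> s c \<Phi>0 \<Phi>1"
  defines "T \<equiv> integral_op M R"
    and "T' \<equiv> integral_op M (\<lambda>x y. R y x)"
  assumes "\<And>a. \<X> a \<in> sets borel"
    and "\<And>a. space (\<mu> a) = \<X> a"
    and "\<And>a. sets (\<mu> a) = sets (restrict_space borel (\<X> a))"
    and "\<And>a. sigma_finite_measure (\<mu> a)"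
    and "\<And>a. emeasure (\<mu> a) (\<X> a) \<noteq> 0"
    and "\<And>a. s a \<in> borel_measurable (\<mu> a)"
    and "\<And>a. c a \<in> borel_measurable (\<mu> a)"
    and "transpose \<Phi>0 = \<Phi>0"
    and "\<And>a. \<Phi>0 $ a $ a = 0"
    and "\<Phi>m = transpose \<Phi>1"
    and "integral_op_on_L2 M R"
    and "compact_op M T"
  shows
    "(\<exists>(P :: (int \<Rightarrow> 'p \<Rightarrow> real) measure) X. stationary_CS_process \<mu> \<theta> s c \<Phi>m \<Phi>0 \<Phi>1 P X) \<and>
     (\<forall>(P :: 'w measure) X (Q :: 'v measure) Y.
        stationary_CS_process \<mu> \<theta> s c \<Phi>m \<Phi>0 \<Phi>1 P X \<and>
        stationary_CS_process \<mu> \<theta> s c \<Phi>m \<Phi>0 \<Phi>1 Q Y \<longrightarrow> law P M X = law Q M Y) \<and>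
     (let r = spectral_radius M T;
          normalised_pair = (\<lambda>v w. eigenfunction M T (of_real r) v \<and> AE_positive M v \<and>
            eigenfunction M T' (of_real r) w \<and> AE_positive M w \<and> L2_inner M v w = 1)
      in 0 < r \<and> r = spectral_radius M T' \<and> (\<exists>v w. normalised_pair v w) \<and>
         (\<forall>(P :: 'w measure) X v w.
            stationary_CS_process \<mu> \<theta> s c \<Phi>m \<Phi>0 \<Phi>1 P X \<and> normalised_pair v w \<longrightarrow>
            (\<forall>n\<ge>1. \<forall>m :: int.
               distributed P (Pi\<^sub>M {1..n} (\<lambda>_. M)) (\<lambda>\<omega>. \<lambda>i\<in>{1..n}. X (m + int i - 1) \<omega>)
                 (\<lambda>x. ennreal (1 / r ^ (n - 1) *
                    (Re (v (x 1)) * (\<Prod>t=2..n. R (x (t - 1)) (x t)) * Re (w (x n)))))) \<and>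
            (\<forall>t. distributed P M (X t) (\<lambda>x. ennreal (Re (v x) * Re (w x))))))"
proof -
  interpret CS: conditional_spec \<X> \<mu> s c \<theta> \<Phi>m \<Phi>0 \<Phi>1
    by (rule conditional_spec.intro) (use assms in auto)
  interpret PK: positive_kernel M R
    unfolding M_def R_def by (rule CS.positive_kernelI) (use assms in auto)
  interpret tr: positive_kernel M "\<lambda>x y. R y x" by (rule PK.transpose)
  obtain r v0 w0 where pair: "principal_pair M R r v0 w0" using PK.exists_principal_pair by blast
  interpret pp: principal_pair M R r v0 w0 by (rule pair)
  interpret S: spec_pair \<X> \<mu> s c \<theta> \<Phi>m \<Phi>0 \<Phi>1 r v0 w0
    by (rule spec_pair.intro[OF CS.conditional_spec_axioms pair[unfolded M_def R_def]])
  have rT: "spectral_radius M T = r" unfolding T_def by (rule pp.spectral_radius)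
  have rT': "spectral_radius M T' = r"
    unfolding T'_def by (rule principal_pair.spectral_radius[OF pp.transpose_pair])
  define np where "np v w \<longleftrightarrow> eigenfunction M T (of_real r) v \<and> AE_positive M v \<and>
    eigenfunction M T' (of_real r) w \<and> AE_positive M w \<and> L2_inner M v w = 1" for v w
  \<comment> \<open>Stated for every principal pair: the densities can then be derived for the very
    eigenfunctions that are given, instead of comparing them with \<open>v0\<close> and
    \<open>w0\<close>.\<close>
  have chain_iff: "stationary_CS_process \<mu> \<theta> s c \<Phi>m \<Phi>0 \<Phi>1 P X \<longleftrightarrow> principal_pair.chain_process M R r v w P X"
    if "principal_pair M R r v w" for P :: "'z measure" and X v w
    unfolding M_def R_def
    by (rule spec_pair.stationary_CS_process_iff[OF spec_pair.intro[OF CS.conditional_spec_axioms that[unfolded M_def R_def]]])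
  have ex: "\<exists>(P :: (int \<Rightarrow> 'p \<Rightarrow> real) measure) X. stationary_CS_process \<mu> \<theta> s c \<Phi>m \<Phi>0 \<Phi>1 P X"
    using S.exists_chain_process unfolding S.stationary_CS_process_iff .
  have uniq: "law P M X = law Q M Y"
    if "stationary_CS_process \<mu> \<theta> s c \<Phi>m \<Phi>0 \<Phi>1 P X" "stationary_CS_process \<mu> \<theta> s c \<Phi>m \<Phi>0 \<Phi>1 Q Y"
    for P :: "'w measure" and X and Q :: "'v measure" and Y
    using that unfolding chain_iff[OF pair] by (rule pp.chain_process_law)
  have np: "np (\<lambda>x. complex_of_real (v0 x)) (\<lambda>x. complex_of_real (w0 x))"
  proof -
    have p: "AE x in M. 0 < v0 x" "AE x in M. 0 < w0 x" by (simp_all add: pp.v_pos pp.w_pos)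
    show ?thesis
      unfolding np_def T_def T'_def
    proof (intro conjI)
      show "eigenfunction M (integral_op M R) (of_real r) (\<lambda>x. complex_of_real (v0 x))"
        by (rule PK.eigenfunction_of_real[OF pp.v_sq p(1) pp.v_eigen])
      show "eigenfunction M (integral_op M (\<lambda>x y. R y x)) (of_real r) (\<lambda>x. complex_of_real (w0 x))"
        by (rule tr.eigenfunction_of_real[OF pp.w_sq p(2)]) (use pp.w_eigen PK.transpose_Tr in simp)
      show "L2_inner M (\<lambda>x. complex_of_real (v0 x)) (\<lambda>x. complex_of_real (w0 x)) = 1"
        using pp.vw_integral by (subst PK.L2_inner_Re) (auto intro!: AE_positive_of_real p)
    qed (intro AE_positive_of_real p)+
  qed
  have dist: "(\<forall>n\<ge>1. \<forall>m :: int.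
      distributed P (Pi\<^sub>M {1..n} (\<lambda>_. M)) (\<lambda>\<omega>. \<lambda>i\<in>{1..n}. X (m + int i - 1) \<omega>)
        (\<lambda>x. ennreal (1 / r ^ (n - 1) * (Re (v (x 1)) * (\<Prod>t=2..n. R (x (t - 1)) (x t)) * Re (w (x n)))))) \<and>
      (\<forall>t. distributed P M (X t) (\<lambda>x. ennreal (Re (v x) * Re (w x))))"
    if sp: "stationary_CS_process \<mu> \<theta> s c \<Phi>m \<Phi>0 \<Phi>1 P X" and vw: "np v w" for P :: "'w measure" and X v w
  proof -
    have v: "eigenfunction M (integral_op M R) (of_real r) v" "AE_positive M v"
      and w: "eigenfunction M (integral_op M (\<lambda>x y. R y x)) (of_real r) w" "AE_positive M w"
      using vw by (simp_all add: np_def T_def T'_def)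
    note v' = PK.eigenfunction_Re[OF v] and w' = tr.eigenfunction_Re[OF w, unfolded PK.transpose_Tr]
    have m: "v \<in> borel_measurable M" "w \<in> borel_measurable M"
      using v(1) w(1) by (simp_all add: eigenfunction_def L2_def)
    have "complex_of_real (LINT x|M. Re (v x) * Re (w x)) = 1"
      using PK.L2_inner_Re[OF m(1) v(2) m(2) w(2)] vw by (simp add: np_def)
    then have "(LINT x|M. Re (v x) * Re (w x)) = 1" by (simp only: of_real_eq_1_iff)
    \<comment> \<open>The given eigenfunctions, made positive on a null set, form a principal pair
      of their own with the same \<open>r\<close>.\<close>
    note pair' = PK.principal_pairI[OF pp.r_pos v' w' this]
    interpret q: principal_pair M R r "\<lambda>x. if 0 < Re (v x) then Re (v x) else 1" "\<lambda>x. if 0 < Re (w x) then Re (w x) else 1"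
      by (rule pair')
    have cp: "q.chain_process P X" using sp unfolding chain_iff[OF pair'] .
    have ae: "AE x in M. Re (v x) = (if 0 < Re (v x) then Re (v x) else 1)" "AE x in M. Re (w x) = (if 0 < Re (w x) then Re (w x) else 1)"
      using v'(2) w'(2) by (auto elim!: eventually_mono)
    have m': "(\<lambda>x. Re (v x)) \<in> borel_measurable M" "(\<lambda>x. Re (w x)) \<in> borel_measurable M"
      using m by simp_all
    show ?thesis
      using q.chain_process_distributed[OF cp _ m'(1) ae(1) m'(2) ae(2)] q.chain_process_marginal[OF cp m'(1) ae(1) m'(2) ae(2)]
      by blast
  qed
  show ?thesis
    unfolding Let_def rT rT' np_def[symmetric]
    using ex uniq np dist pp.r_pos by blast
qed

end
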